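(* Let $(M,g)$ be a compact Riemannian manifold without boundary, $n=\dim M$, and let $H\subset M$ be a compact embedded submanifold, $d=\dim H<n$. Suppose the only $L^1$ measure on $SN^*H$ that is invariant under the first return map (as defined in the context) is the trivial one (the zero measure). Then, with $\mathcal T$ and $q$ as defined in the context, $$\lim_{T\to\infty}\frac1T\sum_{t\in\mathcal T\cap[-T,T]}|q(t)|=0.$$
   Context: Dynamics. $p(x,\xi)=|\xi|_{g(x)}$ on $\dot T^*M=T^*M\setminus 0$; $G^t$ is the time-$t$ flow of the Hamilton vector field $H_p=\sum_j(\partial_{\xi_j}p\,\partial_{x_j}-\partial_{x_j}p\,\partial_{\xi_j})$; $\dot N^*H$ is the conormal bundle of $H$ minus the zero section; $SN^*H=\dot N^*H\cap p^{-1}(1)$. For $t\neq0$, $\Sigma_t$ is the set of $(x,\xi)\in\dot N^*H$ such that $G^t(x,\xi)\in\dot N^*H$ and $dG^t$ maps $T_{(x,\xi)}\dot N^*H$ isomorphically onto $T_{G^t(x,\xi)}\dot N^*H$; $S\Sigma_t=\Sigma_t\cap SN^*H$. In local coordinates $x=(x',x'')\in\mathbb R^d\times\mathbb R^{n-d}$ with $H=\{x''=0\}$ and dual coordinates $\xi=(\xi',\xi'')$, $\dot N^*H$ is parametrized by $(x',\xi'')$ and carries the natural density $|g_H(x')||g(x)|^{-1/2}|dx'\,d\xi''|$ at $x=(x',0)$ ($g_H$ the induced metric on $H$, $|\cdot|$ determinants). For $(x,\xi)\in\Sigma_t$, $J_t(x,\xi)>0$ is the absolute value of the determinant of $dG^t:T_{(x,\xi)}\dot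 N^*H\to T_{G^t(x,\xi)}\dot N^*H$ with respect to these densities, i.e. with $(y,\eta)=G^t(x,\xi)$, $|g_H(y')||g(y)|^{-1/2}|dy'd\eta''|$ corresponds to $J_t(x,\xi)|g_H(x')||g(x)|^{-1/2}|dx'd\xi''|$. $SN^*H$ carries the Leray measure, denoted $dx\,d\xi$, induced by $p=1$ (if the $x''$ coordinate vectors are an orthonormal normal frame along $H$, it is $|g_H(x')|^{1/2}dx'\,d\omega$, with $\xi''=|\xi''|\omega$, $\omega\in S^{n-d-1}$). $\mathcal T\subset\mathbb R\setminus\{0\}$ is the countable set of nonzero $t$ for which $S\Sigma_t$ has positive measure. Invariant measures. $\mathbf T(x,\xi)$ is the smallest positive time $t$ for which $(x,\xi)\in S\Sigma_t$, with $\mathbf T(x,\xi)=\infty$ if there is no such time. An $L^1$ measure $f(x,\xi)\,dx\,d\xi$ on $SN^*H$ (with $f\in L^1(SN^*H)$) is invariant under the first return map if $f=(f\circ G^{\mathbf T})\,J_{\mathbf T}$ where $\mathbf T<\infty$ and $f=0$ where $\mathbf T=\infty$ (almost everywhere). Maslov factor. Let $P=\sqrt{-\Delta_g}$, and let $\delta_H$ be the half-density distribution $f|dV_M|^{1/2}\mapsto\int_Hf\,dV_H$. Then $e^{itP}\delta_H$ is a Lagrangian distribution associated with $G^{-t}(\dot N^*H)$. If $(x,\xi)\in\Sigma_t$, this Lagrangian contains $(x,\xi)$ and is tangent to $\dot N^*H$ there, so in coordinates with $H=\{x''=0\}$ it is locally $\{x''=\psi'_{\xi''},\ \xi'=-\psi'_{x'}\}$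 with $\psi(x',\xi'')$ smooth and positive-homogeneous of degree 1 in $\xi''$, and microlocally $e^{itP}\delta_H=\left(\int e^{i(\langle x'',\xi''\rangle-\psi(x',\xi''))}b(x,\xi'')\,d\xi''\right)|dx|^{1/2}$ with $b$ a classical symbol of order $0$. The factor $i^{\sigma_t(x,\xi)}$, $\sigma_t(x,\xi)\in\mathbb Z/4$, is the phase of the principal part of $b$ at $(x,\xi)$ (which is a positive multiple of $i^{\sigma_t(x,\xi)}$). For $t\in\mathcal T$, $q(t)=(2\pi)^{-n+d}\int_{S\Sigma_t}i^{\sigma_t}\sqrt{J_t}$. *)

theory Defs
  imports "HOL-Analysis.Analysis"
begin

section \<open>Smooth maps and smooth structures\<close>

primrec Ck_on :: "nat \<Rightarrow> 'a::real_normed_vector set \<Rightarrow> ('a \<Rightarrow> 'b::real_normed_vector) \<Rightarrow> bool" where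
  "Ck_on 0 S f \<longleftrightarrow> continuous_on S f"
| "Ck_on (Suc k) S f \<longleftrightarrow>
     (\<forall>x\<in>S. f differentiable (at x)) \<and> (\<forall>v. Ck_on k S (\<lambda>x. frechet_derivative f (at x) v))"

text \<open>Only used for open \<open>S\<close> in finite-dimensional spaces.\<close>
definition smooth_on :: "'a::real_normed_vector set \<Rightarrow> ('a \<Rightarrow> 'b::real_normed_vector) \<Rightarrow> bool" where
  "smooth_on S f \<longleftrightarrow> (\<forall>k. Ck_on k S f)"

definition partial :: "'n \<Rightarrow> (real^'n \<Rightarrow> 'b::real_normed_vector) \<Rightarrow> real^'n \<Rightarrow> 'b" where
  "partial i f x = frechet_derivative f (at x) (axis i 1)"

definition grad :: "(real^'n \<Rightarrow> real) \<Rightarrow> real^'n \<Rightarrow> real^'n" where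
  "grad f x = (\<chi> i. partial i f x)"

primrec iter_deriv :: "'a::real_normed_vector list \<Rightarrow> ('a \<Rightarrow> 'b::real_normed_vector) \<Rightarrow> 'a \<Rightarrow> 'b" where
  "iter_deriv [] f = f"
| "iter_deriv (v # vs) f = iter_deriv vs (\<lambda>x. frechet_derivative f (at x) v)"

text \<open>A chart is a pair \<open>(U, \<phi>)\<close>; the values of \<open>\<phi>\<close> outside \<open>U\<close> are irrelevant.\<close>
type_synonym ('m, 'n) chart = "'m set \<times> ('m \<Rightarrow> (real, 'n) vec)"

definition cinv :: "('m, 'n) chart \<Rightarrow> real^'n \<Rightarrow> 'm" where
  "cinv c = inv_into (fst c) (snd c)"

definition crange :: "('m, 'n) chart \<Rightarrow> (real^'n) set" where
  "crange c = snd c ` fst c"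

definition is_chart :: "('m::topological_space, 'n::finite) chart \<Rightarrow> bool" where
  "is_chart c \<longleftrightarrow> open (fst c) \<and> open (crange c) \<and> homeomorphism (fst c) (crange c) (snd c) (cinv c)"

definition compatible :: "('m, 'n::finite) chart \<Rightarrow> ('m, 'n) chart \<Rightarrow> bool" where
  "compatible c c' \<longleftrightarrow>
     smooth_on (snd c ` (fst c \<inter> fst c')) (snd c' \<circ> cinv c) \<and>
     smooth_on (snd c' ` (fst c \<inter> fst c')) (snd c \<circ> cinv c')"

definition smooth_structure :: "('m::topological_space, 'n::finite) chart set \<Rightarrow> bool" where
  "smooth_structure A \<longleftrightarrow>
     (\<forall>c\<in>A. is_chart c) \<and> (\<Union>c\<in>A. fst c) = UNIV \<and> (\<forall>c\<in>A. \<forall>c'\<in>A. compatible c c') \<and>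
     (\<forall>c. is_chart c \<and> (\<forall>c'\<in>A. compatible c c') \<longrightarrow> c \<in> A)"

definition chart_at :: "('m, 'n::finite) chart set \<Rightarrow> 'm \<Rightarrow> ('m, 'n) chart" where
  "chart_at A q = (SOME c. c \<in> A \<and> q \<in> fst c)"

definition smooth_fun :: "('m, 'n::finite) chart set \<Rightarrow> ('m \<Rightarrow> real) \<Rightarrow> bool" where
  "smooth_fun A f \<longleftrightarrow> (\<forall>c\<in>A. smooth_on (crange c) (f \<circ> cinv c))"

text \<open>\<open>jac c c' q\<close> is the matrix of partial derivatives of the \<open>c'\<close>-coordinates with respect
  to the \<open>c\<close>-coordinates at \<open>q\<close>.\<close>
definition jac :: "('m, 'n) chart \<Rightarrow> ('m, 'n) chart \<Rightarrow> 'm \<Rightarrow> real^'n^'n" where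
  "jac c c' q = matrix (frechet_derivative (snd c' \<circ> cinv c) (at (snd c q)))"


section \<open>Riemannian metrics\<close>

text \<open>A metric is given by its matrix \<open>g c q\<close> at the point \<open>q\<close> in each chart \<open>c\<close> around \<open>q\<close>,
  subject to the tensor transformation law.\<close>
type_synonym ('m, 'n) metric = "('m, 'n) chart \<Rightarrow> 'm \<Rightarrow> ((real, 'n) vec, 'n) vec"

definition riemannian_metric :: "('m, 'n::finite) chart set \<Rightarrow> ('m, 'n) metric \<Rightarrow> bool" where
  "riemannian_metric A g \<longleftrightarrow>
     (\<forall>c\<in>A. smooth_on (crange c) (g c \<circ> cinv c) \<and>
        (\<forall>q\<in>fst c. transpose (g c q) = g c q \<and> (\<forall>v. v \<noteq> 0 \<longrightarrow> v \<bullet> (g c q *v v) > 0))) \<and>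
     (\<forall>c\<in>A. \<forall>c'\<in>A. \<forall>q\<in>fst c \<inter> fst c'.
        g c q = transpose (jac c c' q) ** g c' q ** jac c c' q)"

definition closed_riemannian_manifold ::
    "('m::t2_space, 'n::finite) chart set \<Rightarrow> ('m, 'n) metric \<Rightarrow> bool" where
  "closed_riemannian_manifold A g \<longleftrightarrow>
     compact (UNIV :: 'm set) \<and> smooth_structure A \<and> riemannian_metric A g"


section \<open>The cotangent bundle and the geodesic Hamilton flow\<close>

text \<open>A covector at \<open>q\<close> is the family \<open>\<xi>\<close> of its component vectors \<open>\<xi> c\<close> in all charts \<open>c\<close> around
  \<open>q\<close> (set to \<open>0\<close> for all other \<open>c\<close>), subject to the transformation law.\<close>
type_synonym ('m, 'n) cov = "'m \<times> (('m, 'n) chart \<Rightarrow> (real, 'n) vec)"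

definition cotangent_bundle :: "('m, 'n::finite) chart set \<Rightarrow> ('m, 'n) cov set" where
  "cotangent_bundle A = {(q, \<xi>).
     (\<forall>c\<in>A. \<forall>c'\<in>A. q \<in> fst c \<inter> fst c' \<longrightarrow> \<xi> c = transpose (jac c c' q) *v \<xi> c') \<and>
     (\<forall>c. \<not> (c \<in> A \<and> q \<in> fst c) \<longrightarrow> \<xi> c = 0)}"

definition punctured_cotangent_bundle :: "('m, 'n::finite) chart set \<Rightarrow> ('m, 'n) cov set" where
  "punctured_cotangent_bundle A = {(q, \<xi>) \<in> cotangent_bundle A. \<xi> \<noteq> (\<lambda>c. 0)}"

definition coords :: "('m, 'n) chart \<Rightarrow> ('m, 'n) cov \<Rightarrow> (real^'n) \<times> (real^'n)" where
  "coords c z = (snd c (fst z), snd z c)"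

text \<open>The inverse of \<open>coords c\<close>: the point of the cotangent bundle with given coordinates.\<close>
definition cov_point ::
    "('m, 'n) chart set \<Rightarrow> ('m, 'n) chart \<Rightarrow> (real^'n) \<times> (real^'n) \<Rightarrow> ('m, 'n) cov" where
  "cov_point A c y = (let q = cinv c (fst y) in
     (q, \<lambda>c'. if c' \<in> A \<and> q \<in> fst c' then transpose (jac c' c q) *v snd y else 0))"

definition ham :: "('m, 'n) metric \<Rightarrow> ('m, 'n) chart \<Rightarrow> (real^'n) \<times> (real^'n) \<Rightarrow> real" where
  "ham g c y = sqrt (snd y \<bullet> (matrix_inv (g c (cinv c (fst y))) *v snd y))"

text \<open>The function \<open>p(x, \<xi>) = |\<xi>|\<close>; the value does not depend on the chart.\<close>
definition cov_norm :: "('m, 'n::finite) chart set \<Rightarrow> ('m, 'n) metric \<Rightarrow> ('m, 'n) cov \<Rightarrow> real" where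
  "cov_norm A g z = (let c = chart_at A (fst z) in ham g c (coords c z))"

definition ham_field ::
    "('m, 'n) metric \<Rightarrow> ('m, 'n) chart \<Rightarrow> (real^'n) \<times> (real^'n) \<Rightarrow> (real^'n) \<times> (real^'n)" where
  "ham_field g c y =
     (grad (\<lambda>\<xi>. ham g c (fst y, \<xi>)) (snd y), - grad (\<lambda>x. ham g c (x, snd y)) (fst y))"

text \<open>\<open>G\<close> is the flow of the Hamilton vector field of \<open>p\<close> on the punctured cotangent bundle: the
  smooth one-parameter group generated by this vector field.\<close>
definition hamilton_flow ::
    "('m, 'n::finite) chart set \<Rightarrow> ('m, 'n) metric \<Rightarrow> (real \<Rightarrow> ('m, 'n) cov \<Rightarrow> ('m, 'n) cov) \<Rightarrow> bool" where
  "hamilton_flow A g G \<longleftrightarrow>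
     (\<forall>z\<in>punctured_cotangent_bundle A.
        (\<forall>t. G t z \<in> punctured_cotangent_bundle A) \<and> G 0 z = z \<and>
        (\<forall>s t. G (s + t) z = G s (G t z)) \<and>
        (\<forall>t. \<forall>c\<in>A. fst (G t z) \<in> fst c \<longrightarrow>
           ((\<lambda>s. coords c (G s z)) has_vector_derivative ham_field g c (coords c (G t z))) (at t))) \<and>
     (\<forall>c\<in>A. \<forall>c'\<in>A.
        let W = {(t, y). fst y \<in> crange c \<and> snd y \<noteq> 0 \<and> fst (G t (cov_point A c y)) \<in> fst c'}
        in open W \<and> smooth_on W (\<lambda>(t, y). coords c' (G t (cov_point A c y))))"


section \<open>Submanifolds and conormal bundles\<close>

text \<open>The coordinates are split by an index set \<open>D\<close> with \<open>d\<close> elements: \<open>x'\<close> collects the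
  coordinates with index in \<open>D\<close>, \<open>x''\<close> the others, and similarly for \<open>\<xi>'\<close> and \<open>\<xi>''\<close>.
  The case of empty \<open>D\<close> (a submanifold of dimension 0) is included.
  Vectors in the coordinate subspaces are padded by zeros.\<close>
definition proj :: "'n set \<Rightarrow> real^'n \<Rightarrow> real^'n" where
  "proj I v = (\<chi> i. if i \<in> I then v $ i else 0)"

definition vec_on :: "'n set \<Rightarrow> ('n \<Rightarrow> real) \<Rightarrow> real^'n" where
  "vec_on I w = (\<chi> i. if i \<in> I then w i else 0)"

text \<open>A single vector \<open>w\<close> encodes the pair \<open>(x', \<xi>'')\<close>; it stands for the point
  \<open>((x', 0), (0, \<xi>''))\<close>.\<close>
definition split_cn :: "'n set \<Rightarrow> real^'n \<Rightarrow> (real^'n) \<times> (real^'n)" where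
  "split_cn D w = (proj D w, proj (-D) w)"

definition merge_cn :: "'n set \<Rightarrow> (real^'n) \<times> (real^'n) \<Rightarrow> real^'n" where
  "merge_cn D y = proj D (fst y) + proj (-D) (snd y)"

definition slice_charts :: "('m, 'n::finite) chart set \<Rightarrow> 'n set \<Rightarrow> 'm set \<Rightarrow> ('m, 'n) chart set" where
  "slice_charts A D H = {c \<in> A. H \<inter> fst c = {q \<in> fst c. proj (-D) (snd c q) = 0}}"

definition compact_submanifold ::
    "('m::topological_space, 'n::finite) chart set \<Rightarrow> 'n set \<Rightarrow> 'm set \<Rightarrow> bool" where
  "compact_submanifold A D H \<longleftrightarrow> compact H \<and> (\<forall>q\<in>H. \<exists>c\<in>slice_charts A D H. q \<in> fst c)"

definition slice_at :: "('m, 'n::finite) chart set \<Rightarrow> 'n set \<Rightarrow> 'm set \<Rightarrow> 'm \<Rightarrow> ('m, 'n) chart" where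
  "slice_at A D H q = (SOME c. c \<in> slice_charts A D H \<and> q \<in> fst c)"

definition conormal :: "('m, 'n::finite) chart set \<Rightarrow> 'n set \<Rightarrow> 'm set \<Rightarrow> ('m, 'n) cov set" where
  "conormal A D H = {z \<in> punctured_cotangent_bundle A. fst z \<in> H \<and>
     (\<forall>c\<in>slice_charts A D H. fst z \<in> fst c \<longrightarrow> proj D (snd z c) = 0)}"

definition unit_conormal ::
    "('m, 'n::finite) chart set \<Rightarrow> ('m, 'n) metric \<Rightarrow> 'n set \<Rightarrow> 'm set \<Rightarrow> ('m, 'n) cov set" where
  "unit_conormal A g D H = {z \<in> conormal A D H. cov_norm A g z = 1}"

definition conormal_dom :: "'n set \<Rightarrow> ('m, 'n) chart \<Rightarrow> (real^'n) set" where
  "conormal_dom D c = {w. proj D w \<in> crange c \<and> proj (-D) w \<noteq> 0}"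

text \<open>The local parametrization of the conormal bundle by \<open>(x', \<xi>'')\<close>.\<close>
definition conormal_point ::
    "('m, 'n) chart set \<Rightarrow> 'n set \<Rightarrow> ('m, 'n) chart \<Rightarrow> real^'n \<Rightarrow> ('m, 'n) cov" where
  "conormal_point A D c w = cov_point A c (split_cn D w)"

text \<open>The determinant of the submatrix with rows and columns in \<open>D\<close>
  (equal to \<open>1\<close> for empty \<open>D\<close>).\<close>
definition sub_det :: "'n set \<Rightarrow> real^'n^'n \<Rightarrow> real" where
  "sub_det D a =
     det ((\<chi> i j. if i \<in> D \<and> j \<in> D then a $ i $ j else if i = j then 1 else 0) :: real^'n^'n)"

text \<open>The coefficient of the natural density on the conormal bundle with respect to the
  Lebesgue measure in the variables \<open>(x', \<xi>'')\<close>. In a slice chart the induced metric of \<open>H\<close>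
  has the matrix with the entries of \<open>g c q\<close> with indices in \<open>D\<close>.\<close>
definition conormal_density :: "('m, 'n::finite) metric \<Rightarrow> 'n set \<Rightarrow> ('m, 'n) chart \<Rightarrow> 'm \<Rightarrow> real" where
  "conormal_density g D c q = sub_det D (g c q) / sqrt (det (g c q))"

text \<open>\<open>lam\<close> is the Leray measure on the unit conormal bundle induced by \<open>p = 1\<close>. With \<open>\<mu>\<close> the
  natural density on the conormal bundle, it is the measure with
  \<open>\<integral> h d(lam) = d/ds (\<integral>\<^bsub>p < s\<^esub> h d\<mu>)\<close> at \<open>s = 1\<close> for all continuous compactly
  supported \<open>h\<close> (Gelfand--Leray); by linearity it is enough to test with \<open>h\<close> supported in one
  slice chart. Measurability means Borel measurability in slice charts.\<close>
definition leray_measure ::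
    "('m, 'n::finite) chart set \<Rightarrow> ('m, 'n) metric \<Rightarrow> 'n set \<Rightarrow> 'm set \<Rightarrow> ('m, 'n) cov measure \<Rightarrow> bool" where
  "leray_measure A g D H lam \<longleftrightarrow>
     space lam = unit_conormal A g D H \<and>
     sets lam = {B. B \<subseteq> unit_conormal A g D H \<and>
       (\<forall>c\<in>slice_charts A D H. {w \<in> conormal_dom D c. conormal_point A D c w \<in> B} \<in> sets borel)} \<and>
     (\<forall>c\<in>slice_charts A D H. \<forall>h::real^'n \<Rightarrow> real. \<forall>K.
        continuous_on UNIV h \<and> compact K \<and> K \<subseteq> conormal_dom D c \<and> (\<forall>w. w \<notin> K \<longrightarrow> h w = 0) \<longrightarrow>
        ((\<lambda>s. LINT w:{w \<in> conormal_dom D c. ham g c (split_cn D w) < s}|lborel.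
            h w * conormal_density g D c (cinv c (proj D w)))
          has_real_derivative
            (LINT z:{z \<in> unit_conormal A g D H. fst z \<in> fst c}|lam. h (merge_cn D (coords c z))))
          (at 1))"


section \<open>Return times and Jacobians\<close>

text \<open>The restriction of \<open>dG\<^sup>t\<close> to the tangent space of the conormal bundle at \<open>z\<close>, in the
  coordinates \<open>(x', \<xi>'')\<close> near \<open>z\<close> and canonical coordinates near \<open>G t z\<close>.
  In the latter, the tangent space of the conormal bundle is \<open>{x'' = 0, \<xi>' = 0}\<close>, the
  range of \<open>split_cn D\<close>.\<close>
definition conormal_deriv ::
    "('m, 'n) chart set \<Rightarrow> 'n set \<Rightarrow> 'm set \<Rightarrow> (real \<Rightarrow> ('m, 'n) cov \<Rightarrow> ('m, 'n) cov) \<Rightarrow>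
     real \<Rightarrow> ('m, 'n) cov \<Rightarrow> real^'n \<Rightarrow> (real^'n) \<times> (real^'n)" where
  "conormal_deriv A D H G t z =
     (let c = slice_at A D H (fst z); c' = slice_at A D H (fst (G t z)) in
      frechet_derivative (\<lambda>w. coords c' (G t (conormal_point A D c w)))
        (at (merge_cn D (coords c z))))"

definition Sigma_t ::
    "('m, 'n::finite) chart set \<Rightarrow> 'n set \<Rightarrow> 'm set \<Rightarrow> (real \<Rightarrow> ('m, 'n) cov \<Rightarrow> ('m, 'n) cov) \<Rightarrow>
     real \<Rightarrow> ('m, 'n) cov set" where
  "Sigma_t A D H G t = {z \<in> conormal A D H. G t z \<in> conormal A D H \<and>
     bij_betw (conormal_deriv A D H G t z) UNIV (range (split_cn D))}"

definition unit_Sigma ::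
    "('m, 'n::finite) chart set \<Rightarrow> ('m, 'n) metric \<Rightarrow> 'n set \<Rightarrow> 'm set \<Rightarrow>
     (real \<Rightarrow> ('m, 'n) cov \<Rightarrow> ('m, 'n) cov) \<Rightarrow> real \<Rightarrow> ('m, 'n) cov set" where
  "unit_Sigma A g D H G t = Sigma_t A D H G t \<inter> unit_conormal A g D H"

text \<open>The value does not depend on the slice charts, since the densities are invariant.\<close>
definition jacobian ::
    "('m, 'n::finite) chart set \<Rightarrow> ('m, 'n) metric \<Rightarrow> 'n set \<Rightarrow> 'm set \<Rightarrow>
     (real \<Rightarrow> ('m, 'n) cov \<Rightarrow> ('m, 'n) cov) \<Rightarrow> real \<Rightarrow> ('m, 'n) cov \<Rightarrow> real" where
  "jacobian A g D H G t z =
     (let c = slice_at A D H (fst z); c' = slice_at A D H (fst (G t z)) in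
      \<bar>det (matrix (\<lambda>v. merge_cn D (conormal_deriv A D H G t z v)))\<bar>
        * conormal_density g D c' (fst (G t z)) / conormal_density g D c (fst z))"

definition return_time ::
    "('m, 'n::finite) chart set \<Rightarrow> ('m, 'n) metric \<Rightarrow> 'n set \<Rightarrow> 'm set \<Rightarrow>
     (real \<Rightarrow> ('m, 'n) cov \<Rightarrow> ('m, 'n) cov) \<Rightarrow> ('m, 'n) cov \<Rightarrow> ereal" where
  "return_time A g D H G z =
     (if \<exists>t>0. z \<in> unit_Sigma A g D H G t
      then ereal (LEAST t. t > 0 \<and> z \<in> unit_Sigma A g D H G t) else \<infinity>)"

definition return_invariant ::
    "('m, 'n::finite) chart set \<Rightarrow> ('m, 'n) metric \<Rightarrow> 'n set \<Rightarrow> 'm set \<Rightarrow>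
     (real \<Rightarrow> ('m, 'n) cov \<Rightarrow> ('m, 'n) cov) \<Rightarrow> ('m, 'n) cov measure \<Rightarrow> (('m, 'n) cov \<Rightarrow> real) \<Rightarrow> bool"
  where
  "return_invariant A g D H G lam f \<longleftrightarrow>
     (AE z in lam. let T = return_time A g D H G z; t = real_of_ereal T in
        if T < \<infinity> then f z = f (G t z) * jacobian A g D H G t z else f z = 0)"

definition recurrent_times ::
    "('m, 'n::finite) chart set \<Rightarrow> ('m, 'n) metric \<Rightarrow> 'n set \<Rightarrow> 'm set \<Rightarrow>
     (real \<Rightarrow> ('m, 'n) cov \<Rightarrow> ('m, 'n) cov) \<Rightarrow> ('m, 'n) cov measure \<Rightarrow> real set" where
  "recurrent_times A g D H G lam = {t. t \<noteq> 0 \<and> emeasure lam (unit_Sigma A g D H G t) > 0}"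


section \<open>The half-wave group applied to the delta distribution of \<open>H\<close>\<close>

definition riem_volume ::
    "('m::topological_space, 'n::finite) chart set \<Rightarrow> ('m, 'n) metric \<Rightarrow> 'm measure" where
  "riem_volume A g = (THE \<nu>. sets \<nu> = sets borel \<and>
     (\<forall>c\<in>A. \<forall>B\<in>sets borel. B \<subseteq> fst c \<longrightarrow>
        emeasure \<nu> B = (\<integral>\<^sup>+ x\<in>snd c ` B. ennreal (sqrt (det (g c (cinv c x)))) \<partial>lborel)))"

text \<open>The Riemannian measure of \<open>H\<close>, as a measure on the ambient manifold.\<close>
definition sub_volume ::
    "('m::topological_space, 'n::finite) chart set \<Rightarrow> ('m, 'n) metric \<Rightarrow> 'n set \<Rightarrow> 'm set \<Rightarrow> 'm measure" where
  "sub_volume A g D H = (THE \<nu>. sets \<nu> = sets borel \<and> emeasure \<nu> (- H) = 0 \<and>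
     (\<forall>c\<in>slice_charts A D H. \<forall>B\<in>sets borel. B \<subseteq> fst c \<longrightarrow>
        emeasure \<nu> B = (\<integral>\<^sup>+ w\<in>{w. vec_on D w \<in> snd c ` B}.
          ennreal (sqrt (sub_det D (g c (cinv c (vec_on D w))))) \<partial>PiM D (\<lambda>_. lborel))))"

definition laplacian ::
    "('m, 'n) metric \<Rightarrow> ('m, 'n) chart \<Rightarrow> (real^'n \<Rightarrow> real) \<Rightarrow> real^'n \<Rightarrow> real" where
  "laplacian g c u x = (let a = (\<lambda>y. g c (cinv c y)) in
     (\<Sum>i\<in>UNIV. \<Sum>j\<in>UNIV.
        partial i (\<lambda>y. sqrt (det (a y)) * matrix_inv (a y) $ i $ j * partial j u y) x)
      / sqrt (det (a x)))"

text \<open>An orthonormal basis of \<open>L\<^sup>2\<close> consisting of real eigenfunctions of \<open>P\<close>, the square root of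
  minus the Laplacian, with eigenvalues \<open>l j\<close>.\<close>
definition laplace_eigenbasis ::
    "('m::topological_space, 'n::finite) chart set \<Rightarrow> ('m, 'n) metric \<Rightarrow>
     (nat \<Rightarrow> 'm \<Rightarrow> real) \<Rightarrow> (nat \<Rightarrow> real) \<Rightarrow> bool" where
  "laplace_eigenbasis A g e l \<longleftrightarrow>
     (\<forall>j. smooth_fun A (e j) \<and> l j \<ge> 0 \<and>
        (\<forall>c\<in>A. \<forall>x\<in>crange c. - laplacian g c (e j \<circ> cinv c) x = (l j)^2 * e j (cinv c x))) \<and>
     (\<forall>j k. (\<integral>q. e j q * e k q \<partial>riem_volume A g) = (if j = k then 1 else 0)) \<and>
     (\<forall>f. f \<in> borel_measurable borel \<and> integrable (riem_volume A g) (\<lambda>q. (f q)^2) \<and>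
        (\<forall>j. (\<integral>q. e j q * f q \<partial>riem_volume A g) = 0) \<longrightarrow> (AE q in riem_volume A g. f q = 0))"

text \<open>The pairing of the half-density distribution \<open>e\<^sup>i\<^sup>t\<^sup>P \<delta>\<^sub>H\<close> with the half-density
  \<open>f |dV|\<^sup>1\<^sup>/\<^sup>2\<close> for smooth \<open>f\<close>, by the spectral decomposition of \<open>P\<close>; it does not depend on the
  choice of the eigenbasis.\<close>
definition half_wave_delta ::
    "('m::topological_space, 'n::finite) chart set \<Rightarrow> ('m, 'n) metric \<Rightarrow> 'n set \<Rightarrow> 'm set \<Rightarrow>
     real \<Rightarrow> ('m \<Rightarrow> complex) \<Rightarrow> complex" where
  "half_wave_delta A g D H t f =
     (let (e, l) = (SOME (e, l). laplace_eigenbasis A g e l) in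
      \<Sum>j. cis (t * l j) * complex_of_real (\<integral>q. e j q \<partial>sub_volume A g D H)
            * (\<integral>q. complex_of_real (e j q) * f q \<partial>riem_volume A g))"

text \<open>The coordinate expression of a half-density distribution \<open>u\<close>: its pairing with
  \<open>\<phi> |dx|\<^sup>1\<^sup>/\<^sup>2\<close>, where \<open>|dV|\<^sup>1\<^sup>/\<^sup>2 = |g|\<^sup>1\<^sup>/\<^sup>4 |dx|\<^sup>1\<^sup>/\<^sup>2\<close> and \<open>\<phi>\<close> is supported in the
  range of the chart.\<close>
definition in_chart ::
    "('m, 'n) metric \<Rightarrow> ('m, 'n) chart \<Rightarrow> (('m \<Rightarrow> complex) \<Rightarrow> complex) \<Rightarrow>
     (real^'n \<Rightarrow> complex) \<Rightarrow> complex" where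
  "in_chart g c u \<phi> =
     u (\<lambda>q. if q \<in> fst c then \<phi> (snd c q) / complex_of_real (det (g c q) powr (1/4)) else 0)"


section \<open>The Maslov factor\<close>

text \<open>Fibre dilation \<open>(x', \<xi>'') \<mapsto> (x', r \<xi>'')\<close> in the encoding by a single vector.\<close>
definition dilate :: "'n set \<Rightarrow> real \<Rightarrow> real^'n \<Rightarrow> real^'n" where
  "dilate D r w = proj D w + r *\<^sub>R proj (-D) w"

text \<open>Classical symbols \<open>b(x, \<xi>'')\<close> of order \<open>0\<close> with the homogeneous terms \<open>bs k\<close> of degree
  \<open>-k\<close>; \<open>bs 0\<close> is the principal part. Functions of \<open>\<xi>''\<close> are functions on the full space
  which do not depend on the coordinates with index in \<open>D\<close>.\<close>
definition classical_symbol0 ::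
    "'n set \<Rightarrow> ((real^'n) \<times> (real^'n) \<Rightarrow> complex) \<Rightarrow>
     (nat \<Rightarrow> (real^'n) \<times> (real^'n) \<Rightarrow> complex) \<Rightarrow> bool" where
  "classical_symbol0 D b bs \<longleftrightarrow>
     smooth_on UNIV b \<and> (\<forall>x \<zeta>. b (x, \<zeta>) = b (x, proj (-D) \<zeta>)) \<and>
     (\<forall>k. smooth_on {(x, \<zeta>). proj (-D) \<zeta> \<noteq> 0} (bs k) \<and>
        (\<forall>x \<zeta>. bs k (x, \<zeta>) = bs k (x, proj (-D) \<zeta>)) \<and>
        (\<forall>x \<zeta> r. r > 0 \<and> proj (-D) \<zeta> \<noteq> 0 \<longrightarrow> bs k (x, r *\<^sub>R \<zeta>) = bs k (x, \<zeta>) / of_real (r ^ k))) \<and>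
     (\<forall>N vs ws K. compact K \<longrightarrow> (\<exists>C. \<forall>x\<in>K. \<forall>\<zeta>. norm (proj (-D) \<zeta>) \<ge> 1 \<longrightarrow>
        norm (iter_deriv (map (\<lambda>v. (v, 0)) vs @ map (\<lambda>w. (0, w)) ws)
                (\<lambda>y. b y - (\<Sum>k<N. bs k y)) (x, \<zeta>))
          \<le> C / norm (proj (-D) \<zeta>) ^ (N + length ws)))"

text \<open>The oscillatory integral with phase \<open>\<langle>x'', \<xi>''\<rangle> - \<psi>(x', \<xi>'')\<close> and amplitude \<open>b\<close>,
  paired with a test function. It is the iterated integral, \<open>x\<close> first: the inner integral decays
  rapidly in \<open>\<xi>''\<close>.\<close>
definition oscillatory_integral ::
    "'n set \<Rightarrow> (real^'n \<Rightarrow> real) \<Rightarrow> ((real^'n) \<times> (real^'n) \<Rightarrow> complex) \<Rightarrow>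
     (real^'n \<Rightarrow> complex) \<Rightarrow> complex" where
  "oscillatory_integral D \<psi> b \<phi> =
     (LINT w|PiM (-D) (\<lambda>_. lborel). (let \<zeta> = vec_on (-D) w in
        (LINT x|lborel. cis (proj (-D) x \<bullet> \<zeta> - \<psi> (merge_cn D (x, \<zeta>))) * b (x, \<zeta>) * \<phi> x)))"

text \<open>\<open>(x0, \<xi>0)\<close> is not in the wave front set of \<open>u1 - u2\<close>, for distributions \<open>u1\<close> and \<open>u2\<close> on
  the open set \<open>V\<close>.\<close>
definition microlocally_equal ::
    "(real^'n) set \<Rightarrow> ((real^'n \<Rightarrow> complex) \<Rightarrow> complex) \<Rightarrow> ((real^'n \<Rightarrow> complex) \<Rightarrow> complex) \<Rightarrow>
     (real^'n) \<times> (real^'n) \<Rightarrow> bool" where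
  "microlocally_equal V u1 u2 y \<longleftrightarrow>
     (\<exists>(h :: real^'n \<Rightarrow> real) K \<Gamma>.
        smooth_on UNIV h \<and> compact K \<and> K \<subseteq> V \<and> (\<forall>x. x \<notin> K \<longrightarrow> h x = 0) \<and> h (fst y) \<noteq> 0 \<and>
        open \<Gamma> \<and> snd y \<in> \<Gamma> \<and> (\<forall>\<eta>\<in>\<Gamma>. \<forall>r>0. r *\<^sub>R \<eta> \<in> \<Gamma>) \<and>
        (\<forall>N::nat. \<exists>C. \<forall>\<eta>\<in>\<Gamma>.
           let \<phi> = (\<lambda>x. complex_of_real (h x) * cis (- (x \<bullet> \<eta>)))
           in norm (u1 \<phi> - u2 \<phi>) \<le> C / (1 + norm \<eta>) ^ N))"

text \<open>In the slice chart \<open>c\<close>, the Lagrangian \<open>G\<^sup>-\<^sup>t(N\<^sup>*H)\<close> is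
  \<open>{x'' = \<psi>'\<^bsub>\<xi>''\<^esub>, \<xi>' = - \<psi>'\<^bsub>x'\<^esub>}\<close> near \<open>z\<close>, where \<open>\<psi>\<close> is smooth on the open cone \<open>W\<close>
  and homogeneous of degree 1 in \<open>\<xi>''\<close>.\<close>
definition lagrangian_phase ::
    "('m, 'n) chart set \<Rightarrow> 'n set \<Rightarrow> 'm set \<Rightarrow> (real \<Rightarrow> ('m, 'n) cov \<Rightarrow> ('m, 'n) cov) \<Rightarrow>
     real \<Rightarrow> ('m, 'n) cov \<Rightarrow> ('m, 'n) chart \<Rightarrow> (real^'n) set \<Rightarrow> (real^'n \<Rightarrow> real) \<Rightarrow> bool" where
  "lagrangian_phase A D H G t z c W \<psi> \<longleftrightarrow>
     open W \<and> (\<forall>w\<in>W. proj (-D) w \<noteq> 0) \<and>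
     (\<forall>w\<in>W. \<forall>r>0. dilate D r w \<in> W \<and> \<psi> (dilate D r w) = r * \<psi> w) \<and> smooth_on W \<psi> \<and>
     (\<exists>Q. open Q \<and> coords c z \<in> Q \<and> Q \<subseteq> crange c \<times> (- {0}) \<and> merge_cn D ` Q \<subseteq> W \<and>
        (\<forall>(x, \<xi>)\<in>Q. G t (cov_point A c (x, \<xi>)) \<in> conormal A D H \<longleftrightarrow>
           proj (-D) x = proj (-D) (grad \<psi> (merge_cn D (x, \<xi>))) \<and>
           proj D \<xi> = - proj D (grad \<psi> (merge_cn D (x, \<xi>)))))"

text \<open>\<open>\<beta>\<close> is the value at \<open>z\<close> of the principal part of the amplitude in a local representation of
  \<open>e\<^sup>i\<^sup>t\<^sup>P \<delta>\<^sub>H\<close> by an oscillatory integral as above. The amplitude is supported in a cone with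
  compact base in the domain \<open>W\<close> of the phase function.\<close>
definition principal_amplitude ::
    "('m::topological_space, 'n::finite) chart set \<Rightarrow> ('m, 'n) metric \<Rightarrow> 'n set \<Rightarrow> 'm set \<Rightarrow>
     (real \<Rightarrow> ('m, 'n) cov \<Rightarrow> ('m, 'n) cov) \<Rightarrow> real \<Rightarrow> ('m, 'n) cov \<Rightarrow> complex \<Rightarrow> bool" where
  "principal_amplitude A g D H G t z \<beta> \<longleftrightarrow>
     (\<exists>c\<in>slice_charts A D H. \<exists>W \<psi> b bs K.
        fst z \<in> fst c \<and> lagrangian_phase A D H G t z c W \<psi> \<and> classical_symbol0 D b bs \<and>
        compact K \<and> K \<subseteq> W \<and>
        (\<forall>x \<zeta>. b (x, \<zeta>) \<noteq> 0 \<longrightarrow> (\<exists>w\<in>K. \<exists>r>0. merge_cn D (x, \<zeta>) = dilate D r w)) \<and>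
        microlocally_equal (crange c) (in_chart g c (half_wave_delta A g D H t))
          (oscillatory_integral D \<psi> b) (coords c z) \<and>
        \<beta> = bs 0 (coords c z))"

text \<open>An integer representing the residue class modulo 4.\<close>
definition maslov_index ::
    "('m::topological_space, 'n::finite) chart set \<Rightarrow> ('m, 'n) metric \<Rightarrow> 'n set \<Rightarrow> 'm set \<Rightarrow>
     (real \<Rightarrow> ('m, 'n) cov \<Rightarrow> ('m, 'n) cov) \<Rightarrow> real \<Rightarrow> ('m, 'n) cov \<Rightarrow> int" where
  "maslov_index A g D H G t z =
     (SOME \<sigma>. \<exists>r>0. principal_amplitude A g D H G t z (complex_of_real r * \<i> powi \<sigma>))"

definition q_coeff ::
    "('m::topological_space, 'n::finite) chart set \<Rightarrow> ('m, 'n) metric \<Rightarrow> 'n set \<Rightarrow> 'm set \<Rightarrow>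
     (real \<Rightarrow> ('m, 'n) cov \<Rightarrow> ('m, 'n) cov) \<Rightarrow> ('m, 'n) cov measure \<Rightarrow> real \<Rightarrow> complex" where
  "q_coeff A g D H G lam t =
     complex_of_real ((2 * pi) powi (- int CARD('n) + int (card D))) *
     (LINT z:unit_Sigma A g D H G t|lam.
        \<i> powi maslov_index A g D H G t z * complex_of_real (sqrt (jacobian A g D H G t z)))"

end

theory Submission
  imports Defs
begin

text \<open>
Let \<open>T\<close> be the first return time and \<open>R z = G\<^sup>T z\<close> the first return map. On functions on the unit
conormal bundle consider the operator \<open>V h = \<surd>J\<^sub>T \<cdot> (h \<circ> R)\<close>, where \<open>V h = 0\<close> off the set on which \<open>T\<close> is
finite. The Jacobian \<open>J\<^sub>t\<close> is the factor by which \<open>G\<^sup>t\<close> transforms the Leray measure between \<open>S\<Sigma>\<^sub>t\<close> and its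
image, and \<open>R\<close> is injective on the set of returning points, because two points with the same
image and different return times would give the one with the longer time an earlier return. Hence
\<open>\<integral> J\<^sub>T (k \<circ> R) \<le> \<integral> k\<close> for \<open>k \<ge> 0\<close> (\<open>first_return_transfer\<close>), so \<open>V\<close> is a contraction of \<open>L\<^sup>2\<close>. If \<open>V h = h\<close>,
then \<open>h\<^sup>2\<close> is the density of an invariant \<open>L\<^sup>1\<close> measure, so the hypothesis says that \<open>V\<close> has no nonzero
fixed vector. By the mean ergodic theorem the averages of \<open>V\<^sup>k 1\<close> tend to \<open>0\<close>
(\<open>integral_average_tendsto_0\<close>).

These averages dominate the sum in the theorem. If \<open>t > 0\<close> and \<open>z \<in> S\<Sigma>\<^sub>t\<close>, then \<open>t\<close> is the sum of the first
\<open>k\<close> successive return times of \<open>z\<close> for some \<open>k \<ge> 1\<close>, and the cocycle identity \<open>J\<^sub>s\<^sub>+\<^sub>t = (J\<^sub>s \<circ> G\<^sup>t) J\<^sub>t\<close> gives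
\<open>\<surd>J\<^sub>t(z) = (V\<^sup>k 1)(z)\<close>. Different times correspond to different \<open>k\<close>, and successive returns to the
conormal bundle are at least a fixed time \<open>gap > 0\<close> apart. So the functions
\<open>\<surd>J\<^sub>t\<close> on \<open>S\<Sigma>\<^sub>t\<close>, summed over finitely many \<open>t\<close> in \<open>]0, K gap[\<close>, are at most \<open>V 1 + \<dots> + V\<^sup>K 1\<close>
(\<open>sum_amp_le\<close>). Since the Maslov factor has modulus 1, \<open>|q(t)|\<close> is at most a constant times the
integral of \<open>\<surd>J\<^sub>t\<close> over \<open>S\<Sigma>\<^sub>t\<close>; for negative times this integral is compared with the one at \<open>-t\<close>
(\<open>mass_minus\<close>).

The analytic work is in the transformation rule for the map \<open>R\<close>, whose return time varies from point
to point and is not smooth. The set of returning points is the union of countably many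
pieces, on each of which the return time is the restriction of a continuous function \<open>\<tau>\<close> on a compact set. On such a set
\<open>\<tau>\<close> has derivative zero: the canonical one-form \<open>\<xi> dx\<close> vanishes on the conormal bundle, while its value on the
Hamilton field is \<open>p \<noteq> 0\<close> by Euler's identity (\<open>cone_map_deriv\<close>). Therefore the derivative of
\<open>z \<mapsto> G\<^sup>\<tau>\<^sup>(\<^sup>z\<^sup>) z\<close> within the set is the one at a fixed time, and the change of variables formula for maps that
are differentiable only relative to a measurable set applies. The Leray measure enters through the
formula \<open>\<lambda>(B) = (n - d) \<mu>({r z | z \<in> B, 0 < r < 1})\<close>, where \<open>\<mu>\<close> is the natural density on the conormal
bundle (\<open>nn_integral_eq_cone\<close>): the flow commutes with dilations, and \<open>G\<^sup>t\<close> transforms \<open>\<mu>\<close> by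
\<open>J\<^sub>t\<close> by definition.
\<close>

section \<open>Change of variables on arbitrary finite index types\<close>

text \<open>The change of variables theorems for vectors indexed by \<open>'n\<close> require a
  well-order on \<open>'n\<close>. A copy of \<open>'n\<close> with an arbitrarily chosen well-order
  carries the results over to all finite index types.\<close>
typedef 'n ord_copy = "UNIV :: 'n set" by simp

lemma finite_ord_copy: "finite (UNIV :: 'n::finite ord_copy set)"
proof -
  have "UNIV = range (Abs_ord_copy :: 'n \<Rightarrow> _)"
    by (metis Rep_ord_copy_inverse surjI)
  then show ?thesis by (metis finite finite_imageI)
qed

instance ord_copy :: (finite) finite
  by standard (rule finite_ord_copy)

definition ord_copy_rank :: "'n::finite ord_copy \<Rightarrow> nat" where
  "ord_copy_rank = (SOME f. inj f)"

lemma inj_ord_copy_rank: "inj (ord_copy_rank :: 'n::finite ord_copy \<Rightarrow> nat)"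
proof -
  obtain f :: "'n ord_copy \<Rightarrow> nat" where "inj f"
    using finite_imp_inj_to_nat_seg[OF finite_ord_copy] by blast
  then show ?thesis unfolding ord_copy_rank_def by (rule someI[of inj])
qed

instantiation ord_copy :: (finite) wellorder
begin
definition "x \<le> y \<longleftrightarrow> ord_copy_rank x \<le> ord_copy_rank y"
definition "x < y \<longleftrightarrow> ord_copy_rank x < ord_copy_rank y"
instance
proof
  fix x y z :: "'a ord_copy"
  show "(x < y) = (x \<le> y \<and> \<not> y \<le> x)" "x \<le> x" "x \<le> y \<or> y \<le> x"
    unfolding less_eq_ord_copy_def less_ord_copy_def by linarith+
  show "x \<le> z" if "x \<le> y" "y \<le> z" using that unfolding less_eq_ord_copy_def by linarith
  show "x = y" if "x \<le> y" "y \<le> x"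
    using that injD[OF inj_ord_copy_rank, of x y] unfolding less_eq_ord_copy_def by linarith
next
  fix P :: "'a ord_copy \<Rightarrow> bool" and a
  assume step: "\<And>x. (\<And>y. y < x \<Longrightarrow> P y) \<Longrightarrow> P x"
  show "P a"
  proof (induction "ord_copy_rank a" arbitrary: a rule: less_induct)
    case less
    show ?case by (rule step) (rule less, simp add: less_ord_copy_def)
  qed
qed
end

lemma bij_Rep_ord_copy: "bij (Rep_ord_copy :: 'n ord_copy \<Rightarrow> 'n)"
  by (intro bijI injI surjI[of _ Abs_ord_copy]) (simp_all add: Rep_ord_copy_inject Abs_ord_copy_inverse)

definition reindex :: "('b \<Rightarrow> 'a) \<Rightarrow> (real, 'a::finite) vec \<Rightarrow> (real, 'b::finite) vec" where
  "reindex p x = (\<chi> i. x $ p i)"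

lemma reindex_nth [simp]: "reindex p x $ i = x $ p i"
  by (simp add: reindex_def)

lemma linear_reindex: "linear (reindex p)"
  by (intro linearI) (auto simp: vec_eq_iff)

lemma borel_reindex [measurable]: "reindex p \<in> borel_measurable borel"
  by (intro borel_measurable_continuous_onI linear_continuous_on linear_linear[THEN iffD1] linear_reindex)
   (simp add: linear_conv_bounded_linear[symmetric] linear_reindex)

lemma reindex_inverse:
  assumes "bij p" shows "reindex (inv p) (reindex p x) = x" "reindex p (reindex (inv p) y) = y"
  using assms by (auto simp: vec_eq_iff bij_is_surj surj_f_inv_f bij_is_inj inv_f_f)

lemma lborel_distr_reindex:
  fixes p :: "'b::finite \<Rightarrow> 'a::finite"
  assumes p: "bij p"
  shows "distr lborel borel (reindex p) = (lborel :: (real^'b) measure)"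
proof (rule lborel_eqI[symmetric])
  fix l u :: "real^'b"
  assume lu: "\<And>b. b \<in> Basis \<Longrightarrow> l \<bullet> b \<le> u \<bullet> b"
  have le: "l $ i \<le> u $ i" for i
    using lu[of "axis i 1"] by (auto simp: inner_axis Basis_vec_def)
  have vim: "reindex p -` box l u = box (reindex (inv p) l) (reindex (inv p) u)"
  proof (intro set_eqI)
    fix x :: "real^'a"
    have "(\<forall>i. P (p i) i) \<longleftrightarrow> (\<forall>j. P j (inv p j))" for P :: "'a \<Rightarrow> 'b \<Rightarrow> bool"
      using p by (metis bij_inv_eq_iff)
    from this[of "\<lambda>j i. l $ i < x $ j \<and> x $ j < u $ i"]
    show "x \<in> reindex p -` box l u \<longleftrightarrow> x \<in> box (reindex (inv p) l) (reindex (inv p) u)"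
      by (simp add: mem_box_cart)
  qed
  have pr: "(\<Prod>b\<in>Basis. (v::real^'c::finite) \<bullet> b) = (\<Prod>i\<in>UNIV. v $ i)" for v
  proof -
    have B: "Basis = range (\<lambda>i::'c. axis i (1::real))" by (auto simp: Basis_vec_def)
    show ?thesis
      unfolding B by (subst prod.reindex) (auto simp: inj_on_def axis_eq_axis inner_axis)
  qed
  have "emeasure (distr lborel borel (reindex p)) (box l u) = emeasure lborel (box (reindex (inv p) l) (reindex (inv p) u))"
    by (subst emeasure_distr) (auto simp: vim)
  also have "\<dots> = ennreal (\<Prod>b\<in>Basis. (reindex (inv p) u - reindex (inv p) l) \<bullet> b)"
    by (rule emeasure_lborel_box) (auto simp: Basis_vec_def inner_axis le)
  also have "(\<Prod>b\<in>Basis. (reindex (inv p) u - reindex (inv p) l) \<bullet> b) = (\<Prod>i\<in>UNIV. u $ inv p i - l $ inv p i)"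
    by (simp add: pr)
  also have "\<dots> = (\<Prod>i\<in>UNIV. u $ i - l $ i)"
    by (rule prod.reindex_bij_betw[of "inv p"]) (simp add: p bij_imp_bij_inv)
  also have "\<dots> = (\<Prod>b\<in>Basis. (u - l) \<bullet> b)" by (simp add: pr)
  finally show "emeasure (distr lborel borel (reindex p)) (box l u) = ennreal (\<Prod>b\<in>Basis. (u - l) \<bullet> b)" .
qed simp

lemma det_reindex:
  fixes M :: "real^'n::finite^'n" and p :: "'b::finite \<Rightarrow> 'n"
  assumes p: "bij p"
  shows "det ((\<chi> i j. M $ p i $ p j) :: real^'b^'b) = det M"
proof -
  let ?q = "\<lambda>\<sigma>. p \<circ> \<sigma> \<circ> inv p"
  have pinv: "inv p (p i) = i" "p (inv p j) = j" for i j
    using p by (auto simp: bij_is_surj surj_f_inv_f bij_is_inj inv_f_f)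
  have conj: "(?q \<sigma>) permutes UNIV" if "\<sigma> permutes UNIV" for \<sigma>
    using bij_comp[OF bij_comp[OF bij_imp_bij_inv[OF p] permutes_bij[OF that]] p]
    by (intro bij_imp_permutes) (simp_all add: o_assoc)
  have conj': "(inv p \<circ> \<sigma> \<circ> p) permutes UNIV" if "\<sigma> permutes UNIV" for \<sigma>
    using bij_comp[OF bij_comp[OF p permutes_bij[OF that]] bij_imp_bij_inv[OF p]]
    by (intro bij_imp_permutes) (simp_all add: o_assoc)
  have "det M = (\<Sum>\<sigma> | \<sigma> permutes UNIV. of_int (sign (?q \<sigma>)) * (\<Prod>i\<in>UNIV. M $ i $ ?q \<sigma> i))"
  proof -
    have qq: "?q (inv p \<circ> \<sigma> \<circ> p) = \<sigma>" "inv p \<circ> (?q \<tau>) \<circ> p = \<tau>" for \<sigma> \<tau>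
      by (simp_all add: o_def pinv)
    show ?thesis
      unfolding det_def
      by (rule sum.reindex_bij_witness[where i="?q" and j="\<lambda>\<sigma>. inv p \<circ> \<sigma> \<circ> p"])
         (simp_all only: mem_Collect_eq qq conj conj')
  qed
  also have "\<dots> = (\<Sum>\<sigma> | \<sigma> permutes UNIV. of_int (sign \<sigma>) * (\<Prod>i\<in>UNIV. M $ p i $ p (\<sigma> i)))"
  proof (rule sum.cong[OF refl])
    fix \<sigma> :: "'b \<Rightarrow> 'b" assume "\<sigma> \<in> {\<sigma>. \<sigma> permutes UNIV}"
    then have s: "\<sigma> permutes UNIV" by simp
    have "map_permutation UNIV p \<sigma> = ?q \<sigma>"
      using p by (auto simp: map_permutation_def restrict_id_def fun_eq_iff bij_is_surj)
    then have "sign (?q \<sigma>) = sign \<sigma>"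
      using sign_map_permutation[of p UNIV \<sigma>] s p by (simp add: bij_is_inj)
    moreover have "(\<Prod>i\<in>UNIV. M $ i $ ?q \<sigma> i) = (\<Prod>i\<in>UNIV. M $ p i $ p (\<sigma> i))"
      using prod.reindex_bij_betw[of p UNIV UNIV "\<lambda>i. M $ i $ ?q \<sigma> i"] p by (simp add: pinv o_def)
    ultimately show "of_int (sign (?q \<sigma>)) * (\<Prod>i\<in>UNIV. M $ i $ ?q \<sigma> i) = of_int (sign \<sigma>) * (\<Prod>i\<in>UNIV. M $ p i $ p (\<sigma> i))"
      by simp
  qed
  finally show ?thesis by (simp add: det_def)
qed

text \<open>If the integral is finite, this is the change of variables theorem for absolutely
  integrable functions. If it is infinite, the image cannot have finite measure, by the converse
  part of that theorem.\<close>
lemma emeasure_differentiable_image_wellorder: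
  fixes f :: "real^'n::{finite,wellorder} \<Rightarrow> real^'n::_"
  assumes S: "S \<in> sets lebesgue"
    and f: "\<And>x. x \<in> S \<Longrightarrow> (f has_derivative f' x) (at x within S)"
    and inj: "inj_on f S" and fS: "f ` S \<in> sets lebesgue"
  shows "emeasure lebesgue (f ` S) = (\<integral>\<^sup>+ x\<in>S. ennreal \<bar>det (matrix (f' x))\<bar> \<partial>lebesgue)"
proof -
  let ?D = "\<lambda>x. \<bar>det (matrix (f' x))\<bar>"
  have meas: "?D \<in> borel_measurable (lebesgue_on S)"
    using borel_measurable_det_Jacobian[OF S f] by (rule borel_measurable_abs)
  have eq: "(\<integral>\<^sup>+ x\<in>S. ennreal (?D x) \<partial>lebesgue) = (\<integral>\<^sup>+ x. ennreal (?D x) \<partial>lebesgue_on S)"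
    using S by (subst nn_integral_restrict_space) auto
  show ?thesis
  proof (cases "(\<integral>\<^sup>+ x\<in>S. ennreal (?D x) \<partial>lebesgue) = \<infinity>")
    case True
    have "\<not> f ` S \<in> lmeasurable"
    proof
      assume "f ` S \<in> lmeasurable"
      then have "?D absolutely_integrable_on S"
        using measurable_differentiable_image_alt[OF S f inj] by blast
      then have "integrable (lebesgue_on S) ?D"
        using S by (simp add: set_integrable_def integrable_restrict_space)
      then have "(\<integral>\<^sup>+ x. ennreal (?D x) \<partial>lebesgue_on S) < \<infinity>"
        using integrableD(2) by (auto simp: integrable_iff_bounded)
      with True eq show False by simp
    qed
    then have "\<not> emeasure lebesgue (f ` S) < \<infinity>"
      using fS unfolding fmeasurable_def by blast
    then have "emeasure lebesgue (f ` S) = \<infinity>"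
      by (metis infinity_ennreal_def less_top)
    with True show ?thesis by simp
  next
    case False
    then have int: "integrable (lebesgue_on S) ?D"
      using meas eq by (auto simp: integrable_iff_bounded less_top)
    then have ab: "?D absolutely_integrable_on S"
      using S by (simp add: set_integrable_def integrable_restrict_space)
    then have lm: "f ` S \<in> lmeasurable"
      using measurable_differentiable_image_alt[OF S f inj] by blast
    have "measure lebesgue (f ` S) = integral S ?D"
      by (rule measure_differentiable_image_eq[OF S f inj])
         (use ab in \<open>auto simp: absolutely_integrable_on_def\<close>)
    also have "\<dots> = integral\<^sup>L (lebesgue_on S) ?D"
      using lebesgue_integral_eq_integral[OF int S] by simp
    finally have "ennreal (measure lebesgue (f ` S)) = (\<integral>\<^sup>+ x. ennreal (?D x) \<partial>lebesgue_on S)"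
      using nn_integral_eq_integral[OF int] by simp
    moreover have "emeasure lebesgue (f ` S) = ennreal (measure lebesgue (f ` S))"
      using lm by (intro emeasure_eq_ennreal_measure) (auto simp: fmeasurable_def)
    ultimately show ?thesis using eq by simp
  qed
qed

lemma matrix_reindex:
  fixes f :: "real^'n::finite \<Rightarrow> real^'n" and p :: "'b::finite \<Rightarrow> 'n"
  assumes p: "bij p"
  shows "matrix (reindex p \<circ> f \<circ> reindex (inv p)) = (\<chi> i j. matrix f $ p i $ p j)"
proof -
  have "(inv p i = j) = (i = p j)" for i j
    using bij_inv_eq_iff[OF p] by metis
  then have *: "reindex (inv p) (axis j (1::real)) = axis (p j) 1" for j
    by (simp add: vec_eq_iff axis_def)
  show ?thesis by (simp add: matrix_def vec_eq_iff *)
qed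

text \<open>Conjugation with the permutation of coordinates onto the well-ordered copy of the index
  type changes neither Lebesgue measure nor the determinant of the derivative.\<close>
lemma emeasure_differentiable_image:
  fixes f :: "real^'n::finite \<Rightarrow> real^'n"
  assumes S: "S \<in> sets borel"
    and f: "\<And>x. x \<in> S \<Longrightarrow> (f has_derivative f' x) (at x within S)"
    and inj: "inj_on f S" and fS: "f ` S \<in> sets borel"
    and D: "(\<lambda>x. det (matrix (f' x)) * indicator S x) \<in> borel_measurable borel"
  shows "emeasure lborel (f ` S) = (\<integral>\<^sup>+ x\<in>S. ennreal \<bar>det (matrix (f' x))\<bar> \<partial>lborel)"
proof -
  define p where "p = (Rep_ord_copy :: 'n ord_copy \<Rightarrow> 'n)"
  have p: "bij p" unfolding p_def by (rule bij_Rep_ord_copy)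
  define R where "R = (reindex p :: real^'n \<Rightarrow> real^'n ord_copy)"
  define R' where "R' = (reindex (inv p) :: real^'n ord_copy \<Rightarrow> real^'n)"
  have RR: "R' (R x) = x" "R (R' y) = y" for x y
    unfolding R_def R'_def using reindex_inverse[OF p] by auto
  have Rm [measurable]: "R \<in> borel_measurable borel" "R' \<in> borel_measurable borel"
    unfolding R_def R'_def by measurable
  have img: "R ` X = R' -` X" for X
  proof (intro set_eqI iffI)
    fix y assume "y \<in> R' -` X" then show "y \<in> R ` X" using RR(2)[of y] by (intro image_eqI[of _ _ "R' y"]) auto
  qed (auto simp: RR)
  have imgb: "R ` X \<in> sets borel" if "X \<in> sets borel" for X
    unfolding img using measurable_sets_borel[OF Rm(2) that] by simp
  have dR: "distr lborel borel R = lborel" unfolding R_def by (rule lborel_distr_reindex[OF p])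
  have dR': "distr lborel borel R' = lborel" unfolding R'_def
    by (rule lborel_distr_reindex) (rule bij_imp_bij_inv[OF p])
  have lin: "bounded_linear R" "bounded_linear R'"
    unfolding R_def R'_def using linear_reindex linear_conv_bounded_linear by blast+
  let ?g = "R \<circ> f \<circ> R'" and ?g' = "\<lambda>y. R \<circ> f' (R' y) \<circ> R'"
  have gS: "?g ` (R ` S) = R ` (f ` S)" by (simp add: image_image RR)
  have det: "det (matrix (?g' y)) = det (matrix (f' (R' y)))" for y
    unfolding R_def R'_def matrix_reindex[OF p] by (rule det_reindex[OF p])
  have der: "(?g has_derivative ?g' y) (at y within R ` S)" if y: "y \<in> R ` S" for y
  proof -
    have 1: "(R' has_derivative R') (at y within R ` S)"
      using lin(2) by (rule bounded_linear_imp_has_derivative)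
    have RS: "R' ` R ` S = S" by (simp add: image_image RR)
    moreover have "R' y \<in> S" using y RR by auto
    ultimately have 2: "(f has_derivative f' (R' y)) (at (R' y) within R' ` R ` S)" using f by metis
    have 3: "(R has_derivative R) (at ((f \<circ> R') y) within (f \<circ> R') ` R ` S)"
      using lin(1) by (rule bounded_linear_imp_has_derivative)
    from diff_chain_within[OF diff_chain_within[OF 1 2] 3]
    show ?thesis by (simp only: o_assoc)
  qed
  have "emeasure lborel (f ` S) = emeasure lborel (R ` (f ` S))"
  proof -
    have m: "R' \<in> measurable lborel borel" using Rm(2) by simp
    have "emeasure lborel (f ` S) = emeasure (distr lborel borel R') (f ` S)" by (simp only: dR')
    also have "\<dots> = emeasure lborel (R' -` (f ` S) \<inter> space lborel)"
      by (rule emeasure_distr[OF m fS])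
    also have "\<dots> = emeasure lborel (R ` (f ` S))" by (simp add: img)
    finally show ?thesis .
  qed
  also have "\<dots> = emeasure lebesgue (?g ` (R ` S))"
    unfolding gS using imgb[OF fS] by (simp add: emeasure_completion)
  also have "\<dots> = (\<integral>\<^sup>+ y\<in>R ` S. ennreal \<bar>det (matrix (?g' y))\<bar> \<partial>lebesgue)"
  proof (rule emeasure_differentiable_image_wellorder[OF _ der])
    show "inj_on ?g (R ` S)"
    proof (rule inj_onI)
      fix x y assume "x \<in> R ` S" "y \<in> R ` S" and e: "?g x = ?g y"
      then have "R' x \<in> S" "R' y \<in> S" using RR by auto
      moreover have "f (R' x) = f (R' y)" using arg_cong[OF e, of R'] RR by simp
      ultimately have "R' x = R' y" using inj by (auto dest: inj_onD)
      then have "R (R' x) = R (R' y)" by (rule arg_cong)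
      then show "x = y" by (simp only: RR)
    qed
    show "?g ` (R ` S) \<in> sets lebesgue" using imgb[OF fS] gS by simp
    show "R ` S \<in> sets lebesgue" using imgb[OF S] by simp
  qed
  also have "\<dots> = (\<integral>\<^sup>+ y. ennreal \<bar>det (matrix (f' (R' y))) * indicator S (R' y)\<bar> \<partial>lborel)"
    unfolding det nn_integral_completion
  proof (rule nn_integral_cong)
    fix y
    have "indicator (R ` S) y = (indicator S (R' y) :: ennreal)"
      unfolding img by (simp add: indicator_def)
    then show "ennreal \<bar>det (matrix (f' (R' y)))\<bar> * indicator (R ` S) y
      = ennreal \<bar>det (matrix (f' (R' y))) * indicator S (R' y)\<bar>"
      by (simp add: indicator_def)
  qed
  also have "\<dots> = (\<integral>\<^sup>+ x. ennreal \<bar>det (matrix (f' x)) * indicator S x\<bar> \<partial>lborel)"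
    using nn_integral_distr[of R' lborel borel "\<lambda>x. ennreal \<bar>det (matrix (f' x)) * indicator S x\<bar>"] D
    by (simp add: dR')
  also have "\<dots> = (\<integral>\<^sup>+ x\<in>S. ennreal \<bar>det (matrix (f' x))\<bar> \<partial>lborel)"
    by (rule nn_integral_cong) (auto simp: indicator_def)
  finally show ?thesis .
qed

text \<open>The measure \<open>B \<mapsto> |f(S) \<inter> B|\<close> is the image under
  \<open>f\<close> of the density \<open>|det f'|\<close> on \<open>S\<close>, by the previous lemma
  applied to the sets \<open>S \<inter> f\<^sup>-\<^sup>1(B)\<close>. Differentiability is relative
  to \<open>S\<close>, which may have empty interior; the return map below is differentiable in this
  sense only.\<close>
lemma nn_integral_change_of_variables:
  fixes f :: "real^'n::finite \<Rightarrow> real^'n"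
  assumes S: "S \<in> sets borel"
    and f: "\<And>x. x \<in> S \<Longrightarrow> (f has_derivative f' x) (at x within S)"
    and inj: "inj_on f S"
    and fS: "\<And>B. B \<subseteq> S \<Longrightarrow> B \<in> sets borel \<Longrightarrow> f ` B \<in> sets borel"
    and D: "(\<lambda>x. det (matrix (f' x)) * indicator S x) \<in> borel_measurable borel"
    and h: "h \<in> borel_measurable borel"
  shows "(\<integral>\<^sup>+ y\<in>f ` S. h y \<partial>lborel) = (\<integral>\<^sup>+ x\<in>S. ennreal \<bar>det (matrix (f' x))\<bar> * h (f x) \<partial>lborel)"
proof -
  have contf: "continuous_on S f"
    using f by (meson continuous_on_eq_continuous_within has_derivative_continuous)
  let ?d = "\<lambda>x. ennreal \<bar>det (matrix (f' x)) * indicator S x\<bar>"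
  have dm: "?d \<in> borel_measurable lborel" using D by auto
  define f0 where "f0 x = (if x \<in> S then f x else 0)" for x
  have f0[measurable]: "f0 \<in> borel_measurable borel"
    unfolding f0_def using borel_measurable_continuous_on_if[OF S contf] by simp
  let ?N = "distr (density lborel ?d) borel f0"
  let ?M = "density lborel (indicator (f ` S))"
  have fSS: "f ` S \<in> sets borel" using fS S by auto
  have "?M = ?N"
  proof (rule measure_eqI)
    fix B assume "B \<in> sets ?M"
    then have B: "B \<in> sets borel" by simp
    let ?C = "S \<inter> f0 -` B"
    have C: "?C \<in> sets borel" using S measurable_sets_borel[OF f0 B] by auto
    have fC: "f ` ?C = f ` S \<inter> B" by (auto simp: f0_def)
    have dC: "(\<lambda>x. det (matrix (f' x)) * indicator ?C x) = (\<lambda>x. det (matrix (f' x)) * indicator S x * indicator ?C x)"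
      by (auto simp: indicator_def fun_eq_iff)
    have "emeasure ?M B = emeasure lborel (f ` ?C)"
      using B fSS by (simp add: emeasure_density fC indicator_inter_arith[symmetric])
    also have "\<dots> = (\<integral>\<^sup>+ x\<in>?C. ennreal \<bar>det (matrix (f' x))\<bar> \<partial>lborel)"
    proof (rule emeasure_differentiable_image[OF C])
      show "(f has_derivative f' x) (at x within ?C)" if "x \<in> ?C" for x
        using f[of x] that has_derivative_subset by blast
      show "(\<lambda>x. det (matrix (f' x)) * indicator ?C x) \<in> borel_measurable borel"
        unfolding dC using D C by (rule borel_measurable_times[OF _ borel_measurable_indicator])
    qed (use inj fS C in \<open>auto simp: inj_on_def\<close>)
    also have "\<dots> = emeasure ?N B"
    proof -
      have "emeasure ?N B = (\<integral>\<^sup>+ x. ?d x * indicator (f0 -` B) x \<partial>lborel)"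
        using B dm f0 measurable_sets_borel[OF f0 B] by (simp add: emeasure_distr emeasure_density)
      then show ?thesis by (simp only:) (rule nn_integral_cong, auto simp: indicator_def)
    qed
    finally show "emeasure ?M B = emeasure ?N B" .
  qed simp
  then have "(\<integral>\<^sup>+ y. h y \<partial>?M) = (\<integral>\<^sup>+ y. h y \<partial>?N)" by simp
  moreover have "(\<integral>\<^sup>+ y. h y \<partial>?M) = (\<integral>\<^sup>+ y\<in>f ` S. h y \<partial>lborel)"
    using h fSS by (subst nn_integral_density) (auto simp: mult.commute)
  moreover have "(\<integral>\<^sup>+ y. h y \<partial>?N) = (\<integral>\<^sup>+ x\<in>S. ennreal \<bar>det (matrix (f' x))\<bar> * h (f x) \<partial>lborel)"
    using h f0 dm by (simp add: nn_integral_distr nn_integral_density)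
      (rule nn_integral_cong, auto simp: indicator_def f0_def)
  ultimately show ?thesis by simp
qed

section \<open>Ergodic averages of weighted composition operators\<close>
definition sq_int :: "'a measure \<Rightarrow> ('a \<Rightarrow> real) \<Rightarrow> bool" where
  "sq_int M f \<longleftrightarrow> f \<in> borel_measurable M \<and> integrable M (\<lambda>x. (f x)\<^sup>2)"

definition l2norm :: "'a measure \<Rightarrow> ('a \<Rightarrow> real) \<Rightarrow> real" where
  "l2norm M f = sqrt (\<integral>x. (f x)\<^sup>2 \<partial>M)"

lemma sq_int_mult_integrable:
  assumes "sq_int M f" "sq_int M g"
  shows "integrable M (\<lambda>x. f x * g x)"
proof (rule Bochner_Integration.integrable_bound)
  show "integrable M (\<lambda>x. (f x)\<^sup>2 + (g x)\<^sup>2)" using assms by (auto simp: sq_int_def)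
  show "(\<lambda>x. f x * g x) \<in> borel_measurable M" using assms by (auto simp: sq_int_def)
  have "\<bar>a * b\<bar> \<le> a\<^sup>2 + b\<^sup>2" for a b :: real
  proof -
    have "2 * (\<bar>a\<bar> * \<bar>b\<bar>) \<le> \<bar>a\<bar>\<^sup>2 + \<bar>b\<bar>\<^sup>2" using sum_squares_bound[of "\<bar>a\<bar>" "\<bar>b\<bar>"] by simp
    moreover have "0 \<le> \<bar>a\<bar> * \<bar>b\<bar>" by simp
    ultimately have "\<bar>a\<bar> * \<bar>b\<bar> \<le> \<bar>a\<bar>\<^sup>2 + \<bar>b\<bar>\<^sup>2" by linarith
    then show ?thesis by (simp add: abs_mult)
  qed
  then show "AE x in M. norm (f x * g x) \<le> norm ((f x)\<^sup>2 + (g x)\<^sup>2)"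
    by simp
qed

lemma sq_int_add: "sq_int M f \<Longrightarrow> sq_int M g \<Longrightarrow> sq_int M (\<lambda>x. f x + g x)"
  using sq_int_mult_integrable[of M f g]
  by (auto simp: sq_int_def power2_sum mult.assoc)

lemma sq_int_scale: "sq_int M f \<Longrightarrow> sq_int M (\<lambda>x. c * f x)"
  by (auto simp: sq_int_def power_mult_distrib)

lemma l2norm_nonneg: "0 \<le> l2norm M f"
  by (simp add: l2norm_def)

lemma l2norm_power2: "(l2norm M f)\<^sup>2 = (\<integral>x. (f x)\<^sup>2 \<partial>M)"
  by (simp add: l2norm_def)

lemma l2norm_scale: "l2norm M (\<lambda>x. c * f x) = \<bar>c\<bar> * l2norm M f"
  by (simp add: l2norm_def power_mult_distrib real_sqrt_mult)

lemma cauchy_schwarz_integral: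
  assumes f: "sq_int M f" and g: "sq_int M g"
  shows "(\<integral>x. f x * g x \<partial>M) \<le> l2norm M f * l2norm M g"
proof -
  let ?a = "l2norm M f" and ?b = "l2norm M g" and ?c = "\<integral>x. f x * g x \<partial>M"
  have *: "0 \<le> s\<^sup>2 * ?a\<^sup>2 + t\<^sup>2 * ?b\<^sup>2 - 2 * s * t * ?c" for s t
  proof -
    have "0 \<le> (\<integral>x. (s * f x - t * g x)\<^sup>2 \<partial>M)" by simp
    also have "(\<lambda>x. (s * f x - t * g x)\<^sup>2) = (\<lambda>x. s\<^sup>2 * (f x)\<^sup>2 + t\<^sup>2 * (g x)\<^sup>2 - 2 * s * t * (f x * g x))"
      by (auto simp: fun_eq_iff power2_eq_square algebra_simps)
    also have "(\<integral>x. s\<^sup>2 * (f x)\<^sup>2 + t\<^sup>2 * (g x)\<^sup>2 - 2 * s * t * (f x * g x) \<partial>M)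
        = s\<^sup>2 * (\<integral>x. (f x)\<^sup>2 \<partial>M) + t\<^sup>2 * (\<integral>x. (g x)\<^sup>2 \<partial>M) - 2 * s * t * ?c"
      using f g sq_int_mult_integrable[OF f g] unfolding sq_int_def
      by (simp del: mult_cancel_left)
    finally show ?thesis by (simp add: l2norm_power2)
  qed
  show ?thesis
  proof (cases "?a = 0 \<or> ?b = 0")
    case False
    then have pos: "?a > 0" "?b > 0" using l2norm_nonneg[of M f] l2norm_nonneg[of M g] by auto
    have "2 * (?a * ?b) * ?c \<le> 2 * (?a * ?b) * (?a * ?b)"
      using *[of ?b ?a] by (simp add: power2_eq_square algebra_simps)
    then show ?thesis using pos by (simp add: mult_le_cancel_left_pos)
  next
    case True
    have "?c \<le> 0"
    proof (rule ccontr)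
      assume "\<not> ?c \<le> 0"
      then have c: "?c > 0" by simp
      from True show False
      proof
        assume a: "?a = 0"
        have "2 * ((?b\<^sup>2 + 1) / ?c) * ?c \<le> ?b\<^sup>2" using *[of "(?b\<^sup>2 + 1) / ?c" 1] a by simp
        with c have "2 * (?b\<^sup>2 + 1) \<le> ?b\<^sup>2" by simp
        then show False using zero_le_power2[of ?b] by (simp add: algebra_simps)
      next
        assume b: "?b = 0"
        have "2 * ((?a\<^sup>2 + 1) / ?c) * ?c \<le> ?a\<^sup>2" using *[of 1 "(?a\<^sup>2 + 1) / ?c"] b by simp
        with c have "2 * (?a\<^sup>2 + 1) \<le> ?a\<^sup>2" by simp
        then show False using zero_le_power2[of ?a] by (simp add: algebra_simps)
      qed
    qed
    then show ?thesis using True by auto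
  qed
qed

lemma l2norm_triangle:
  assumes f: "sq_int M f" and g: "sq_int M g"
  shows "l2norm M (\<lambda>x. f x + g x) \<le> l2norm M f + l2norm M g"
proof (rule power2_le_imp_le)
  have "(l2norm M (\<lambda>x. f x + g x))\<^sup>2 = (\<integral>x. (f x)\<^sup>2 + (g x)\<^sup>2 + 2 * (f x * g x) \<partial>M)"
    by (simp add: l2norm_power2 power2_sum mult.assoc)
  also have "\<dots> = (l2norm M f)\<^sup>2 + (l2norm M g)\<^sup>2 + 2 * (\<integral>x. f x * g x \<partial>M)"
    using f g sq_int_mult_integrable[OF f g] unfolding sq_int_def by (simp add: l2norm_power2)
  also have "\<dots> \<le> (l2norm M f + l2norm M g)\<^sup>2"
    using cauchy_schwarz_integral[OF f g] by (simp add: power2_sum)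
  finally show "(l2norm M (\<lambda>x. f x + g x))\<^sup>2 \<le> (l2norm M f + l2norm M g)\<^sup>2" .
qed (simp add: l2norm_nonneg)

lemma l2norm_parallelogram:
  assumes f: "sq_int M f" and g: "sq_int M g"
  shows "(l2norm M (\<lambda>x. f x - g x))\<^sup>2 = 2 * (l2norm M f)\<^sup>2 + 2 * (l2norm M g)\<^sup>2 - (l2norm M (\<lambda>x. f x + g x))\<^sup>2"
proof -
  have "(\<integral>x. (f x - g x)\<^sup>2 \<partial>M) = (\<integral>x. (f x)\<^sup>2 + (g x)\<^sup>2 - 2 * (f x * g x) \<partial>M)"
    by (simp add: power2_diff mult.assoc)
  also have "\<dots> = (\<integral>x. (f x)\<^sup>2 \<partial>M) + (\<integral>x. (g x)\<^sup>2 \<partial>M) - 2 * (\<integral>x. f x * g x \<partial>M)"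
    using f g sq_int_mult_integrable[OF f g] unfolding sq_int_def by simp
  finally have 1: "(\<integral>x. (f x - g x)\<^sup>2 \<partial>M) = (\<integral>x. (f x)\<^sup>2 \<partial>M) + (\<integral>x. (g x)\<^sup>2 \<partial>M) - 2 * (\<integral>x. f x * g x \<partial>M)" .
  have "(\<integral>x. (f x + g x)\<^sup>2 \<partial>M) = (\<integral>x. (f x)\<^sup>2 + (g x)\<^sup>2 + 2 * (f x * g x) \<partial>M)"
    by (simp add: power2_sum mult.assoc)
  also have "\<dots> = (\<integral>x. (f x)\<^sup>2 \<partial>M) + (\<integral>x. (g x)\<^sup>2 \<partial>M) + 2 * (\<integral>x. f x * g x \<partial>M)"
    using f g sq_int_mult_integrable[OF f g] unfolding sq_int_def by simp
  finally show ?thesis using 1 by (simp add: l2norm_power2)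
qed

lemma l2norm_mono:
  assumes "sq_int M f" "sq_int M g" "\<And>x. x \<in> space M \<Longrightarrow> 0 \<le> f x" "\<And>x. x \<in> space M \<Longrightarrow> f x \<le> g x"
  shows "l2norm M f \<le> l2norm M g"
  unfolding l2norm_def using assms
  by (intro real_sqrt_le_mono integral_mono) (auto simp: sq_int_def intro!: power_mono)

text \<open>The assumption \<open>contract\<close> says that \<open>h \<mapsto> w \<cdot> (h \<circ>
  R)\<close> does not increase the \<open>L\<^sup>2\<close> norm.\<close>
locale weighted_composition = finite_measure M for M :: "'a measure" +
  fixes R :: "'a \<Rightarrow> 'a" and w :: "'a \<Rightarrow> real"
  assumes R [measurable]: "R \<in> measurable M M"
    and w [measurable]: "w \<in> borel_measurable M"
    and w_nonneg: "\<And>x. 0 \<le> w x"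
    and contract: "\<And>k. k \<in> borel_measurable M \<Longrightarrow> (\<integral>\<^sup>+x. ennreal ((w x)\<^sup>2) * k (R x) \<partial>M) \<le> (\<integral>\<^sup>+x. k x \<partial>M)"
begin

text \<open>\<open>V\<close> is the operator, \<open>U k = V\<^sup>k 1\<close> are the iterates of
  the constant function, \<open>S n h\<close> are the partial sums and \<open>A n\<close> the
  averages of the iterates of \<open>h = 1\<close>.\<close>
definition V :: "('a \<Rightarrow> real) \<Rightarrow> 'a \<Rightarrow> real" where "V h x = w x * h (R x)"

definition U :: "nat \<Rightarrow> 'a \<Rightarrow> real" where "U k = (V ^^ k) (\<lambda>_. 1)"

lemma U_0 [simp]: "U 0 x = 1" by (simp add: U_def)

lemma U_Suc: "U (Suc k) x = w x * U k (R x)"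
  by (simp add: U_def V_def)

lemma U_nonneg: "0 \<le> U k x"
  by (induction k arbitrary: x) (auto simp: U_Suc w_nonneg)

lemma V_measurable [measurable]: "h \<in> borel_measurable M \<Longrightarrow> V h \<in> borel_measurable M"
  unfolding V_def[abs_def] using measurable_compose[OF R, of h borel] by measurable

lemma V_sq_int:
  assumes "sq_int M h"
  shows "sq_int M (V h)" "l2norm M (V h) \<le> l2norm M h"
proof -
  have h [measurable]: "h \<in> borel_measurable M" and i: "integrable M (\<lambda>x. (h x)\<^sup>2)"
    using assms by (auto simp: sq_int_def)
  have "(\<integral>\<^sup>+x. ennreal ((V h x)\<^sup>2) \<partial>M) = (\<integral>\<^sup>+x. ennreal ((w x)\<^sup>2) * ennreal ((h (R x))\<^sup>2) \<partial>M)"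
    by (simp add: V_def power_mult_distrib ennreal_mult)
  also have "\<dots> \<le> (\<integral>\<^sup>+x. ennreal ((h x)\<^sup>2) \<partial>M)" by (rule contract) simp
  finally have le: "(\<integral>\<^sup>+x. ennreal ((V h x)\<^sup>2) \<partial>M) \<le> (\<integral>\<^sup>+x. ennreal ((h x)\<^sup>2) \<partial>M)" .
  also have fin: "\<dots> < \<infinity>" using i by (simp add: integrable_iff_bounded)
  finally have j: "integrable M (\<lambda>x. (V h x)\<^sup>2)" by (simp add: integrable_iff_bounded)
  then show "sq_int M (V h)" by (simp add: sq_int_def)
  have "ennreal (\<integral>x. (V h x)\<^sup>2 \<partial>M) \<le> ennreal (\<integral>x. (h x)\<^sup>2 \<partial>M)"
    using le nn_integral_eq_integral[OF i] nn_integral_eq_integral[OF j] by simp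
  then show "l2norm M (V h) \<le> l2norm M h" unfolding l2norm_def by (simp add: ennreal_le_iff)
qed

lemma V_add: "V (\<lambda>x. f x + g x) = (\<lambda>x. V f x + V g x)"
  by (simp add: V_def fun_eq_iff algebra_simps)

lemma V_scale: "V (\<lambda>x. c * f x) = (\<lambda>x. c * V f x)"
  by (simp add: V_def fun_eq_iff algebra_simps)

definition S :: "nat \<Rightarrow> ('a \<Rightarrow> real) \<Rightarrow> 'a \<Rightarrow> real" where
  "S n h x = (\<Sum>k<n. (V ^^ k) h x)"

lemma iterate_sq_int:
  assumes "sq_int M h"
  shows "sq_int M ((V ^^ k) h) \<and> l2norm M ((V ^^ k) h) \<le> l2norm M h"
proof (induction k)
  case (Suc k) then show ?case using V_sq_int[of "(V ^^ k) h"] by auto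
qed (use assms in simp)

lemma sq_int_zero: "sq_int M (\<lambda>_. 0)" by (simp add: sq_int_def)

lemma sq_int_const: "sq_int M (\<lambda>_. c)" by (simp add: sq_int_def)

lemma S_sq_int:
  assumes "sq_int M h"
  shows "sq_int M (S n h) \<and> l2norm M (S n h) \<le> n * l2norm M h"
proof (induction n)
  case 0 then show ?case by (simp add: S_def[abs_def] sq_int_zero l2norm_def)
next
  case (Suc n)
  have eq: "S (Suc n) h = (\<lambda>x. S n h x + (V ^^ n) h x)" by (simp add: S_def[abs_def])
  have "l2norm M (S (Suc n) h) \<le> l2norm M (S n h) + l2norm M ((V ^^ n) h)"
    unfolding eq using Suc iterate_sq_int[OF assms] by (intro l2norm_triangle) auto
  then show ?case unfolding eq using Suc iterate_sq_int[OF assms, of n] sq_int_add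
    by (auto simp: algebra_simps)
qed

lemma iterate_add: "(V ^^ k) (\<lambda>x. f x + g x) = (\<lambda>x. (V ^^ k) f x + (V ^^ k) g x)"
  by (induction k) (auto simp: V_add)

lemma iterate_scale: "(V ^^ k) (\<lambda>x. c * f x) = (\<lambda>x. c * (V ^^ k) f x)"
  by (induction k) (auto simp: V_scale)

abbreviation "one \<equiv> \<lambda>_::'a. 1::real"

lemma iterate_S: "(V ^^ k) (S n one) x = (\<Sum>j<n. U (k + j) x)"
proof (induction n)
  case 0
  have "(V ^^ k) (\<lambda>x. 0) = (\<lambda>x. 0)" using iterate_scale[of k 0 one] by simp
  then show ?case by (simp add: S_def[abs_def])
next
  case (Suc n)
  have eq: "S (Suc n) one = (\<lambda>x. S n one x + U n x)" by (simp add: S_def[abs_def] U_def)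
  have "(V ^^ k) (U n) = U (k + n)" by (simp add: U_def funpow_add)
  then show ?case using Suc by (simp add: eq iterate_add)
qed

lemma S_one: "S n one x = (\<Sum>j<n. U j x)"
  by (simp add: S_def U_def)

lemma S_one_nonneg: "0 \<le> S n one x"
  by (simp add: S_one sum_nonneg U_nonneg)

definition A :: "nat \<Rightarrow> 'a \<Rightarrow> real" where "A n x = S n one x / real n"

lemma A_eq: "A n = (\<lambda>x. (1 / real n) * S n one x)"
  by (simp add: A_def fun_eq_iff)

lemma A_nonneg: "0 \<le> A n x" by (simp add: A_def S_one_nonneg)

lemma A_sq_int: "sq_int M (A n)" "l2norm M (A n) = l2norm M (S n one) / n"
  using sq_int_scale[of M "S n one" "1/n"] l2norm_scale[of M "1/n" "S n one"] S_sq_int[OF sq_int_const]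
  by (auto simp: A_eq)

lemma A_le: "n > 0 \<Longrightarrow> l2norm M (A n) \<le> l2norm M one"
  using A_sq_int(2)[of n] S_sq_int[OF sq_int_const[of 1], of n] by (simp add: pos_divide_le_eq mult.commute)

lemma norm_S_subadd: "l2norm M (S (n + k) one) \<le> l2norm M (S n one) + l2norm M (S k one)"
proof -
  have "S (n + k) one x = S n one x + (V ^^ n) (S k one) x" for x
    unfolding iterate_S S_one by (induction k) (simp_all add: add.assoc)
  then have eq: "S (n + k) one = (\<lambda>x. S n one x + (V ^^ n) (S k one) x)" by (simp add: fun_eq_iff)
  have sk: "sq_int M (S j one)" for j using S_sq_int[OF sq_int_const] by auto
  show ?thesis unfolding eq
    using l2norm_triangle[OF sk[of n], of "(V ^^ n) (S k one)"] iterate_sq_int[OF sk, of n k] by auto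
qed

lemma norm_S_mult: "l2norm M (S (q * n) one) \<le> q * l2norm M (S n one)"
proof (induction q)
  case 0 then show ?case by (simp add: S_def[abs_def] l2norm_def)
next
  case (Suc q)
  have "l2norm M (S (Suc q * n) one) \<le> l2norm M (S n one) + l2norm M (S (q * n) one)"
    using norm_S_subadd[of n "q * n"] by simp
  then show ?case using Suc by (simp add: algebra_simps)
qed

text \<open>The proof of the mean ergodic theorem follows F. Riesz: the averages are a minimizing
  sequence for the norm on a convex set, so they form a Cauchy sequence by the parallelogram
  identity.\<close>
definition m :: real where "m = (INF n\<in>{0<..}. l2norm M (A n))"

lemma m_le: "n > 0 \<Longrightarrow> m \<le> l2norm M (A n)"
  unfolding m_def by (rule cINF_lower) (auto intro!: bdd_belowI2[of _ 0] simp: l2norm_nonneg)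

lemma m_nonneg: "0 \<le> m"
  unfolding m_def by (rule cINF_greatest) (auto simp: l2norm_nonneg)

text \<open>The norms of the sums \<open>S n 1\<close> are subadditive in \<open>n\<close>, so their
  quotients by \<open>n\<close> converge to the infimum (Fekete).\<close>
lemma norm_A_tendsto: "(\<lambda>n. l2norm M (A n)) \<longlonglongrightarrow> m"
proof (rule LIMSEQ_I)
  fix e :: real assume e: "e > 0"
  have "\<exists>n\<in>{0<..}. l2norm M (A n) < m + e / 2"
  proof -
    have "bdd_below ((\<lambda>n. l2norm M (A n)) ` {0<..})"
      by (rule bdd_belowI2[of _ 0]) (simp add: l2norm_nonneg)
    then show ?thesis
      using cINF_less_iff[of "{0<..}" "\<lambda>n. l2norm M (A n)" "m + e/2"] e by (auto simp: m_def)
  qed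
  then obtain n where n: "n > 0" "l2norm M (A n) < m + e / 2" by auto
  define C where "C = l2norm M one"
  have C: "C \<ge> 0" by (simp add: C_def l2norm_nonneg)
  obtain K :: nat where K: "real K > 2 * n * C / e" using reals_Archimedean2 by blast
  show "\<exists>no. \<forall>k\<ge>no. norm (l2norm M (A k) - m) < e"
  proof (intro exI[of _ "Suc K"] allI impI)
    fix k assume k: "Suc K \<le> k"
    then have kp: "k > 0" and kK: "real k > 2 * n * C / e" using K by auto
    have dm: "k = (k div n) * n + k mod n" by simp
    have "l2norm M (S k one) \<le> l2norm M (S ((k div n) * n) one) + l2norm M (S (k mod n) one)"
      using norm_S_subadd[of "(k div n) * n" "k mod n"] by simp
    also have "\<dots> \<le> real (k div n) * l2norm M (S n one) + real (k mod n) * C"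
      using norm_S_mult S_sq_int[OF sq_int_const] unfolding C_def by (intro add_mono) auto
    also have "\<dots> \<le> real (k div n) * (real n * l2norm M (A n)) + n * C"
      using n C by (intro add_mono mult_right_mono) (auto simp: A_sq_int intro: less_imp_le)
    also have "\<dots> \<le> real k * l2norm M (A n) + n * C"
    proof -
      have "real (k div n) * real n \<le> real k"
        by (metis div_times_less_eq_dividend of_nat_le_iff of_nat_mult)
      then show ?thesis using mult_right_mono[OF _ l2norm_nonneg] by (simp add: mult.assoc[symmetric])
    qed
    finally have "l2norm M (A k) \<le> l2norm M (A n) + n * C / k"
      using kp by (simp add: A_sq_int(2)[of k] field_simps)
    moreover have "n * C / k < e / 2" using kK kp e by (simp add: field_simps)
    ultimately have "l2norm M (A k) < m + e" using n by linarith
    then show "norm (l2norm M (A k) - m) < e" using m_le[OF kp] by simp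
  qed
qed

text \<open>The mean of \<open>A n\<close> and \<open>A k\<close> is again a convex combination of
  iterates of \<open>1\<close>. Averaging such a combination over \<open>K\<close> further
  iterations gives at least \<open>A K\<close> up to an error \<open>O(1/K)\<close> and does not
  increase the norm, so the norm of the mean is at least \<open>m\<close>.\<close>
lemma norm_A_sum_ge:
  assumes "n > 0" "k > 0"
  shows "2 * m \<le> l2norm M (\<lambda>x. A n x + A k x)"
proof -
  let ?B = "\<lambda>x. A n x + A k x"
  have B: "sq_int M ?B" by (intro sq_int_add A_sq_int)
  \<comment> \<open>positivity of the iterates turns the boundary terms of the double sum into an inequality\<close>
  have shift: "S K one x \<le> S K (A n) x + S n one x" if "n > 0" for K n x
  proof -
    have "S K (A n) x = (\<Sum>i<K. (1 / real n) * (\<Sum>j<n. U (i + j) x))"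
      unfolding S_def[of K] A_eq iterate_scale iterate_S by (simp add: add.commute)
    also have "\<dots> = (1 / real n) * (\<Sum>j<n. \<Sum>i<K. U (i + j) x)"
      by (subst sum.swap) (simp add: sum_distrib_left)
    finally have e: "S K (A n) x = (1 / real n) * (\<Sum>j<n. \<Sum>i<K. U (i + j) x)" .
    have "S K one x - S n one x \<le> (\<Sum>i<K. U (i + j) x)" if "j < n" for j
    proof -
      have "(\<Sum>i<K. U i x) \<le> (\<Sum>i<j + K. U i x)" by (intro sum_mono2) (auto simp: U_nonneg)
      also have "\<dots> = (\<Sum>i<j. U i x) + (\<Sum>i<K. U (i + j) x)"
        by (induction K) (simp_all add: add_ac)
      also have "(\<Sum>i<j. U i x) \<le> (\<Sum>i<n. U i x)" using that by (intro sum_mono2) (auto simp: U_nonneg)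
      finally show ?thesis by (simp add: S_one)
    qed
    then have "(\<Sum>j<n. S K one x - S n one x) \<le> (\<Sum>j<n. \<Sum>i<K. U (i + j) x)" by (intro sum_mono) auto
    then have "real n * (S K one x - S n one x) \<le> (\<Sum>j<n. \<Sum>i<K. U (i + j) x)" by simp
    then show ?thesis unfolding e using that by (simp add: field_simps)
  qed
  define C where "C = l2norm M (S n one) + l2norm M (S k one)"
  have main: "2 * l2norm M (A K) \<le> l2norm M ?B + C / K" if K: "K > 0" for K
  proof -
    have sq: "sq_int M (S K ?B)" "sq_int M (S j one)" for j using S_sq_int[OF B] S_sq_int[OF sq_int_const] by auto
    have SB: "S K ?B x = S K (A n) x + S K (A k) x" for x
      by (simp add: S_def iterate_add sum.distrib)
    have "2 * l2norm M (S K one) = l2norm M (\<lambda>x. 2 * S K one x)" by (simp add: l2norm_scale)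
    also have "\<dots> \<le> l2norm M (\<lambda>x. S K ?B x + (S n one x + S k one x))"
    proof (intro l2norm_mono sq_int_scale sq_int_add sq)
      fix x
      show "0 \<le> 2 * S K one x" using S_one_nonneg by simp
      show "2 * S K one x \<le> S K ?B x + (S n one x + S k one x)"
        using shift[OF assms(1), of K x] shift[OF assms(2), of K x] unfolding SB by linarith
    qed
    also have "\<dots> \<le> l2norm M (S K ?B) + l2norm M (\<lambda>x. S n one x + S k one x)"
      by (intro l2norm_triangle sq sq_int_add)
    also have "\<dots> \<le> K * l2norm M ?B + C"
      unfolding C_def using S_sq_int[OF B, of K] by (intro add_mono l2norm_triangle sq) auto
    finally show ?thesis using K by (simp add: A_sq_int field_simps)
  qed
  have "(\<lambda>K. 2 * l2norm M (A K)) \<longlonglongrightarrow> 2 * m" by (intro tendsto_intros norm_A_tendsto)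
  moreover have "(\<lambda>K. l2norm M ?B + C / real K) \<longlonglongrightarrow> l2norm M ?B + 0"
    by (intro tendsto_intros lim_const_over_n)
  moreover have "\<exists>N. \<forall>K\<ge>N. 2 * l2norm M (A K) \<le> l2norm M ?B + C / real K"
    using main by (intro exI[of _ 1]) auto
  ultimately have "2 * m \<le> l2norm M ?B + 0" by (rule LIMSEQ_le)
  then show ?thesis by simp
qed

lemma A_cauchy:
  assumes "e > 0"
  obtains N where "N > 0" "\<And>n k. n \<ge> N \<Longrightarrow> k \<ge> N \<Longrightarrow> l2norm M (\<lambda>x. A n x - A k x) < e"
proof -
  have "(\<lambda>n. (l2norm M (A n))\<^sup>2) \<longlonglongrightarrow> m\<^sup>2" by (intro tendsto_intros norm_A_tendsto)
  from LIMSEQ_D[OF this, of "e\<^sup>2 / 4"] assms obtain N where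
    N: "\<And>n. n \<ge> N \<Longrightarrow> \<bar>(l2norm M (A n))\<^sup>2 - m\<^sup>2\<bar> < e\<^sup>2 / 4" by auto
  show ?thesis
  proof
    fix n k assume nk: "n \<ge> Suc N" "k \<ge> Suc N"
    have "(2 * m)\<^sup>2 \<le> (l2norm M (\<lambda>x. A n x + A k x))\<^sup>2"
      using norm_A_sum_ge[of n k] nk m_nonneg by (intro power_mono) auto
    then have "(l2norm M (\<lambda>x. A n x - A k x))\<^sup>2 < e\<^sup>2"
      using N[of n] N[of k] nk l2norm_parallelogram[OF A_sq_int(1)[of n] A_sq_int(1)[of k]]
      unfolding power_mult_distrib abs_less_iff by simp
    then show "l2norm M (\<lambda>x. A n x - A k x) < e"
      using power2_less_imp_less[OF _ less_imp_le[OF assms]] by blast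
  qed simp
qed

lemma integral_le_l2norm:
  assumes "sq_int M f"
  shows "integrable M f" "(\<integral>x. \<bar>f x\<bar> \<partial>M) \<le> l2norm M one * l2norm M f"
proof -
  have 1: "sq_int M (\<lambda>x. \<bar>f x\<bar>)" using assms by (auto simp: sq_int_def)
  show "integrable M f" using sq_int_mult_integrable[OF sq_int_const[of 1] assms] by simp
  show "(\<integral>x. \<bar>f x\<bar> \<partial>M) \<le> l2norm M one * l2norm M f"
    using cauchy_schwarz_integral[OF sq_int_const[of 1] 1] by (simp add: l2norm_def[of _ f] l2norm_def[of _ "\<lambda>x. \<bar>f x\<bar>"])
qed

text \<open>A null set pulls back under \<open>R\<close> to a set that is null where \<open>w
  \<noteq> 0\<close>, by \<open>contract\<close> for its indicator function.\<close>
lemma AE_pullback: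
  assumes "AE x in M. Q x"
  shows "AE x in M. w x \<noteq> 0 \<longrightarrow> Q (R x)"
proof -
  obtain N where N: "{x \<in> space M. \<not> Q x} \<subseteq> N" "emeasure M N = 0" "N \<in> sets M"
    using assms by (rule AE_E)
  have [measurable]: "(\<lambda>x. indicator N (R x) :: ennreal) \<in> borel_measurable M"
    by (rule measurable_compose[OF R]) (use N in simp)
  have "(\<integral>\<^sup>+x. ennreal ((w x)\<^sup>2) * indicator N (R x) \<partial>M) \<le> (\<integral>\<^sup>+x. indicator N x \<partial>M)"
    by (rule contract) (use N in simp)
  also have "\<dots> = 0" using N by simp
  finally have "AE x in M. ennreal ((w x)\<^sup>2) * indicator N (R x) = 0"
    by (subst nn_integral_0_iff_AE[symmetric]) auto
  then show ?thesis
  proof (rule AE_mp, intro AE_I2 impI)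
    fix x assume x: "x \<in> space M" "ennreal ((w x)\<^sup>2) * indicator N (R x) = 0" "w x \<noteq> 0"
    have "R x \<in> space M" using measurable_space[OF R x(1)] .
    moreover have "(0::real) < (w x)\<^sup>2" using x by simp
    ultimately show "Q (R x)" using x N(1) by (auto simp: indicator_def ennreal_eq_0_iff split: if_splits)
  qed
qed

text \<open>By the Cauchy property the averages converge, along a subsequence almost everywhere, to
  a function \<open>h\<close> with finite \<open>L\<^sup>2\<close> norm. The identity \<open>V (A p)
  = A p + (U p - 1) / p\<close> shows \<open>V h = h\<close>, hence \<open>h = 0\<close>. Working
  with an almost everywhere convergent subsequence avoids the completeness of
  \<open>L\<^sup>2\<close>.\<close>
theorem integral_average_tendsto_0:
  assumes no_fixed: "\<And>h. h \<in> borel_measurable M \<Longrightarrow> integrable M (\<lambda>x. (h x)\<^sup>2) \<Longrightarrow>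
     (AE x in M. h x = w x * h (R x)) \<Longrightarrow> AE x in M. h x = 0"
  shows "(\<lambda>n. \<integral>x. A n x \<partial>M) \<longlonglongrightarrow> 0"
proof -
  define C where "C = l2norm M one"
  have C: "C \<ge> 0" by (simp add: C_def l2norm_nonneg)
  have "\<exists>N. \<forall>n\<ge>N. \<forall>k\<ge>N. l2norm M (\<lambda>x. A n x - A k x) < (1/2)^j" for j
  proof -
    have "(0::real) < (1/2)^j" by simp
    then obtain N where "\<And>n k. n \<ge> N \<Longrightarrow> k \<ge> N \<Longrightarrow> l2norm M (\<lambda>x. A n x - A k x) < (1/2)^j"
      by (rule A_cauchy) iprover
    then show ?thesis by blast
  qed
  then have "\<forall>j. \<exists>N. \<forall>n\<ge>N. \<forall>k\<ge>N. l2norm M (\<lambda>x. A n x - A k x) < (1/2)^j" by iprover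
  from choice[OF this] obtain N where
    N: "\<And>j n k. n \<ge> N j \<Longrightarrow> k \<ge> N j \<Longrightarrow> l2norm M (\<lambda>x. A n x - A k x) < (1/2)^j" by blast
  \<comment> \<open>a sparse subsequence: consecutive averages are \<open>2\<^sup>-\<^sup>j\<close>-close, and the remainder \<open>U (n j) / n j\<close> is summable\<close>
  define n where "n j = (\<Sum>i\<le>j. N i) + 2 ^ j" for j
  have "N j \<le> (\<Sum>i\<le>j. N i)" for j by (rule member_le_sum) auto
  then have nN: "n j \<ge> N j" "n (Suc j) \<ge> N j" for j
    by (simp_all add: n_def trans_le_add1 trans_le_add2)
  have n2: "n j \<ge> 2 ^ j" for j by (simp add: n_def)
  then have npos: "n j > 0" for j using less_le_trans[of 0 "2^j" "n j"] by simp
  have n2r: "2 ^ j \<le> real (n j)" for j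
  proof -
    have "real (2 ^ j) \<le> real (n j)" using n2 by (simp only: of_nat_le_iff)
    then show ?thesis by simp
  qed
  have sqd: "sq_int M (\<lambda>x. A p x - A q x)" for p q
    using sq_int_add[OF A_sq_int(1)[of p] sq_int_scale[OF A_sq_int(1)[of q], of "-1"]] by simp
  have sqU: "sq_int M (U k)" "l2norm M (U k) \<le> C" for k
    using iterate_sq_int[OF sq_int_const[of 1], of k] by (auto simp: U_def C_def)
  have A_meas [measurable]: "A k \<in> borel_measurable M" for k using A_sq_int(1)[of k] by (simp add: sq_int_def)
  have U_meas [measurable]: "U k \<in> borel_measurable M" for k using sqU(1)[of k] by (simp add: sq_int_def)
  \<comment> \<open>one dominating series controls both the increments of the averages and the remainders\<close>
  define D where "D j x = \<bar>A (n (Suc j)) x - A (n j) x\<bar> + U (n j) x / n j" for j x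
  have D_nonneg: "0 \<le> D j x" for j x by (simp add: D_def U_nonneg)
  have D_meas [measurable]: "D j \<in> borel_measurable M" for j unfolding D_def[abs_def] by measurable
  define C' where "C' = C + C * C"
  have D_int: "(\<integral>\<^sup>+x. ennreal (D j x) \<partial>M) \<le> ennreal (C' * (1/2)^j)" for j
  proof -
    have i1: "integrable M (\<lambda>x. \<bar>A (n (Suc j)) x - A (n j) x\<bar>)" using integral_le_l2norm(1)[OF sqd] by simp
    have i2: "integrable M (\<lambda>x. U (n j) x / n j)" using integral_le_l2norm(1)[OF sqU(1)] by simp
    have "(\<integral>x. D j x \<partial>M) = (\<integral>x. \<bar>A (n (Suc j)) x - A (n j) x\<bar> \<partial>M) + (\<integral>x. \<bar>U (n j) x\<bar> \<partial>M) / n j"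
      unfolding D_def using i1 i2 by (simp add: U_nonneg)
    also have "\<dots> \<le> C * (1/2)^j + C * C * (1/2)^j"
    proof (rule add_mono)
      have "(\<integral>x. \<bar>A (n (Suc j)) x - A (n j) x\<bar> \<partial>M) \<le> C * l2norm M (\<lambda>x. A (n (Suc j)) x - A (n j) x)"
        using integral_le_l2norm(2)[OF sqd] by (simp add: C_def)
      also have "\<dots> \<le> C * (1/2)^j" using N[OF nN(2) nN(1)] C by (intro mult_left_mono) (auto intro: less_imp_le)
      finally show "(\<integral>x. \<bar>A (n (Suc j)) x - A (n j) x\<bar> \<partial>M) \<le> C * (1/2)^j" .
      have "(\<integral>x. \<bar>U (n j) x\<bar> \<partial>M) \<le> C * C"
        using integral_le_l2norm(2)[OF sqU(1), of "n j"] mult_left_mono[OF sqU(2) C, of "n j"] by (simp add: C_def)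
      then have "(\<integral>x. \<bar>U (n j) x\<bar> \<partial>M) / n j \<le> C * C / n j" by (simp add: divide_right_mono)
      also have "\<dots> \<le> C * C / 2 ^ j"
        using n2r[of j] C npos[of j] by (intro divide_left_mono) simp_all
      finally show "(\<integral>x. \<bar>U (n j) x\<bar> \<partial>M) / n j \<le> C * C * (1/2)^j" by (simp add: power_one_over)
    qed
    finally have "(\<integral>x. D j x \<partial>M) \<le> C' * (1/2)^j" by (simp add: C'_def algebra_simps)
    moreover have "integrable M (D j)" unfolding D_def[abs_def] using i1 i2 by simp
    ultimately show ?thesis by (simp add: nn_integral_eq_integral D_nonneg ennreal_leI)
  qed
  have C': "C' \<ge> 0" using C by (simp add: C'_def)
  have tail: "(\<integral>\<^sup>+x. (\<Sum>j. ennreal (D (j + i) x)) \<partial>M) \<le> ennreal (2 * C' * (1/2)^i)" for i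
  proof -
    have "(\<integral>\<^sup>+x. (\<Sum>j. ennreal (D (j + i) x)) \<partial>M) = (\<Sum>j. \<integral>\<^sup>+x. ennreal (D (j + i) x) \<partial>M)"
      by (rule nn_integral_suminf) simp
    also have "\<dots> \<le> (\<Sum>j. ennreal (C' * (1/2)^(j + i)))" by (intro suminf_le D_int) auto
    also have "\<dots> = ennreal (\<Sum>j. C' * (1/2)^(j + i))"
    proof (rule suminf_ennreal2)
      show "summable (\<lambda>j. C' * (1/2::real)^(j + i))"
        using summable_mult[OF summable_ignore_initial_segment[OF summable_geometric[of "1/2::real"], of i], of C'] by simp
    qed (use C' in simp)
    also have "(\<Sum>j. C' * (1/2)^(j + i)) = (\<Sum>j. (C' * (1/2)^i) * (1/2)^j)" by (simp add: power_add mult_ac)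
    also have "\<dots> = C' * (1/2)^i * 2" by (subst suminf_mult) (auto simp: suminf_geometric)
    finally show ?thesis by (simp add: mult_ac)
  qed
  have "AE x in M. (\<Sum>j. ennreal (D (j + 0) x)) \<noteq> \<infinity>"
    by (rule nn_integral_noteq_infinite) (use tail[of 0] in \<open>auto simp: top_unique\<close>)
  then have sumD: "AE x in M. summable (\<lambda>j. D j x)"
    by (rule AE_mp) (auto intro!: AE_I2 summable_suminf_not_top D_nonneg)
  define h where "h x = lim (\<lambda>j. A (n j) x)" for x
  have h_meas [measurable]: "h \<in> borel_measurable M"
    unfolding h_def[abs_def] by (rule borel_measurable_lim_metric) simp
  have conv: "AE x in M. (\<lambda>j. A (n j) x) \<longlonglongrightarrow> h x \<and> (\<lambda>j. U (n j) x / n j) \<longlonglongrightarrow> 0"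
    using sumD
  proof (rule AE_mp, intro AE_I2 impI conjI)
    fix x assume s: "summable (\<lambda>j. D j x)"
    have "summable (\<lambda>j. A (n (Suc j)) x - A (n j) x)"
      by (rule summable_comparison_test'[OF s, of 0]) (auto simp: D_def U_nonneg)
    then have "convergent (\<lambda>k. \<Sum>j<k. A (n (Suc j)) x - A (n j) x)" by (simp add: summable_iff_convergent)
    then have "convergent (\<lambda>k. A (n k) x - A (n 0) x)" unfolding sum_lessThan_telescope[of "\<lambda>j. A (n j) x"] .
    then have "convergent (\<lambda>k. (A (n k) x - A (n 0) x) + A (n 0) x)"
      by (intro convergent_add convergent_const)
    then have "convergent (\<lambda>k. A (n k) x)" by simp
    then show "(\<lambda>j. A (n j) x) \<longlonglongrightarrow> h x" unfolding h_def by (simp add: convergent_LIMSEQ_iff)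
    have "summable (\<lambda>j. U (n j) x / n j)"
      by (rule summable_comparison_test'[OF s, of 0]) (auto simp: D_def U_nonneg)
    then show "(\<lambda>j. U (n j) x / n j) \<longlonglongrightarrow> 0" by (rule summable_LIMSEQ_zero)
  qed
  have h_sq: "integrable M (\<lambda>x. (h x)\<^sup>2)"
  proof -
    have "(\<integral>\<^sup>+x. ennreal ((h x)\<^sup>2) \<partial>M) = (\<integral>\<^sup>+x. liminf (\<lambda>j. ennreal ((A (n j) x)\<^sup>2)) \<partial>M)"
    proof (rule nn_integral_cong_AE, rule AE_mp[OF conv], intro AE_I2 impI)
      fix x assume "(\<lambda>j. A (n j) x) \<longlonglongrightarrow> h x \<and> (\<lambda>j. U (n j) x / n j) \<longlonglongrightarrow> 0"
      then have "(\<lambda>j. ennreal ((A (n j) x)\<^sup>2)) \<longlonglongrightarrow> ennreal ((h x)\<^sup>2)"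
        by (intro tendsto_ennrealI tendsto_power) auto
      then show "ennreal ((h x)\<^sup>2) = liminf (\<lambda>j. ennreal ((A (n j) x)\<^sup>2))"
        by (intro lim_imp_Liminf[symmetric]) auto
    qed
    also have "\<dots> \<le> liminf (\<lambda>j. \<integral>\<^sup>+x. ennreal ((A (n j) x)\<^sup>2) \<partial>M)" by (rule nn_integral_liminf) simp
    also have "\<dots> \<le> ennreal (C\<^sup>2)"
    proof (rule order_trans[OF Liminf_le_Limsup Limsup_bounded], simp, rule always_eventually, rule allI)
      fix j
      have "(\<integral>\<^sup>+x. ennreal ((A (n j) x)\<^sup>2) \<partial>M) = ennreal ((l2norm M (A (n j)))\<^sup>2)"
        using A_sq_int(1)[of "n j"] by (simp add: sq_int_def nn_integral_eq_integral l2norm_power2)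
      also have "\<dots> \<le> ennreal (C\<^sup>2)"
        using A_le[OF npos, of j] by (intro ennreal_leI power_mono) (auto simp: C_def l2norm_nonneg)
      finally show "(\<integral>\<^sup>+x. ennreal ((A (n j) x)\<^sup>2) \<partial>M) \<le> ennreal (C\<^sup>2)" .
    qed
    finally show ?thesis by (simp add: integrable_iff_bounded le_less_trans)
  qed
  \<comment> \<open>\<open>V\<close> shifts the average by one index\<close>
  have VA: "w x * A p (R x) = A p x + U p x / p - 1 / p" if "p > 0" for p x
  proof -
    have "w x * (\<Sum>j<p. U j (R x)) = (\<Sum>j<p. U (Suc j) x)" by (simp add: sum_distrib_left U_Suc)
    also have "\<dots> = (\<Sum>j<p. U j x) + U p x - 1"
      using sum.lessThan_Suc_shift[of "\<lambda>j. U j x" p] by simp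
    finally have e: "w x * (\<Sum>j<p. U j (R x)) = (\<Sum>j<p. U j x) + U p x - 1" .
    have "w x * A p (R x) = (w x * (\<Sum>j<p. U j (R x))) / p" by (simp add: A_def S_one)
    then show ?thesis unfolding e by (simp add: A_def S_one add_divide_distrib diff_divide_distrib)
  qed
  have ninf: "(\<lambda>j. 1 / real (n j)) \<longlonglongrightarrow> 0"
  proof (rule Lim_null_comparison)
    show "\<forall>\<^sub>F j in sequentially. norm (1 / real (n j)) \<le> (1/2)^j"
      using n2r by (intro always_eventually allI) (simp add: power_one_over frac_le)
    show "(\<lambda>j. (1/2::real)^j) \<longlonglongrightarrow> 0" by (rule LIMSEQ_realpow_zero) auto
  qed
  have "AE x in M. h x = w x * h (R x)"
    using conv AE_pullback[OF conv]
  proof eventually_elim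
    case (elim x)
    have "(\<lambda>j. w x * A (n j) (R x)) \<longlonglongrightarrow> w x * h (R x)"
    proof (cases "w x = 0")
      case False then show ?thesis using elim by (intro tendsto_intros) auto
    qed simp
    moreover have "(\<lambda>j. w x * A (n j) (R x)) \<longlonglongrightarrow> h x + 0 - 0"
      unfolding VA[OF npos] using elim ninf by (intro tendsto_intros) auto
    ultimately show ?case using LIMSEQ_unique by fastforce
  qed
  from no_fixed[OF h_meas h_sq this] have h0: "AE x in M. h x = 0" .
  \<comment> \<open>the limit being \<open>0\<close>, each average is dominated by the tail of the telescoping series\<close>
  have small: "(\<integral>x. A (n i) x \<partial>M) \<le> 2 * C' * (1/2)^i" for i
  proof -
    have "(\<integral>\<^sup>+x. ennreal (A (n i) x) \<partial>M) \<le> (\<integral>\<^sup>+x. (\<Sum>j. ennreal (D (j + i) x)) \<partial>M)"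
    proof (rule nn_integral_mono_AE)
      show "AE x in M. ennreal (A (n i) x) \<le> (\<Sum>j. ennreal (D (j + i) x))"
        using conv h0 sumD
      proof eventually_elim
        case (elim x)
        have sD: "summable (\<lambda>j. D (j + i) x)" using elim(3) by (rule summable_ignore_initial_segment)
        have "(\<lambda>k. A (n i) x - A (n (k + i)) x) \<longlonglongrightarrow> A (n i) x - 0"
          using elim LIMSEQ_ignore_initial_segment[of "\<lambda>j. A (n j) x" "h x" i] by (intro tendsto_intros) auto
        moreover have "A (n i) x - A (n (k + i)) x \<le> (\<Sum>j. D (j + i) x)" for k
        proof -
          have "A (n i) x - A (n (k + i)) x \<le> (\<Sum>j<k. D (j + i) x)"
          proof (induction k)
            case (Suc k)
            have "A (n (k + i)) x - A (n (Suc k + i)) x \<le> D (k + i) x"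
            proof -
              have "0 \<le> U (n (k + i)) x / real (n (k + i))" by (simp add: U_nonneg)
              then show ?thesis unfolding D_def add_Suc by linarith
            qed
            then show ?case using Suc by simp
          qed simp
          also have "\<dots> \<le> (\<Sum>j. D (j + i) x)" by (intro sum_le_suminf sD) (auto simp: D_nonneg)
          finally show ?thesis .
        qed
        ultimately have "A (n i) x \<le> (\<Sum>j. D (j + i) x)"
          using LIMSEQ_le_const2[of "\<lambda>k. A (n i) x - A (n (k + i)) x" "A (n i) x - 0"] by auto
        moreover have "(\<Sum>j. ennreal (D (j + i) x)) = ennreal (\<Sum>j. D (j + i) x)"
          by (rule suminf_ennreal2[OF D_nonneg sD])
        ultimately show ?case by (simp only: ennreal_leI)
      qed
    qed
    also note tail
    finally have "(\<integral>\<^sup>+x. ennreal (A (n i) x) \<partial>M) \<le> ennreal (2 * C' * (1/2)^i)" .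
    then show ?thesis using integral_le_l2norm(1)[OF A_sq_int(1)[of "n i"]] C'
      by (simp add: nn_integral_eq_integral A_nonneg)
  qed
  show ?thesis
  proof (rule LIMSEQ_I)
    fix e :: real assume e: "e > 0"
    have "(\<lambda>i. (2 * C' + C) * (1/2::real)^i) \<longlonglongrightarrow> (2 * C' + C) * 0"
      by (intro tendsto_intros LIMSEQ_realpow_zero) auto
    then have "\<forall>\<^sub>F i in sequentially. (2 * C' + C) * (1/2::real)^i < e" using e by (intro order_tendstoD) auto
    then obtain i where i: "(2 * C' + C) * (1/2::real)^i < e" by (auto simp: eventually_sequentially)
    show "\<exists>no. \<forall>k\<ge>no. norm ((\<integral>x. A k x \<partial>M) - 0) < e"
    proof (intro exI[of _ "N i"] allI impI)
      fix k assume k: "k \<ge> N i"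
      have iA: "integrable M (A p)" for p using integral_le_l2norm(1)[OF A_sq_int(1)] .
      have "(\<integral>x. A k x \<partial>M) \<le> (\<integral>x. A (n i) x + \<bar>A k x - A (n i) x\<bar> \<partial>M)"
        by (intro integral_mono iA Bochner_Integration.integrable_add integrable_abs Bochner_Integration.integrable_diff) linarith
      also have "\<dots> = (\<integral>x. A (n i) x \<partial>M) + (\<integral>x. \<bar>A k x - A (n i) x\<bar> \<partial>M)"
        by (intro Bochner_Integration.integral_add iA integrable_abs Bochner_Integration.integrable_diff)
      also have "\<dots> \<le> 2 * C' * (1/2)^i + C * l2norm M (\<lambda>x. A k x - A (n i) x)"
        using small[of i] integral_le_l2norm(2)[OF sqd, of k "n i"] by (simp add: C_def)
      also have "\<dots> \<le> 2 * C' * (1/2)^i + C * (1/2)^i"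
        using N[OF k nN(1)] C by (intro add_left_mono mult_left_mono) (auto intro: less_imp_le)
      also have "\<dots> < e" using i by (simp add: algebra_simps)
      finally show "norm ((\<integral>x. A k x \<partial>M) - 0) < e" by (simp add: A_nonneg)
    qed
  qed
qed

end

section \<open>The Leray measure of a cone in polar coordinates\<close>
lemma proj_simps [simp]:
  "proj D v $ i = (if i \<in> D then v $ i else 0)"
  by (simp add: proj_def)

lemma dilate_nth [simp]: "dilate D r w $ i = (if i \<in> D then w $ i else r * w $ i)"
  by (simp add: dilate_def)

lemma dilate_dilate [simp]: "dilate D r (dilate D s w) = dilate D (r * s) w"
  by (simp add: vec_eq_iff)

lemma dilate_1 [simp]: "dilate D 1 w = w" by (simp add: vec_eq_iff)

lemma linear_proj: "linear (proj D)" by (intro linearI) (auto simp: vec_eq_iff)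

lemma bounded_linear_proj: "bounded_linear (proj D)"
  using linear_proj linear_conv_bounded_linear by blast

lemma linear_dilate: "linear (dilate D r)"
  by (intro linearI) (auto simp: vec_eq_iff algebra_simps)

lemma continuous_on_proj [continuous_intros]: "continuous_on S f \<Longrightarrow> continuous_on S (\<lambda>x. proj D (f x))"
  by (rule bounded_linear.continuous_on[OF bounded_linear_proj])

lemma continuous_on_dilate [continuous_intros]:
  "continuous_on S r \<Longrightarrow> continuous_on S f \<Longrightarrow> continuous_on S (\<lambda>x. dilate D (r x) (f x))"
  unfolding dilate_def by (intro continuous_intros)

text \<open>Fibre dilation by \<open>s\<close> is linear and diagonal, with determinant
  \<open>s\<close> to the power of the number of fibre coordinates.\<close>
lemma nn_integral_dilate:
  fixes D :: "'n::finite set" and f :: "real^'n \<Rightarrow> ennreal"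
  assumes f: "f \<in> borel_measurable borel" and s: "s > 0"
  shows "(\<integral>\<^sup>+w. f w \<partial>lborel) = ennreal (s ^ card (- D)) * (\<integral>\<^sup>+w. f (dilate D s w) \<partial>lborel)"
proof -
  define c where "c b = (if \<exists>i\<in>D. b = axis i (1::real) then 1 else s)" for b :: "real^'n"
  have ax: "axis i (1::real) = axis j 1 \<longleftrightarrow> i = j" for i j :: 'n by (simp add: axis_eq_axis)
  have B: "Basis = range (\<lambda>i::'n. axis i (1::real))" by (auto simp: Basis_vec_def)
  have ci: "c (axis i 1) = (if i \<in> D then 1 else s)" for i by (auto simp: c_def ax)
  have sumB: "(\<Sum>b\<in>Basis. F b) = (\<Sum>i\<in>UNIV. F (axis i 1))" for F :: "real^'n \<Rightarrow> real^'n"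
    unfolding B by (subst sum.reindex) (auto simp: inj_on_def ax)
  have T: "0 + (\<Sum>b\<in>Basis. (c b * (w \<bullet> b)) *\<^sub>R b) = dilate D s w" for w
  proof -
    have "(0 + (\<Sum>b\<in>Basis. (c b * (w \<bullet> b)) *\<^sub>R b)) $ k = dilate D s w $ k" for k
    proof -
      have "(0 + (\<Sum>b\<in>Basis. (c b * (w \<bullet> b)) *\<^sub>R b)) $ k
        = (\<Sum>i\<in>UNIV. ((if i \<in> D then 1 else s) * w $ i) * axis i 1 $ k)"
        unfolding sumB by (simp add: ci inner_axis)
      also have "\<dots> = (\<Sum>i\<in>UNIV. if k = i then (if k \<in> D then 1 else s) * w $ k else 0)"
        by (rule sum.cong) (auto simp: axis_def)
      finally show ?thesis by simp
    qed
    then show ?thesis unfolding vec_eq_iff by blast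
  qed
  have P: "(\<Prod>b\<in>Basis. \<bar>c b\<bar>) = s ^ card (- D)"
  proof -
    have "(\<Prod>b\<in>Basis. \<bar>c b\<bar>) = (\<Prod>i\<in>UNIV. \<bar>c (axis i 1)\<bar>)"
      unfolding B by (subst prod.reindex) (auto simp: inj_on_def ax)
    also have "\<dots> = (\<Prod>i\<in>UNIV. if i \<in> D then 1 else s)" using s by (intro prod.cong) (auto simp: ci)
    also have "\<dots> = (\<Prod>i\<in>- D. s)" by (subst prod.If_cases) (auto simp: Compl_eq)
    finally show ?thesis by simp
  qed
  have d: "dilate D s \<in> borel_measurable borel"
    by (intro borel_measurable_continuous_onI continuous_intros)
  have "lborel = density (distr lborel borel (\<lambda>w. 0 + (\<Sum>b\<in>Basis. (c b * (w \<bullet> b)) *\<^sub>R b))) (\<lambda>_. \<Prod>b\<in>Basis. \<bar>c b\<bar>)"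
    by (rule lborel_affine_euclidean) (use s in \<open>auto simp: c_def\<close>)
  then have L: "(lborel :: (real^'n) measure) = density (distr lborel borel (dilate D s)) (\<lambda>_. ennreal (s ^ card (- D)))"
    unfolding T P by simp
  have "(\<integral>\<^sup>+w. f w \<partial>lborel) = (\<integral>\<^sup>+w. f w \<partial>density (distr lborel borel (dilate D s)) (\<lambda>_. ennreal (s ^ card (- D))))"
    by (subst L) simp
  also have "\<dots> = (\<integral>\<^sup>+w. ennreal (s ^ card (- D)) * f (dilate D s w) \<partial>lborel)"
    using f d by (subst nn_integral_density, simp, simp) (subst nn_integral_distr, auto)
  also have "\<dots> = ennreal (s ^ card (- D)) * (\<integral>\<^sup>+w. f (dilate D s w) \<partial>lborel)"
    using measurable_compose[OF d f] by (intro nn_integral_cmult) simp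
  finally show ?thesis .
qed

text \<open>Indicator functions of compact sets are decreasing limits of continuous functions with
  compact support in \<open>U\<close>, so the measures agree on compact sets; an exhaustion of
  \<open>U\<close> by compact sets reduces to this \<open>\<inter>\<close>-stable generator.\<close>
lemma measure_eq_if_Cc_integrals_eq:
  fixes U :: "'a::euclidean_space set" and L N :: "'a measure"
  assumes U: "open U" and sL: "sets L = sets borel" and sN: "sets N = sets borel"
    and L0: "emeasure L (- U) = 0" and N0: "emeasure N (- U) = 0"
    and eq: "\<And>\<phi> K. continuous_on UNIV \<phi> \<Longrightarrow> (\<And>w. 0 \<le> \<phi> w) \<Longrightarrow> compact K \<Longrightarrow> K \<subseteq> U \<Longrightarrow> (\<And>w. w \<notin> K \<Longrightarrow> \<phi> w = 0)
      \<Longrightarrow> (\<integral>\<^sup>+w. ennreal (\<phi> w) \<partial>L) = (\<integral>\<^sup>+w. ennreal (\<phi> w) \<partial>N) \<and> (\<integral>\<^sup>+w. ennreal (\<phi> w) \<partial>L) < \<infinity>"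
  shows "L = N"
proof -
  have bm: "f \<in> borel_measurable L" "f \<in> borel_measurable N" if "f \<in> borel_measurable borel" for f :: "'a \<Rightarrow> ennreal"
    using that sL sN by (auto simp: measurable_def sets_eq_imp_space_eq)
  have K: "emeasure L K = emeasure N K \<and> emeasure L K < \<infinity>" if K: "compact K" "K \<subseteq> U" for K
  proof (cases "K = {}")
    case False
    obtain e where e: "e > 0" "{x. infdist x K \<le> e} \<subseteq> U"
      using compact_in_open_separated[OF False K(1) U K(2)] .
    \<comment> \<open>Urysohn functions, equal to 1 on \<open>K\<close> and supported in the \<open>e/(j+1)\<close>-neighbourhood\<close>
    define \<phi> where "\<phi> j x = max 0 (1 - (real (Suc j) / e) * infdist x K)" for j x
    have cont: "continuous_on UNIV (\<phi> j)" for j unfolding \<phi>_def by (intro continuous_intros)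
    have \<phi>0: "0 \<le> \<phi> j x" "\<phi> j x \<le> 1" for j x using e by (auto simp: \<phi>_def infdist_nonneg)
    have supp: "\<phi> j x = 0" if "x \<notin> {x. infdist x K \<le> e}" for j x
    proof -
      have "1 * e \<le> real (Suc j) * infdist x K" using that e by (intro mult_mono) auto
      then show ?thesis using e by (simp add: \<phi>_def field_simps)
    qed
    have dec: "\<phi> j x \<le> \<phi> 0 x" for j x
    proof -
      have "(real (Suc 0) / e) * infdist x K \<le> (real (Suc j) / e) * infdist x K"
        using e by (intro mult_right_mono divide_right_mono) (auto simp: infdist_nonneg)
      then show ?thesis by (simp add: \<phi>_def)
    qed
    have lim: "(\<lambda>j. ennreal (\<phi> j x)) \<longlonglongrightarrow> indicator K x" for x
    proof (cases "x \<in> K")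
      case True then show ?thesis by (simp add: \<phi>_def)
    next
      case x: False
      then have d: "infdist x K > 0"
        using in_closed_iff_infdist_zero[OF compact_imp_closed[OF K(1)] False, of x] infdist_nonneg[of x K] by linarith
      obtain m :: nat where m: "real m > e / infdist x K" using reals_Archimedean2 by blast
      have "\<phi> j x = 0" if "j \<ge> m" for j
      proof -
        have "e / infdist x K \<le> real (Suc j)" using m that by linarith
        then have "e \<le> real (Suc j) * infdist x K" using d by (simp add: pos_divide_le_eq)
        then show ?thesis using e by (simp add: \<phi>_def field_simps)
      qed
      then have "\<forall>\<^sub>F j in sequentially. ennreal (\<phi> j x) = indicator K x"
        using x by (auto simp: eventually_sequentially intro!: exI[of _ m])
      then show ?thesis by (rule tendsto_eventually)
    qed
    have cK: "compact {x. infdist x K \<le> e}" by (rule compact_infdist_le[OF False K(1) e(1)])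
    have eqj: "(\<integral>\<^sup>+w. ennreal (\<phi> j w) \<partial>L) = (\<integral>\<^sup>+w. ennreal (\<phi> j w) \<partial>N)" "(\<integral>\<^sup>+w. ennreal (\<phi> j w) \<partial>L) < \<infinity>" for j
      using eq[OF cont[of j] \<phi>0(1) cK e(2) supp] by auto
    have \<phi>m: "(\<lambda>x. ennreal (\<phi> j x)) \<in> borel_measurable borel" for j
      using borel_measurable_continuous_onI[OF cont[of j]] by simp
    have Km: "(indicator K :: 'a \<Rightarrow> ennreal) \<in> borel_measurable borel"
      using compact_imp_closed[OF K(1)] by simp
    have dec': "ennreal (\<phi> j x) \<le> ennreal (\<phi> 0 x)" for j x by (rule ennreal_leI[OF dec])
    have "(\<lambda>j. \<integral>\<^sup>+w. ennreal (\<phi> j w) \<partial>L) \<longlonglongrightarrow> (\<integral>\<^sup>+w. indicator K w \<partial>L)"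
      by (rule nn_integral_dominated_convergence[OF bm(1)[OF \<phi>m] bm(1)[OF Km] bm(1)[OF \<phi>m]
            AE_I2[OF dec'] eqj(2)[of 0] AE_I2[OF lim]])
    moreover have "(\<lambda>j. \<integral>\<^sup>+w. ennreal (\<phi> j w) \<partial>N) \<longlonglongrightarrow> (\<integral>\<^sup>+w. indicator K w \<partial>N)"
      by (rule nn_integral_dominated_convergence[OF bm(2)[OF \<phi>m] bm(2)[OF Km] bm(2)[OF \<phi>m]
            AE_I2[OF dec'] eqj(2)[of 0, unfolded eqj(1)] AE_I2[OF lim]])
    ultimately have "(\<integral>\<^sup>+w. indicator K w \<partial>L) = (\<integral>\<^sup>+w. indicator K w \<partial>N)"
      unfolding eqj(1) by (rule LIMSEQ_unique)
    moreover have "(\<integral>\<^sup>+w. indicator K w \<partial>L) \<le> (\<integral>\<^sup>+w. ennreal (\<phi> 0 w) \<partial>L)"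
      by (intro nn_integral_mono) (auto simp: indicator_def \<phi>_def)
    moreover have "K \<in> sets L" "K \<in> sets N" using compact_imp_closed[OF K(1)] sL sN by auto
    ultimately show ?thesis using eqj(2)[of 0] by auto
  qed simp
  obtain C where C: "\<And>n::nat. compact (C n)" "\<And>n. C n \<subseteq> U" "\<And>n. C n \<subseteq> interior (C (Suc n))" "\<Union>(range C) = U"
    by (rule open_Union_compact_subsets[OF U]) (rule that, assumption+)
  have Cb: "C n \<in> sets borel" for n by (intro borel_closed compact_imp_closed C(1))
  have inc: "incseq C" by (rule incseq_SucI) (rule order_trans[OF C(3) interior_subset])
  have part: "emeasure L (B \<inter> C n) = emeasure N (B \<inter> C n)" if B: "B \<in> sets borel" for B n
  proof -
    let ?L = "density L (indicator (C n))" and ?N = "density N (indicator (C n))"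
    have dens: "emeasure ?L X = emeasure L (X \<inter> C n)" "emeasure ?N X = emeasure N (X \<inter> C n)" if "X \<in> sets borel" for X
      using that Cb[of n] sL sN by (simp_all add: emeasure_density indicator_inter_arith[symmetric] Int_commute nn_integral_set_ennreal)
    have "?L = ?N"
    proof (rule measure_eqI_generator_eq[where E="Collect closed" and \<Omega>=UNIV and A="\<lambda>_. UNIV"])
      show "sets ?L = sigma_sets UNIV (Collect closed)" "sets ?N = sigma_sets UNIV (Collect closed)"
        using sL sN by (simp_all add: borel_eq_closed)
      show "emeasure ?L X = emeasure ?N X" if "X \<in> Collect closed" for X
        using that K[of "X \<inter> C n"] C(1,2)[of n] closed_Int_compact by (subst dens, simp, subst dens) auto
      show "emeasure ?L UNIV \<noteq> \<infinity>" for i :: nat using K[OF C(1,2), of n] by (subst dens) auto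
    qed (auto simp: Int_stable_def)
    then show ?thesis using dens[OF B] by simp
  qed
  show ?thesis
  proof (rule measure_eqI)
    fix B assume "B \<in> sets L"
    then have B: "B \<in> sets borel" using sL by simp
    have Uo: "U \<in> sets borel" using U by simp
    have *: "emeasure M B = (SUP n. emeasure M (B \<inter> C n))" if M: "sets M = sets borel" "emeasure M (- U) = 0" for M
    proof -
      have "(SUP n. emeasure M (B \<inter> C n)) = emeasure M (\<Union>n. B \<inter> C n)"
        using B Cb inc M(1) by (intro SUP_emeasure_incseq) (auto simp: incseq_def)
      also have "(\<Union>n. B \<inter> C n) = B \<inter> U" using C(4) by auto
      also have "emeasure M (B \<inter> U) = emeasure M B"
      proof (rule emeasure_eq_AE)
        have "- U \<in> null_sets M" using M Uo by (auto simp: null_sets_def)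
        then have "AE x in M. x \<notin> - U" by (rule AE_not_in)
        then show "AE x in M. (x \<in> B \<inter> U) = (x \<in> B)" by eventually_elim auto
      qed (use B Uo M in auto)
      finally show ?thesis by simp
    qed
    show "emeasure L B = emeasure N B" using *[OF sL L0] *[OF sN N0] part[OF B] by simp
  qed (simp add: sL sN)
qed

lemma Collect_less_borel:
  fixes f :: "'a::euclidean_space \<Rightarrow> real"
  assumes U: "open U" and f: "continuous_on U f"
  shows "{w \<in> U. f w < s} \<in> sets borel"
proof -
  have "open (U \<inter> f -` {..<s})" by (rule continuous_open_preimage[OF f U]) simp
  moreover have "{w \<in> U. f w < s} = U \<inter> f -` {..<s}" by auto
  ultimately show ?thesis by simp
qed

text \<open>The situation in one chart of the conormal bundle. \<open>U\<close> is an open cone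
  (invariant under fibre dilations), \<open>h0\<close> is the coordinate expression of
  \<open>p\<close>, homogeneous of degree 1, \<open>dens\<close> that of the natural density,
  homogeneous of degree 0, and \<open>L\<close> is a measure on \<open>{h0 = 1}\<close> which
  satisfies the defining relation of the Leray measure for test functions with compact
  support.\<close>
locale cone_measure =
  fixes D :: "'n::finite set" and U :: "(real^'n) set" and h0 dens :: "real^'n \<Rightarrow> real"
    and L :: "(real^'n) measure"
  assumes openU: "open U"
    and U_dil: "\<And>w r. w \<in> U \<Longrightarrow> r > 0 \<Longrightarrow> dilate D r w \<in> U"
    and h0_cont: "continuous_on U h0" and h0_pos: "\<And>w. w \<in> U \<Longrightarrow> h0 w > 0"
    and h0_dil: "\<And>w r. w \<in> U \<Longrightarrow> r > 0 \<Longrightarrow> h0 (dilate D r w) = r * h0 w"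
    and dens_cont: "continuous_on U dens" and dens_pos: "\<And>w. w \<in> U \<Longrightarrow> dens w > 0"
    and dens_dil: "\<And>w r. w \<in> U \<Longrightarrow> r > 0 \<Longrightarrow> dens (dilate D r w) = dens w"
    and sL: "sets L = sets borel" and L_conc: "emeasure L (- {w \<in> U. h0 w = 1}) = 0"
    and der: "\<And>h K. continuous_on UNIV h \<Longrightarrow> compact K \<Longrightarrow> K \<subseteq> U \<Longrightarrow> (\<And>w. w \<notin> K \<Longrightarrow> h w = 0) \<Longrightarrow>
       ((\<lambda>s. LINT w:{w \<in> U. h0 w < s}|lborel. h w * dens w) has_real_derivative (LINT w|L. h w)) (at 1)"
    and card: "card (- D) > 0"
begin

text \<open>Radial projection to \<open>{h0 = 1}\<close>, with an arbitrary value off the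
  cone.\<close>
definition nrm :: "real^'n \<Rightarrow> real^'n" where "nrm w = (if w \<in> U then dilate D (1 / h0 w) w else 0)"

lemma nrm_U: "w \<in> U \<Longrightarrow> nrm w \<in> U \<and> h0 (nrm w) = 1 \<and> w = dilate D (h0 w) (nrm w) \<and> dens (nrm w) = dens w"
  using U_dil[of w "1 / h0 w"] h0_pos[of w] h0_dil[of w "1 / h0 w"] dens_dil[of w "1 / h0 w"] by (simp add: nrm_def)

lemma nrm_dil: "w \<in> U \<Longrightarrow> r > 0 \<Longrightarrow> nrm (dilate D r w) = nrm w"
  using U_dil[of w r] h0_dil[of w r] h0_pos[of w] by (simp add: nrm_def)

lemma nrm_id: "w \<in> U \<Longrightarrow> h0 w = 1 \<Longrightarrow> nrm w = w" by (simp add: nrm_def)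

lemma nrm_cont: "continuous_on U nrm"
proof -
  have "continuous_on U (\<lambda>w. dilate D (1 / h0 w) w)"
    using h0_cont h0_pos by (intro continuous_intros) (auto simp: less_le)
  then show ?thesis by (rule continuous_on_eq) (simp add: nrm_def)
qed

lemma borel_U [measurable]: "U \<in> sets borel" using openU by simp

lemma borel_if_cont:
  fixes f :: "real^'n \<Rightarrow> 'b::real_normed_vector"
  assumes "continuous_on U f" shows "(\<lambda>w. if w \<in> U then f w else 0) \<in> borel_measurable borel"
  using borel_measurable_continuous_on_if[OF borel_U assms, of "\<lambda>_. 0"] by simp

lemma nrm_borel [measurable]: "nrm \<in> borel_measurable borel"
proof -
  have "nrm = (\<lambda>w. if w \<in> U then nrm w else 0)" by (auto simp: nrm_def)
  then show ?thesis using borel_if_cont[OF nrm_cont] by metis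
qed

text \<open>The extension of \<open>k\<close> to the cone as a function homogeneous of degree 0,
  times the density.\<close>
definition E :: "(real^'n \<Rightarrow> ennreal) \<Rightarrow> real^'n \<Rightarrow> ennreal" where
  "E k w = (if w \<in> U then k (nrm w) * ennreal (dens w) else 0)"

lemma E_borel: "k \<in> borel_measurable borel \<Longrightarrow> E k \<in> borel_measurable borel"
proof -
  assume k: "k \<in> borel_measurable borel"
  have "E k = (\<lambda>w. k (nrm w) * ennreal (if w \<in> U then dens w else 0))" by (auto simp: E_def fun_eq_iff)
  moreover have "(\<lambda>w. k (nrm w)) \<in> borel_measurable borel" using measurable_compose[OF nrm_borel k] .
  ultimately show ?thesis using borel_if_cont[OF dens_cont] by simp
qed

definition cone :: "real \<Rightarrow> (real^'n) set" where "cone s = {w \<in> U. h0 w < s}"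

lemma cone_borel [measurable]: "cone s \<in> sets borel"
  unfolding cone_def by (rule Collect_less_borel[OF openU h0_cont])

definition c :: "(real^'n \<Rightarrow> ennreal) \<Rightarrow> ennreal" where "c k = (\<integral>\<^sup>+w\<in>cone 1. E k w \<partial>lborel)"

text \<open>Dilation by \<open>s\<close> maps \<open>cone 1\<close> to \<open>cone s\<close> and
  leaves \<open>E k\<close> unchanged.\<close>
lemma cone_scale:
  assumes k: "k \<in> borel_measurable borel" and s: "s > 0"
  shows "(\<integral>\<^sup>+w\<in>cone s. E k w \<partial>lborel) = ennreal (s ^ card (- D)) * c k"
proof -
  have "(\<integral>\<^sup>+w\<in>cone s. E k w \<partial>lborel) = ennreal (s ^ card (- D)) * (\<integral>\<^sup>+w. E k (dilate D s w) * indicator (cone s) (dilate D s w) \<partial>lborel)"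
    by (rule nn_integral_dilate[OF _ s]) (use E_borel[OF k] in measurable)
  also have "(\<lambda>w. E k (dilate D s w) * indicator (cone s) (dilate D s w)) = (\<lambda>w. E k w * indicator (cone 1) w)"
  proof
    fix w
    have iff: "dilate D s w \<in> U \<longleftrightarrow> w \<in> U"
      using U_dil[of w s] U_dil[of "dilate D s w" "1/s"] s by auto
    show "E k (dilate D s w) * indicator (cone s) (dilate D s w) = E k w * indicator (cone 1) w"
      using s by (auto simp: E_def iff nrm_dil dens_dil cone_def indicator_def h0_dil)
  qed
  finally show ?thesis by (simp add: c_def)
qed

text \<open>By homogeneity the integral of \<open>E \<phi>\<close> over \<open>{h0 < s}\<close> is
  \<open>s\<^sup>m c \<phi>\<close>, with \<open>m\<close> the number of fibre coordinates, and its
  derivative at \<open>s = 1\<close> is \<open>m c \<phi>\<close>. But \<open>E \<phi>\<close> does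
  not have compact support in the cone: its support reaches the vertex. So \<open>\<phi>\<close> is
  extended with a radial cutoff that equals 1 near \<open>h0 = 1\<close>; this changes the integral
  over \<open>{h0 < s}\<close> only by a constant for \<open>s\<close> near 1.\<close>
lemma Cc_integral:
  assumes \<phi>: "continuous_on UNIV \<phi>" and \<phi>0: "\<And>w. 0 \<le> \<phi> w" and K: "compact K" "K \<subseteq> U" and supp: "\<And>w. w \<notin> K \<Longrightarrow> \<phi> w = 0"
  shows "c (\<lambda>w. ennreal (\<phi> w)) < \<infinity>"
    and "(\<integral>\<^sup>+w. ennreal (\<phi> w) \<partial>L) = ennreal (real (card (- D))) * c (\<lambda>w. ennreal (\<phi> w))"
proof -
  let ?m = "card (- D)" and ?k = "\<lambda>w. ennreal (\<phi> w)"
  have kb: "?k \<in> borel_measurable borel" using borel_measurable_continuous_onI[OF \<phi>] by simp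
  define K1 where "K1 = K \<inter> h0 -` {1}"
  have K1: "compact K1" unfolding K1_def
    by (rule closedin_compact[OF K(1)]) (intro continuous_closedin_preimage continuous_on_subset[OF h0_cont K(2)] closed_singleton)
  have nz: "nrm w \<in> K1" if "w \<in> U" "\<phi> (nrm w) \<noteq> 0" for w
    using that nrm_U[OF that(1)] supp[of "nrm w"] by (auto simp: K1_def)
  define e where "e w = (if w \<in> U then \<phi> (nrm w) * dens w else 0)" for w
  have E_e: "E ?k w = ennreal (e w)" for w
    using \<phi>0 dens_pos[of w] by (simp add: E_def e_def ennreal_mult less_imp_le)
  have e0: "0 \<le> e w" for w using \<phi>0 dens_pos[of w] by (simp add: e_def less_imp_le)
  have eb [measurable]: "e \<in> borel_measurable borel"
    unfolding e_def by (intro borel_if_cont continuous_intros continuous_on_compose2[OF \<phi> nrm_cont] dens_cont) auto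
  define Q where "Q = (\<lambda>(r, w). dilate D r w) ` ({0..1} \<times> K1)"
  have Qc: "compact Q" unfolding Q_def case_prod_unfold
    by (intro compact_continuous_image compact_Times K1 continuous_intros) auto
  obtain B1 where B1: "\<And>w. w \<in> K1 \<Longrightarrow> \<phi> w * dens w \<le> B1"
  proof -
    have "compact ((\<lambda>w. \<phi> w * dens w) ` K1)"
      using K(2) by (intro compact_continuous_image K1 continuous_intros continuous_on_subset[OF \<phi>] continuous_on_subset[OF dens_cont]) (auto simp: K1_def)
    then have "bdd_above ((\<lambda>w. \<phi> w * dens w) ` K1)" by (simp add: bounded_imp_bdd_above compact_imp_bounded)
    then show ?thesis using that by (auto simp: bdd_above_def)
  qed
  have bound: "E ?k w * indicator (cone 1) w \<le> ennreal B1 * indicator Q w" for w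
  proof (cases "w \<in> U \<and> h0 w < 1 \<and> \<phi> (nrm w) \<noteq> 0")
    case True
    then have w: "w \<in> U" "nrm w \<in> K1" using nz by auto
    have "w \<in> Q" unfolding Q_def
      using nrm_U[OF w(1)] w h0_pos[OF w(1)] True by (intro image_eqI[of _ _ "(h0 w, nrm w)"]) auto
    moreover have "e w \<le> B1" using B1[OF w(2)] nrm_U[OF w(1)] w by (simp add: e_def)
    ultimately show ?thesis unfolding E_e by (simp add: indicator_def ennreal_leI)
  next
    case False then show ?thesis by (auto simp: E_e e_def cone_def indicator_def)
  qed
  have "c ?k \<le> (\<integral>\<^sup>+w. ennreal B1 * indicator Q w \<partial>lborel)" unfolding c_def by (intro nn_integral_mono bound)
  also have "\<dots> = ennreal B1 * emeasure lborel Q" using compact_imp_closed[OF Qc] by (simp add: nn_integral_cmult)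
  also have "\<dots> < \<infinity>" using emeasure_compact_finite[OF Qc] by (simp add: ennreal_mult_less_top)
  finally show cfin: "c ?k < \<infinity>" .
  define cr where "cr = enn2real (c ?k)"
  have cr: "c ?k = ennreal cr" "0 \<le> cr" using cfin by (auto simp: cr_def)
  have int: "has_bochner_integral lborel (\<lambda>w. indicator (cone s) w * e w) (s ^ ?m * cr)" if "s > 0" for s
  proof (rule has_bochner_integral_nn_integral)
    have "(\<integral>\<^sup>+w. ennreal (indicator (cone s) w * e w) \<partial>lborel) = (\<integral>\<^sup>+w\<in>cone s. E ?k w \<partial>lborel)"
      by (intro nn_integral_cong) (auto simp: E_e indicator_def)
    also have "\<dots> = ennreal (s ^ ?m * cr)" using cone_scale[OF kb that] that cr by (simp add: ennreal_mult)
    finally show "(\<integral>\<^sup>+w. ennreal (indicator (cone s) w * e w) \<partial>lborel) = ennreal (s ^ ?m * cr)" .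
  qed (use that e0 cr in \<open>auto intro!: mult_nonneg_nonneg\<close>)
  \<comment> \<open>the radial cutoff, equal to 1 on \<open>[3/4, 5/4]\<close> and supported in \<open>[1/2, 3/2]\<close>\<close>
  define cut where "cut r = max 0 (min 1 (2 - 4 * \<bar>r - 1\<bar>))" for r :: real
  have cut01: "0 \<le> cut r" "cut r \<le> 1" for r by (auto simp: cut_def)
  have cut_1: "cut r = 1" if "3/4 \<le> r" "r < 5/4" for r using that by (auto simp: cut_def max_def min_def abs_if)
  have cut_0: "cut r = 0" if "r < 1/2 \<or> r > 3/2" for r using that by (auto simp: cut_def max_def min_def abs_if)
  define h where "h w = (if w \<in> U then \<phi> (nrm w) * cut (h0 w) else 0)" for w
  define K' where "K' = (\<lambda>(r, w). dilate D r w) ` ({1/2..3/2} \<times> K1)"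
  have K'c: "compact K'" unfolding K'_def case_prod_unfold
    by (intro compact_continuous_image compact_Times K1 continuous_intros) auto
  have K'U: "K' \<subseteq> U" unfolding K'_def using U_dil K(2) by (auto simp: K1_def)
  have hK': "h w = 0" if "w \<notin> K'" for w
  proof (rule ccontr)
    assume "h w \<noteq> 0"
    then have w: "w \<in> U" "\<phi> (nrm w) \<noteq> 0" "cut (h0 w) \<noteq> 0" by (auto simp: h_def split: if_splits)
    have "w \<in> K'" unfolding K'_def
    proof (rule image_eqI[of _ _ "(h0 w, nrm w)"])
      have "\<not> (h0 w < 1/2 \<or> h0 w > 3/2)" using cut_0[of "h0 w"] w(3) by blast
      then have "1/2 \<le> h0 w" "h0 w \<le> 3/2" by linarith+
      then show "(h0 w, nrm w) \<in> {1/2..3/2} \<times> K1" using nz[OF w(1,2)] by simp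
    qed (use nrm_U[OF w(1)] in simp)
    with that show False by simp
  qed
  have hc: "continuous_on UNIV h"
  proof -
    have "continuous_on U (\<lambda>w. \<phi> (nrm w) * cut (h0 w))"
      unfolding cut_def by (intro continuous_intros continuous_on_compose2[OF \<phi> nrm_cont] h0_cont) auto
    then have "continuous_on U h" by (rule continuous_on_eq) (simp add: h_def)
    moreover have "continuous_on (- K') h"
      by (rule continuous_on_eq[of _ "\<lambda>_. 0"]) (use hK' in auto)
    ultimately have "continuous_on (U \<union> - K') h"
      using compact_imp_closed[OF K'c] by (intro continuous_on_open_Un openU) auto
    moreover have "U \<union> - K' = UNIV" using K'U by auto
    ultimately show ?thesis by simp
  qed
  \<comment> \<open>the part of the integral that does not depend on \<open>s\<close> for \<open>s > 3/4\<close>\<close>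
  define h1 where "h1 w = indicator (cone (3/4)) w * (h w * dens w)" for w
  have h1_int: "integrable lborel h1"
  proof (rule Bochner_Integration.integrable_bound)
    show "integrable lborel (\<lambda>w. indicator (cone (3/4)) w * e w)" using int[of "3/4"] by (simp add: has_bochner_integral_iff)
    have "h1 = (\<lambda>w. indicator (cone (3/4)) w * (h w * (if w \<in> U then dens w else 0)))"
      by (auto simp: h1_def h_def fun_eq_iff)
    then show "h1 \<in> borel_measurable lborel"
      using borel_if_cont[OF dens_cont] borel_measurable_continuous_onI[OF hc] by simp
    show "AE w in lborel. norm (h1 w) \<le> norm (indicator (cone (3/4)) w * e w)"
    proof (rule AE_I2)
      fix w
      have "\<bar>h w * dens w\<bar> \<le> e w"
        using \<phi>0[of "nrm w"] dens_pos[of w] cut01[of "h0 w"] mult_left_le[of "cut (h0 w)" "\<phi> (nrm w) * dens w"]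
        by (auto simp: h_def e_def abs_mult mult_ac)
      then show "norm (h1 w) \<le> norm (indicator (cone (3/4)) w * e w)"
        using e0[of w] by (auto simp: h1_def indicator_def)
    qed
  qed
  have F: "(LINT w:{w \<in> U. h0 w < s}|lborel. h w * dens w) = s ^ ?m * cr + ((LINT w|lborel. h1 w) - (3/4) ^ ?m * cr)"
    if s: "3/4 < s" "s < 5/4" for s
  proof -
    have "indicator {w \<in> U. h0 w < s} w *\<^sub>R (h w * dens w) = h1 w + (indicator (cone s) w * e w - indicator (cone (3/4)) w * e w)" for w
    proof (cases "w \<in> U \<and> 3/4 \<le> h0 w \<and> h0 w < s")
      case True
      then have "h w * dens w = e w" using s cut_1[of "h0 w"] by (simp add: h_def e_def)
      then show ?thesis using True s by (simp add: h1_def cone_def indicator_def)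
    next
      case False
      then show ?thesis using s by (auto simp: h1_def cone_def indicator_def)
    qed
    then have "(LINT w:{w \<in> U. h0 w < s}|lborel. h w * dens w)
       = (LINT w|lborel. h1 w + (indicator (cone s) w * e w - indicator (cone (3/4)) w * e w))"
      unfolding set_lebesgue_integral_def by simp
    also have "\<dots> = (LINT w|lborel. h1 w) + (s ^ ?m * cr - (3/4) ^ ?m * cr)"
      using h1_int int[of s] int[of "3/4"] s by (simp add: has_bochner_integral_iff)
    finally show ?thesis by simp
  qed
  have "((\<lambda>s. LINT w:{w \<in> U. h0 w < s}|lborel. h w * dens w) has_real_derivative (LINT w|L. h w)) (at 1)"
    by (rule der[OF hc K'c K'U hK'])
  moreover have "((\<lambda>s. LINT w:{w \<in> U. h0 w < s}|lborel. h w * dens w) has_real_derivative (real ?m * cr)) (at 1)"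
  proof (rule has_field_derivative_transform_within_open[where S="{3/4<..<5/4}"])
    show "((\<lambda>s. s ^ ?m * cr + ((LINT w|lborel. h1 w) - (3/4) ^ ?m * cr)) has_real_derivative (real ?m * cr)) (at 1)"
      by (auto intro!: derivative_eq_intros)
  qed (use F in auto)
  ultimately have LI: "(LINT w|L. h w) = real ?m * cr" by (rule DERIV_unique)
  have conc: "AE w in L. w \<in> U \<and> h0 w = 1"
  proof -
    have "{w \<in> U. h0 w = 1} \<in> sets borel"
    proof -
      have "{w \<in> U. h0 w = 1} = U - ({w \<in> U. h0 w < 1} \<union> {w\<in>U. - h0 w < -1})" by auto
      also have "\<dots> \<in> sets borel"
        by (intro sets.Diff sets.Un borel_U Collect_less_borel openU h0_cont continuous_on_minus)
      finally show ?thesis .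
    qed
    then have "- {w \<in> U. h0 w = 1} \<in> null_sets L" using L_conc sL by (auto simp: null_sets_def)
    then have "AE w in L. w \<notin> - {w \<in> U. h0 w = 1}" by (rule AE_not_in)
    then show ?thesis by eventually_elim auto
  qed
  have h_eq: "AE w in L. h w = \<phi> w"
    using conc by eventually_elim (simp add: h_def nrm_id cut_1)
  have hL: "h \<in> borel_measurable L" "\<phi> \<in> borel_measurable L"
    using borel_measurable_continuous_onI[OF hc] borel_measurable_continuous_onI[OF \<phi>] sL by (auto simp: measurable_def sets_eq_imp_space_eq)
  show "(\<integral>\<^sup>+w. ennreal (\<phi> w) \<partial>L) = ennreal (real ?m) * c ?k"
  proof (cases "integrable L h")
    case True
    then have i: "integrable L \<phi>" using h_eq hL by (subst integrable_cong_AE[OF hL(2,1)]) (auto elim: eventually_mono)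
    have "(LINT w|L. h w) = (LINT w|L. \<phi> w)" using h_eq hL by (intro integral_cong_AE) auto
    then show ?thesis using LI i \<phi>0 cr by (simp add: nn_integral_eq_integral ennreal_mult[symmetric])
  next
    case False
    \<comment> \<open>a non-integrable function has integral 0 by convention; then \<open>c \<phi> = 0\<close>, which forces \<open>\<phi> = 0\<close> on \<open>{h0 = 1}\<close>\<close>
    then have "real ?m * cr = 0" using LI by (simp add: not_integrable_integral_eq)
    then have "cr = 0" using card by (metis mult_eq_0_iff of_nat_0_eq_iff less_numeral_extra(3))
    then have "(\<integral>\<^sup>+w. E ?k w * indicator (cone 1) w \<partial>lborel) = 0" using cr by (simp add: c_def)
    then have "AE w in lborel. E ?k w * indicator (cone 1) w = 0"
      using E_borel[OF kb] by (subst nn_integral_0_iff_AE[symmetric]) auto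
    then have "AE w in lborel. \<not> (w \<in> U \<and> h0 w < 1 \<and> \<phi> (nrm w) > 0)"
    proof eventually_elim
      case (elim w)
      then show ?case using dens_pos[of w] by (auto simp: E_e e_def cone_def ennreal_eq_0_iff mult_le_0_iff)
    qed
    moreover have op: "open {w \<in> U. h0 w < 1 \<and> \<phi> (nrm w) > 0}"
    proof -
      have "open (U \<inter> (\<lambda>w. (h0 w, \<phi> (nrm w))) -` ({..<1} \<times> {0<..}))"
        by (intro continuous_open_preimage openU continuous_on_Pair h0_cont continuous_on_compose2[OF \<phi> nrm_cont] open_Times) auto
      moreover have "U \<inter> (\<lambda>w. (h0 w, \<phi> (nrm w))) -` ({..<1} \<times> {0<..}) = {w \<in> U. h0 w < 1 \<and> \<phi> (nrm w) > 0}" by auto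
      ultimately show ?thesis by simp
    qed
    ultimately have "{w \<in> U. h0 w < 1 \<and> \<phi> (nrm w) > 0} \<in> null_sets lborel"
      by (subst AE_iff_null_sets) auto
    then have "negligible {w \<in> U. h0 w < 1 \<and> \<phi> (nrm w) > 0}"
      using null_sets_completionI negligible_iff_null_sets by blast
    then have emp: "{w \<in> U. h0 w < 1 \<and> \<phi> (nrm w) > 0} = {}" using open_not_negligible[OF op] by blast
    have phi0: "\<phi> w = 0" if w: "w \<in> U" "h0 w = 1" for w
    proof (rule ccontr)
      assume "\<phi> w \<noteq> 0"
      then have "\<phi> w > 0" using \<phi>0[of w] by simp
      moreover have "nrm (dilate D (1/2) w) = w" using nrm_dil[of w "1/2"] nrm_id w by simp
      ultimately have "dilate D (1/2) w \<in> {w \<in> U. h0 w < 1 \<and> \<phi> (nrm w) > 0}"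
        using U_dil[of w "1/2"] h0_dil[of w "1/2"] w by simp
      then show False unfolding emp by simp
    qed
    have "AE w in L. \<phi> w = 0" by (rule AE_mp[OF conc], rule AE_I2) (use phi0 in blast)
    then have "(\<integral>\<^sup>+w. ennreal (\<phi> w) \<partial>L) = (\<integral>\<^sup>+w. 0 \<partial>L)" by (intro nn_integral_cong_AE) (auto elim: eventually_mono)
    then show ?thesis using cr \<open>cr = 0\<close> by simp
  qed
qed

text \<open>Polar coordinates: both sides are integrals with respect to measures on
  \<open>U\<close>, the right-hand one being the image under radial projection of the density on
  \<open>cone 1\<close>. They agree on continuous functions with compact support.\<close>
theorem nn_integral_eq_cone:
  assumes k: "k \<in> borel_measurable borel"
  shows "(\<integral>\<^sup>+w. k w \<partial>L) = ennreal (real (card (- D))) * c k"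
proof -
  let ?d = "\<lambda>w. ennreal (real (card (- D))) * (E (\<lambda>_. 1) w * indicator (cone 1) w)"
  let ?N = "distr (density lborel ?d) borel nrm"
  have d: "?d \<in> borel_measurable lborel" using E_borel[of "\<lambda>_. 1"] by simp
  have N: "(\<integral>\<^sup>+w. k w \<partial>?N) = ennreal (real (card (- D))) * c k" if "k \<in> borel_measurable borel" for k
  proof -
    have "(\<integral>\<^sup>+w. k w \<partial>?N) = (\<integral>\<^sup>+w. ?d w * k (nrm w) \<partial>lborel)"
      using that d measurable_compose[OF nrm_borel that]
      by (subst nn_integral_distr, simp, simp, subst nn_integral_density) auto
    also have "\<dots> = (\<integral>\<^sup>+w. ennreal (real (card (- D))) * (E k w * indicator (cone 1) w) \<partial>lborel)"
      by (intro nn_integral_cong) (auto simp: E_def indicator_def mult_ac)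
    also have "\<dots> = ennreal (real (card (- D))) * c k"
      unfolding c_def using E_borel[OF that] by (intro nn_integral_cmult) simp
    finally show ?thesis .
  qed
  have "L = ?N"
  proof (rule measure_eq_if_Cc_integrals_eq[OF openU sL])
    show "sets ?N = sets borel" by simp
    have sub: "- U \<subseteq> - {w \<in> U. h0 w = 1}" by auto
    have "{w \<in> U. h0 w = 1} = U - ({w \<in> U. h0 w < 1} \<union> {w\<in>U. - h0 w < -1})" by auto
    also have "\<dots> \<in> sets borel"
      by (intro sets.Diff sets.Un borel_U Collect_less_borel openU h0_cont continuous_on_minus)
    finally have "- {w \<in> U. h0 w = 1} \<in> sets L" using sL by (metis borel_comp)
    then have "emeasure L (- U) \<le> emeasure L (- {w \<in> U. h0 w = 1})" by (rule emeasure_mono[OF sub])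
    then show "emeasure L (- U) = 0" unfolding L_conc by simp
    have "emeasure ?N (- U) = (\<integral>\<^sup>+w. indicator (- U) w \<partial>?N)" by simp
    also have "\<dots> = ennreal (real (card (- D))) * c (indicator (- U))" by (rule N) simp
    also have "c (indicator (- U)) = (\<integral>\<^sup>+w. 0 \<partial>(lborel :: (real^'n) measure))" unfolding c_def
      by (intro nn_integral_cong) (use nrm_U in \<open>auto simp: E_def indicator_def\<close>)
    finally show "emeasure ?N (- U) = 0" by simp
    fix \<phi> :: "real^'n \<Rightarrow> real" and K
    assume a: "continuous_on UNIV \<phi>" "\<And>w. 0 \<le> \<phi> w" "compact K" "K \<subseteq> U" "\<And>w. w \<notin> K \<Longrightarrow> \<phi> w = 0"
    have "(\<lambda>w. ennreal (\<phi> w)) \<in> borel_measurable borel" using borel_measurable_continuous_onI[OF a(1)] by simp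
    from N[OF this] Cc_integral[OF a]
    show "(\<integral>\<^sup>+w. ennreal (\<phi> w) \<partial>L) = (\<integral>\<^sup>+w. ennreal (\<phi> w) \<partial>?N) \<and> (\<integral>\<^sup>+w. ennreal (\<phi> w) \<partial>L) < \<infinity>"
      by (simp add: ennreal_mult_less_top)
  qed
  then show ?thesis using N[OF k] by simp
qed

lemma compact_emeasure_finite:
  assumes K: "compact K" "K \<subseteq> U" shows "emeasure L K < \<infinity>"
proof (cases "K = {}")
  case False
  obtain e where e: "e > 0" "{x. infdist x K \<le> e} \<subseteq> U"
    using compact_in_open_separated[OF False K(1) openU K(2)] .
  define \<phi> where "\<phi> x = max 0 (1 - infdist x K / e)" for x
  have cont: "continuous_on UNIV \<phi>" unfolding \<phi>_def using e(1) by (intro continuous_intros) auto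
  have "\<phi> w = 0" if "w \<notin> {x. infdist x K \<le> e}" for w
    using that e by (simp add: \<phi>_def field_simps)
  note * = Cc_integral[OF cont _ compact_infdist_le[OF False K(1) e(1)] e(2) this]
  have "(\<integral>\<^sup>+w. ennreal (\<phi> w) \<partial>L) < \<infinity>"
    using * by (simp add: \<phi>_def ennreal_mult_less_top)
  moreover have "emeasure L K \<le> (\<integral>\<^sup>+w. ennreal (\<phi> w) \<partial>L)"
  proof -
    have "emeasure L K = (\<integral>\<^sup>+w. indicator K w \<partial>L)" using compact_imp_closed[OF K(1)] sL by simp
    also have "\<dots> \<le> (\<integral>\<^sup>+w. ennreal (\<phi> w) \<partial>L)"
      by (intro nn_integral_mono) (auto simp: indicator_def \<phi>_def)
    finally show ?thesis .
  qed
  ultimately show ?thesis by simp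
qed simp

end

section \<open>Charts, covectors and the symbol\<close>
lemma smooth_onD:
  fixes f :: "'a::real_normed_vector \<Rightarrow> 'b::real_normed_vector"
  assumes "smooth_on S f"
  shows smooth_on_has_derivative: "x \<in> S \<Longrightarrow> (f has_derivative frechet_derivative f (at x)) (at x)"
    and smooth_on_continuous_derivative: "continuous_on S (\<lambda>x. frechet_derivative f (at x) v)"
    and smooth_on_continuous: "continuous_on S f"
proof -
  have k: "Ck_on k S f" for k using assms by (auto simp: smooth_on_def)
  show "x \<in> S \<Longrightarrow> (f has_derivative frechet_derivative f (at x)) (at x)"
    using k[of "Suc 0"] by (simp add: frechet_derivative_works)
  show "continuous_on S (\<lambda>x. frechet_derivative f (at x) v)" using k[of "Suc 0"] by simp
  show "continuous_on S f" using k[of 0] by simp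
qed

lemma det_differentiable:
  fixes M :: "'a::real_normed_vector \<Rightarrow> real^'n^'n"
  assumes "\<And>i j. (\<lambda>x. M x $ i $ j) differentiable (at x)"
  shows "(\<lambda>x. det (M x)) differentiable (at x)"
proof -
  have prod: "(\<lambda>x. \<Prod>i\<in>I. M x $ i $ p i) differentiable (at x)" for p and I :: "'n set"
    using finite[of I] by (induction I rule: finite_induct) (auto intro!: differentiable_mult assms)
  show ?thesis unfolding det_def by (intro differentiable_sum ballI differentiable_mult prod) auto
qed

lemma differentiable_vec_nth:
  assumes "f differentiable F" shows "(\<lambda>x. f x $ i) differentiable F"
  using assms bounded_linear.has_derivative[OF bounded_linear_vec_nth] unfolding differentiable_def by blast

lemma differentiable_vec_lambda:
  fixes f :: "'a::real_normed_vector \<Rightarrow> real^'n"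
  assumes "\<And>i. (\<lambda>x. f x $ i) differentiable (at x)" shows "f differentiable (at x)"
proof -
  obtain f' where f': "\<And>i. ((\<lambda>x. f x $ i) has_derivative f' i) (at x)"
    using assms unfolding differentiable_def by metis
  have "(f has_derivative (\<lambda>h. \<chi> i. f' i h)) (at x)"
  proof (rule has_derivative_componentwise_within[THEN iffD2], rule ballI)
    fix b :: "real^'n" assume "b \<in> Basis"
    then obtain i where "b = axis i 1" by (auto simp: Basis_vec_def)
    then show "((\<lambda>x. f x \<bullet> b) has_derivative (\<lambda>h. (\<chi> i. f' i h) \<bullet> b)) (at x)"
      using f'[of i] by (simp add: inner_axis)
  qed
  then show ?thesis by (rule differentiableI)
qed

lemma pos_def_det_nz:
  fixes a :: "real^'n^'n"
  assumes "\<And>v. v \<noteq> 0 \<Longrightarrow> v \<bullet> (a *v v) > 0"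
  shows "invertible a" "det a \<noteq> 0"
proof -
  have "v = 0" if "a *v v = 0" for v using assms[of v] that by auto
  then show "invertible a"
    using matrix_left_invertible_ker[of a] invertible_left_inverse by blast
  then show "det a \<noteq> 0" by (simp add: invertible_det_nz)
qed

lemma matrix_inv_mult:
  fixes a :: "real^'n^'n"
  assumes "invertible a"
  shows "a *v (matrix_inv a *v v) = v" "matrix_inv a *v (a *v v) = v"
proof -
  have "a ** matrix_inv a = mat 1 \<and> matrix_inv a ** a = mat 1"
    using assms unfolding matrix_inv_def invertible_def by (rule someI_ex)
  then show "a *v (matrix_inv a *v v) = v" "matrix_inv a *v (a *v v) = v"
    by (simp_all add: matrix_vector_mul_assoc)
qed

lemma matrix_inv_differentiable:
  fixes a :: "'a::real_normed_vector \<Rightarrow> real^'n^'n" and b :: "'a \<Rightarrow> real^'n"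
  assumes a: "\<And>i j. (\<lambda>x. a x $ i $ j) differentiable (at x)" and b: "\<And>i. (\<lambda>x. b x $ i) differentiable (at x)"
    and S: "open S" "x \<in> S" and inv: "\<And>y. y \<in> S \<Longrightarrow> invertible (a y)"
  shows "(\<lambda>x. matrix_inv (a x) *v b x) differentiable (at x)"
proof -
  let ?u = "\<lambda>x. (\<chi> k. det (\<chi> i j. if j = k then b x $ i else a x $ i $ j) / det (a x)) :: real^'n"
  have eq: "?u y = matrix_inv (a y) *v b y" if "y \<in> S" for y
    using cramer[of "a y" "matrix_inv (a y) *v b y" "b y"] inv[OF that] matrix_inv_mult[OF inv[OF that]]
    by (simp add: invertible_det_nz)
  have "?u differentiable (at x)"
  proof (rule differentiable_vec_lambda)
    fix k
    have "(\<lambda>x. det (\<chi> i j. if j = k then b x $ i else a x $ i $ j)) differentiable (at x)"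
    proof (rule det_differentiable)
      fix i j show "(\<lambda>x. (\<chi> i j. if j = k then b x $ i else a x $ i $ j) $ i $ j) differentiable (at x)"
        using a[of i j] b[of i] by (cases "j = k") simp_all
    qed
    then show "(\<lambda>x. ?u x $ k) differentiable (at x)"
      using det_differentiable[OF a] inv[OF S(2)] by (simp add: differentiable_divide invertible_det_nz)
  qed
  then obtain u' where "(?u has_derivative u') (at x)" unfolding differentiable_def by blast
  then have "((\<lambda>x. matrix_inv (a x) *v b x) has_derivative u') (at x)"
    by (rule has_derivative_transform_within_open[OF _ S]) (rule eq)
  then show ?thesis by (rule differentiableI)
qed

text \<open>The dilation of the fibres of the cotangent bundle.\<close>
definition cscale :: "real \<Rightarrow> ('m, 'n::finite) cov \<Rightarrow> ('m, 'n) cov" where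
  "cscale r z = (fst z, \<lambda>c. r *\<^sub>R snd z c)"

lemma cscale_simps [simp]: "fst (cscale r z) = fst z" "snd (cscale r z) c = r *\<^sub>R snd z c"
  "cscale r (cscale s z) = cscale (r * s) z" "cscale 1 z = z"
  "coords c (cscale r z) = (fst (coords c z), r *\<^sub>R snd (coords c z))"
  by (simp_all add: cscale_def coords_def)

locale closed_manifold =
  fixes A :: "('m::t2_space, 'n::finite) chart set" and g :: "('m, 'n) metric"
  assumes mfd: "closed_riemannian_manifold A g"
begin

lemma atlas:
  shows atlas_chart: "c \<in> A \<Longrightarrow> is_chart c" and atlas_UN: "(\<Union>c\<in>A. fst c) = UNIV"
    and atlas_compatible: "c \<in> A \<Longrightarrow> c' \<in> A \<Longrightarrow> compatible c c'"
proof -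
  note m = mfd[unfolded closed_riemannian_manifold_def smooth_structure_def]
  have 1: "\<forall>c\<in>A. is_chart c" using m by (elim conjE) assumption
  have 2: "(\<Union>c\<in>A. fst c) = UNIV" using m by (elim conjE) assumption
  have 3: "\<forall>c\<in>A. \<forall>c'\<in>A. compatible c c'" using m by (elim conjE) assumption
  show "c \<in> A \<Longrightarrow> is_chart c" using 1 by simp
  show "(\<Union>c\<in>A. fst c) = UNIV" by (fact 2)
  show "c \<in> A \<Longrightarrow> c' \<in> A \<Longrightarrow> compatible c c'" using 3 by simp
qed

lemma chart:
  assumes "c \<in> A"
  shows chart_open: "open (fst c)" and crange_open: "open (crange c)"
    and cinv_snd: "q \<in> fst c \<Longrightarrow> cinv c (snd c q) = q"
    and snd_cinv: "x \<in> crange c \<Longrightarrow> snd c (cinv c x) = x"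
    and cinv_in: "x \<in> crange c \<Longrightarrow> cinv c x \<in> fst c"
    and snd_in: "q \<in> fst c \<Longrightarrow> snd c q \<in> crange c"
    and cinv_cont: "continuous_on (crange c) (cinv c)" and snd_cont: "continuous_on (fst c) (snd c)"
proof -
  have "is_chart c" using assms by (rule atlas_chart)
  then have o: "open (fst c)" "open (crange c)" and h: "homeomorphism (fst c) (crange c) (snd c) (cinv c)"
    by (auto simp: is_chart_def)
  show "open (fst c)" "open (crange c)" by (fact o)+
  show "q \<in> fst c \<Longrightarrow> cinv c (snd c q) = q" "x \<in> crange c \<Longrightarrow> snd c (cinv c x) = x"
    "continuous_on (crange c) (cinv c)" "continuous_on (fst c) (snd c)"
    using h by (auto simp: homeomorphism_def)
  show "snd c q \<in> crange c" if "q \<in> fst c" using that by (simp add: crange_def)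
  show "cinv c x \<in> fst c" if x: "x \<in> crange c"
  proof -
    obtain q where q: "q \<in> fst c" "x = snd c q" using x by (auto simp: crange_def)
    have "cinv c (snd c q) = q" using h q(1) by (simp add: homeomorphism_def)
    then show ?thesis using q by simp
  qed
qed

lemma chart_exists: "\<exists>c\<in>A. q \<in> fst c"
  using atlas_UN by blast

lemma overlap_open:
  assumes "c \<in> A" "open V"
  shows "open {x \<in> crange c. cinv c x \<in> V}"
proof -
  have "open (crange c \<inter> cinv c -` V)"
    by (rule continuous_open_preimage[OF cinv_cont[OF assms(1)] crange_open[OF assms(1)] assms(2)])
  moreover have "crange c \<inter> cinv c -` V = {x \<in> crange c. cinv c x \<in> V}" by auto
  ultimately show ?thesis by simp
qed

lemma transition_deriv:
  assumes c: "c \<in> A" "c' \<in> A" and q: "q \<in> fst c" "q \<in> fst c'"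
  shows "((snd c' \<circ> cinv c) has_derivative (\<lambda>v. jac c c' q *v v)) (at (snd c q))"
proof -
  have "compatible c c'" using c by (rule atlas_compatible)
  then have "smooth_on (snd c ` (fst c \<inter> fst c')) (snd c' \<circ> cinv c)" by (simp add: compatible_def)
  then have d: "((snd c' \<circ> cinv c) has_derivative frechet_derivative (snd c' \<circ> cinv c) (at (snd c q))) (at (snd c q))"
    using q by (intro smooth_on_has_derivative) auto
  have "jac c c' q *v v = frechet_derivative (snd c' \<circ> cinv c) (at (snd c q)) v" for v
    unfolding jac_def using linear_frechet_derivative[OF differentiableI[OF d]]
    by (simp add: matrix_works linear_matrix_vector_mul_eq)
  then show ?thesis using d by simp
qed

lemma jac_unique:
  assumes c: "c \<in> A" "c' \<in> A" and q: "q \<in> fst c" "q \<in> fst c'"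
    and d: "((snd c' \<circ> cinv c) has_derivative (\<lambda>v. M *v v)) (at (snd c q))"
  shows "jac c c' q = M"
  using has_derivative_unique[OF transition_deriv[OF c q] d] by (metis matrix_eq)

lemma jac_self: "c \<in> A \<Longrightarrow> q \<in> fst c \<Longrightarrow> jac c c q = mat 1"
proof (rule jac_unique)
  assume c: "c \<in> A" "q \<in> fst c"
  have "((\<lambda>x. x) has_derivative (\<lambda>v. mat 1 *v v)) (at (snd c q))" by simp
  then show "((snd c \<circ> cinv c) has_derivative (\<lambda>v. mat 1 *v v)) (at (snd c q))"
    by (rule has_derivative_transform_within_open[OF _ crange_open[OF c(1)] snd_in[OF c]])
       (use snd_cinv[OF c(1)] in simp)
qed

text \<open>The chain rule for coordinate changes.\<close>
lemma jac_comp: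
  assumes c: "c \<in> A" "c' \<in> A" "c'' \<in> A" and q: "q \<in> fst c" "q \<in> fst c'" "q \<in> fst c''"
  shows "jac c c'' q = jac c' c'' q ** jac c c' q"
proof (rule jac_unique[OF c(1,3) q(1,3)])
  have "(((snd c'' \<circ> cinv c') \<circ> (snd c' \<circ> cinv c)) has_derivative (\<lambda>v. jac c' c'' q *v v) \<circ> (\<lambda>v. jac c c' q *v v)) (at (snd c q))"
    by (rule diff_chain_at[OF transition_deriv[OF c(1,2) q(1,2)]])
       (use transition_deriv[OF c(2,3) q(2,3)] cinv_snd[OF c(1) q(1)] in simp)
  then have "(((snd c'' \<circ> cinv c') \<circ> (snd c' \<circ> cinv c)) has_derivative (\<lambda>v. (jac c' c'' q ** jac c c' q) *v v)) (at (snd c q))"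
    by (simp add: o_def matrix_vector_mul_assoc)
  then show "((snd c'' \<circ> cinv c) has_derivative (\<lambda>v. (jac c' c'' q ** jac c c' q) *v v)) (at (snd c q))"
    by (rule has_derivative_transform_within_open[OF _ overlap_open[OF c(1) chart_open[OF c(2)]]])
       (use q snd_in[OF c(1)] cinv_snd[OF c(1)] cinv_snd[OF c(2)] in auto)
qed

abbreviation "T0 \<equiv> punctured_cotangent_bundle A"

lemma cotangent_iff:
  "z \<in> cotangent_bundle A \<longleftrightarrow>
     (\<forall>c\<in>A. \<forall>c'\<in>A. fst z \<in> fst c \<inter> fst c' \<longrightarrow> snd z c = transpose (jac c c' (fst z)) *v snd z c') \<and>
     (\<forall>c. \<not> (c \<in> A \<and> fst z \<in> fst c) \<longrightarrow> snd z c = 0)"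
  by (cases z) (simp add: cotangent_bundle_def del: transpose_matrix_vector)

lemma cotangentD:
  assumes "z \<in> cotangent_bundle A" "c \<in> A" "c' \<in> A" "fst z \<in> fst c" "fst z \<in> fst c'"
  shows "snd z c = transpose (jac c c' (fst z)) *v snd z c'"
  using assms unfolding cotangent_iff by blast

lemma cotangent_zero: "z \<in> cotangent_bundle A \<Longrightarrow> \<not> (c \<in> A \<and> fst z \<in> fst c) \<Longrightarrow> snd z c = 0"
  unfolding cotangent_iff by blast

lemma T0_def: "z \<in> T0 \<longleftrightarrow> z \<in> cotangent_bundle A \<and> snd z \<noteq> (\<lambda>c. 0)"
  by (cases z) (simp add: punctured_cotangent_bundle_def)

lemma T0_cot: "z \<in> T0 \<Longrightarrow> z \<in> cotangent_bundle A"
  by (simp add: T0_def)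

lemma cov_point_simps:
  assumes c: "c \<in> A" and y: "fst y \<in> crange c"
  shows fst_cov_point: "fst (cov_point A c y) = cinv c (fst y)"
    and fst_cov_point_in: "fst (cov_point A c y) \<in> fst c"
    and cov_point_in: "cov_point A c y \<in> cotangent_bundle A"
    and coords_cov_point: "coords c (cov_point A c y) = y"
proof -
  let ?q = "cinv c (fst y)"
  have q: "?q \<in> fst c" using cinv_in[OF c y] .
  show 1: "fst (cov_point A c y) = ?q" by (simp add: cov_point_def Let_def)
  then show "fst (cov_point A c y) \<in> fst c" using q by simp
  have s: "snd (cov_point A c y) c' = (if c' \<in> A \<and> ?q \<in> fst c' then transpose (jac c' c ?q) *v snd y else 0)" for c'
    by (simp add: cov_point_def Let_def)
  show "cov_point A c y \<in> cotangent_bundle A"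
    unfolding cotangent_iff
  proof (intro conjI ballI impI allI)
    fix c1 c2 assume a: "c1 \<in> A" "c2 \<in> A" "fst (cov_point A c y) \<in> fst c1 \<inter> fst c2"
    then have "jac c1 c ?q = jac c2 c ?q ** jac c1 c2 ?q" using q c 1 by (intro jac_comp) auto
    then show "snd (cov_point A c y) c1 = transpose (jac c1 c2 (fst (cov_point A c y))) *v snd (cov_point A c y) c2"
      using a 1 by (simp add: s matrix_transpose_mul matrix_vector_mul_assoc del: transpose_matrix_vector)
  qed (auto simp: s 1)
  show "coords c (cov_point A c y) = y"
    using q c by (simp add: coords_def 1 s jac_self snd_cinv[OF c y] transpose_mat prod_eq_iff)
qed

lemma cov_point_coords:
  assumes z: "z \<in> cotangent_bundle A" and c: "c \<in> A" "fst z \<in> fst c"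
  shows "cov_point A c (coords c z) = z"
proof -
  have q: "cinv c (fst (coords c z)) = fst z" using cinv_snd[OF c] by (simp add: coords_def)
  have "snd (cov_point A c (coords c z)) c' = snd z c'" for c'
  proof (cases "c' \<in> A \<and> fst z \<in> fst c'")
    case True
    then show ?thesis using cotangentD[OF z, of c' c] c by (simp add: cov_point_def Let_def q) (simp add: coords_def)
  next
    case False
    then have "snd z c' = 0" using cotangent_zero[OF z] by simp
    then show ?thesis using False by (auto simp: cov_point_def Let_def q)
  qed
  then show ?thesis by (auto simp: prod_eq_iff cov_point_def Let_def q)
qed

lemma coords_inj:
  assumes "z \<in> cotangent_bundle A" "z' \<in> cotangent_bundle A" "c \<in> A" "fst z \<in> fst c" "fst z' \<in> fst c"
    "coords c z = coords c z'"
  shows "z = z'"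
  using cov_point_coords assms by metis

lemma T0_iff:
  assumes "z \<in> cotangent_bundle A" "c \<in> A" "fst z \<in> fst c"
  shows "z \<in> T0 \<longleftrightarrow> snd z c \<noteq> 0"
proof -
  have "snd z = (\<lambda>c. 0)" if "snd z c = 0"
  proof
    fix c'
    show "snd z c' = 0"
    proof (cases "c' \<in> A \<and> fst z \<in> fst c'")
      case True then show ?thesis using cotangentD[OF assms(1), of c' c] assms that by simp
    next
      case False then show ?thesis using cotangent_zero[OF assms(1)] by simp
    qed
  qed
  then show ?thesis using assms(1) by (auto simp: T0_def)
qed

lemma cov_point_T0:
  assumes "c \<in> A" "fst y \<in> crange c" "snd y \<noteq> 0" shows "cov_point A c y \<in> T0"
  using T0_iff[OF cov_point_in[OF assms(1,2)] assms(1) fst_cov_point_in[OF assms(1,2)]]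
    coords_cov_point[OF assms(1,2)] assms(3) by (simp add: coords_def prod_eq_iff)

lemma cscale_T0: "z \<in> T0 \<Longrightarrow> r \<noteq> 0 \<Longrightarrow> cscale r z \<in> T0"
proof -
  assume z: "z \<in> T0" and r: "r \<noteq> 0"
  have "cscale r z \<in> cotangent_bundle A"
    unfolding cotangent_iff
  proof (intro conjI ballI impI allI)
    fix c c' assume a: "c \<in> A" "c' \<in> A" "fst (cscale r z) \<in> fst c \<inter> fst c'"
    then have "snd z c = transpose (jac c c' (fst z)) *v snd z c'" using T0_cot[OF z] by (intro cotangentD) auto
    then show "snd (cscale r z) c = transpose (jac c c' (fst (cscale r z))) *v snd (cscale r z) c'"
      by (simp add: matrix_vector_mult_scaleR del: transpose_matrix_vector)
  qed (simp add: cotangent_zero[OF T0_cot[OF z]])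
  moreover have "snd (cscale r z) \<noteq> (\<lambda>c. 0)"
    using z r by (auto simp: T0_def fun_eq_iff)
  ultimately show ?thesis by (simp add: T0_def)
qed

lemma coords_T0: "z \<in> T0 \<Longrightarrow> c \<in> A \<Longrightarrow> fst z \<in> fst c \<Longrightarrow> fst (coords c z) \<in> crange c \<and> snd (coords c z) \<noteq> 0"
  using T0_iff[OF T0_cot] snd_in by (simp add: coords_def)

lemma cov_point_scale:
  assumes c: "c \<in> A" and y: "fst y \<in> crange c"
  shows "cov_point A c (fst y, r *\<^sub>R snd y) = cscale r (cov_point A c y)"
  by (auto simp: cov_point_def Let_def cscale_def matrix_vector_mult_scaleR)

lemma metric:
  assumes "c \<in> A"
  shows g_smooth: "smooth_on (crange c) (g c \<circ> cinv c)"
    and g_pos: "q \<in> fst c \<Longrightarrow> v \<noteq> 0 \<Longrightarrow> v \<bullet> (g c q *v v) > 0"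
    and g_trans: "c' \<in> A \<Longrightarrow> q \<in> fst c \<Longrightarrow> q \<in> fst c' \<Longrightarrow> g c q = transpose (jac c c' q) ** g c' q ** jac c c' q"
proof -
  note m = mfd[unfolded closed_riemannian_manifold_def riemannian_metric_def]
  have 1: "\<forall>c\<in>A. smooth_on (crange c) (g c \<circ> cinv c) \<and>
        (\<forall>q\<in>fst c. transpose (g c q) = g c q \<and> (\<forall>v. v \<noteq> 0 \<longrightarrow> v \<bullet> (g c q *v v) > 0))"
    using m by (elim conjE) assumption
  have 2: "\<forall>c\<in>A. \<forall>c'\<in>A. \<forall>q\<in>fst c \<inter> fst c'. g c q = transpose (jac c c' q) ** g c' q ** jac c c' q"
    using m by (elim conjE) assumption
  show "smooth_on (crange c) (g c \<circ> cinv c)" using 1 assms by simp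
  show "q \<in> fst c \<Longrightarrow> v \<noteq> 0 \<Longrightarrow> v \<bullet> (g c q *v v) > 0" using 1 assms by blast
  show "c' \<in> A \<Longrightarrow> q \<in> fst c \<Longrightarrow> q \<in> fst c' \<Longrightarrow> g c q = transpose (jac c c' q) ** g c' q ** jac c c' q"
    using 2 assms by blast
qed

lemma g_inv: "c \<in> A \<Longrightarrow> q \<in> fst c \<Longrightarrow> invertible (g c q) \<and> det (g c q) \<noteq> 0"
  using pos_def_det_nz[of "g c q"] g_pos by blast

lemma ham_radicand_pos:
  assumes c: "c \<in> A" and y: "fst y \<in> crange c" "snd y \<noteq> 0"
  shows "snd y \<bullet> (matrix_inv (g c (cinv c (fst y))) *v snd y) > 0"
proof -
  let ?a = "g c (cinv c (fst y))"
  have q: "cinv c (fst y) \<in> fst c" using cinv_in[OF c y(1)] .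
  define u where "u = matrix_inv ?a *v snd y"
  have au: "?a *v u = snd y" unfolding u_def using matrix_inv_mult(1) g_inv[OF c q] by blast
  then have "u \<noteq> 0" using y(2) by auto
  then have "u \<bullet> (?a *v u) > 0" using g_pos[OF c q] by blast
  then show ?thesis unfolding au unfolding u_def by (simp add: inner_commute)
qed

lemma ham_pos: "c \<in> A \<Longrightarrow> fst y \<in> crange c \<Longrightarrow> snd y \<noteq> 0 \<Longrightarrow> ham g c y > 0"
  using ham_radicand_pos by (simp add: ham_def)

lemma ham_scale: "ham g c (x, r *\<^sub>R \<xi>) = \<bar>r\<bar> * ham g c (x, \<xi>)"
proof -
  have "ham g c (x, r *\<^sub>R \<xi>) = sqrt (r\<^sup>2 * (\<xi> \<bullet> (matrix_inv (g c (cinv c x)) *v \<xi>)))"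
    by (simp add: ham_def matrix_vector_mult_scaleR power2_eq_square mult_ac)
  then show ?thesis by (simp add: ham_def real_sqrt_mult)
qed

text \<open>Covectors and the metric transform with the same Jacobian matrix, which cancels against
  that of the inverse metric.\<close>
lemma ham_chart:
  assumes z: "z \<in> cotangent_bundle A" and c: "c \<in> A" "c' \<in> A" "fst z \<in> fst c" "fst z \<in> fst c'"
  shows "ham g c (coords c z) = ham g c' (coords c' z)"
proof -
  let ?q = "fst z" and ?J = "jac c c' (fst z)"
  let ?a = "g c ?q" and ?b = "g c' ?q"
  define u where "u = matrix_inv ?a *v snd z c"
  have au: "?a *v u = snd z c" unfolding u_def using matrix_inv_mult(1) g_inv[OF c(1,3)] by blast
  have xi: "snd z c = transpose ?J *v snd z c'" by (rule cotangentD[OF z c])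
  have JJ: "jac c' c ?q ** ?J = mat 1" using jac_comp[OF c(1,2,1) c(3,4,3)] jac_self[OF c(1,3)] by simp
  have "transpose (jac c' c ?q ** ?J) = mat 1" using JJ by (simp add: transpose_mat)
  then have "transpose ?J ** transpose (jac c' c ?q) = mat 1" by (simp add: matrix_transpose_mul)
  then have JT: "transpose (jac c' c ?q) ** transpose ?J = mat 1" by (simp add: matrix_left_right_inverse)
  have "transpose ?J *v (?b *v (?J *v u)) = transpose ?J *v snd z c'"
    using au unfolding xi g_trans[OF c(1,2,3,4)] by (simp add: matrix_vector_mul_assoc matrix_mul_assoc)
  then have "transpose (jac c' c ?q) *v (transpose ?J *v (?b *v (?J *v u))) = transpose (jac c' c ?q) *v (transpose ?J *v snd z c')"
    by simp
  then have b: "?b *v (?J *v u) = snd z c'"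
    by (simp only: matrix_vector_mul_assoc JT matrix_mul_assoc matrix_mul_lid matrix_vector_mul_lid)
  then have Ju: "?J *v u = matrix_inv ?b *v snd z c'" using matrix_inv_mult(2) g_inv[OF c(2,4)] by metis
  have "snd z c' \<bullet> (matrix_inv ?b *v snd z c') = snd z c' \<bullet> (?J *v u)" by (simp add: Ju)
  also have "\<dots> = (transpose ?J *v snd z c') \<bullet> u" by (simp add: dot_lmul_matrix)
  also have "\<dots> = snd z c \<bullet> (matrix_inv ?a *v snd z c)" unfolding xi[symmetric] u_def by simp
  finally show ?thesis using cinv_snd[OF c(1,3)] cinv_snd[OF c(2,4)] by (simp add: ham_def coords_def)
qed

lemma cov_norm_eq:
  assumes z: "z \<in> cotangent_bundle A" and c: "c \<in> A" "fst z \<in> fst c"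
  shows "cov_norm A g z = ham g c (coords c z)"
proof -
  have "chart_at A (fst z) \<in> A \<and> fst z \<in> fst (chart_at A (fst z))"
    unfolding chart_at_def by (rule someI_ex) (use chart_exists[of "fst z"] in blast)
  then show ?thesis unfolding cov_norm_def Let_def using ham_chart[OF z _ c(1) _ c(2)] by blast
qed

lemma cov_norm_scale: "z \<in> cotangent_bundle A \<Longrightarrow> cov_norm A g (cscale r z) = \<bar>r\<bar> * cov_norm A g z"
  by (simp add: cov_norm_def Let_def coords_def ham_scale)

lemma cov_norm_pos: "z \<in> T0 \<Longrightarrow> cov_norm A g z > 0"
  using chart_exists[of "fst z"] cov_norm_eq[OF T0_cot] coords_T0 ham_pos by metis

lemma ham_differentiable:
  assumes c: "c \<in> A" and y: "fst y \<in> crange c" "snd y \<noteq> 0"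
  shows "ham g c differentiable (at y)"
proof -
  let ?a = "\<lambda>y. g c (cinv c (fst y))"
  have S: "open (crange c \<times> (UNIV :: (real^'n) set))" using crange_open[OF c] by (simp add: open_Times)
  have "(g c \<circ> cinv c) differentiable (at (fst y))"
    using smooth_on_has_derivative[OF g_smooth[OF c] y(1)] by (rule differentiableI)
  then have "((g c \<circ> cinv c) \<circ> fst) differentiable (at y)"
    by (intro differentiable_chain_at) (auto intro: bounded_linear_imp_differentiable bounded_linear_fst)
  then have a: "(\<lambda>y. ?a y $ i $ j) differentiable (at y)" for i j
    by (intro differentiable_vec_nth) (simp add: o_def)
  have s: "snd differentiable (at y)" by (intro bounded_linear_imp_differentiable bounded_linear_snd)
  have "(\<lambda>y. matrix_inv (?a y) *v snd y) differentiable (at y)"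
    by (rule matrix_inv_differentiable[OF a differentiable_vec_nth[OF s] S]) (use y g_inv[OF c] cinv_in[OF c] in \<open>auto simp: mem_Times_iff\<close>)
  then have "(\<lambda>y. snd y \<bullet> (matrix_inv (?a y) *v snd y)) differentiable (at y)"
    using s by (rule differentiable_inner[rotated])
  then obtain f' where f': "((\<lambda>y. snd y \<bullet> (matrix_inv (?a y) *v snd y)) has_derivative f') (at y)"
    unfolding differentiable_def by blast
  have "((\<lambda>y. sqrt (snd y \<bullet> (matrix_inv (?a y) *v snd y))) has_derivative
     (\<lambda>h. f' h * (inverse (sqrt (snd y \<bullet> (matrix_inv (?a y) *v snd y))) / 2))) (at y)"
    using has_derivative_compose[OF f' DERIV_real_sqrt[OF ham_radicand_pos[OF c y], unfolded has_field_derivative_def]]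
    by (simp add: mult.commute)
  then show ?thesis unfolding ham_def[abs_def] by (rule differentiableI)
qed

lemma ham_grad:
  assumes c: "c \<in> A" and y: "fst y \<in> crange c" "snd y \<noteq> 0"
    and d: "(ham g c has_derivative f') (at y)"
  shows "grad (\<lambda>x. ham g c (x, snd y)) (fst y) \<bullet> v = f' (v, 0)"
    and "grad (\<lambda>\<xi>. ham g c (fst y, \<xi>)) (snd y) \<bullet> v = f' (0, v)"
proof -
  have lin: "linear f'" using d has_derivative_linear by blast
  have key: "grad F u \<bullet> v = f'' v" if F: "(F has_derivative f'') (at u)" for F :: "real^'n \<Rightarrow> real" and f'' u v
  proof -
    have l: "linear f''" using F has_derivative_linear by blast
    have fd: "frechet_derivative F (at u) = f''" using frechet_derivative_at[OF F] by simp
    have "f'' v = f'' (\<Sum>i\<in>UNIV. v $ i *\<^sub>R axis i 1)"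
      by (metis basis_expansion scalar_mult_eq_scaleR)
    also have "\<dots> = (\<Sum>i\<in>UNIV. v $ i * f'' (axis i 1))" by (simp add: linear_sum[OF l] linear_scale[OF l])
    also have "\<dots> = grad F u \<bullet> v" by (simp add: grad_def partial_def inner_vec_def fd mult.commute)
    finally show ?thesis by simp
  qed
  have d': "(ham g c has_derivative f') (at (fst y, snd y))" using d by simp
  have 1: "((\<lambda>x. (x, snd y)) has_derivative (\<lambda>v. (v, 0))) (at (fst y))" by (auto intro!: derivative_eq_intros)
  have 2: "((\<lambda>\<xi>. (fst y, \<xi>)) has_derivative (\<lambda>v. (0, v))) (at (snd y))" by (auto intro!: derivative_eq_intros)
  show "grad (\<lambda>x. ham g c (x, snd y)) (fst y) \<bullet> v = f' (v, 0)"
    by (rule key) (rule has_derivative_compose[OF 1 d'])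
  show "grad (\<lambda>\<xi>. ham g c (fst y, \<xi>)) (snd y) \<bullet> v = f' (0, v)"
    by (rule key) (rule has_derivative_compose[OF 2 d'])
qed

text \<open>Euler's identity for the positively homogeneous function \<open>p\<close>: the
  \<open>x\<close>-component of the Hamilton field pairs with \<open>\<xi>\<close> to
  \<open>p\<close>.\<close>
lemma ham_euler:
  assumes c: "c \<in> A" and y: "fst y \<in> crange c" "snd y \<noteq> 0"
  shows "grad (\<lambda>\<xi>. ham g c (fst y, \<xi>)) (snd y) \<bullet> snd y = ham g c y"
proof -
  obtain f' where f': "(ham g c has_derivative f') (at y)" using ham_differentiable[OF assms] unfolding differentiable_def by blast
  have 1: "((\<lambda>r. (fst y, r *\<^sub>R snd y)) has_derivative (\<lambda>h. (0, h *\<^sub>R snd y))) (at 1)"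
    by (auto intro!: derivative_eq_intros)
  have "((\<lambda>r. ham g c (fst y, r *\<^sub>R snd y)) has_derivative (\<lambda>h. f' (0, h *\<^sub>R snd y))) (at 1)"
    by (rule has_derivative_compose[OF 1]) (use f' in simp)
  moreover have "((\<lambda>r. ham g c (fst y, r *\<^sub>R snd y)) has_derivative (\<lambda>h. h * ham g c y)) (at 1)"
  proof (rule has_derivative_transform_within_open)
    show "((\<lambda>r. r * ham g c y) has_derivative (\<lambda>h. h * ham g c y)) (at 1)" by (auto intro!: derivative_eq_intros)
    show "open {(0::real)<..}" "(1::real) \<in> {0<..}" by auto
  qed (auto simp: ham_scale)
  ultimately have "(\<lambda>h. f' (0, h *\<^sub>R snd y)) = (\<lambda>h. h * ham g c y)" by (rule has_derivative_unique)
  then have "f' (0, snd y) = ham g c y" by (metis mult_1 scaleR_one)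
  then show ?thesis using ham_grad(2)[OF assms f', of "snd y"] by simp
qed

text \<open>The position component of the field has degree 0 and the momentum component degree 1, so
  dilation maps integral curves to integral curves.\<close>
lemma ham_field_scale:
  assumes c: "c \<in> A" and y: "fst y \<in> crange c" "snd y \<noteq> 0" and r: "r > 0"
  shows "ham_field g c (fst y, r *\<^sub>R snd y) = (fst (ham_field g c y), r *\<^sub>R snd (ham_field g c y))"
proof -
  let ?y = "(fst y, r *\<^sub>R snd y)"
  have y': "fst ?y \<in> crange c" "snd ?y \<noteq> 0" using y r by auto
  obtain f where f: "(ham g c has_derivative f) (at y)" using ham_differentiable[OF c y] unfolding differentiable_def by blast
  obtain f' where f': "(ham g c has_derivative f') (at ?y)" using ham_differentiable[OF c y'] unfolding differentiable_def by blast
  have 1: "((\<lambda>y. (fst y, r *\<^sub>R snd y)) has_derivative (\<lambda>h. (fst h, r *\<^sub>R snd h))) (at y)"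
    by (auto intro!: derivative_eq_intros)
  have "((\<lambda>y. ham g c (fst y, r *\<^sub>R snd y)) has_derivative (\<lambda>h. f' (fst h, r *\<^sub>R snd h))) (at y)"
    by (rule has_derivative_compose[OF 1 f'])
  moreover have "((\<lambda>y. ham g c (fst y, r *\<^sub>R snd y)) has_derivative (\<lambda>h. r * f h)) (at y)"
    using has_derivative_mult_right[OF f, of r] r by (simp add: ham_scale)
  ultimately have eq: "(\<lambda>h. f' (fst h, r *\<^sub>R snd h)) = (\<lambda>h. r * f h)" by (rule has_derivative_unique)
  have lin: "linear f'" using f' has_derivative_linear by blast
  have x: "f' (v, 0) = r * f (v, 0)" for v using fun_cong[OF eq, of "(v, 0)"] by simp
  have "r * f' (0, v) = r * f (0, v)" for v
  proof -
    have "f' (0, r *\<^sub>R v) = r * f' (0, v)" using linear_scale[OF lin, of r "(0, v)"] by simp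
    moreover have "f' (0, r *\<^sub>R v) = r * f (0, v)" using fun_cong[OF eq, of "(0, v)"] by simp
    ultimately show ?thesis by (simp only:)
  qed
  then have xi: "f' (0, v) = f (0, v)" for v using r by (metis less_irrefl mult_left_cancel)
  have "grad (\<lambda>x. ham g c (x, snd ?y)) (fst ?y) \<bullet> v = (r *\<^sub>R grad (\<lambda>x. ham g c (x, snd y)) (fst y)) \<bullet> v" for v
    unfolding ham_grad(1)[OF c y' f'] using ham_grad(1)[OF c y f] x by simp
  then have A: "grad (\<lambda>x. ham g c (x, snd ?y)) (fst ?y) = r *\<^sub>R grad (\<lambda>x. ham g c (x, snd y)) (fst y)"
    by (metis vector_eq_rdot)
  have "grad (\<lambda>\<xi>. ham g c (fst ?y, \<xi>)) (snd ?y) \<bullet> v = grad (\<lambda>\<xi>. ham g c (fst y, \<xi>)) (snd y) \<bullet> v" for v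
    unfolding ham_grad(2)[OF c y' f'] using ham_grad(2)[OF c y f] xi by simp
  then have B: "grad (\<lambda>\<xi>. ham g c (fst ?y, \<xi>)) (snd ?y) = grad (\<lambda>\<xi>. ham g c (fst y, \<xi>)) (snd y)"
    by (metis vector_eq_rdot)
  show ?thesis using A B by (simp add: ham_field_def)
qed

end

section \<open>The Hamilton flow\<close>
lemma locally_constant_real:
  fixes f :: "real \<Rightarrow> 'a"
  assumes "\<And>s. \<exists>e>0. \<forall>u. \<bar>u - s\<bar> < e \<longrightarrow> f u = f s"
  shows "f s = f t"
proof (rule connected_local_const[where A=UNIV])
  show "\<forall>a\<in>UNIV. \<forall>\<^sub>F b in at a within UNIV. f a = f b"
  proof
    fix a :: real
    obtain e where "e > 0" "\<And>u. \<bar>u - a\<bar> < e \<Longrightarrow> f u = f a" using assms[of a] by blast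
    then have H: "e > 0" "\<bar>u - a\<bar> < e \<Longrightarrow> f u = f a" for u by iprover+
    have "\<forall>x. x \<noteq> a \<and> dist x a < e \<longrightarrow> f a = f x"
    proof (intro allI impI)
      fix x assume "x \<noteq> a \<and> dist x a < e"
      then have "\<bar>x - a\<bar> < e" by (simp add: dist_real_def)
      from H(2)[OF this] show "f a = f x" by (rule sym)
    qed
    then show "\<forall>\<^sub>F b in at a within UNIV. f a = f b"
      unfolding eventually_at using H(1) by blast
  qed
qed auto

lemma zero_derivative_const:
  fixes f :: "real \<Rightarrow> 'a::real_inner"
  assumes e: "e > 0" and d: "\<And>u. \<bar>u - s\<bar> < e \<Longrightarrow> (f has_vector_derivative 0) (at u)" and u: "\<bar>u - s\<bar> < e"
  shows "f u = f s"
proof -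
  have d0: "(f has_derivative (\<lambda>h. 0)) (at v within ball s e)" if "v \<in> ball s e" for v
    using d[of v] that has_derivative_at_withinI[of f "\<lambda>h. 0" v]
    by (simp add: has_vector_derivative_def dist_real_def abs_minus_commute)
  show ?thesis
    by (rule has_derivative_zero_unique[OF convex_ball d0]) (use e u in \<open>auto simp: dist_real_def\<close>)
qed

locale conormal_geometry = closed_manifold A g
  for A :: "('m::t2_space, 'n::finite) chart set" and g :: "('m, 'n) metric" +
  fixes D :: "'n set" and H :: "'m set" and G :: "real \<Rightarrow> ('m, 'n) cov \<Rightarrow> ('m, 'n) cov"
  assumes card_D: "card D < CARD('n)"
    and submfd: "compact_submanifold A D H"
    and flow: "hamilton_flow A g G"
begin

lemma G_T0: "z \<in> T0 \<Longrightarrow> G t z \<in> T0" and G_0: "z \<in> T0 \<Longrightarrow> G 0 z = z"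
  and G_add: "z \<in> T0 \<Longrightarrow> G (s + t) z = G s (G t z)"
  and G_deriv: "z \<in> T0 \<Longrightarrow> c \<in> A \<Longrightarrow> fst (G t z) \<in> fst c \<Longrightarrow>
    ((\<lambda>s. coords c (G s z)) has_vector_derivative ham_field g c (coords c (G t z))) (at t)"
  using flow unfolding hamilton_flow_def by (blast, blast, blast, blast)

lemma G_minus: "z \<in> T0 \<Longrightarrow> G (- t) (G t z) = z" "z \<in> T0 \<Longrightarrow> G t (G (- t) z) = z"
  using G_add[of z "- t" t] G_add[of z t "- t"] G_0[of z] by auto

text \<open>The flow in charts, as a function of time and initial coordinates, and its domain
  \<open>W\<close>.\<close>
definition Psi :: "('m, 'n) chart \<Rightarrow> ('m, 'n) chart \<Rightarrow> real \<times> (real^'n) \<times> (real^'n) \<Rightarrow> (real^'n) \<times> (real^'n)" where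
  "Psi c c' = (\<lambda>(t, y). coords c' (G t (cov_point A c y)))"

definition W :: "('m, 'n) chart \<Rightarrow> ('m, 'n) chart \<Rightarrow> (real \<times> (real^'n) \<times> (real^'n)) set" where
  "W c c' = {(t, y). fst y \<in> crange c \<and> snd y \<noteq> 0 \<and> fst (G t (cov_point A c y)) \<in> fst c'}"

lemma W_smooth:
  assumes "c \<in> A" "c' \<in> A" shows W_open: "open (W c c')" and Psi_smooth: "smooth_on (W c c') (Psi c c')"
  using flow assms unfolding hamilton_flow_def Let_def W_def Psi_def by blast+

lemma mem_W: "(t, y) \<in> W c c' \<longleftrightarrow> fst y \<in> crange c \<and> snd y \<noteq> 0 \<and> fst (G t (cov_point A c y)) \<in> fst c'"
  by (simp add: W_def)

lemma coords_mem_W: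
  assumes z: "z \<in> T0" and c: "c \<in> A" "fst z \<in> fst c"
  shows "(t, coords c z) \<in> W c c' \<longleftrightarrow> fst (G t z) \<in> fst c'"
    and "Psi c c' (t, coords c z) = coords c' (G t z)"
  using coords_T0[OF z c] cov_point_coords[OF T0_cot[OF z] c] by (auto simp: mem_W Psi_def)

definition dPsi :: "('m, 'n) chart \<Rightarrow> ('m, 'n) chart \<Rightarrow> real \<times> (real^'n) \<times> (real^'n) \<Rightarrow> real \<times> (real^'n) \<times> (real^'n) \<Rightarrow> (real^'n) \<times> (real^'n)" where
  "dPsi c c' x = frechet_derivative (Psi c c') (at x)"

lemma Psi_deriv:
  assumes "c \<in> A" "c' \<in> A" "x \<in> W c c'"
  shows "(Psi c c' has_derivative dPsi c c' x) (at x)"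
  unfolding dPsi_def by (rule smooth_on_has_derivative[OF Psi_smooth[OF assms(1,2)] assms(3)])

lemma dPsi_cont: "c \<in> A \<Longrightarrow> c' \<in> A \<Longrightarrow> continuous_on (W c c') (\<lambda>x. dPsi c c' x v)"
  unfolding dPsi_def by (rule smooth_on_continuous_derivative[OF Psi_smooth])

lemma Psi_cont: "c \<in> A \<Longrightarrow> c' \<in> A \<Longrightarrow> continuous_on (W c c') (Psi c c')"
  by (rule smooth_on_continuous[OF Psi_smooth])

lemma dPsi_linear:
  assumes "c \<in> A" "c' \<in> A" "x \<in> W c c'" shows "linear (dPsi c c' x)"
  using Psi_deriv[OF assms] has_derivative_linear by blast

lemma dPsi_time:
  assumes c: "c \<in> A" "c' \<in> A" and x: "(t, y) \<in> W c c'"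
  shows "dPsi c c' (t, y) (1, 0) = ham_field g c' (Psi c c' (t, y))"
proof -
  let ?z = "cov_point A c y"
  have z: "?z \<in> T0" using x by (auto simp: mem_W intro!: cov_point_T0 c)
  have "((\<lambda>s. coords c' (G s ?z)) has_vector_derivative ham_field g c' (coords c' (G t ?z))) (at t)"
    by (rule G_deriv[OF z c(2)]) (use x in \<open>simp add: mem_W\<close>)
  moreover have "((\<lambda>s. coords c' (G s ?z)) has_vector_derivative dPsi c c' (t, y) (1, 0)) (at t)"
  proof -
    have 1: "((\<lambda>s. (s, y)) has_derivative (\<lambda>h. (h, 0))) (at t)" by (auto intro!: derivative_eq_intros)
    have "((\<lambda>s. Psi c c' (s, y)) has_derivative (\<lambda>h. dPsi c c' (t, y) (h, 0))) (at t)"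
      by (rule has_derivative_compose[OF 1 Psi_deriv[OF c x]])
    moreover have "(\<lambda>h. dPsi c c' (t, y) (h, 0)) = (\<lambda>h. h *\<^sub>R dPsi c c' (t, y) (1, 0))"
    proof
      fix h show "dPsi c c' (t, y) (h, 0) = h *\<^sub>R dPsi c c' (t, y) (1, 0)"
        using linear_scale[OF dPsi_linear[OF c x], of h "(1, 0)"] by simp
    qed
    ultimately show ?thesis unfolding has_vector_derivative_def Psi_def case_prod_conv by (simp only:)
  qed
  ultimately show ?thesis using vector_derivative_unique_at by (metis Psi_def case_prod_conv)
qed

lemma G_in_chart_open:
  assumes z: "z \<in> T0" and c: "c \<in> A" shows "open {s. fst (G s z) \<in> fst c}"
proof -
  obtain c0 where c0: "c0 \<in> A" "fst z \<in> fst c0" using chart_exists by blast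
  have "open ((\<lambda>s. (s, coords c0 z)) -` W c0 c)"
    by (intro open_vimage W_open c c0 continuous_intros)
  moreover have "(\<lambda>s. (s, coords c0 z)) -` W c0 c = {s. fst (G s z) \<in> fst c}"
    by (simp only: vimage_def coords_mem_W(1)[OF z c0])
  ultimately show ?thesis by simp
qed

text \<open>The derivative of \<open>p\<close> along its own Hamilton field is a Poisson bracket
  \<open>{p, p} = 0\<close>.\<close>
lemma cov_norm_G:
  assumes z: "z \<in> T0" shows "cov_norm A g (G t z) = cov_norm A g z"
proof -
  have "((\<lambda>s. cov_norm A g (G s z)) has_real_derivative 0) (at t)" for t
  proof -
    obtain c where c: "c \<in> A" "fst (G t z) \<in> fst c" using chart_exists by blast
    let ?y = "coords c (G t z)"
    have y: "fst ?y \<in> crange c" "snd ?y \<noteq> 0" using coords_T0[OF G_T0[OF z] c] by auto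
    obtain f' where f': "(ham g c has_derivative f') (at ?y)" using ham_differentiable[OF c(1) y] unfolding differentiable_def by blast
    have lin: "linear f'" using f' has_derivative_linear by blast
    have "f' (ham_field g c ?y) = 0"
    proof -
      let ?a = "grad (\<lambda>\<xi>. ham g c (fst ?y, \<xi>)) (snd ?y)" and ?b = "grad (\<lambda>x. ham g c (x, snd ?y)) (fst ?y)"
      have "f' (ham_field g c ?y) = f' ((?a, 0) + (0, - ?b))" by (simp add: ham_field_def)
      also have "\<dots> = f' (?a, 0) + f' (0, - ?b)" by (rule linear_add[OF lin])
      also have "\<dots> = ?b \<bullet> ?a + ?a \<bullet> (- ?b)"
        using ham_grad(1)[OF c(1) y f', of ?a] ham_grad(2)[OF c(1) y f', of "- ?b"] by (simp only:)
      finally show ?thesis by (simp add: inner_commute)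
    qed
    then have "((\<lambda>s. ham g c (coords c (G s z))) has_derivative (\<lambda>h. 0)) (at t)"
      using has_derivative_compose[OF G_deriv[OF z c, unfolded has_vector_derivative_def] f'] linear_scale[OF lin] by simp
    then have "((\<lambda>s. cov_norm A g (G s z)) has_derivative (\<lambda>h. 0)) (at t)"
      by (rule has_derivative_transform_within_open[OF _ G_in_chart_open[OF z c(1)]])
         (use c cov_norm_eq[OF T0_cot[OF G_T0[OF z]] c(1)] in auto)
    then show ?thesis unfolding has_field_derivative_def by (rule has_derivative_eq_rhs) auto
  qed
  then have "cov_norm A g (G t z) = cov_norm A g (G 0 z)" by (intro DERIV_isconst_all) blast
  then show ?thesis using G_0[OF z] by simp
qed

text \<open>The dilation of an integral curve is an integral curve. Uniqueness is replaced by the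
  group property: if \<open>\<gamma>\<close> is an integral curve, then \<open>G (- s) (\<gamma>
  s)\<close> is locally constant, because its derivative is the difference of the push-forward of
  the Hamilton field by \<open>G (- s)\<close> and the Hamilton field at the image, which
  agree.\<close>
lemma G_cscale:
  assumes z: "z \<in> T0" and r: "r > 0"
  shows "G t (cscale r z) = cscale r (G t z)"
proof -
  let ?\<gamma> = "\<lambda>s. cscale r (G s z)"
  have gT: "?\<gamma> s \<in> T0" for s by (rule cscale_T0[OF G_T0[OF z]]) (use r in simp)
  define F where "F s = G (- s) (?\<gamma> s)" for s
  have FT: "F s \<in> T0" for s unfolding F_def by (rule G_T0[OF gT])
  have "\<exists>e>0. \<forall>u. \<bar>u - s\<bar> < e \<longrightarrow> F u = F s" for s
  proof -
    obtain c where c: "c \<in> A" "fst (G s z) \<in> fst c" using chart_exists by blast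
    obtain c' where c': "c' \<in> A" "fst (F s) \<in> fst c'" using chart_exists by blast
    have dgamma: "((\<lambda>v. coords c (?\<gamma> v)) has_vector_derivative ham_field g c (coords c (?\<gamma> u))) (at u)"
      if u: "fst (G u z) \<in> fst c" for u
    proof -
      let ?y = "coords c (G u z)"
      have y: "fst ?y \<in> crange c" "snd ?y \<noteq> 0" using coords_T0[OF G_T0[OF z] c(1) u] by auto
      have "((\<lambda>v. (fst (coords c (G v z)), r *\<^sub>R snd (coords c (G v z)))) has_vector_derivative
          (fst (ham_field g c ?y), r *\<^sub>R snd (ham_field g c ?y))) (at u)"
        using G_deriv[OF z c(1) u] unfolding has_vector_derivative_def
        by (auto intro!: derivative_eq_intros)
      then show ?thesis using ham_field_scale[OF c(1) y r] by simp
    qed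
    have opc: "open {u. fst (G u z) \<in> fst c}" by (rule G_in_chart_open[OF z c(1)])
    have cont: "continuous_on {u. fst (G u z) \<in> fst c} (\<lambda>u. (- u, coords c (?\<gamma> u)))"
      by (intro continuous_intros continuous_at_imp_continuous_on ballI)
         (rule has_vector_derivative_continuous[OF dgamma], simp)
    have "open ({u. fst (G u z) \<in> fst c} \<inter> (\<lambda>u. (- u, coords c (?\<gamma> u))) -` W c c')"
      by (rule continuous_open_preimage[OF cont opc W_open[OF c(1) c'(1)]])
    moreover have "s \<in> {u. fst (G u z) \<in> fst c} \<inter> (\<lambda>u. (- u, coords c (?\<gamma> u))) -` W c c'"
      using c c' coords_mem_W(1)[OF gT[of s] c(1), where t="- s" and c'=c'] by (simp add: F_def)
    ultimately obtain e where e: "e > 0" "ball s e \<subseteq> {u. fst (G u z) \<in> fst c} \<inter> (\<lambda>u. (- u, coords c (?\<gamma> u))) -` W c c'"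
      using open_contains_ball by blast
    have near: "fst (G u z) \<in> fst c \<and> (- u, coords c (?\<gamma> u)) \<in> W c c'" if "\<bar>u - s\<bar> < e" for u
      using e(2) that by (auto simp: dist_real_def abs_minus_commute)
    have Fc: "coords c' (F u) = Psi c c' (- u, coords c (?\<gamma> u))" and Fin: "fst (F u) \<in> fst c'" if "\<bar>u - s\<bar> < e" for u
      using coords_mem_W[OF gT[of u] c(1), where t="- u" and c'=c'] near[OF that] by (simp_all add: F_def)
    have dz: "((\<lambda>u. Psi c c' (- u, coords c (?\<gamma> u))) has_vector_derivative 0) (at u)" if u: "\<bar>u - s\<bar> < e" for u
    proof -
      let ?y = "coords c (?\<gamma> u)" and ?X = "ham_field g c (coords c (?\<gamma> u))"
      have w: "(- u, ?y) \<in> W c c'" and uc: "fst (G u z) \<in> fst c" using near[OF u] by auto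
      have lin: "linear (dPsi c c' (- u, ?y))" by (rule dPsi_linear[OF c(1) c'(1) w])
      have 1: "((\<lambda>v. (- v, coords c (?\<gamma> v))) has_derivative (\<lambda>h. (- h, h *\<^sub>R ?X))) (at u)"
        by (rule has_derivative_Pair[OF has_derivative_minus[OF has_derivative_ident] dgamma[OF uc, unfolded has_vector_derivative_def]])
      have "((\<lambda>v. Psi c c' (- v, coords c (?\<gamma> v))) has_derivative (\<lambda>h. dPsi c c' (- u, ?y) (- h, h *\<^sub>R ?X))) (at u)"
        by (rule has_derivative_compose[OF 1 Psi_deriv[OF c(1) c'(1) w]])
      moreover have "dPsi c c' (- u, ?y) (- h, h *\<^sub>R ?X) = 0" for h
      proof -
        \<comment> \<open>the flow preserves its field: differentiate \<open>G (- u) (G v y) = G v (G (- u) y)\<close> at \<open>v = 0\<close>\<close>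
        let ?w = "?\<gamma> u"
        have slice_coords0: "fst ?w \<in> fst c" using uc by simp
        have g0: "((\<lambda>v. coords c (G v ?w)) has_vector_derivative ham_field g c (coords c (G 0 ?w))) (at 0)"
          by (rule G_deriv[OF gT c(1)]) (use G_0[OF gT] slice_coords0 in simp)
        have 2: "((\<lambda>v. (- u, coords c (G v ?w))) has_derivative (\<lambda>h. (0, h *\<^sub>R ?X))) (at 0)"
          using g0 G_0[OF gT[of u]] unfolding has_vector_derivative_def by (auto intro!: derivative_eq_intros)
        have "((\<lambda>v. Psi c c' (- u, coords c (G v ?w))) has_derivative (\<lambda>h. dPsi c c' (- u, ?y) (0, h *\<^sub>R ?X))) (at 0)"
          using has_derivative_compose[OF 2, of "Psi c c'" "dPsi c c' (- u, ?y)"] Psi_deriv[OF c(1) c'(1) w] G_0[OF gT[of u]] by simp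
        then have A1: "((\<lambda>v. Psi c c' (- u, coords c (G v ?w))) has_vector_derivative dPsi c c' (- u, ?y) (0, ?X)) (at 0)"
          unfolding has_vector_derivative_def linear_scale[OF lin, symmetric] by simp
        have "((\<lambda>v. coords c' (G v (F u))) has_vector_derivative ham_field g c' (coords c' (G 0 (F u)))) (at 0)"
          by (rule G_deriv[OF FT c'(1)]) (use G_0[OF FT] Fin[OF u] in simp)
        then have "((\<lambda>v. Psi c c' (- u, coords c (G v ?w))) has_vector_derivative ham_field g c' (coords c' (G 0 (F u)))) (at 0)"
        proof (rule has_vector_derivative_transform_within_open[OF _ G_in_chart_open[OF gT[of u] c(1)]])
          show "0 \<in> {s. fst (G s ?w) \<in> fst c}" using G_0[OF gT[of u]] slice_coords0 by simp
          fix v assume "v \<in> {s. fst (G s ?w) \<in> fst c}"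
          then have "Psi c c' (- u, coords c (G v ?w)) = coords c' (G (- u) (G v ?w))"
            using coords_mem_W(2)[OF G_T0[OF gT] c(1)] by simp
          also have "G (- u) (G v ?w) = G v (G (- u) ?w)"
            using G_add[OF gT[of u], of "- u" v] G_add[OF gT[of u], of v "- u"] by (simp add: add.commute)
          finally show "coords c' (G v (F u)) = Psi c c' (- u, coords c (G v ?w))" by (simp add: F_def)
        qed
        then have "dPsi c c' (- u, ?y) (0, ?X) = ham_field g c' (coords c' (F u))"
          using A1 vector_derivative_unique_at G_0[OF FT] by metis
        moreover have "dPsi c c' (- u, ?y) (1, 0) = ham_field g c' (coords c' (F u))"
          using dPsi_time[OF c(1) c'(1) w] Fc[OF u] by simp
        moreover have "(- h, h *\<^sub>R ?X) = (- h) *\<^sub>R (1, 0) + h *\<^sub>R (0, ?X)" by simp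
        ultimately show ?thesis using linear_add[OF lin] linear_scale[OF lin]
          by (metis (no_types, lifting) add.left_inverse scaleR_minus_left)
      qed
      ultimately show ?thesis unfolding has_vector_derivative_def by simp
    qed
    have ss: "\<bar>s - s\<bar> < e" using e(1) by simp
    have "F u = F s" if u: "\<bar>u - s\<bar> < e" for u
    proof (rule coords_inj[OF T0_cot[OF FT] T0_cot[OF FT] c'(1) Fin[OF u] Fin[OF ss]])
      show "coords c' (F u) = coords c' (F s)"
        unfolding Fc[OF u] Fc[OF ss] by (rule zero_derivative_const[OF e(1) dz u])
    qed
    then show ?thesis using e(1) by blast
  qed
  then have "F t = F 0" by (rule locally_constant_real)
  then have "G (- t) (?\<gamma> t) = cscale r z" using G_0[OF z] G_0 cscale_T0[OF z] r by (simp add: F_def)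
  then show ?thesis using G_minus(2)[OF gT[of t]] by metis
qed

end

section \<open>The conormal bundle and the gap between returns\<close>
lemma continuous_on_det [continuous_intros]:
  fixes M :: "'a::topological_space \<Rightarrow> real^'n^'n"
  assumes "\<And>i j. continuous_on S (\<lambda>x. M x $ i $ j)"
  shows "continuous_on S (\<lambda>x. det (M x))"
  unfolding det_def by (intro continuous_intros assms)

text \<open>The determinant does not vanish on the segment from the identity to the matrix, since
  all matrices on it are positive definite.\<close>
lemma pos_def_det_pos:
  fixes a :: "real^'n^'n"
  assumes a: "\<And>v. v \<noteq> 0 \<Longrightarrow> v \<bullet> (a *v v) > 0"
  shows "det a > 0"
proof (rule ccontr)
  assume "\<not> det a > 0"
  let ?m = "\<lambda>s. (1 - s) *\<^sub>R mat 1 + s *\<^sub>R a"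
  have cont: "continuous_on {0..1} (\<lambda>s. det (?m s))" by (intro continuous_intros)
  have "\<exists>s\<ge>0. s \<le> 1 \<and> det (?m s) = 0"
    by (rule IVT2') (use cont \<open>\<not> det a > 0\<close> in auto)
  then obtain s where s: "0 \<le> s" "s \<le> 1" "det (?m s) = 0" by blast
  have "v \<bullet> (?m s *v v) > 0" if v: "v \<noteq> 0" for v
  proof -
    have e: "v \<bullet> (?m s *v v) = (1 - s) * (v \<bullet> v) + s * (v \<bullet> (a *v v))"
      by (simp add: matrix_vector_mult_add_rdistrib scaleR_matrix_vector_assoc[symmetric] inner_add_right)
    show ?thesis
    proof (cases "s = 0")
      case False
      then have "s * (v \<bullet> (a *v v)) > 0" using s a[OF v] by simp
      moreover have "(1 - s) * (v \<bullet> v) \<ge> 0" using s by simp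
      ultimately show ?thesis unfolding e by linarith
    qed (use e v in simp)
  qed
  then have "det (?m s) \<noteq> 0" by (rule pos_def_det_nz(2))
  with s show False by simp
qed

lemma bounded_linear_split_cn: "bounded_linear (split_cn D)"
proof -
  have "split_cn D = (\<lambda>w. (proj D w, proj (- D) w))" by (simp add: split_cn_def fun_eq_iff)
  then show ?thesis using bounded_linear_Pair[OF bounded_linear_proj[of D] bounded_linear_proj[of "- D"]] by simp
qed

lemma bounded_linear_merge_cn: "bounded_linear (merge_cn D)"
proof -
  have "merge_cn D = (\<lambda>y. proj D (fst y) + proj (- D) (snd y))" by (simp add: merge_cn_def fun_eq_iff)
  then show ?thesis
    using bounded_linear_add[OF bounded_linear_compose[OF bounded_linear_proj[of D] bounded_linear_fst]
       bounded_linear_compose[OF bounded_linear_proj[of "- D"] bounded_linear_snd]] by simp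
qed

lemma merge_split [simp]: "merge_cn D (split_cn D w) = w"
  by (simp add: vec_eq_iff merge_cn_def split_cn_def)

lemma range_split_iff:
  "y \<in> range (split_cn D) \<longleftrightarrow> proj (- D) (fst y) = 0 \<and> proj D (snd y) = 0"
proof
  assume "proj (- D) (fst y) = 0 \<and> proj D (snd y) = 0"
  then have "y = split_cn D (merge_cn D y)"
    by (simp add: prod_eq_iff vec_eq_iff merge_cn_def split_cn_def) metis
  then show "y \<in> range (split_cn D)" by blast
qed (auto simp: split_cn_def vec_eq_iff)

lemma split_merge: "y \<in> range (split_cn D) \<Longrightarrow> split_cn D (merge_cn D y) = y"
  by auto

lemma split_dilate: "split_cn D (dilate D r w) = (fst (split_cn D w), r *\<^sub>R snd (split_cn D w))"
  by (simp add: split_cn_def prod_eq_iff vec_eq_iff)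

lemma proj_dilate [simp]: "proj D (dilate D r w) = proj D w" "proj (- D) (dilate D r w) = r *\<^sub>R proj (- D) w"
  by (simp_all add: vec_eq_iff)

lemma proj_orth: "proj (- D) x = 0 \<Longrightarrow> proj D y = 0 \<Longrightarrow> x \<bullet> y = 0"
proof -
  assume a: "proj (- D) x = 0" "proj D y = 0"
  have "x $ i * y $ i = 0" for i
    using arg_cong[OF a(1), of "\<lambda>v. v $ i"] arg_cong[OF a(2), of "\<lambda>v. v $ i"] by (cases "i \<in> D") auto
  then have "x $ i \<bullet> y $ i = 0" for i unfolding inner_real_def .
  then show ?thesis unfolding inner_vec_def by (intro sum.neutral ballI)
qed

context conormal_geometry
begin

abbreviation "SC \<equiv> slice_charts A D H"
abbreviation "N \<equiv> conormal A D H"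
abbreviation "P \<equiv> conormal_point A D"
abbreviation "Om \<equiv> conormal_dom D"

definition slice_coords :: "('m, 'n) chart \<Rightarrow> ('m, 'n) cov \<Rightarrow> real^'n" where "slice_coords c z = merge_cn D (coords c z)"

lemma SC_A: "c \<in> SC \<Longrightarrow> c \<in> A" by (simp add: slice_charts_def)

lemma SC_H: "c \<in> SC \<Longrightarrow> q \<in> fst c \<Longrightarrow> q \<in> H \<longleftrightarrow> proj (- D) (snd c q) = 0"
  unfolding slice_charts_def by blast

lemma slice_exists: "q \<in> H \<Longrightarrow> \<exists>c\<in>SC. q \<in> fst c"
  using submfd by (simp add: compact_submanifold_def)

lemma slice_at: "q \<in> H \<Longrightarrow> slice_at A D H q \<in> SC \<and> q \<in> fst (slice_at A D H q)"
  unfolding slice_at_def by (rule someI_ex) (use slice_exists in blast)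

lemma N_T0: "z \<in> N \<Longrightarrow> z \<in> T0" and N_H: "z \<in> N \<Longrightarrow> fst z \<in> H"
  by (auto simp: conormal_def)

text \<open>Coordinate changes between slice charts map the set \<open>{x'' = 0}\<close> to itself,
  so their derivatives preserve its tangent space.\<close>
lemma jac_slice:
  assumes c: "c \<in> SC" "c' \<in> SC" and q: "q \<in> fst c" "q \<in> fst c'" "q \<in> H" and v: "proj (- D) v = 0"
  shows "proj (- D) (jac c c' q *v v) = 0"
proof -
  let ?x = "snd c q" and ?f = "\<lambda>s. proj (- D) ((snd c' \<circ> cinv c) (snd c q + s *\<^sub>R v))"
  have A: "c \<in> A" "c' \<in> A" using c SC_A by auto
  have 1: "((\<lambda>s. ?x + s *\<^sub>R v) has_derivative (\<lambda>h. h *\<^sub>R v)) (at 0)" by (auto intro!: derivative_eq_intros)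
  have "((\<lambda>s. (snd c' \<circ> cinv c) (?x + s *\<^sub>R v)) has_derivative (\<lambda>h. jac c c' q *v (h *\<^sub>R v))) (at 0)"
    by (rule has_derivative_compose[OF 1]) (use transition_deriv[OF A q(1,2)] in \<open>simp add: o_def\<close>)
  then have d: "(?f has_derivative (\<lambda>h. proj (- D) (jac c c' q *v (h *\<^sub>R v)))) (at 0)"
    by (rule bounded_linear.has_derivative[OF bounded_linear_proj])
  let ?S = "(\<lambda>s. ?x + s *\<^sub>R v) -` {x \<in> crange c. cinv c x \<in> fst c'}"
  have S: "open ?S" by (intro open_vimage overlap_open chart_open A continuous_intros)
  have S0: "0 \<in> ?S" using q snd_in[OF A(1)] cinv_snd[OF A(1)] by simp
  have "((\<lambda>s. 0) has_derivative (\<lambda>h. proj (- D) (jac c c' q *v (h *\<^sub>R v)))) (at (0::real))"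
  proof (rule has_derivative_transform_within_open[OF d S S0])
    fix s assume s: "s \<in> ?S"
    let ?p = "cinv c (?x + s *\<^sub>R v)"
    have p: "?p \<in> fst c" "?p \<in> fst c'" "snd c ?p = ?x + s *\<^sub>R v" using s cinv_in[OF A(1)] snd_cinv[OF A(1)] by auto
    have "proj (- D) (?x + s *\<^sub>R v) = 0"
    proof -
      have "proj (- D) (?x + s *\<^sub>R v) = proj (- D) ?x + s *\<^sub>R proj (- D) v" by (simp add: vec_eq_iff)
      then show ?thesis using SC_H[OF c(1) q(1)] q(3) v by simp
    qed
    then have "?p \<in> H" using SC_H[OF c(1) p(1)] p(3) by simp
    then show "?f s = 0" using SC_H[OF c(2) p(2)] by simp
  qed
  then have "(\<lambda>h. proj (- D) (jac c c' q *v (h *\<^sub>R v))) = (\<lambda>h. 0)"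
    by (rule has_derivative_unique) simp
  from fun_cong[OF this, of 1] show ?thesis by simp
qed

text \<open>By \<open>jac_slice\<close>, the condition in one slice chart implies that in all
  others.\<close>
lemma conormal_iff:
  assumes z: "z \<in> T0" and c: "c \<in> SC" "fst z \<in> fst c"
  shows "z \<in> N \<longleftrightarrow> fst z \<in> H \<and> proj D (snd z c) = 0"
proof
  assume h: "fst z \<in> H \<and> proj D (snd z c) = 0"
  have "proj D (snd z c') = 0" if c': "c' \<in> SC" "fst z \<in> fst c'" for c'
  proof -
    have "snd z c' $ i = 0" if i: "i \<in> D" for i
    proof -
      have "snd z c' = transpose (jac c' c (fst z)) *v snd z c"
        by (rule cotangentD[OF T0_cot[OF z] SC_A[OF c'(1)] SC_A[OF c(1)] c'(2) c(2)])
      then have "snd z c' \<bullet> axis i 1 = snd z c \<bullet> (jac c' c (fst z) *v axis i 1)" by (simp add: dot_lmul_matrix)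
      also have "\<dots> = 0"
        unfolding inner_commute[of "snd z c"]
        by (rule proj_orth[OF jac_slice[OF c'(1) c(1) c'(2) c(2)]]) (use h i in \<open>auto simp: vec_eq_iff axis_def\<close>)
      finally show ?thesis by (simp add: inner_axis)
    qed
    then show ?thesis by (simp add: vec_eq_iff)
  qed
  then show "z \<in> N" using z h by (simp add: conormal_def)
qed (use c in \<open>auto simp: conormal_def\<close>)

lemma conormal_coords_iff:
  assumes z: "z \<in> T0" and c: "c \<in> SC" "fst z \<in> fst c"
  shows "z \<in> N \<longleftrightarrow> coords c z \<in> range (split_cn D)"
  unfolding conormal_iff[OF assms] range_split_iff SC_H[OF c] by (simp add: coords_def)

lemma conormal_coords:
  assumes z: "z \<in> N" and c: "c \<in> SC" "fst z \<in> fst c"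
  shows "coords c z = split_cn D (slice_coords c z)" "slice_coords c z \<in> Om c" "P c (slice_coords c z) = z"
proof -
  show e: "coords c z = split_cn D (slice_coords c z)"
    using conormal_coords_iff[OF N_T0[OF z] c] z split_merge unfolding slice_coords_def by fastforce
  have "fst (coords c z) \<in> crange c \<and> snd (coords c z) \<noteq> 0" by (rule coords_T0[OF N_T0[OF z] SC_A[OF c(1)] c(2)])
  then show "slice_coords c z \<in> Om c" unfolding e by (simp add: conormal_dom_def split_cn_def)
  show "P c (slice_coords c z) = z" unfolding conormal_point_def e[symmetric]
    by (rule cov_point_coords[OF T0_cot[OF N_T0[OF z]] SC_A[OF c(1)] c(2)])
qed

lemma Om_split: "w \<in> Om c \<longleftrightarrow> fst (split_cn D w) \<in> crange c \<and> snd (split_cn D w) \<noteq> 0"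
  by (simp add: conormal_dom_def split_cn_def)

lemma P_props:
  assumes c: "c \<in> SC" and w: "w \<in> Om c"
  shows P_T0: "P c w \<in> T0" and P_in: "fst (P c w) \<in> fst c" and coords_P: "coords c (P c w) = split_cn D w"
    and P_N: "P c w \<in> N" and slice_coords_P: "slice_coords c (P c w) = w" and fst_P: "fst (P c w) = cinv c (proj D w)"
proof -
  note cA = SC_A[OF c]
  have y: "fst (split_cn D w) \<in> crange c" "snd (split_cn D w) \<noteq> 0" using w Om_split[of w c] by auto
  show T: "P c w \<in> T0" unfolding conormal_point_def by (rule cov_point_T0[OF cA y])
  show i: "fst (P c w) \<in> fst c" unfolding conormal_point_def by (rule fst_cov_point_in[OF cA y(1)])
  show e: "coords c (P c w) = split_cn D w" unfolding conormal_point_def by (rule coords_cov_point[OF cA y(1)])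
  show "P c w \<in> N" using conormal_coords_iff[OF T c i] e by simp
  show "slice_coords c (P c w) = w" by (simp add: slice_coords_def e)
  show "fst (P c w) = cinv c (proj D w)" unfolding conormal_point_def fst_cov_point[OF cA y(1)] by (simp add: split_cn_def)
qed

lemma Om_open: "c \<in> SC \<Longrightarrow> open (Om c)"
proof -
  assume c: "c \<in> SC"
  have "Om c = (split_cn D) -` (crange c \<times> (- {0}))"
    by (simp only: set_eq_iff vimage_eq mem_Times_iff Om_split Compl_iff singleton_iff) simp
  moreover have "open ((split_cn D) -` (crange c \<times> (- {0})))"
    by (intro open_vimage open_Times crange_open[OF SC_A[OF c]] linear_continuous_on[OF bounded_linear_split_cn]) auto
  ultimately show ?thesis by simp
qed

lemma Om_dilate: "w \<in> Om c \<Longrightarrow> r > 0 \<Longrightarrow> dilate D r w \<in> Om c"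
  by (simp add: conormal_dom_def)

lemma P_dilate: "c \<in> SC \<Longrightarrow> w \<in> Om c \<Longrightarrow> P c (dilate D r w) = cscale r (P c w)"
  unfolding conormal_point_def split_dilate using Om_split[of w c] by (intro cov_point_scale SC_A) auto

lemma cscale_N:
  assumes z: "z \<in> N" and r: "r > 0" shows "cscale r z \<in> N"
proof -
  obtain c where c: "c \<in> SC" "fst z \<in> fst c" using slice_exists[OF N_H[OF z]] by blast
  have "proj D (snd z c) = 0" using conormal_iff[OF N_T0[OF z] c] z by simp
  moreover have "proj D (r *\<^sub>R snd z c) = r *\<^sub>R proj D (snd z c)" by (simp add: vec_eq_iff)
  ultimately have "proj D (r *\<^sub>R snd z c) = 0" by simp
  then show ?thesis using conormal_iff[OF cscale_T0[OF N_T0[OF z]] c(1), of r] c r N_H[OF z] by simp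
qed

lemma slice_coords_cscale: "slice_coords c (cscale r z) = dilate D r (slice_coords c z)"
  by (simp add: slice_coords_def merge_cn_def vec_eq_iff)

lemma mem_W_split: "w \<in> Om c \<Longrightarrow> (t, split_cn D w) \<in> W c c' \<longleftrightarrow> fst (G t (P c w)) \<in> fst c'"
  using Om_split[of w c] by (simp add: mem_W conormal_point_def)

lemma Psi_split: "Psi c c' (t, split_cn D w) = coords c' (G t (P c w))"
  by (simp add: Psi_def conormal_point_def)

text \<open>At time 0 the derivative of \<open>\<langle>\<xi>'', x''\<rangle>\<close> along the
  flow, with \<open>\<xi>''\<close> fixed at its initial value, is \<open>p > 0\<close> by Euler's
  identity. Hence this quantity, which vanishes on \<open>H\<close>, is positive for a short
  positive time, and the orbit leaves \<open>H\<close>.\<close>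
lemma local_gap:
  assumes c: "c \<in> SC" and w0: "w0 \<in> Om c"
  shows "\<exists>e>0. \<forall>t w. 0 < t \<and> t < e \<and> dist w w0 < e \<longrightarrow> w \<in> Om c \<and> G t (P c w) \<notin> N"
proof -
  note cA = SC_A[OF c]
  let ?x = "(0, split_cn D w0)"
  have z0: "P c w0 \<in> T0" by (rule P_T0[OF c w0])
  have x0: "?x \<in> W c c" using mem_W_split[OF w0, of 0 c] P_in[OF c w0] G_0[OF z0] by simp
  let ?F = "\<lambda>p. proj (- D) (snd p) \<bullet> fst (dPsi c c (fst p, split_cn D (snd p)) (1, 0))"
  let ?O = "(\<lambda>p. (fst p, split_cn D (snd p))) -` W c c \<inter> (UNIV \<times> Om c)"
  have cs: "continuous_on S (\<lambda>p. split_cn D (f p))" if "continuous_on S f" for S and f :: "real \<times> (real^'n) \<Rightarrow> real^'n"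
    by (rule bounded_linear.continuous_on[OF bounded_linear_split_cn that])
  have O: "open ?O" by (intro open_Int open_vimage W_open cA open_Times Om_open c open_UNIV continuous_intros cs)
  have "continuous_on ?O (\<lambda>p. dPsi c c (fst p, split_cn D (snd p)) (1, 0))"
    by (rule continuous_on_compose2[OF dPsi_cont[OF cA cA]]) (auto intro!: continuous_intros cs)
  then have F: "continuous_on ?O ?F" by (intro continuous_intros)
  have "?F (0, w0) = ham g c (split_cn D w0)"
  proof -
    have y: "fst (split_cn D w0) \<in> crange c" "snd (split_cn D w0) \<noteq> 0" using w0 Om_split[of w0 c] by auto
    have "Psi c c ?x = split_cn D w0" unfolding Psi_split using G_0[OF z0] coords_P[OF c w0] by simp
    then have "?F (0, w0) = snd (split_cn D w0) \<bullet> fst (ham_field g c (split_cn D w0))"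
      using dPsi_time[OF cA cA x0] by (simp add: split_cn_def)
    then show ?thesis using ham_euler[OF cA y] by (simp add: ham_field_def inner_commute)
  qed
  also have "\<dots> > 0" using ham_pos[OF cA] w0 Om_split[of w0 c] by blast
  finally have pos: "?F (0, w0) > 0" .
  have op: "open (?O \<inter> ?F -` {0<..})" by (rule continuous_open_preimage[OF F O]) simp
  have mem: "(0, w0) \<in> ?O \<inter> ?F -` {0<..}" using x0 w0 pos by simp
  obtain e where e: "e > 0" "ball (0, w0) e \<subseteq> ?O \<inter> ?F -` {0<..}"
    by (rule openE[OF op mem])
  have near: "(s, split_cn D w) \<in> W c c \<and> w \<in> Om c \<and> ?F (s, w) > 0" if "\<bar>s\<bar> < e / 2" "dist w w0 < e / 2" for s w
  proof -
    have "dist (0, w0) (s, w) \<le> dist 0 s + dist w0 w" using sqrt_sum_squares_le_sum[of "dist 0 s" "dist w0 w"] by (simp add: dist_Pair_Pair)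
    also have "\<dots> < e" using that by (simp add: dist_commute dist_real_def)
    finally show ?thesis using e(2) by auto
  qed
  show ?thesis
  proof (intro exI[of _ "e / 2"] conjI allI impI)
    fix t w assume tw: "0 < t \<and> t < e / 2 \<and> dist w w0 < e / 2"
    have w: "w \<in> Om c" using near[of 0 w] tw e by simp
    then show "w \<in> Om c" .
    have z: "P c w \<in> T0" by (rule P_T0[OF c w])
    let ?f = "\<lambda>s. proj (- D) w \<bullet> fst (Psi c c (s, split_cn D w))"
    have df: "(?f has_real_derivative ?F (s, w)) (at s)" if "0 \<le> s" "s \<le> t" for s
    proof -
      have x: "(s, split_cn D w) \<in> W c c" using near[of s w] that tw by auto
      have 1: "((\<lambda>s. (s, split_cn D w)) has_derivative (\<lambda>h. (h, 0))) (at s)" by (auto intro!: derivative_eq_intros)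
      have "((\<lambda>s. Psi c c (s, split_cn D w)) has_derivative (\<lambda>h. dPsi c c (s, split_cn D w) (h, 0))) (at s)"
        by (rule has_derivative_compose[OF 1 Psi_deriv[OF cA cA x]])
      then have 2: "(?f has_derivative (\<lambda>h. proj (- D) w \<bullet> fst (dPsi c c (s, split_cn D w) (h, 0)))) (at s)"
        by (intro has_derivative_inner_right has_derivative_fst)
      have e1: "dPsi c c (s, split_cn D w) (h, 0) = h *\<^sub>R dPsi c c (s, split_cn D w) (1, 0)" for h
        using linear_scale[OF dPsi_linear[OF cA cA x], of h "(1, 0)"] by simp
      have "(\<lambda>h. proj (- D) w \<bullet> fst (dPsi c c (s, split_cn D w) (h, 0))) = (*) (?F (s, w))"
      proof
        fix h show "proj (- D) w \<bullet> fst (dPsi c c (s, split_cn D w) (h, 0)) = ?F (s, w) * h"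
          unfolding e1[of h] by (simp add: mult.commute)
      qed
      then show ?thesis using 2 unfolding has_field_derivative_def by (simp only:)
    qed
    have "?f 0 < ?f t"
      by (rule DERIV_pos_imp_increasing) (use tw df near[of _ w] in \<open>auto intro!: exI\<close>)
    moreover have "?f 0 = 0"
      unfolding Psi_split using G_0[OF z] coords_P[OF c w] proj_orth[of D "proj D w" "proj (- D) w"]
      by (simp add: split_cn_def inner_commute vec_eq_iff)
    ultimately have nz: "proj (- D) w \<bullet> fst (Psi c c (t, split_cn D w)) \<noteq> 0" by simp
    show "G t (P c w) \<notin> N"
    proof
      assume n: "G t (P c w) \<in> N"
      have "(t, split_cn D w) \<in> W c c" using near[of t w] tw by simp
      then have i: "fst (G t (P c w)) \<in> fst c" using mem_W_split[OF w] by simp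
      have "proj (- D) (snd c (fst (G t (P c w)))) = 0" using SC_H[OF c i] N_H[OF n] by simp
      then have "fst (Psi c c (t, split_cn D w)) \<bullet> proj (- D) w = 0"
        unfolding Psi_split by (intro proj_orth[of D]) (simp_all add: coords_def vec_eq_iff)
      with nz show False by (simp add: inner_commute)
    qed
  qed (use e in simp)
qed

text \<open>By compactness of \<open>H\<close> finitely many closed coordinate balls in slice charts
  suffice, and a dilation moves every covector to the Euclidean unit sphere of the fibre
  coordinates.\<close>
lemma finite_atlas:
  obtains I :: "nat set" and cs :: "nat \<Rightarrow> ('m, 'n) chart" and Ks :: "nat \<Rightarrow> (real^'n) set" where
    "finite I" "\<And>i. i \<in> I \<Longrightarrow> cs i \<in> SC" "\<And>i. i \<in> I \<Longrightarrow> compact (Ks i)" "\<And>i. i \<in> I \<Longrightarrow> Ks i \<subseteq> Om (cs i)"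
    "\<And>z. z \<in> N \<Longrightarrow> \<exists>i\<in>I. \<exists>w\<in>Ks i. \<exists>r>0. z = cscale r (P (cs i) w)"
proof -
  have ex: "\<exists>c e. c \<in> SC \<and> q \<in> fst c \<and> e > 0 \<and> cball (snd c q) e \<subseteq> crange c" if qH: "q \<in> H" for q
  proof -
    obtain c where c: "c \<in> SC" "q \<in> fst c" using slice_exists[OF qH] by blast
    have "open (crange c)" "snd c q \<in> crange c" using crange_open[OF SC_A[OF c(1)]] snd_in[OF SC_A[OF c(1)] c(2)] by auto
    then have "\<exists>e>0. cball (snd c q) e \<subseteq> crange c" unfolding open_contains_cball by blast
    then show ?thesis using c by blast
  qed
  then have "\<forall>q\<in>H. \<exists>ce. fst ce \<in> SC \<and> q \<in> fst (fst ce) \<and> snd ce > 0 \<and> cball (snd (fst ce) q) (snd ce) \<subseteq> crange (fst ce)"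
    by (metis fst_conv snd_conv)
  from bchoice[OF this] obtain cef where cef: "\<forall>q\<in>H. fst (cef q) \<in> SC \<and> q \<in> fst (fst (cef q)) \<and> snd (cef q) > (0::real)
      \<and> cball (snd (fst (cef q)) q) (snd (cef q)) \<subseteq> crange (fst (cef q))" by blast
  define cq where "cq q = fst (cef q)" for q
  define eq where "eq q = snd (cef q)" for q
  have ce: "cq q \<in> SC \<and> q \<in> fst (cq q) \<and> eq q > 0 \<and> cball (snd (cq q) q) (eq q) \<subseteq> crange (cq q)" if "q \<in> H" for q
    using bspec[OF cef that] unfolding cq_def eq_def .
  let ?V = "\<lambda>q. {p \<in> fst (cq q). snd (cq q) p \<in> ball (snd (cq q) q) (eq q)}"
  have V: "open (?V q)" "q \<in> ?V q" if qH: "q \<in> H" for q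
  proof -
    have c: "cq q \<in> A" using ce[OF qH] SC_A by blast
    have "open (fst (cq q) \<inter> snd (cq q) -` ball (snd (cq q) q) (eq q))"
      by (rule continuous_open_preimage[OF snd_cont[OF c] chart_open[OF c]]) simp
    moreover have "fst (cq q) \<inter> snd (cq q) -` ball (snd (cq q) q) (eq q) = ?V q" by auto
    ultimately show "open (?V q)" by simp
    show "q \<in> ?V q" using ce[OF qH] by simp
  qed
  have cH: "compact H" using submfd by (simp add: compact_submanifold_def)
  have "H \<subseteq> (\<Union>q\<in>H. ?V q)"
  proof
    fix q assume "q \<in> H" then show "q \<in> (\<Union>q\<in>H. ?V q)" using V(2)[of q] by (intro UN_I[of q])
  qed
  from compactE_image[OF cH V(1) this]
  obtain Q where Q: "Q \<subseteq> H" "finite Q" "H \<subseteq> (\<Union>q\<in>Q. ?V q)" .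
  obtain f :: "'m \<Rightarrow> nat" where f: "inj_on f Q" using finite_imp_inj_to_nat_seg[OF Q(2)] by blast
  let ?q = "inv_into Q f"
  have fq: "?q (f q) = q" if qQ: "q \<in> Q" for q using f qQ by simp
  let ?K = "\<lambda>q. (\<lambda>p. proj D (fst p) + proj (- D) (snd p)) ` (cball (snd (cq q) q) (eq q) \<times> sphere 0 1)
     \<inter> {w. proj D w \<in> cball (snd (cq q) q) (eq q)} \<inter> {w. norm (proj (- D) w) = 1}"
  show ?thesis
  proof (rule that[of "f ` Q" "\<lambda>i. cq (?q i)" "\<lambda>i. ?K (?q i)"])
    show "finite (f ` Q)" using Q(2) by simp
    fix i assume "i \<in> f ` Q"
    then obtain q where q: "q \<in> Q" "?q i = q" using fq by auto
    then have qH: "q \<in> H" using Q(1) by blast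
    show "cq (?q i) \<in> SC" using ce[OF qH] q by simp
    show "compact (?K (?q i))" unfolding q
    proof (intro compact_Int_closed compact_continuous_image compact_Times compact_cball compact_sphere continuous_intros)
      show "closed {w. proj D w \<in> cball (snd (cq q) q) (eq q)}"
        using closed_vimage[OF closed_cball, of "proj D"] continuous_on_proj[OF continuous_on_id, of UNIV D] by (simp add: vimage_def)
      show "closed {w. norm (proj (- D) w) = 1}"
        by (intro closed_Collect_eq continuous_intros)
    qed
    show "?K (?q i) \<subseteq> Om (cq (?q i))" unfolding q using ce[OF qH] by (auto simp: conormal_dom_def)
  next
    fix z assume z: "z \<in> N"
    then obtain q where q: "q \<in> Q" "fst z \<in> ?V q" using Q(3) N_H by blast
    have qH: "q \<in> H" using q Q by blast
    let ?c = "cq q"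
    have c: "?c \<in> SC" "fst z \<in> fst ?c" using ce[OF qH] q by auto
    define r where "r = norm (snd z ?c)"
    have cz: "coords ?c z = split_cn D (slice_coords ?c z)" by (rule conormal_coords[OF z c])
    have sz: "snd z ?c = proj (- D) (slice_coords ?c z)" "snd ?c (fst z) = proj D (slice_coords ?c z)" using cz by (simp_all add: coords_def split_cn_def)
    have r: "r > 0" using coords_T0[OF N_T0[OF z] SC_A[OF c(1)] c(2)] by (simp add: r_def coords_def)
    define w where "w = dilate D (1 / r) (slice_coords ?c z)"
    have wz: "P ?c w = cscale (1 / r) z" unfolding w_def P_dilate[OF c(1) conormal_coords(2)[OF z c]] conormal_coords(3)[OF z c] ..
    have n1: "norm (proj (- D) w) = 1" unfolding w_def using r by (simp add: sz[symmetric] r_def)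
    have p1: "proj D w \<in> cball (snd ?c q) (eq q)" unfolding w_def using q sz by simp
    have "w = proj D (proj D w) + proj (- D) (proj (- D) w)" by (simp add: vec_eq_iff)
    then have "w \<in> ?K q" using n1 p1 by (auto intro!: image_eqI[of _ _ "(proj D w, proj (- D) w)"])
    moreover have "z = cscale r (P ?c w)" using r by (simp add: wz)
    ultimately show "\<exists>i\<in>f ` Q. \<exists>w\<in>?K (?q i). \<exists>r>0. z = cscale r (P (cq (?q i)) w)"
      using q(1) fq[OF q(1)] r by (intro bexI[of _ "f q"] bexI[of _ w] exI[of _ r]) auto
  qed
qed

text \<open>The flow commutes with dilations, so \<open>local_gap\<close> on the compact sets of
  \<open>finite_atlas\<close> gives a uniform time.\<close>
lemma gap_exists: "\<exists>e>0. \<forall>z\<in>N. \<forall>t. 0 < t \<and> t < e \<longrightarrow> G t z \<notin> N"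
proof -
  obtain I :: "nat set" and cs Ks where I: "finite I" "\<And>i. i \<in> I \<Longrightarrow> cs i \<in> SC" "\<And>i. i \<in> I \<Longrightarrow> compact (Ks i)"
      "\<And>i. i \<in> I \<Longrightarrow> Ks i \<subseteq> Om (cs i)"
      "\<And>z. z \<in> N \<Longrightarrow> \<exists>i\<in>I. \<exists>w\<in>Ks i. \<exists>r>0. z = cscale r (P (cs i) w)"
    by (rule finite_atlas) (rule that, assumption+)
  have "\<exists>e>0. \<forall>w\<in>Ks i. \<forall>t. 0 < t \<and> t < e \<longrightarrow> G t (P (cs i) w) \<notin> N" if i: "i \<in> I" for i
  proof -
    have "\<exists>e. \<forall>w0\<in>Ks i. e w0 > 0 \<and> (\<forall>t w. 0 < t \<and> t < e w0 \<and> dist w w0 < e w0 \<longrightarrow> w \<in> Om (cs i) \<and> G t (P (cs i) w) \<notin> N)"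
    proof (rule bchoice, rule ballI)
      fix w0 assume "w0 \<in> Ks i"
      then have "w0 \<in> Om (cs i)" using I(4)[OF i] by blast
      from local_gap[OF I(2)[OF i] this]
      show "\<exists>e>0. \<forall>t w. 0 < t \<and> t < e \<and> dist w w0 < e \<longrightarrow> w \<in> Om (cs i) \<and> G t (P (cs i) w) \<notin> N" .
    qed
    then obtain e where e: "\<And>w0. w0 \<in> Ks i \<Longrightarrow> e w0 > 0"
      "\<And>w0 t w. w0 \<in> Ks i \<Longrightarrow> 0 < t \<Longrightarrow> t < e w0 \<Longrightarrow> dist w w0 < e w0 \<Longrightarrow> G t (P (cs i) w) \<notin> N" by blast
    have "Ks i \<subseteq> (\<Union>w0\<in>Ks i. ball w0 (e w0))" using e(1) by force
    then obtain Q where Q: "Q \<subseteq> Ks i" "finite Q" "Ks i \<subseteq> (\<Union>w0\<in>Q. ball w0 (e w0))"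
      using compactE_image[OF I(3)[OF i], of "Ks i" "\<lambda>w0. ball w0 (e w0)"] open_ball by blast
    define m where "m = Min (insert 1 (e ` Q))"
    have m: "m > 0" unfolding m_def using Q e(1) by (subst Min_gr_iff) auto
    have me: "m \<le> e w0" if "w0 \<in> Q" for w0 unfolding m_def using Q(2) that by (intro Min_le) auto
    show ?thesis
    proof (intro exI[of _ m] conjI ballI allI impI m)
      fix w t assume w: "w \<in> Ks i" and t: "0 < t \<and> t < m"
      obtain w0 where w0: "w0 \<in> Q" "w \<in> ball w0 (e w0)" using Q(3) w by blast
      show "G t (P (cs i) w) \<notin> N"
        by (rule e(2)[of w0]) (use w0 Q(1) t me[OF w0(1)] in \<open>auto simp: dist_commute\<close>)
    qed
  qed
  then have "\<exists>e. \<forall>i\<in>I. e i > 0 \<and> (\<forall>w\<in>Ks i. \<forall>t. 0 < t \<and> t < e i \<longrightarrow> G t (P (cs i) w) \<notin> N)"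
    by (intro bchoice) blast
  then obtain e where e: "\<And>i. i \<in> I \<Longrightarrow> e i > (0::real)"
    "\<And>i w t. i \<in> I \<Longrightarrow> w \<in> Ks i \<Longrightarrow> 0 < t \<Longrightarrow> t < e i \<Longrightarrow> G t (P (cs i) w) \<notin> N" by blast
  define m where "m = Min (insert 1 (e ` I))"
  have m: "m > 0" unfolding m_def using I(1) e(1) by (subst Min_gr_iff) auto
  have me: "m \<le> e i" if "i \<in> I" for i unfolding m_def using I(1) that by (intro Min_le) auto
  show ?thesis
  proof (intro exI[of _ m] conjI ballI allI impI m)
    fix z t assume z: "z \<in> N" and t: "0 < t \<and> t < m"
    obtain i w r where i: "i \<in> I" "w \<in> Ks i" "r > 0" "z = cscale r (P (cs i) w)" using I(5)[OF z] by blast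
    have w: "w \<in> Om (cs i)" using I(4)[OF i(1)] i(2) by blast
    have "G t z = cscale r (G t (P (cs i) w))" unfolding i(4) by (rule G_cscale[OF P_T0[OF I(2)[OF i(1)] w] i(3)])
    then have "cscale (1 / r) (G t z) = G t (P (cs i) w)" using i(3) by simp
    moreover have "G t (P (cs i) w) \<notin> N" using e(2)[OF i(1,2)] t me[OF i(1)] by auto
    ultimately show "G t z \<notin> N" using cscale_N[of "G t z" "1 / r"] i(3) by auto
  qed
qed

definition gap :: real where "gap = (SOME e. e > 0 \<and> (\<forall>z\<in>N. \<forall>t. 0 < t \<and> t < e \<longrightarrow> G t z \<notin> N))"

lemma gap: "gap > 0" "z \<in> N \<Longrightarrow> 0 < t \<Longrightarrow> t < gap \<Longrightarrow> G t z \<notin> N"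
proof -
  have "gap > 0 \<and> (\<forall>z\<in>N. \<forall>t. 0 < t \<and> t < gap \<longrightarrow> G t z \<notin> N)"
    unfolding gap_def by (rule someI_ex) (use gap_exists in blast)
  then show "gap > 0" "z \<in> N \<Longrightarrow> 0 < t \<Longrightarrow> t < gap \<Longrightarrow> G t z \<notin> N" by blast+
qed

lemma return_times_separated:
  assumes z: "z \<in> T0" "G s z \<in> N" "G t z \<in> N" and st: "\<bar>s - t\<bar> < gap"
  shows "s = t"
proof (rule ccontr)
  assume "s \<noteq> t"
  have "G (t - s) (G s z) = G t z" "G (s - t) (G t z) = G s z"
    using G_add[OF z(1), of "t - s" s] G_add[OF z(1), of "s - t" t] by simp_all
  then show False
    using gap(2)[OF z(2), of "t - s"] gap(2)[OF z(3), of "s - t"] z st \<open>s \<noteq> t\<close> by (cases "s < t") auto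
qed

end

section \<open>The return derivative in slice charts\<close>
lemma merge_cn_linear: "linear (merge_cn D)"
  using bounded_linear_merge_cn bounded_linear.linear by blast

context conormal_geometry
begin

text \<open>For slice charts \<open>c\<close> and \<open>c'\<close>: the flow in the conormal
  parameters of \<open>c\<close> and canonical coordinates of \<open>c'\<close>, its derivative
  \<open>L\<close> in the conormal directions at a fixed time, and the matrix \<open>M\<close> of
  its conormal part. At a return, \<open>tangent\<close> says that tangent vectors of the conormal
  bundle go to tangent vectors, and \<open>clean\<close> that in addition this map is an
  isomorphism.\<close>
definition flow_coords :: "('m, 'n) chart \<Rightarrow> ('m, 'n) chart \<Rightarrow> real \<times> (real^'n) \<Rightarrow> (real^'n) \<times> (real^'n)" where
  "flow_coords c c' p = coords c' (G (fst p) (P c (snd p)))"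

definition L :: "('m, 'n) chart \<Rightarrow> ('m, 'n) chart \<Rightarrow> real \<Rightarrow> real^'n \<Rightarrow> real^'n \<Rightarrow> (real^'n) \<times> (real^'n)" where
  "L c c' t w v = dPsi c c' (t, split_cn D w) (0, split_cn D v)"

definition M :: "('m, 'n) chart \<Rightarrow> ('m, 'n) chart \<Rightarrow> real \<Rightarrow> real^'n \<Rightarrow> real^'n^'n" where
  "M c c' t w = matrix (\<lambda>v. merge_cn D (L c c' t w v))"

definition slice_pair :: "('m, 'n) chart \<Rightarrow> ('m, 'n) chart \<Rightarrow> real \<Rightarrow> ('m, 'n) cov \<Rightarrow> bool" where
  "slice_pair c c' t z \<longleftrightarrow> z \<in> N \<and> G t z \<in> N \<and> c \<in> SC \<and> c' \<in> SC \<and> fst z \<in> fst c \<and> fst (G t z) \<in> fst c'"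

definition tangent :: "('m, 'n) chart \<Rightarrow> ('m, 'n) chart \<Rightarrow> real \<Rightarrow> real^'n \<Rightarrow> bool" where
  "tangent c c' t w \<longleftrightarrow> (\<forall>v. L c c' t w v \<in> range (split_cn D))"

definition clean :: "('m, 'n) chart \<Rightarrow> ('m, 'n) chart \<Rightarrow> real \<Rightarrow> ('m, 'n) cov \<Rightarrow> bool" where
  "clean c c' t z \<longleftrightarrow> tangent c c' t (slice_coords c z) \<and> det (M c c' t (slice_coords c z)) \<noteq> 0"

lemma flow_coords_deriv:
  assumes c: "c \<in> SC" "c' \<in> SC" and w: "w \<in> Om c" "fst (G t (P c w)) \<in> fst c'"
  shows "(flow_coords c c' has_derivative (\<lambda>(h, v). dPsi c c' (t, split_cn D w) (h, split_cn D v))) (at (t, w))"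
proof -
  have x: "(t, split_cn D w) \<in> W c c'" using mem_W_split[OF w(1)] w(2) by simp
  have 1: "((\<lambda>p. (fst p, split_cn D (snd p))) has_derivative (\<lambda>p. (fst p, split_cn D (snd p)))) (at (t, w))"
    by (intro bounded_linear_imp_has_derivative bounded_linear_Pair bounded_linear_fst
        bounded_linear_compose[OF bounded_linear_split_cn bounded_linear_snd])
  have "((\<lambda>p. Psi c c' (fst p, split_cn D (snd p))) has_derivative (\<lambda>p. dPsi c c' (t, split_cn D w) (fst p, split_cn D (snd p)))) (at (t, w))"
    by (rule has_derivative_compose[OF 1]) (use Psi_deriv[OF SC_A[OF c(1)] SC_A[OF c(2)] x] in simp)
  then show ?thesis unfolding flow_coords_def[abs_def] Psi_split by (simp add: case_prod_unfold)
qed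

lemma L_deriv:
  assumes c: "c \<in> SC" "c' \<in> SC" and w: "w \<in> Om c" "fst (G t (P c w)) \<in> fst c'"
  shows "((\<lambda>w. coords c' (G t (P c w))) has_derivative L c c' t w) (at w)"
proof -
  have 1: "((\<lambda>w. (t, w)) has_derivative (\<lambda>v. (0, v))) (at w)" by (auto intro!: derivative_eq_intros)
  have "((\<lambda>w. flow_coords c c' (t, w)) has_derivative (\<lambda>v. case (0, v) of (h, v) \<Rightarrow> dPsi c c' (t, split_cn D w) (h, split_cn D v))) (at w)"
    by (rule has_derivative_compose[OF 1 flow_coords_deriv[OF assms]])
  moreover have "(\<lambda>v. case (0, v) of (h, v) \<Rightarrow> dPsi c c' (t, split_cn D w) (h, split_cn D v)) = L c c' t w"
    by (simp add: L_def fun_eq_iff)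
  ultimately show ?thesis by (simp add: flow_coords_def)
qed

lemma L_linear:
  assumes "c \<in> SC" "c' \<in> SC" "w \<in> Om c" "fst (G t (P c w)) \<in> fst c'"
  shows "linear (L c c' t w)" "linear (\<lambda>v. merge_cn D (L c c' t w v))"
proof -
  show l: "linear (L c c' t w)" using L_deriv[OF assms] by (rule has_derivative_linear)
  show "linear (\<lambda>v. merge_cn D (L c c' t w v))" using linear_compose[OF l merge_cn_linear] by (simp add: o_def)
qed

lemma M_works:
  assumes "c \<in> SC" "c' \<in> SC" "w \<in> Om c" "fst (G t (P c w)) \<in> fst c'"
  shows "M c c' t w *v v = merge_cn D (L c c' t w v)"
  unfolding M_def using L_linear(2)[OF assms] by (simp add: matrix_works linear_matrix_vector_mul_eq)

lemma slice_pairD: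
  assumes "slice_pair c c' t z"
  shows "z \<in> N" "G t z \<in> N" "c \<in> SC" "c' \<in> SC" "fst z \<in> fst c" "fst (G t z) \<in> fst c'"
    "slice_coords c z \<in> Om c" "P c (slice_coords c z) = z" "fst (G t (P c (slice_coords c z))) \<in> fst c'"
proof -
  show a: "z \<in> N" "G t z \<in> N" "c \<in> SC" "c' \<in> SC" "fst z \<in> fst c" "fst (G t z) \<in> fst c'"
    using assms by (auto simp: slice_pair_def)
  show "slice_coords c z \<in> Om c" "P c (slice_coords c z) = z" using conormal_coords[OF a(1,3,5)] by auto
  then show "fst (G t (P c (slice_coords c z))) \<in> fst c'" using a(6) by simp
qed

lemma landing_open:
  assumes c: "c \<in> SC" "c' \<in> SC"
  shows "open {p. snd p \<in> Om c \<and> fst (G (fst p) (P c (snd p))) \<in> fst c'}"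
proof -
  have "{p. snd p \<in> Om c \<and> fst (G (fst p) (P c (snd p))) \<in> fst c'} = (\<lambda>p. (fst p, split_cn D (snd p))) -` W c c'"
    by (auto simp: mem_W conormal_point_def Om_split)
  moreover have "open ((\<lambda>p. (fst p, split_cn D (snd p))) -` W c c')"
    by (intro open_vimage W_open SC_A c continuous_intros bounded_linear.continuous_on[OF bounded_linear_split_cn])
  ultimately show ?thesis by simp
qed

lemma landing_open':
  assumes c: "c \<in> SC" "c' \<in> SC"
  shows "open {w. w \<in> Om c \<and> fst (G t (P c w)) \<in> fst c'}"
proof -
  have "open ((\<lambda>w. (t, w)) -` {p. snd p \<in> Om c \<and> fst (G (fst p) (P c (snd p))) \<in> fst c'})"
    by (intro open_vimage landing_open c continuous_intros)
  then show ?thesis by (simp add: vimage_def)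
qed

text \<open>The chain rule holds for these restricted derivatives only if the first return is
  tangential: then \<open>L\<close> can be factored through the conormal parameters at the
  intermediate point.\<close>
lemma L_chain:
  assumes cn: "slice_pair c c' t z" "slice_pair c' c'' s (G t z)" and tg: "tangent c c' t (slice_coords c z)"
  shows "L c c'' (s + t) (slice_coords c z) v = L c' c'' s (slice_coords c' (G t z)) (merge_cn D (L c c' t (slice_coords c z) v))"
proof -
  note a = slice_pairD[OF cn(1)] and b = slice_pairD[OF cn(2)]
  let ?w = "slice_coords c z" and ?w' = "slice_coords c' (G t z)"
  have zT: "z \<in> T0" using N_T0 a(1) by blast
  have Gst: "G (s + t) z = G s (G t z)" by (rule G_add[OF zT])
  have d1: "((\<lambda>w. coords c'' (G (s + t) (P c w))) has_derivative L c c'' (s + t) ?w) (at ?w)"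
    by (rule L_deriv) (use a b Gst in auto)
  have dl: "((\<lambda>w. coords c' (G t (P c w))) has_derivative L c c' t ?w) (at ?w)"
    by (rule L_deriv) (use a in auto)
  have e: "coords c' (G t (P c ?w)) = split_cn D ?w'" unfolding a(8) by (rule conormal_coords(1)[OF a(2,4,6)])
  have x: "(s, split_cn D ?w') \<in> W c' c''" using mem_W_split[OF b(7)] b(9) by simp
  have "((\<lambda>w. (s, coords c' (G t (P c w)))) has_derivative (\<lambda>v. (0, L c c' t ?w v))) (at ?w)"
    by (rule has_derivative_Pair[OF has_derivative_const dl])
  then have "((\<lambda>w. Psi c' c'' (s, coords c' (G t (P c w)))) has_derivative (\<lambda>v. dPsi c' c'' (s, split_cn D ?w') (0, L c c' t ?w v))) (at ?w)"
    by (rule has_derivative_compose) (use Psi_deriv[OF SC_A[OF b(3)] SC_A[OF b(4)] x] e in simp)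
  then have "((\<lambda>w. coords c'' (G (s + t) (P c w))) has_derivative (\<lambda>v. dPsi c' c'' (s, split_cn D ?w') (0, L c c' t ?w v))) (at ?w)"
  proof (rule has_derivative_transform_within_open[OF _ landing_open'[OF a(3,4)]])
    show "?w \<in> {w \<in> Om c. fst (G t (P c w)) \<in> fst c'}" using a by simp
    fix w assume "w \<in> {w \<in> Om c. fst (G t (P c w)) \<in> fst c'}"
    then have w: "w \<in> Om c" "fst (G t (P c w)) \<in> fst c'" by auto
    have T: "P c w \<in> T0" by (rule P_T0[OF a(3) w(1)])
    show "Psi c' c'' (s, coords c' (G t (P c w))) = coords c'' (G (s + t) (P c w))"
      using coords_mem_W(2)[OF G_T0[OF T] SC_A[OF a(4)] w(2), of c'' s] G_add[OF T, of s t] by simp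
  qed
  then have "L c c'' (s + t) ?w = (\<lambda>v. dPsi c' c'' (s, split_cn D ?w') (0, L c c' t ?w v))"
    using d1 has_derivative_unique by blast
  then have "L c c'' (s + t) ?w v = dPsi c' c'' (s, split_cn D ?w') (0, L c c' t ?w v)" by (rule fun_cong)
  also have "L c c' t ?w v = split_cn D (merge_cn D (L c c' t ?w v))" using tg by (simp add: tangent_def split_merge)
  finally show ?thesis by (simp add: L_def)
qed

lemma clean_comp:
  assumes cn: "slice_pair c c' t z" "slice_pair c' c'' s (G t z)" and gd: "clean c c' t z" "clean c' c'' s (G t z)"
  shows "slice_pair c c'' (s + t) z" "clean c c'' (s + t) z"
    "M c c'' (s + t) (slice_coords c z) = M c' c'' s (slice_coords c' (G t z)) ** M c c' t (slice_coords c z)"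
proof -
  note a = slice_pairD[OF cn(1)] and b = slice_pairD[OF cn(2)]
  have tg: "tangent c c' t (slice_coords c z)" using gd by (simp add: clean_def)
  have Gst: "G (s + t) z = G s (G t z)" by (rule G_add[OF N_T0[OF a(1)]])
  show cn': "slice_pair c c'' (s + t) z" using a b Gst by (simp add: slice_pair_def)
  note e = slice_pairD[OF cn']
  have "M c c'' (s + t) (slice_coords c z) *v v = (M c' c'' s (slice_coords c' (G t z)) ** M c c' t (slice_coords c z)) *v v" for v
    unfolding M_works[OF e(3,4,7,9)] matrix_vector_mul_assoc[symmetric] M_works[OF a(3,4,7,9)] M_works[OF b(3,4,7,9)]
      L_chain[OF cn tg] ..
  then show Me: "M c c'' (s + t) (slice_coords c z) = M c' c'' s (slice_coords c' (G t z)) ** M c c' t (slice_coords c z)"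
    by (simp add: matrix_eq)
  have "tangent c c'' (s + t) (slice_coords c z)" using gd(2) unfolding tangent_def L_chain[OF cn tg] clean_def by blast
  then show "clean c c'' (s + t) z" using gd by (simp add: clean_def Me det_mul)
qed

lemma L_0:
  assumes "slice_pair c c 0 z" shows "L c c 0 (slice_coords c z) = split_cn D"
proof -
  note a = slice_pairD[OF assms]
  have "((\<lambda>w. coords c (G 0 (P c w))) has_derivative L c c 0 (slice_coords c z)) (at (slice_coords c z))"
    by (rule L_deriv) (use a in auto)
  moreover have "((\<lambda>w. coords c (G 0 (P c w))) has_derivative split_cn D) (at (slice_coords c z))"
  proof (rule has_derivative_transform_within_open[OF _ Om_open[OF a(3)] a(7)])
    show "(split_cn D has_derivative split_cn D) (at (slice_coords c z))" by (rule bounded_linear_imp_has_derivative[OF bounded_linear_split_cn])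
    show "split_cn D w = coords c (G 0 (P c w))" if "w \<in> Om c" for w
      using G_0[OF P_T0[OF a(3) that]] coords_P[OF a(3) that] by simp
  qed
  ultimately show ?thesis by (rule has_derivative_unique)
qed

lemma M_0: "slice_pair c c 0 z \<Longrightarrow> M c c 0 (slice_coords c z) = mat 1"
  unfolding M_def by (simp add: L_0 matrix_id_mat_1[unfolded id_def])

text \<open>At time 0 all conormal points near \<open>z\<close> stay in the conormal bundle, so the
  linear equations of its tangent space can be differentiated.\<close>
lemma tangent_0:
  assumes "slice_pair c c' 0 z" shows "tangent c c' 0 (slice_coords c z)"
  unfolding tangent_def
proof
  fix v
  note a = slice_pairD[OF assms]
  let ?w = "slice_coords c z" and ?f = "\<lambda>w. coords c' (G 0 (P c w))"
  have d: "(?f has_derivative L c c' 0 ?w) (at ?w)" by (rule L_deriv) (use a in auto)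
  have rng: "?f w \<in> range (split_cn D)" if "w \<in> {w \<in> Om c. fst (G 0 (P c w)) \<in> fst c'}" for w
  proof -
    have w: "w \<in> Om c" "fst (G 0 (P c w)) \<in> fst c'" using that by auto
    have "G 0 (P c w) \<in> N" using G_0[OF P_T0[OF a(3) w(1)]] P_N[OF a(3) w(1)] by simp
    then show ?thesis using conormal_coords_iff[OF N_T0 a(4) w(2)] by blast
  qed
  have mem: "?w \<in> {w \<in> Om c. fst (G 0 (P c w)) \<in> fst c'}" using a by simp
  have zero: "F (L c c' 0 ?w v) = 0" if F: "bounded_linear F" and F0: "\<And>y. y \<in> range (split_cn D) \<Longrightarrow> F y = 0" for F :: "_ \<Rightarrow> real^'n"
  proof -
    have "((\<lambda>w. 0) has_derivative (\<lambda>v. F (L c c' 0 ?w v))) (at ?w)"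
      by (rule has_derivative_transform_within_open[OF bounded_linear.has_derivative[OF F d] landing_open'[OF a(3,4)] mem])
         (rule F0[OF rng])
    then have "(\<lambda>v. F (L c c' 0 ?w v)) = (\<lambda>v. 0)" by (rule has_derivative_unique) simp
    then show ?thesis by (rule fun_cong)
  qed
  have "proj (- D) (fst (L c c' 0 ?w v)) = 0"
    by (rule zero[OF bounded_linear_compose[OF bounded_linear_proj bounded_linear_fst]]) (simp add: range_split_iff)
  moreover have "proj D (snd (L c c' 0 ?w v)) = 0"
    by (rule zero[OF bounded_linear_compose[OF bounded_linear_proj bounded_linear_snd]]) (simp add: range_split_iff)
  ultimately show "L c c' 0 ?w v \<in> range (split_cn D)" by (simp add: range_split_iff)
qed

lemma slice_pair_0_sym: "slice_pair c c' 0 z \<Longrightarrow> slice_pair c' c 0 z" and slice_pair_0_refl: "slice_pair c c' 0 z \<Longrightarrow> slice_pair c c 0 z"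
  using G_0[OF N_T0, of z] by (auto simp: slice_pair_def)

text \<open>The case of a coordinate change: the matrices of the two opposite changes are inverse to
  each other.\<close>
lemma clean_0:
  assumes "slice_pair c c' 0 z" shows "clean c c' 0 z"
proof -
  note a = slice_pairD[OF assms]
  have z0: "G 0 z = z" by (rule G_0[OF N_T0[OF a(1)]])
  have cn': "slice_pair c' c 0 (G 0 z)" using slice_pair_0_sym[OF assms] z0 by simp
  note b = slice_pairD[OF cn']
  have cc: "slice_pair c c 0 z" by (rule slice_pair_0_refl[OF assms])
  have "M c c 0 (slice_coords c z) *v v = (M c' c 0 (slice_coords c' (G 0 z)) ** M c c' 0 (slice_coords c z)) *v v" for v
    unfolding matrix_vector_mul_assoc[symmetric] M_works[OF a(3,4,7,9)] M_works[OF b(3,4,7,9)]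
    using L_chain[OF assms cn' tangent_0[OF assms]] M_works[OF slice_pairD(3,4,7,9)[OF cc]] by simp
  then have "M c' c 0 (slice_coords c' (G 0 z)) ** M c c' 0 (slice_coords c z) = mat 1" using M_0[OF cc] by (simp add: matrix_eq)
  then have "det (M c' c 0 (slice_coords c' (G 0 z))) * det (M c c' 0 (slice_coords c z)) = 1" by (metis det_I det_mul)
  then show ?thesis using tangent_0[OF assms] by (auto simp: clean_def)
qed

text \<open>Compose with coordinate changes, which are clean returns at time 0, on both
  sides.\<close>
lemma clean_charts:
  assumes cn: "slice_pair c c' t z" "slice_pair d d' t z" and gd: "clean c c' t z"
  shows "clean d d' t z"
proof -
  note a = slice_pairD[OF cn(1)] and b = slice_pairD[OF cn(2)]
  have z0: "G 0 z = z" "G 0 (G t z) = G t z" using G_0 N_T0 a(1,2) by blast+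
  have 1: "slice_pair d c 0 z" "slice_pair c' d' 0 (G t z)" using a b z0 by (auto simp: slice_pair_def)
  have "slice_pair d c' (t + 0) z" "clean d c' (t + 0) z"
    using clean_comp[OF 1(1), of c' t] cn(1) gd clean_0[OF 1(1)] z0 by auto
  then have 2: "slice_pair d c' t z" "clean d c' t z" by auto
  show ?thesis using clean_comp(2)[OF 2(1) 1(2) 2(2) clean_0[OF 1(2)]] by simp
qed

text \<open>By the chain rule the derivative of \<open>G\<^sup>-\<^sup>t\<close> undoes that of
  \<open>G\<^sup>t\<close> on conormal directions. As \<open>M\<close> is invertible, every conormal
  direction at \<open>G\<^sup>t z\<close> is the image of one at \<open>z\<close>, so the return at
  time \<open>-t\<close> is tangential as well.\<close>
lemma clean_inverse:
  assumes cn: "slice_pair c c' t z" and gd: "clean c c' t z"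
  shows "slice_pair c' c (- t) (G t z)" "clean c' c (- t) (G t z)"
proof -
  note a = slice_pairD[OF cn]
  have zT: "z \<in> T0" by (rule N_T0[OF a(1)])
  have inv: "G (- t) (G t z) = z" by (rule G_minus(1)[OF zT])
  show cn': "slice_pair c' c (- t) (G t z)" using a inv by (simp add: slice_pair_def)
  note b = slice_pairD[OF cn']
  have cc: "slice_pair c c 0 z" using a G_0[OF zT] by (simp add: slice_pair_def)
  have tg: "tangent c c' t (slice_coords c z)" and dt: "det (M c c' t (slice_coords c z)) \<noteq> 0" using gd by (auto simp: clean_def)
  have ch: "L c' c (- t) (slice_coords c' (G t z)) (merge_cn D (L c c' t (slice_coords c z) v)) = split_cn D v" for v
    using L_chain[OF cn cn' tg, of v] L_0[OF cc] by simp
  have "tangent c' c (- t) (slice_coords c' (G t z))"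
    unfolding tangent_def
  proof
    fix u
    obtain B where B: "M c c' t (slice_coords c z) ** B = mat 1" using dt invertible_det_nz[of "M c c' t (slice_coords c z)"] by (auto simp: invertible_def)
    have "u = M c c' t (slice_coords c z) *v (B *v u)" by (simp add: matrix_vector_mul_assoc B)
    then have "u = merge_cn D (L c c' t (slice_coords c z) (B *v u))" unfolding M_works[OF a(3,4,7,9)] .
    then show "L c' c (- t) (slice_coords c' (G t z)) u \<in> range (split_cn D)" using ch[of "B *v u"] by simp
  qed
  moreover have "M c' c (- t) (slice_coords c' (G t z)) ** M c c' t (slice_coords c z) = mat 1"
  proof -
    have "(M c' c (- t) (slice_coords c' (G t z)) ** M c c' t (slice_coords c z)) *v v = mat 1 *v v" for v
      unfolding matrix_vector_mul_assoc[symmetric] M_works[OF a(3,4,7,9)] M_works[OF b(3,4,7,9)] ch by simp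
    then show ?thesis by (simp add: matrix_eq)
  qed
  then have "det (M c' c (- t) (slice_coords c' (G t z))) * det (M c c' t (slice_coords c z)) = 1" by (metis det_I det_mul)
  ultimately show "clean c' c (- t) (G t z)" by (auto simp: clean_def)
qed

lemma slice_at_slice_pair:
  assumes "z \<in> N" "G t z \<in> N"
  shows "slice_pair (slice_at A D H (fst z)) (slice_at A D H (fst (G t z))) t z"
  using assms slice_at[OF N_H[OF assms(1)]] slice_at[OF N_H[OF assms(2)]] by (simp add: slice_pair_def)

lemma conormal_deriv_eq:
  assumes "z \<in> N" "G t z \<in> N"
  shows "conormal_deriv A D H G t z = L (slice_at A D H (fst z)) (slice_at A D H (fst (G t z))) t (slice_coords (slice_at A D H (fst z)) z)"
proof -
  note a = slice_pairD[OF slice_at_slice_pair[OF assms]]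
  show ?thesis unfolding conormal_deriv_def Let_def
    using frechet_derivative_at[OF L_deriv[OF a(3,4,7,9)]] by (simp add: slice_coords_def)
qed

text \<open>The definition of \<open>\<Sigma>\<^sub>t\<close> refers to arbitrarily chosen slice
  charts; any other pair will do.\<close>
lemma Sigma_iff:
  assumes cn: "slice_pair c c' t z" shows "z \<in> Sigma_t A D H G t \<longleftrightarrow> clean c c' t z"
proof -
  note a = slice_pairD[OF cn]
  let ?c = "slice_at A D H (fst z)" and ?c' = "slice_at A D H (fst (G t z))"
  have cn0: "slice_pair ?c ?c' t z" by (rule slice_at_slice_pair[OF a(1,2)])
  note b = slice_pairD[OF cn0]
  let ?w = "slice_coords ?c z"
  let ?L = "L ?c ?c' t ?w"
  have lin: "linear ?L" "linear (\<lambda>v. merge_cn D (?L v))" using L_linear[OF b(3,4,7,9)] .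
  have "bij_betw ?L UNIV (range (split_cn D)) \<longleftrightarrow> clean ?c ?c' t z"
  proof
    assume bij: "bij_betw ?L UNIV (range (split_cn D))"
    then have tg: "tangent ?c ?c' t ?w" by (auto simp: tangent_def bij_betw_def)
    have "inj (\<lambda>v. merge_cn D (?L v))"
    proof (rule injI)
      fix u v assume "merge_cn D (?L u) = merge_cn D (?L v)"
      then have "split_cn D (merge_cn D (?L u)) = split_cn D (merge_cn D (?L v))" by simp
      then have "?L u = ?L v" using tg by (simp add: tangent_def split_merge)
      then show "u = v" using bij by (auto simp: bij_betw_def dest: injD)
    qed
    then have "det (M ?c ?c' t ?w) \<noteq> 0" unfolding M_def using det_nz_iff_inj[OF lin(2)] by simp
    then show "clean ?c ?c' t z" using tg by (simp add: clean_def)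
  next
    assume gd: "clean ?c ?c' t z"
    then have inj: "inj (\<lambda>v. merge_cn D (?L v))" using det_nz_iff_inj[OF lin(2)] by (simp add: clean_def M_def)
    then have surj: "surj (\<lambda>v. merge_cn D (?L v))" by (rule linear_inj_imp_surj[OF lin(2)])
    have tg: "?L v \<in> range (split_cn D)" for v using gd by (simp add: clean_def tangent_def)
    show "bij_betw ?L UNIV (range (split_cn D))"
      unfolding bij_betw_def
    proof
      show "inj ?L"
      proof (rule injI)
        fix u v assume "?L u = ?L v"
        then have "merge_cn D (?L u) = merge_cn D (?L v)" by simp
        then show "u = v" using injD[OF inj] by blast
      qed
      show "range ?L = range (split_cn D)"
      proof
        show "range ?L \<subseteq> range (split_cn D)" using tg by blast
        show "range (split_cn D) \<subseteq> range ?L"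
        proof
          fix y assume "y \<in> range (split_cn D)"
          then obtain u where u: "y = split_cn D u" by blast
          obtain v where v: "u = merge_cn D (?L v)" using surj by (metis surjD)
          have "y = ?L v" unfolding u v by (rule split_merge[OF tg])
          then show "y \<in> range ?L" by blast
        qed
      qed
    qed
  qed
  moreover have "z \<in> Sigma_t A D H G t \<longleftrightarrow> bij_betw ?L UNIV (range (split_cn D))"
    unfolding Sigma_t_def using a(1,2) conormal_deriv_eq[OF a(1,2)] by simp
  moreover have "clean ?c ?c' t z \<longleftrightarrow> clean c c' t z" using clean_charts cn cn0 by blast
  ultimately show ?thesis by blast
qed

lemma Sigma_ND: "z \<in> Sigma_t A D H G t \<Longrightarrow> z \<in> N \<and> G t z \<in> N"
  by (simp add: Sigma_t_def)

lemma Sigma_slice_pair: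
  assumes "z \<in> Sigma_t A D H G t"
  obtains c c' where "slice_pair c c' t z" "clean c c' t z"
proof -
  have n: "z \<in> N" "G t z \<in> N" using Sigma_ND[OF assms] by auto
  have cn: "slice_pair (slice_at A D H (fst z)) (slice_at A D H (fst (G t z))) t z" by (rule slice_at_slice_pair[OF n])
  then have "clean (slice_at A D H (fst z)) (slice_at A D H (fst (G t z))) t z" using Sigma_iff assms by blast
  with cn show thesis by (rule that)
qed

lemma Sigma_add:
  assumes "z \<in> Sigma_t A D H G t" "G t z \<in> Sigma_t A D H G s"
  shows "z \<in> Sigma_t A D H G (s + t)"
proof -
  have n: "z \<in> N" "G t z \<in> N" "G s (G t z) \<in> N" using Sigma_ND assms by auto
  obtain c c' c'' where c: "c \<in> SC" "fst z \<in> fst c" "c' \<in> SC" "fst (G t z) \<in> fst c'" "c'' \<in> SC" "fst (G s (G t z)) \<in> fst c''"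
    using slice_exists[OF N_H[OF n(1)]] slice_exists[OF N_H[OF n(2)]] slice_exists[OF N_H[OF n(3)]] by blast
  have cn: "slice_pair c c' t z" "slice_pair c' c'' s (G t z)" using n c by (auto simp: slice_pair_def)
  show ?thesis using clean_comp[OF cn] Sigma_iff cn assms by blast
qed

lemma Sigma_minus:
  assumes "z \<in> Sigma_t A D H G t" shows "G t z \<in> Sigma_t A D H G (- t)"
proof -
  obtain c c' where "slice_pair c c' t z" "clean c c' t z" by (rule Sigma_slice_pair[OF assms])
  from clean_inverse[OF this] show ?thesis using Sigma_iff by blast
qed

abbreviation "cdens c q \<equiv> conormal_density g D c q"

text \<open>The matrix in the definition is block diagonal with a compression of \<open>a\<close>
  and an identity block, and is again positive definite.\<close>
lemma sub_det_pos:
  fixes a :: "real^'n^'n"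
  assumes a: "\<And>v. v \<noteq> 0 \<Longrightarrow> v \<bullet> (a *v v) > 0"
  shows "sub_det D a > 0"
  unfolding sub_det_def
proof (rule pos_def_det_pos)
  fix v :: "real^'n" assume v: "v \<noteq> 0"
  let ?b = "(\<chi> i j. if i \<in> D \<and> j \<in> D then a $ i $ j else if i = j then 1 else 0) :: real^'n^'n"
  have row: "(?b *v v) $ i = (if i \<in> D then (a *v proj D v) $ i else v $ i)" for i
  proof (cases "i \<in> D")
    case True
    have "(\<Sum>j\<in>UNIV. ?b $ i $ j * v $ j) = (\<Sum>j\<in>UNIV. a $ i $ j * proj D v $ j)"
      by (rule sum.cong) (use True in auto)
    then show ?thesis using True by (simp add: matrix_vector_mult_def)
  next
    case False
    have "(\<Sum>j\<in>UNIV. ?b $ i $ j * v $ j) = (\<Sum>j\<in>UNIV. if i = j then v $ i else 0)"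
      by (rule sum.cong) (use False in auto)
    then show ?thesis using False by (simp add: matrix_vector_mult_def)
  qed
  have "v \<bullet> (?b *v v) = (\<Sum>i\<in>UNIV. proj D v $ i * (a *v proj D v) $ i + proj (- D) v $ i * proj (- D) v $ i)"
    unfolding inner_vec_def inner_real_def row by (rule sum.cong) auto
  also have "\<dots> = proj D v \<bullet> (a *v proj D v) + proj (- D) v \<bullet> proj (- D) v"
    by (simp add: inner_vec_def sum.distrib)
  also have "\<dots> > 0"
  proof (cases "proj D v = 0")
    case True
    then have "proj (- D) v \<noteq> 0" using v by (auto simp: vec_eq_iff split: if_splits)
    then show ?thesis using True by simp
  next
    case False
    then have "proj D v \<bullet> (a *v proj D v) > 0" by (rule a)
    then show ?thesis by (simp add: add_pos_nonneg)
  qed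
  finally show "v \<bullet> (?b *v v) > 0" .
qed

lemma cdens_pos: "c \<in> A \<Longrightarrow> q \<in> fst c \<Longrightarrow> cdens c q > 0"
  unfolding conormal_density_def using sub_det_pos[of "g c q"] pos_def_det_pos[of "g c q"] g_pos[of c q] by simp

lemma cdens_cont: "c \<in> A \<Longrightarrow> continuous_on (crange c) (\<lambda>x. cdens c (cinv c x))"
proof -
  assume c: "c \<in> A"
  have "continuous_on (crange c) (g c \<circ> cinv c)" by (rule smooth_on_continuous[OF g_smooth[OF c]])
  then have ij: "continuous_on (crange c) (\<lambda>x. g c (cinv c x) $ i $ j)" for i j
    by (intro continuous_on_component) (simp add: o_def)
  have 1: "continuous_on (crange c) (\<lambda>x. sub_det D (g c (cinv c x)))"
    unfolding sub_det_def
  proof (rule continuous_on_det)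
    fix i j show "continuous_on (crange c) (\<lambda>x. (\<chi> i j. if i \<in> D \<and> j \<in> D then g c (cinv c x) $ i $ j else if i = j then 1 else 0) $ i $ j)"
      using ij[of i j] by (cases "i \<in> D"; cases "j \<in> D"; cases "i = j") simp_all
  qed
  have 2: "continuous_on (crange c) (\<lambda>x. sqrt (det (g c (cinv c x))))" by (intro continuous_intros ij)
  have "\<And>x. x \<in> crange c \<Longrightarrow> sqrt (det (g c (cinv c x))) \<noteq> 0" using g_inv[OF c cinv_in[OF c]] by simp
  then show ?thesis unfolding conormal_density_def by (intro continuous_on_divide 1 2) blast
qed

definition J :: "('m, 'n) chart \<Rightarrow> ('m, 'n) chart \<Rightarrow> real \<Rightarrow> ('m, 'n) cov \<Rightarrow> real" where
  "J c c' t z = \<bar>det (M c c' t (slice_coords c z))\<bar> * cdens c' (fst (G t z)) / cdens c (fst z)"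

lemma J_pos: "slice_pair c c' t z \<Longrightarrow> clean c c' t z \<Longrightarrow> J c c' t z > 0"
  using slice_pairD[of c c' t z] cdens_pos SC_A by (simp add: J_def clean_def)

lemma J_comp:
  assumes cn: "slice_pair c c' t z" "slice_pair c' c'' s (G t z)" and gd: "clean c c' t z" "clean c' c'' s (G t z)"
  shows "J c c'' (s + t) z = J c' c'' s (G t z) * J c c' t z"
proof -
  note a = slice_pairD[OF cn(1)]
  have "cdens c' (fst (G t z)) > 0" using cdens_pos[OF SC_A[OF a(4)] a(6)] .
  then show ?thesis
    unfolding J_def clean_comp(3)[OF assms] det_mul G_add[OF N_T0[OF a(1)]] by (simp add: abs_mult)
qed

lemma jacobian_eq_J:
  assumes "z \<in> N" "G t z \<in> N"
  shows "jacobian A g D H G t z = J (slice_at A D H (fst z)) (slice_at A D H (fst (G t z))) t z"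
  unfolding jacobian_def Let_def conormal_deriv_eq[OF assms] J_def M_def ..

lemma slice_pair_cscale:
  assumes cn: "slice_pair c c' t z" and r: "r > 0" shows "slice_pair c c' t (cscale r z)"
  using slice_pairD[OF cn] cscale_N[OF _ r] G_cscale[OF N_T0 r] by (simp add: slice_pair_def)

text \<open>The flow commutes with dilations. In canonical coordinates a dilation multiplies the
  momenta only, and on the conormal parameters it is the linear map \<open>dilate D r\<close> on
  both sides, whose determinants cancel.\<close>
lemma M_cscale:
  assumes cn: "slice_pair c c' t z" and r: "r > 0"
  shows "tangent c c' t (slice_coords c (cscale r z)) \<longleftrightarrow> tangent c c' t (slice_coords c z)"
    and "det (M c c' t (slice_coords c (cscale r z))) = det (M c c' t (slice_coords c z))"
proof -
  note a = slice_pairD[OF cn] and b = slice_pairD[OF slice_pair_cscale[OF cn r]]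
  let ?w = "slice_coords c z" and ?S = "\<lambda>y. (fst y, r *\<^sub>R snd y) :: (real^'n) \<times> (real^'n)"
  let ?f = "\<lambda>w. coords c' (G t (P c w))"
  have dl: "bounded_linear (dilate D r :: real^'n \<Rightarrow> real^'n)" using linear_dilate linear_conv_bounded_linear by blast
  have S: "bounded_linear ?S" by (intro bounded_linear_Pair bounded_linear_fst bounded_linear_scaleR_right[THEN bounded_linear_compose] bounded_linear_snd)
  have w': "slice_coords c (cscale r z) = dilate D r ?w" by (rule slice_coords_cscale)
  have "(?f has_derivative L c c' t (dilate D r ?w)) (at (dilate D r ?w))"
    using L_deriv[OF b(3,4,7,9)] unfolding w' .
  then have d1: "((\<lambda>w. ?f (dilate D r w)) has_derivative (\<lambda>v. L c c' t (dilate D r ?w) (dilate D r v))) (at ?w)"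
    by (rule has_derivative_compose[OF bounded_linear_imp_has_derivative[OF dl]])
  have "((\<lambda>w. ?S (?f w)) has_derivative (\<lambda>v. ?S (L c c' t ?w v))) (at ?w)"
    by (rule bounded_linear.has_derivative[OF S L_deriv[OF a(3,4,7,9)]])
  then have d2: "((\<lambda>w. ?f (dilate D r w)) has_derivative (\<lambda>v. ?S (L c c' t ?w v))) (at ?w)"
  proof (rule has_derivative_transform_within_open[OF _ Om_open[OF a(3)] a(7)])
    fix w assume w: "w \<in> Om c"
    show "?S (?f w) = ?f (dilate D r w)"
      unfolding P_dilate[OF a(3) w] G_cscale[OF P_T0[OF a(3) w] r] by simp
  qed
  have eq: "L c c' t (dilate D r ?w) (dilate D r v) = ?S (L c c' t ?w v)" for v
    using fun_cong[OF has_derivative_unique[OF d1 d2]] .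
  have rng: "?S y \<in> range (split_cn D) \<longleftrightarrow> y \<in> range (split_cn D)" for y
    using r by (simp add: range_split_iff vec_eq_iff)
  have dinv: "dilate D r (dilate D (1 / r) v) = v" for v :: "real^'n" using r by simp
  show "tangent c c' t (slice_coords c (cscale r z)) \<longleftrightarrow> tangent c c' t (slice_coords c z)"
    unfolding w' tangent_def
  proof
    assume h: "\<forall>v. L c c' t (dilate D r ?w) v \<in> range (split_cn D)"
    show "\<forall>v. L c c' t ?w v \<in> range (split_cn D)"
      using h eq rng by metis
  next
    assume h: "\<forall>v. L c c' t ?w v \<in> range (split_cn D)"
    show "\<forall>v. L c c' t (dilate D r ?w) v \<in> range (split_cn D)"
    proof
      fix v
      have "L c c' t (dilate D r ?w) v = ?S (L c c' t ?w (dilate D (1 / r) v))" using eq[of "dilate D (1 / r) v"] unfolding dinv .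
      then show "L c c' t (dilate D r ?w) v \<in> range (split_cn D)" using h rng by simp
    qed
  qed
  let ?D = "matrix (dilate D r) :: real^'n^'n"
  have Dw: "?D *v v = dilate D r v" for v
    by (simp add: matrix_works linear_matrix_vector_mul_eq linear_dilate)
  have mS: "merge_cn D (?S y) = dilate D r (merge_cn D y)" for y by (simp add: merge_cn_def vec_eq_iff)
  have "(M c c' t (dilate D r ?w) ** ?D) *v v = (?D ** M c c' t ?w) *v v" for v
    unfolding matrix_vector_mul_assoc[symmetric] Dw M_works[OF a(3,4,7,9)]
    using M_works[OF b(3,4,7,9), of "dilate D r v"] unfolding w' eq mS by simp
  then have "M c c' t (dilate D r ?w) ** ?D = ?D ** M c c' t ?w" by (simp add: matrix_eq)
  then have "det (M c c' t (dilate D r ?w)) * det ?D = det ?D * det (M c c' t ?w)" by (metis det_mul)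
  moreover have "det ?D \<noteq> 0"
  proof -
    have "inj (dilate D r :: real^'n \<Rightarrow> real^'n)"
    proof (rule injI)
      fix x y :: "real^'n" assume "dilate D r x = dilate D r y"
      then have "dilate D (1 / r) (dilate D r x) = dilate D (1 / r) (dilate D r y)" by simp
      then show "x = y" using r by simp
    qed
    then show ?thesis using det_nz_iff_inj[OF linear_dilate] by blast
  qed
  ultimately show "det (M c c' t (slice_coords c (cscale r z))) = det (M c c' t (slice_coords c z))" unfolding w' by simp
qed

lemma clean_cscale: "slice_pair c c' t z \<Longrightarrow> r > 0 \<Longrightarrow> clean c c' t (cscale r z) \<longleftrightarrow> clean c c' t z"
  unfolding clean_def by (simp add: M_cscale)

lemma J_cscale: "slice_pair c c' t z \<Longrightarrow> r > 0 \<Longrightarrow> J c c' t (cscale r z) = J c c' t z"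
  unfolding J_def using G_cscale[OF N_T0, of z r t] slice_pairD(1)[of c c' t z] by (simp add: M_cscale)

end

section \<open>The Leray measure of the conormal bundle\<close>
text \<open>If \<open>\<theta>\<close> depends to first order only on time, with nonzero slope, then
  on a level set the time is constant to first order. Continuity of \<open>\<tau>\<close> brings the
  points \<open>(\<tau> y, y)\<close> into the range of the first-order expansion at \<open>(\<tau>
  x, x)\<close>.\<close>
lemma implicit_derivative_zero:
  fixes \<theta> :: "real \<times> 'a::real_normed_vector \<Rightarrow> real" and \<tau> :: "'a \<Rightarrow> real"
  assumes d: "(\<theta> has_derivative (\<lambda>p. fst p * k)) (at (\<tau> x, x))" and k: "k \<noteq> 0"
    and cont: "continuous (at x within S) \<tau>"
    and eq: "\<And>y. y \<in> S \<Longrightarrow> \<theta> (\<tau> y, y) = \<theta> (\<tau> x, x)"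
  shows "(\<tau> has_derivative (\<lambda>_. 0)) (at x within S)"
  unfolding has_derivative_within_alt
proof (intro conjI allI impI bounded_linear_zero)
  fix e :: real assume e: "e > 0"
  define e1 where "e1 = min (\<bar>k\<bar> / 2) (e * \<bar>k\<bar> / 2)"
  have e1: "e1 > 0" using e k by (simp add: e1_def)
  obtain d1 where d1: "d1 > 0" "\<And>p. norm (p - (\<tau> x, x)) < d1 \<Longrightarrow>
      norm (\<theta> p - \<theta> (\<tau> x, x) - fst (p - (\<tau> x, x)) * k) \<le> e1 * norm (p - (\<tau> x, x))"
    using d e1 unfolding has_derivative_at_alt by blast
  obtain d2 where d2: "d2 > 0" "\<And>y. y \<in> S \<Longrightarrow> dist y x < d2 \<Longrightarrow> dist (\<tau> y) (\<tau> x) < d1 / 2"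
    using cont d1(1) unfolding continuous_within_eps_delta by (meson half_gt_zero)
  show "\<exists>d>0. \<forall>y\<in>S. norm (y - x) < d \<longrightarrow> norm (\<tau> y - \<tau> x - 0) \<le> e * norm (y - x)"
  proof (intro exI[of _ "min d2 (d1 / 2)"] conjI ballI impI)
    fix y assume y: "y \<in> S" "norm (y - x) < min d2 (d1 / 2)"
    have b: "\<bar>\<tau> y - \<tau> x\<bar> < d1 / 2" using d2(2)[OF y(1)] y(2) by (simp add: dist_norm)
    have le: "norm ((\<tau> y, y) - (\<tau> x, x)) \<le> \<bar>\<tau> y - \<tau> x\<bar> + norm (y - x)"
      using sqrt_sum_squares_le_sum[of "\<bar>\<tau> y - \<tau> x\<bar>" "norm (y - x)"] by (simp add: norm_Pair)
    also have "\<dots> < d1" using b y(2) by simp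
    finally have "norm (\<theta> (\<tau> y, y) - \<theta> (\<tau> x, x) - fst ((\<tau> y, y) - (\<tau> x, x)) * k) \<le> e1 * norm ((\<tau> y, y) - (\<tau> x, x))"
      by (rule d1(2))
    then have "\<bar>\<tau> y - \<tau> x\<bar> * \<bar>k\<bar> \<le> e1 * norm ((\<tau> y, y) - (\<tau> x, x))"
      unfolding eq[OF y(1)] by (simp add: abs_mult)
    also have "\<dots> \<le> e1 * (\<bar>\<tau> y - \<tau> x\<bar> + norm (y - x))" using le e1 by (intro mult_left_mono) auto
    finally have 1: "\<bar>\<tau> y - \<tau> x\<bar> * \<bar>k\<bar> \<le> e1 * \<bar>\<tau> y - \<tau> x\<bar> + e1 * norm (y - x)" by (simp add: distrib_left)
    have "e1 * \<bar>\<tau> y - \<tau> x\<bar> \<le> (\<bar>k\<bar> / 2) * \<bar>\<tau> y - \<tau> x\<bar>" by (intro mult_right_mono) (auto simp: e1_def)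
    moreover have "e1 * norm (y - x) \<le> (e * \<bar>k\<bar> / 2) * norm (y - x)" by (intro mult_right_mono) (auto simp: e1_def)
    ultimately have "\<bar>k\<bar> * \<bar>\<tau> y - \<tau> x\<bar> \<le> \<bar>k\<bar> * (e * norm (y - x))" using 1 by (simp add: algebra_simps)
    then show "norm (\<tau> y - \<tau> x - 0) \<le> e * norm (y - x)" using k by (simp add: mult_le_cancel_left_pos)
  qed (use d1 d2 in auto)
qed

locale conormal_measure = conormal_geometry A g D H G
  for A :: "('m::t2_space, 'n::finite) chart set" and g :: "('m, 'n) metric" and D :: "'n set" and H :: "'m set"
    and G :: "real \<Rightarrow> ('m, 'n) cov \<Rightarrow> ('m, 'n) cov" +
  fixes lam :: "('m, 'n) cov measure"
  assumes leray: "leray_measure A g D H lam"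
begin

abbreviation "SN \<equiv> unit_conormal A g D H"

text \<open>Coordinate expressions in a slice chart: \<open>cnorm\<close> of \<open>p\<close>,
  \<open>to_unit\<close> of the radial projection to the unit conormal bundle,
  \<open>dens_at\<close> of the natural density; \<open>unit_dom\<close> parametrizes the part
  \<open>unit_over\<close> of the unit conormal bundle over the chart.\<close>
definition cnorm :: "('m, 'n) chart \<Rightarrow> real^'n \<Rightarrow> real" where "cnorm c w = ham g c (split_cn D w)"
definition to_unit :: "('m, 'n) chart \<Rightarrow> real^'n \<Rightarrow> real^'n" where "to_unit c w = dilate D (1 / cnorm c w) w"
definition dens_at :: "('m, 'n) chart \<Rightarrow> real^'n \<Rightarrow> real" where "dens_at c w = cdens c (cinv c (proj D w))"
definition unit_dom :: "('m, 'n) chart \<Rightarrow> (real^'n) set" where "unit_dom c = {w \<in> Om c. cnorm c w = 1}"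
definition unit_over :: "('m, 'n) chart \<Rightarrow> ('m, 'n) cov set" where "unit_over c = {z \<in> SN. fst z \<in> fst c}"

lemma space_lam: "space lam = SN" and sets_lam: "B \<in> sets lam \<longleftrightarrow> B \<subseteq> SN \<and> (\<forall>c\<in>SC. {w \<in> Om c. P c w \<in> B} \<in> sets borel)"
  using leray unfolding leray_measure_def by auto

lemma SN_N: "z \<in> SN \<longleftrightarrow> z \<in> N \<and> cov_norm A g z = 1"
  by (simp add: unit_conormal_def)

lemma cnorm_P: "c \<in> SC \<Longrightarrow> w \<in> Om c \<Longrightarrow> cnorm c w = cov_norm A g (P c w)"
proof -
  assume c: "c \<in> SC" and w: "w \<in> Om c"
  show ?thesis unfolding cnorm_def
    using cov_norm_eq[OF T0_cot[OF P_T0[OF c w]] SC_A[OF c] P_in[OF c w]] coords_P[OF c w] by simp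
qed

lemma cnorm_pos: "c \<in> SC \<Longrightarrow> w \<in> Om c \<Longrightarrow> cnorm c w > 0"
  using cnorm_P cov_norm_pos[OF P_T0] by simp

lemma cnorm_dilate: "r > 0 \<Longrightarrow> cnorm c (dilate D r w) = r * cnorm c w"
  by (simp add: cnorm_def split_dilate ham_scale)

lemma split_cont: "continuous_on S f \<Longrightarrow> continuous_on S (\<lambda>x. split_cn D (f x))"
  by (rule bounded_linear.continuous_on[OF bounded_linear_split_cn])

lemma cnorm_cont: "c \<in> SC \<Longrightarrow> continuous_on (Om c) (cnorm c)"
proof -
  assume c: "c \<in> SC"
  have "continuous_on {y. fst y \<in> crange c \<and> snd y \<noteq> 0} (ham g c)"
    by (intro continuous_at_imp_continuous_on ballI differentiable_imp_continuous_within ham_differentiable[OF SC_A[OF c]]) auto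
  then show ?thesis unfolding cnorm_def[abs_def]
    by (rule continuous_on_compose2[OF _ split_cont[OF continuous_on_id]]) (auto simp: Om_split)
qed

lemma dens_at_cont: "c \<in> SC \<Longrightarrow> continuous_on (Om c) (dens_at c)"
  unfolding dens_at_def[abs_def]
  by (rule continuous_on_compose2[OF cdens_cont[OF SC_A] continuous_on_proj[OF continuous_on_id]]) (auto simp: conormal_dom_def)

lemma dens_at_pos: "c \<in> SC \<Longrightarrow> w \<in> Om c \<Longrightarrow> dens_at c w > 0"
  unfolding dens_at_def by (intro cdens_pos SC_A cinv_in) (auto simp: conormal_dom_def)

lemma dens_at_P: "c \<in> SC \<Longrightarrow> w \<in> Om c \<Longrightarrow> dens_at c w = cdens c (fst (P c w))"
  by (simp add: dens_at_def fst_P)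

lemma to_unit_props:
  assumes c: "c \<in> SC" and w: "w \<in> Om c"
  shows to_unit_Om: "to_unit c w \<in> Om c" and cnorm_to_unit: "cnorm c (to_unit c w) = 1" and dilate_to_unit: "dilate D (cnorm c w) (to_unit c w) = w"
    and to_unit_unit_dom: "to_unit c w \<in> unit_dom c" and P_to_unit: "P c (to_unit c w) = cscale (1 / cnorm c w) (P c w)"
    and P_nm': "P c w = cscale (cnorm c w) (P c (to_unit c w))"
proof -
  have h: "cnorm c w > 0" using cnorm_pos[OF c w] .
  show o: "to_unit c w \<in> Om c" unfolding to_unit_def using h by (intro Om_dilate w) simp
  show o1: "cnorm c (to_unit c w) = 1" unfolding to_unit_def using h by (simp add: cnorm_dilate)
  show "dilate D (cnorm c w) (to_unit c w) = w" unfolding to_unit_def using h by simp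
  show "to_unit c w \<in> unit_dom c" using o o1 by (simp add: unit_dom_def)
  show e: "P c (to_unit c w) = cscale (1 / cnorm c w) (P c w)" unfolding to_unit_def by (rule P_dilate[OF c w])
  show "P c w = cscale (cnorm c w) (P c (to_unit c w))" unfolding e using h by simp
qed

lemma P_SN: "c \<in> SC \<Longrightarrow> w \<in> Om c \<Longrightarrow> P c w \<in> SN \<longleftrightarrow> cnorm c w = 1"
  using cnorm_P P_N by (simp add: SN_N)

lemma unit_dom_P: "c \<in> SC \<Longrightarrow> w \<in> unit_dom c \<Longrightarrow> P c w \<in> unit_over c"
  using P_SN[of c w] P_in[of c w] by (simp add: unit_dom_def unit_over_def)

lemma unit_over_W: "c \<in> SC \<Longrightarrow> z \<in> unit_over c \<Longrightarrow> slice_coords c z \<in> unit_dom c \<and> P c (slice_coords c z) = z"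
  using conormal_coords[of z c] P_SN[of c "slice_coords c z"] by (simp add: unit_over_def unit_dom_def SN_N)

lemma closed_in_open_borel:
  fixes f :: "'a::euclidean_space \<Rightarrow> 'b::t1_space"
  assumes "open S" "continuous_on S f" shows "{x \<in> S. f x = a} \<in> sets borel"
proof -
  have "open (S \<inter> f -` (- {a}))" by (rule continuous_open_preimage[OF assms(2,1)]) (intro open_Compl closed_singleton)
  moreover have "{x \<in> S. f x = a} = S - (S \<inter> f -` (- {a}))" by auto
  ultimately show ?thesis using assms(1) by simp
qed

lemma unit_dom_borel: "c \<in> SC \<Longrightarrow> unit_dom c \<in> sets borel"
  unfolding unit_dom_def by (rule closed_in_open_borel[OF Om_open cnorm_cont])

lemma over_open:
  assumes c: "c \<in> SC" "c' \<in> SC" shows "open {w \<in> Om c. fst (P c w) \<in> fst c'}"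
proof -
  have "{w \<in> Om c. fst (P c w) \<in> fst c'} = {w \<in> Om c. fst (G 0 (P c w)) \<in> fst c'}"
    using G_0[OF P_T0[OF c(1)]] by auto
  then show ?thesis using landing_open'[OF c, of 0] by simp
qed

lemma over_cont:
  assumes c: "c \<in> SC" "c' \<in> SC" shows "continuous_on {w \<in> Om c. fst (P c w) \<in> fst c'} (\<lambda>w. slice_coords c' (P c w))"
proof -
  have "continuous_on {w \<in> Om c. fst (P c w) \<in> fst c'} (\<lambda>w. coords c' (G 0 (P c w)))"
  proof (intro continuous_at_imp_continuous_on ballI)
    fix w assume "w \<in> {w \<in> Om c. fst (P c w) \<in> fst c'}"
    then have "w \<in> Om c" "fst (G 0 (P c w)) \<in> fst c'" using G_0[OF P_T0[OF c(1)]] by auto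
    from L_deriv[OF c this] show "isCont (\<lambda>w. coords c' (G 0 (P c w))) w" by (rule has_derivative_continuous)
  qed
  then have "continuous_on {w \<in> Om c. fst (P c w) \<in> fst c'} (\<lambda>w. merge_cn D (coords c' (G 0 (P c w))))"
    by (rule bounded_linear.continuous_on[OF bounded_linear_merge_cn])
  then show ?thesis
    by (rule continuous_on_eq) (use G_0[OF P_T0[OF c(1)]] in \<open>auto simp: slice_coords_def\<close>)
qed

text \<open>Seen in another slice chart, the image is the preimage of \<open>Q\<close> under a
  continuous coordinate change on an open set.\<close>
lemma P_image_sets:
  assumes c: "c \<in> SC" and Q: "Q \<in> sets borel" "Q \<subseteq> unit_dom c"
  shows "P c ` Q \<in> sets lam"
  unfolding sets_lam
proof (intro conjI ballI)
  show "P c ` Q \<subseteq> SN" using unit_dom_P[OF c] Q(2) by (auto simp: unit_over_def)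
  fix c2 assume c2: "c2 \<in> SC"
  let ?S = "{w \<in> Om c2. fst (P c2 w) \<in> fst c}"
  have S: "?S \<in> sets borel" using over_open[OF c2 c] by simp
  have eq: "{w \<in> Om c2. P c2 w \<in> P c ` Q} = ?S \<inter> (\<lambda>w. if w \<in> ?S then slice_coords c (P c2 w) else 0) -` Q"
  proof (intro set_eqI iffI)
    fix w assume "w \<in> {w \<in> Om c2. P c2 w \<in> P c ` Q}"
    then obtain u where u: "w \<in> Om c2" "u \<in> Q" "P c2 w = P c u" by auto
    have uO: "u \<in> Om c" using u(2) Q(2) by (auto simp: unit_dom_def)
    show "w \<in> ?S \<inter> (\<lambda>w. if w \<in> ?S then slice_coords c (P c2 w) else 0) -` Q"
      using u P_in[OF c uO] slice_coords_P[OF c uO] by simp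
  next
    fix w assume w: "w \<in> ?S \<inter> (\<lambda>w. if w \<in> ?S then slice_coords c (P c2 w) else 0) -` Q"
    then have w': "w \<in> Om c2" "fst (P c2 w) \<in> fst c" "slice_coords c (P c2 w) \<in> Q" by auto
    have "P c (slice_coords c (P c2 w)) = P c2 w" by (rule conormal_coords(3)[OF P_N[OF c2 w'(1)] c w'(2)])
    then show "w \<in> {w \<in> Om c2. P c2 w \<in> P c ` Q}" using w' by (auto intro!: image_eqI[of _ _ "slice_coords c (P c2 w)"])
  qed
  have "(\<lambda>w. if w \<in> ?S then slice_coords c (P c2 w) else 0) \<in> borel_measurable borel"
    using borel_measurable_continuous_on_if[OF S over_cont[OF c2 c], of "\<lambda>_. 0"] by simp
  from measurable_sets_borel[OF this Q(1)] show "{w \<in> Om c2. P c2 w \<in> P c ` Q} \<in> sets borel"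
    unfolding eq using S by simp
qed

lemma unit_over_eq: "c \<in> SC \<Longrightarrow> unit_over c = P c ` unit_dom c"
proof
  assume c: "c \<in> SC"
  show "unit_over c \<subseteq> P c ` unit_dom c"
  proof
    fix z assume "z \<in> unit_over c" then show "z \<in> P c ` unit_dom c" using unit_over_W[OF c] by (intro image_eqI[of _ _ "slice_coords c z"]) auto
  qed
  show "P c ` unit_dom c \<subseteq> unit_over c" using unit_dom_P[OF c] by blast
qed

lemma unit_over_sets: "c \<in> SC \<Longrightarrow> unit_over c \<in> sets lam"
  using P_image_sets[OF _ unit_dom_borel] unit_over_eq by simp

definition slice_coords0 :: "('m, 'n) chart \<Rightarrow> ('m, 'n) cov \<Rightarrow> real^'n" where "slice_coords0 c z = (if z \<in> unit_over c then slice_coords c z else 0)"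

lemma slice_coords0_measurable: "c \<in> SC \<Longrightarrow> slice_coords0 c \<in> borel_measurable lam"
proof (rule measurableI)
  fix B :: "(real^'n) set" assume c: "c \<in> SC" and B: "B \<in> sets borel"
  have "slice_coords0 c -` B \<inter> space lam = P c ` (B \<inter> unit_dom c) \<union> (if 0 \<in> B then space lam - unit_over c else {})"
  proof (intro set_eqI iffI)
    fix z assume z: "z \<in> slice_coords0 c -` B \<inter> space lam"
    show "z \<in> P c ` (B \<inter> unit_dom c) \<union> (if 0 \<in> B then space lam - unit_over c else {})"
    proof (cases "z \<in> unit_over c")
      case True
      then have "z \<in> P c ` (B \<inter> unit_dom c)" using z unit_over_W[OF c True] by (intro image_eqI[of _ _ "slice_coords c z"]) (auto simp: slice_coords0_def)
      then show ?thesis by blast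
    qed (use z in \<open>auto simp: slice_coords0_def\<close>)
  next
    fix z assume "z \<in> P c ` (B \<inter> unit_dom c) \<union> (if 0 \<in> B then space lam - unit_over c else {})"
    then show "z \<in> slice_coords0 c -` B \<inter> space lam"
    proof
      assume "z \<in> P c ` (B \<inter> unit_dom c)"
      then obtain w where w: "w \<in> B" "w \<in> unit_dom c" "z = P c w" by blast
      have "slice_coords c z = w" using slice_coords_P[OF c, of w] w by (simp add: unit_dom_def)
      then show ?thesis using unit_dom_P[OF c w(2)] w by (simp add: slice_coords0_def space_lam unit_over_def)
    next
      assume "z \<in> (if 0 \<in> B then space lam - unit_over c else {})"
      then show ?thesis by (auto simp: slice_coords0_def split: if_splits)
    qed
  qed
  moreover have "P c ` (B \<inter> unit_dom c) \<in> sets lam" using P_image_sets[OF c] unit_dom_borel[OF c] B by auto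
  ultimately show "slice_coords0 c -` B \<inter> space lam \<in> sets lam" using unit_over_sets[OF c] by simp
qed simp

lemma P_pullback_measurable:
  assumes c: "c \<in> SC" and F: "F \<in> borel_measurable lam"
  shows "(\<lambda>w. if w \<in> unit_dom c then F (P c w) else (0::ennreal)) \<in> borel_measurable borel"
proof -
  have "P c \<in> measurable (restrict_space borel (unit_dom c)) lam"
  proof (rule measurableI)
    fix w assume "w \<in> space (restrict_space borel (unit_dom c))"
    then show "P c w \<in> space lam" using unit_dom_P[OF c] by (auto simp: space_restrict_space space_lam unit_over_def)
  next
    fix B assume B: "B \<in> sets lam"
    have "{w \<in> Om c. P c w \<in> B} \<in> sets borel" using B c sets_lam by blast
    moreover have "P c -` B \<inter> space (restrict_space borel (unit_dom c)) = {w \<in> Om c. P c w \<in> B} \<inter> unit_dom c"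
      by (auto simp: space_restrict_space unit_dom_def)
    ultimately show "P c -` B \<inter> space (restrict_space borel (unit_dom c)) \<in> sets (restrict_space borel (unit_dom c))"
      using unit_dom_borel[OF c] by (auto simp: sets_restrict_space_iff)
  qed
  from measurable_compose[OF this F]
  have "(\<lambda>w. F (P c w) * indicator (unit_dom c) w) \<in> borel_measurable borel"
    using borel_measurable_restrict_space_iff_ennreal[of "unit_dom c" borel "\<lambda>w. F (P c w)"] unit_dom_borel[OF c] by simp
  moreover have "(\<lambda>w. F (P c w) * indicator (unit_dom c) w) = (\<lambda>w. if w \<in> unit_dom c then F (P c w) else 0)"
    by (auto simp: indicator_def fun_eq_iff)
  ultimately show ?thesis by simp
qed

text \<open>The part of \<open>lam\<close> over a slice chart, transported to the conormal
  parameters.\<close>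
definition chart_measure :: "('m, 'n) chart \<Rightarrow> (real^'n) measure" where
  "chart_measure c = distr (density lam (indicator (unit_over c))) borel (slice_coords0 c)"

lemma chart_measure_nn_integral:
  assumes c: "c \<in> SC" and k: "k \<in> borel_measurable borel"
  shows "(\<integral>\<^sup>+w. k w \<partial>chart_measure c) = (\<integral>\<^sup>+z\<in>unit_over c. k (slice_coords c z) \<partial>lam)"
proof -
  have "(\<integral>\<^sup>+w. k w \<partial>chart_measure c) = (\<integral>\<^sup>+z. indicator (unit_over c) z * k (slice_coords0 c z) \<partial>lam)"
    unfolding chart_measure_def using k unit_over_sets[OF c] slice_coords0_measurable[OF c] measurable_compose[OF slice_coords0_measurable[OF c] k]
    by (subst nn_integral_distr, simp, simp, subst nn_integral_density) auto
  also have "\<dots> = (\<integral>\<^sup>+z\<in>unit_over c. k (slice_coords c z) \<partial>lam)"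
    by (intro nn_integral_cong) (auto simp: slice_coords0_def indicator_def)
  finally show ?thesis .
qed

lemma card_pos: "card (- D) > 0"
proof -
  have "D \<noteq> UNIV" using card_D by auto
  then have "- D \<noteq> {}" by blast
  then show ?thesis by (simp add: card_gt_0_iff)
qed

lemma cone_measure_chart_measure:
  assumes c: "c \<in> SC" shows "cone_measure D (Om c) (cnorm c) (dens_at c) (chart_measure c)"
proof
  show "emeasure (chart_measure c) (- {w \<in> Om c. cnorm c w = 1}) = 0"
  proof -
    have b: "- unit_dom c \<in> sets borel" using unit_dom_borel[OF c] by simp
    have "emeasure (chart_measure c) (- unit_dom c) = (\<integral>\<^sup>+w. indicator (- unit_dom c) w \<partial>chart_measure c)" using b by (simp add: chart_measure_def)
    also have "\<dots> = (\<integral>\<^sup>+z\<in>unit_over c. indicator (- unit_dom c) (slice_coords c z) \<partial>lam)" by (rule chart_measure_nn_integral[OF c]) (use b in simp)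
    also have "\<dots> = (\<integral>\<^sup>+z. 0 \<partial>lam)" using unit_over_W[OF c] by (intro nn_integral_cong) (auto simp: indicator_def)
    finally show ?thesis by (simp add: unit_dom_def)
  qed
  fix h :: "real^'n \<Rightarrow> real" and K
  assume h: "continuous_on UNIV h" and K: "compact K" "K \<subseteq> Om c" "\<And>w. w \<notin> K \<Longrightarrow> h w = 0"
  have hb: "h \<in> borel_measurable borel" using h by (rule borel_measurable_continuous_onI)
  have "((\<lambda>s. LINT w:{w \<in> Om c. ham g c (split_cn D w) < s}|lborel. h w * cdens c (cinv c (proj D w)))
      has_real_derivative (LINT z:{z \<in> SN. fst z \<in> fst c}|lam. h (merge_cn D (coords c z)))) (at 1)"
    using leray c h K unfolding leray_measure_def by blast
  moreover have "(LINT z:{z \<in> SN. fst z \<in> fst c}|lam. h (merge_cn D (coords c z))) = (LINT w|chart_measure c. h w)"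
  proof -
    have "(LINT w|chart_measure c. h w) = (LINT z|density lam (indicator (unit_over c)). h (slice_coords0 c z))"
      unfolding chart_measure_def using hb slice_coords0_measurable[OF c] by (intro integral_distr) simp_all
    also have "density lam (indicator (unit_over c)) = density lam (\<lambda>z. ennreal (indicator (unit_over c) z))"
    proof -
      have "(\<lambda>z. ennreal (indicator (unit_over c) z)) = indicator (unit_over c)" by (auto simp: indicator_def fun_eq_iff)
      then show ?thesis by simp
    qed
    also have "(LINT z|density lam (\<lambda>z. ennreal (indicator (unit_over c) z)). h (slice_coords0 c z)) = (LINT z|lam. indicator (unit_over c) z *\<^sub>R h (slice_coords0 c z))"
      using unit_over_sets[OF c] measurable_compose[OF slice_coords0_measurable[OF c] hb] by (intro integral_density) auto
    also have "\<dots> = (LINT z:unit_over c|lam. h (merge_cn D (coords c z)))"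
      unfolding set_lebesgue_integral_def by (intro Bochner_Integration.integral_cong) (auto simp: slice_coords0_def slice_coords_def indicator_def)
    finally show ?thesis by (simp add: unit_over_def)
  qed
  ultimately show "((\<lambda>s. LINT w:{w \<in> Om c. cnorm c w < s}|lborel. h w * dens_at c w) has_real_derivative (LINT w|chart_measure c. h w)) (at 1)"
    by (simp add: cnorm_def dens_at_def)
qed (use Om_open[OF c] Om_dilate[of _ c] cnorm_cont[OF c] cnorm_pos[OF c] cnorm_dilate[of _ c] dens_at_cont[OF c] dens_at_pos[OF c] card_pos
    in \<open>simp_all add: dens_at_def chart_measure_def\<close>)

abbreviation "codim \<equiv> ennreal (real (card (- D)))"

text \<open>The polar coordinate formula for the part of \<open>lam\<close> over a slice
  chart.\<close>
lemma leray_piece: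
  assumes c: "c \<in> SC" and Q: "Q \<in> sets borel" "Q \<subseteq> unit_dom c" and k: "k \<in> borel_measurable borel"
  shows "(\<integral>\<^sup>+z\<in>P c ` Q. k (slice_coords c z) \<partial>lam)
     = codim * (\<integral>\<^sup>+w\<in>{w \<in> Om c. cnorm c w < 1 \<and> to_unit c w \<in> Q}. k (to_unit c w) * ennreal (dens_at c w) \<partial>lborel)"
proof -
  interpret cm: cone_measure D "Om c" "cnorm c" "dens_at c" "chart_measure c" by (rule cone_measure_chart_measure[OF c])
  have "(\<integral>\<^sup>+z\<in>P c ` Q. k (slice_coords c z) \<partial>lam) = (\<integral>\<^sup>+z\<in>unit_over c. (k (slice_coords c z) * indicator Q (slice_coords c z)) \<partial>lam)"
  proof (intro nn_integral_cong)
    fix z assume "z \<in> space lam"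
    have "z \<in> P c ` Q \<longleftrightarrow> z \<in> unit_over c \<and> slice_coords c z \<in> Q"
    proof
      assume "z \<in> P c ` Q"
      then obtain w where w: "w \<in> Q" "z = P c w" by blast
      then have "w \<in> unit_dom c" using Q by blast
      then show "z \<in> unit_over c \<and> slice_coords c z \<in> Q" using w unit_dom_P[OF c, of w] slice_coords_P[OF c, of w] by (simp add: unit_dom_def)
    next
      assume "z \<in> unit_over c \<and> slice_coords c z \<in> Q"
      then show "z \<in> P c ` Q" using unit_over_W[OF c, of z] by (intro image_eqI[of _ _ "slice_coords c z"]) auto
    qed
    then show "k (slice_coords c z) * indicator (P c ` Q) z = k (slice_coords c z) * indicator Q (slice_coords c z) * indicator (unit_over c) z"
      by (simp add: indicator_def)
  qed
  also have "\<dots> = (\<integral>\<^sup>+w. k w * indicator Q w \<partial>chart_measure c)"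
    by (rule chart_measure_nn_integral[OF c, symmetric]) (use k Q in simp)
  also have "\<dots> = codim * cm.c (\<lambda>w. k w * indicator Q w)"
    by (rule cm.nn_integral_eq_cone) (use k Q in simp)
  also have "cm.c (\<lambda>w. k w * indicator Q w) = (\<integral>\<^sup>+w\<in>{w \<in> Om c. cnorm c w < 1 \<and> to_unit c w \<in> Q}. k (to_unit c w) * ennreal (dens_at c w) \<partial>lborel)"
    unfolding cm.c_def cm.E_def cm.cone_def cm.nrm_def to_unit_def
    by (intro nn_integral_cong) (auto simp: indicator_def)
  finally show ?thesis .
qed

lemma lam_piece_finite:
  assumes c: "c \<in> SC" and K: "compact K" "K \<subseteq> unit_dom c" shows "emeasure lam (P c ` K) < \<infinity>"
proof -
  interpret cm: cone_measure D "Om c" "cnorm c" "dens_at c" "chart_measure c" by (rule cone_measure_chart_measure[OF c])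
  have Kb: "K \<in> sets borel" using compact_imp_closed[OF K(1)] by simp
  have "emeasure lam (P c ` K) = (\<integral>\<^sup>+z. indicator (P c ` K) z \<partial>lam)" using P_image_sets[OF c Kb K(2)] by simp
  also have "\<dots> \<le> (\<integral>\<^sup>+z\<in>unit_over c. indicator K (slice_coords c z) \<partial>lam)"
  proof (intro nn_integral_mono)
    fix z show "indicator (P c ` K) z \<le> (indicator K (slice_coords c z) * indicator (unit_over c) z :: ennreal)"
    proof (cases "z \<in> P c ` K")
      case True
      then obtain w where w: "w \<in> K" "z = P c w" by blast
      then have "w \<in> unit_dom c" using K by blast
      then show ?thesis using w unit_dom_P[OF c, of w] slice_coords_P[OF c, of w] by (simp add: unit_dom_def)
    qed simp
  qed
  also have "\<dots> = (\<integral>\<^sup>+w. indicator K w \<partial>chart_measure c)" by (rule chart_measure_nn_integral[OF c, symmetric]) (use Kb in simp)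
  also have "\<dots> = emeasure (chart_measure c) K" using Kb by (simp add: chart_measure_def)
  also have "\<dots> < \<infinity>" by (rule cm.compact_emeasure_finite[OF K(1)]) (use K(2) in \<open>auto simp: unit_dom_def\<close>)
  finally show ?thesis .
qed

lemma to_unit_cont: "c \<in> SC \<Longrightarrow> continuous_on (Om c) (to_unit c)"
  unfolding to_unit_def[abs_def] using cnorm_pos by (intro continuous_intros cnorm_cont) (auto simp: less_le)

text \<open>The unit conormal bundle is covered by finitely many compact pieces.\<close>
lemma lam_finite: "emeasure lam (space lam) < \<infinity>"
proof -
  obtain I :: "nat set" and cs Ks where I: "finite I" "\<And>i. i \<in> I \<Longrightarrow> cs i \<in> SC" "\<And>i. i \<in> I \<Longrightarrow> compact (Ks i)"
      "\<And>i. i \<in> I \<Longrightarrow> Ks i \<subseteq> Om (cs i)"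
      "\<And>z. z \<in> N \<Longrightarrow> \<exists>i\<in>I. \<exists>w\<in>Ks i. \<exists>r>0. z = cscale r (P (cs i) w)"
    by (rule finite_atlas) (rule that, assumption+)
  let ?K = "\<lambda>i. to_unit (cs i) ` Ks i"
  have K: "compact (?K i)" "?K i \<subseteq> unit_dom (cs i)" if i: "i \<in> I" for i
    using compact_continuous_image[OF continuous_on_subset[OF to_unit_cont[OF I(2)[OF i]] I(4)[OF i]] I(3)[OF i]]
      to_unit_unit_dom[OF I(2)[OF i]] I(4)[OF i] by auto
  have meas: "P (cs i) ` ?K i \<in> sets lam" if i: "i \<in> I" for i
    by (rule P_image_sets[OF I(2)[OF i] _ K(2)[OF i]]) (use compact_imp_closed[OF K(1)[OF i]] in simp)
  have "space lam \<subseteq> (\<Union>i\<in>I. P (cs i) ` ?K i)"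
  proof
    fix z assume "z \<in> space lam"
    then have z: "z \<in> N" "cov_norm A g z = 1" by (auto simp: space_lam SN_N)
    obtain i w r where i: "i \<in> I" "w \<in> Ks i" "r > 0" "z = cscale r (P (cs i) w)" using I(5)[OF z(1)] by blast
    have w: "w \<in> Om (cs i)" using I(4)[OF i(1)] i(2) by blast
    note c = I(2)[OF i(1)]
    have "1 = r * cnorm (cs i) w" using z(2) i(3) unfolding i(4) cov_norm_scale[OF T0_cot[OF P_T0[OF c w]]] cnorm_P[OF c w] by simp
    then have "r = 1 / cnorm (cs i) w" using cnorm_pos[OF c w] by (simp add: field_simps)
    then have "z = P (cs i) (to_unit (cs i) w)" using i(4) P_to_unit[OF c w] by simp
    then show "z \<in> (\<Union>i\<in>I. P (cs i) ` ?K i)" using i by blast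
  qed
  then have "emeasure lam (space lam) \<le> emeasure lam (\<Union>i\<in>I. P (cs i) ` ?K i)"
    using meas I(1) by (intro emeasure_mono sets.finite_UN) auto
  also have "\<dots> \<le> (\<Sum>i\<in>I. emeasure lam (P (cs i) ` ?K i))"
    using meas I(1) by (intro emeasure_subadditive_finite) auto
  also have "\<dots> < \<infinity>" using lam_piece_finite[OF I(2) K] I(1) by (simp add: ennreal_sum_less_top image_comp)
  finally show ?thesis .
qed

end

context conormal_measure
begin

section \<open>Transport of the Leray measure with a variable return time\<close>
text \<open>A compact set of pairs (time, conormal parameter of a unit covector) describing clean
  returns. As times differ by less than \<open>gap\<close>, the time is determined by the point:
  \<open>K\<close> is the graph of a function, continuous because \<open>K\<close> is
  compact.\<close>
definition piece :: "('m, 'n) chart \<Rightarrow> ('m, 'n) chart \<Rightarrow> (real \<times> (real^'n)) set \<Rightarrow> bool" where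
  "piece c c' K \<longleftrightarrow> compact K \<and> c \<in> SC \<and> c' \<in> SC \<and>
     (\<forall>(t, w)\<in>K. w \<in> unit_dom c \<and> slice_pair c c' t (P c w) \<and> clean c c' t (P c w)) \<and>
     (\<forall>p\<in>K. \<forall>q\<in>K. \<bar>fst p - fst q\<bar> < gap)"

definition landing :: "('m, 'n) chart \<Rightarrow> ('m, 'n) chart \<Rightarrow> (real \<times> (real^'n)) set" where
  "landing c c' = {p. snd p \<in> Om c \<and> fst (G (fst p) (P c (snd p))) \<in> fst c'}"

lemma landing_is_open: "c \<in> SC \<Longrightarrow> c' \<in> SC \<Longrightarrow> open (landing c c')"
  unfolding landing_def by (rule landing_open)

lemma flow_coords_cont: "c \<in> SC \<Longrightarrow> c' \<in> SC \<Longrightarrow> continuous_on (landing c c') (flow_coords c c')"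
proof (intro continuous_at_imp_continuous_on ballI)
  fix p assume c: "c \<in> SC" "c' \<in> SC" and p: "p \<in> landing c c'"
  obtain t w where tw: "p = (t, w)" by (cases p)
  have "w \<in> Om c" "fst (G t (P c w)) \<in> fst c'" using p tw by (auto simp: landing_def)
  from flow_coords_deriv[OF c this] show "isCont (flow_coords c c') p" unfolding tw by (rule has_derivative_continuous)
qed

lemma L_cont: "c \<in> SC \<Longrightarrow> c' \<in> SC \<Longrightarrow> continuous_on (landing c c') (\<lambda>p. L c c' (fst p) (snd p) v)"
  unfolding L_def
  by (rule continuous_on_compose2[OF dPsi_cont[OF SC_A SC_A]])
     (auto intro!: continuous_intros split_cont simp: landing_def mem_W_split)

lemma det_M_cont: "c \<in> SC \<Longrightarrow> c' \<in> SC \<Longrightarrow> continuous_on (landing c c') (\<lambda>p. det (M c c' (fst p) (snd p)))"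
proof -
  assume c: "c \<in> SC" "c' \<in> SC"
  have "continuous_on (landing c c') (\<lambda>p. merge_cn D (L c c' (fst p) (snd p) v))" for v
    by (rule bounded_linear.continuous_on[OF bounded_linear_merge_cn L_cont[OF c]])
  then have "continuous_on (landing c c') (\<lambda>p. M c c' (fst p) (snd p) $ i $ j)" for i j
    unfolding M_def matrix_def by (simp add: continuous_on_component)
  then show ?thesis by (rule continuous_on_det)
qed

lemma slice_pair_landing: "slice_pair c c' t (P c w) \<Longrightarrow> w \<in> Om c \<Longrightarrow> (t, w) \<in> landing c c'"
  by (simp add: slice_pair_def landing_def)

lemma J_alt:
  assumes c: "c \<in> SC" and w: "w \<in> Om c" and cn: "slice_pair c c' t (P c w)"
  shows "J c c' t (P c w) = \<bar>det (M c c' t w)\<bar> * dens_at c' (slice_coords c' (G t (P c w))) / dens_at c w"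
proof -
  note a = slice_pairD[OF cn]
  have "cdens c' (fst (G t (P c w))) = dens_at c' (slice_coords c' (G t (P c w)))"
    using dens_at_P[OF a(4) conormal_coords(2)[OF a(2,4,6)]] conormal_coords(3)[OF a(2,4,6)] by simp
  then show ?thesis unfolding J_def slice_coords_P[OF c w] dens_at_P[OF c w] by simp
qed

end

locale conormal_piece = conormal_measure A g D H G lam
  for A :: "('m::t2_space, 'n::finite) chart set" and g :: "('m, 'n) metric" and D :: "'n set" and H :: "'m set"
    and G :: "real \<Rightarrow> ('m, 'n) cov \<Rightarrow> ('m, 'n) cov" and lam :: "('m, 'n) cov measure" +
  fixes c c' :: "('m, 'n) chart" and K :: "(real \<times> (real^'n)) set"
  assumes piece: "piece c c' K"
begin

lemma c: "c \<in> SC" and c': "c' \<in> SC" and K_compact: "compact K"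
  using piece by (auto simp: piece_def)

text \<open>\<open>base\<close> is the domain of the time function \<open>\<tau>\<close> whose graph
  is \<open>K\<close>, and \<open>\<Phi>\<close> is the return map in conormal parameters.\<close>
definition base where "base = snd ` K"
definition \<tau> where "\<tau> w = fst (inv_into K snd w)"
definition \<Phi> where "\<Phi> w = slice_coords c' (G (\<tau> w) (P c w))"

lemma K_D:
  assumes "(t, w) \<in> K"
  shows "w \<in> unit_dom c" "w \<in> Om c" "slice_pair c c' t (P c w)" "clean c c' t (P c w)"
  using assms piece by (auto simp: piece_def unit_dom_def)

lemma K_gap: "p \<in> K \<Longrightarrow> q \<in> K \<Longrightarrow> \<bar>fst p - fst q\<bar> < gap"
  using piece by (auto simp: piece_def)

lemma K_inj: "inj_on snd K"
proof (rule inj_onI)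
  fix p q assume pq: "p \<in> K" "q \<in> K" "snd p = snd q"
  obtain t s w where e: "p = (t, w)" "q = (s, w)" using pq(3) by (metis prod.collapse)
  have cn: "slice_pair c c' t (P c w)" "slice_pair c c' s (P c w)" using K_D pq e by auto
  have "t = s" by (rule return_times_separated[OF N_T0[OF slice_pairD(1)[OF cn(1)]] slice_pairD(2)[OF cn(1)] slice_pairD(2)[OF cn(2)]])
     (use K_gap[OF pq(1,2)] e in simp)
  then show "p = q" using e by simp
qed

lemma \<tau>_eq: "(t, w) \<in> K \<Longrightarrow> \<tau> w = t"
  unfolding \<tau>_def using inv_into_f_f[OF K_inj, of "(t, w)"] by simp

lemma \<tau>_K: "w \<in> base \<Longrightarrow> (\<tau> w, w) \<in> K"
  unfolding base_def using \<tau>_eq by force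

lemma base_D:
  assumes "w \<in> base"
  shows "w \<in> unit_dom c" "w \<in> Om c" "slice_pair c c' (\<tau> w) (P c w)" "clean c c' (\<tau> w) (P c w)"
  using K_D[OF \<tau>_K[OF assms]] by auto

lemma base_compact: "compact base" unfolding base_def by (intro compact_continuous_image K_compact continuous_intros)

lemma graph_cont: "continuous_on base (\<lambda>w. (\<tau> w, w))"
  unfolding base_def by (rule continuous_on_inv[OF continuous_on_snd[OF continuous_on_id] K_compact]) (use \<tau>_eq in auto)

lemma \<tau>_cont: "continuous_on base \<tau>"
  using continuous_on_fst[OF graph_cont] by simp

lemma graph_landing: "w \<in> base \<Longrightarrow> (\<tau> w, w) \<in> landing c c'"
  using base_D slice_pair_landing by blast

lemma \<Phi>_cont: "continuous_on base \<Phi>"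
proof -
  have "continuous_on base (\<lambda>w. merge_cn D (flow_coords c c' (\<tau> w, w)))"
    by (rule bounded_linear.continuous_on[OF bounded_linear_merge_cn])
       (rule continuous_on_compose2[OF flow_coords_cont[OF c c'] graph_cont], use graph_landing in auto)
  then show ?thesis by (simp add: \<Phi>_def[abs_def] flow_coords_def slice_coords_def)
qed

lemma \<Phi>_P:
  assumes w: "w \<in> base" shows "P c' (\<Phi> w) = G (\<tau> w) (P c w)" "\<Phi> w \<in> unit_dom c'" "\<Phi> w \<in> Om c'"
proof -
  note a = slice_pairD[OF base_D(3)[OF w]]
  show e: "P c' (\<Phi> w) = G (\<tau> w) (P c w)" unfolding \<Phi>_def by (rule conormal_coords(3)[OF a(2,4,6)])
  show o: "\<Phi> w \<in> Om c'" unfolding \<Phi>_def by (rule conormal_coords(2)[OF a(2,4,6)])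
  have "cnorm c' (\<Phi> w) = cnorm c w" unfolding cnorm_P[OF c' o] cnorm_P[OF c base_D(2)[OF w]] e by (rule cov_norm_G[OF N_T0[OF a(1)]])
  then show "\<Phi> w \<in> unit_dom c'" using o base_D(1)[OF w] by (simp add: unit_dom_def)
qed

text \<open>Two points with the same image lie on one orbit, at a time distance less than
  \<open>gap\<close>, so they coincide.\<close>
lemma \<Phi>_inj: "inj_on \<Phi> base"
proof (rule inj_onI)
  fix w w' assume w: "w \<in> base" "w' \<in> base" and e: "\<Phi> w = \<Phi> w'"
  note a = base_D[OF w(1)] and b = base_D[OF w(2)]
  have T: "P c w \<in> T0" "P c w' \<in> T0" using P_T0[OF c a(2)] P_T0[OF c b(2)] .
  have Ge: "G (\<tau> w) (P c w) = G (\<tau> w') (P c w')" using \<Phi>_P(1)[OF w(1)] \<Phi>_P(1)[OF w(2)] e by simp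
  have "P c w = G (- \<tau> w) (G (\<tau> w') (P c w'))" using G_minus(1)[OF T(1), of "\<tau> w"] Ge by simp
  also have "\<dots> = G (\<tau> w' - \<tau> w) (P c w')" using G_add[OF T(2), of "- \<tau> w" "\<tau> w'"] by simp
  finally have 1: "P c w = G (\<tau> w' - \<tau> w) (P c w')" .
  have "\<tau> w' - \<tau> w = 0"
    by (rule return_times_separated[OF T(2)])
       (use 1 P_N[OF c a(2)] P_N[OF c b(2)] G_0[OF T(2)] K_gap[OF \<tau>_K[OF w(2)] \<tau>_K[OF w(1)]] in auto)
  then have "P c w = P c w'" using 1 G_0[OF T(2)] by simp
  then have "slice_coords c (P c w) = slice_coords c (P c w')" by simp
  then show "w = w'" using slice_coords_P[OF c a(2)] slice_coords_P[OF c b(2)] by simp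
qed

definition \<Psi> where "\<Psi> = inv_into base \<Phi>"

lemma \<Psi>_\<Phi>: "w \<in> base \<Longrightarrow> \<Psi> (\<Phi> w) = w" unfolding \<Psi>_def by (rule inv_into_f_f[OF \<Phi>_inj])

lemma \<Psi>_cont: "continuous_on (\<Phi> ` base) \<Psi>"
  by (rule continuous_on_inv[OF \<Phi>_cont base_compact]) (use \<Psi>_\<Phi> in blast)

lemma image_borel:
  assumes Q: "Q \<in> sets borel" "Q \<subseteq> base" shows "\<Phi> ` Q \<in> sets borel"
proof -
  have c: "\<Phi> ` base \<in> sets borel" using compact_imp_closed[OF compact_continuous_image[OF \<Phi>_cont base_compact]] by simp
  have "(\<lambda>u. if u \<in> \<Phi> ` base then \<Psi> u else 0) \<in> borel_measurable borel"
    using borel_measurable_continuous_on_if[OF c \<Psi>_cont, of "\<lambda>_. 0"] by simp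
  from measurable_sets_borel[OF this Q(1)] have "\<Phi> ` base \<inter> (\<lambda>u. if u \<in> \<Phi> ` base then \<Psi> u else 0) -` Q \<in> sets borel" using c by simp
  moreover have "\<Phi> ` base \<inter> (\<lambda>u. if u \<in> \<Phi> ` base then \<Psi> u else 0) -` Q = \<Phi> ` Q"
  proof (intro set_eqI iffI)
    fix u assume "u \<in> \<Phi> ` base \<inter> (\<lambda>u. if u \<in> \<Phi> ` base then \<Psi> u else 0) -` Q"
    then obtain w where "w \<in> base" "u = \<Phi> w" "\<Psi> u \<in> Q" by auto
    then show "u \<in> \<Phi> ` Q" using \<Psi>_\<Phi>[of w] by auto
  next
    fix u assume "u \<in> \<Phi> ` Q"
    then obtain w where "w \<in> Q" "u = \<Phi> w" by blast
    then show "u \<in> \<Phi> ` base \<inter> (\<lambda>u. if u \<in> \<Phi> ` base then \<Psi> u else 0) -` Q" using \<Psi>_\<Phi>[of w] Q(2) by auto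
  qed
  ultimately show ?thesis by simp
qed

text \<open>The homogeneous extension of \<open>\<Phi>\<close> to the cone over \<open>base\<close>.
  The polar coordinate formula for the Leray measure reduces the transport of \<open>lam\<close> by
  \<open>\<Phi>\<close> to the change of variables \<open>cone_map\<close> in the truncated cones
  \<open>unit_cone\<close>.\<close>
definition cone_map where "cone_map v = slice_coords c' (G (\<tau> (to_unit c v)) (P c v))"
definition unit_cone where "unit_cone d Q = {v \<in> Om d. cnorm d v < 1 \<and> to_unit d v \<in> Q}"

lemma unit_cone_borel: "d \<in> SC \<Longrightarrow> Q \<in> sets borel \<Longrightarrow> unit_cone d Q \<in> sets borel"
proof -
  assume d: "d \<in> SC" and Q: "Q \<in> sets borel"
  have o: "Om d \<in> sets borel" using Om_open[OF d] by simp
  have "(\<lambda>v. if v \<in> Om d then to_unit d v else 0) \<in> borel_measurable borel"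
    using borel_measurable_continuous_on_if[OF o to_unit_cont[OF d], of "\<lambda>_. 0"] by simp
  from measurable_sets_borel[OF this Q]
  have "{v \<in> Om d. cnorm d v < 1} \<inter> (\<lambda>v. if v \<in> Om d then to_unit d v else 0) -` Q \<in> sets borel"
    using Collect_less_borel[OF Om_open[OF d] cnorm_cont[OF d]] by simp
  moreover have "{v \<in> Om d. cnorm d v < 1} \<inter> (\<lambda>v. if v \<in> Om d then to_unit d v else 0) -` Q = unit_cone d Q"
    by (auto simp: unit_cone_def)
  ultimately show ?thesis by simp
qed

lemma cone_map_props:
  assumes v: "v \<in> Om c" "to_unit c v \<in> base"
  shows "slice_pair c c' (\<tau> (to_unit c v)) (P c v)" "clean c c' (\<tau> (to_unit c v)) (P c v)"
    "cone_map v = dilate D (cnorm c v) (\<Phi> (to_unit c v))" "cone_map v \<in> Om c'" "cnorm c' (cone_map v) = cnorm c v" "to_unit c' (cone_map v) = \<Phi> (to_unit c v)"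
    "J c c' (\<tau> (to_unit c v)) (P c v) = J c c' (\<tau> (to_unit c v)) (P c (to_unit c v))"
proof -
  let ?w = "to_unit c v" and ?r = "cnorm c v"
  have r: "?r > 0" by (rule cnorm_pos[OF c v(1)])
  have Pv: "P c v = cscale ?r (P c ?w)" by (rule P_nm'[OF c v(1)])
  note a = base_D[OF v(2)]
  show "slice_pair c c' (\<tau> ?w) (P c v)" unfolding Pv by (rule slice_pair_cscale[OF a(3) r])
  show "clean c c' (\<tau> ?w) (P c v)" unfolding Pv using clean_cscale[OF a(3) r] a(4) by simp
  show "J c c' (\<tau> ?w) (P c v) = J c c' (\<tau> ?w) (P c ?w)" unfolding Pv by (rule J_cscale[OF a(3) r])
  show Fe: "cone_map v = dilate D ?r (\<Phi> ?w)"
    unfolding cone_map_def \<Phi>_def Pv G_cscale[OF P_T0[OF c a(2)] r] by (rule slice_coords_cscale)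
  show o: "cone_map v \<in> Om c'" unfolding Fe by (rule Om_dilate[OF \<Phi>_P(3)[OF v(2)] r])
  show hF: "cnorm c' (cone_map v) = ?r" unfolding Fe using cnorm_dilate[OF r] \<Phi>_P(2)[OF v(2)] by (simp add: unit_dom_def)
  show "to_unit c' (cone_map v) = \<Phi> ?w" unfolding to_unit_def[of c'] hF unfolding Fe using r by simp
qed

lemma cone_map_image:
  assumes Q: "Q \<subseteq> base" shows "cone_map ` unit_cone c Q = unit_cone c' (\<Phi> ` Q)"
proof (intro set_eqI iffI)
  fix u assume "u \<in> cone_map ` unit_cone c Q"
  then obtain v where v: "v \<in> Om c" "cnorm c v < 1" "to_unit c v \<in> Q" "u = cone_map v" by (auto simp: unit_cone_def)
  then show "u \<in> unit_cone c' (\<Phi> ` Q)" using cone_map_props[OF v(1)] Q by (auto simp: unit_cone_def)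
next
  fix u assume "u \<in> unit_cone c' (\<Phi> ` Q)"
  then obtain w where u: "u \<in> Om c'" "cnorm c' u < 1" "w \<in> Q" "to_unit c' u = \<Phi> w" by (auto simp: unit_cone_def)
  have w: "w \<in> base" using u(3) Q by blast
  have r: "cnorm c' u > 0" by (rule cnorm_pos[OF c' u(1)])
  let ?v = "dilate D (cnorm c' u) w"
  have v: "?v \<in> Om c" by (rule Om_dilate[OF base_D(2)[OF w] r])
  have hv: "cnorm c ?v = cnorm c' u" using cnorm_dilate[OF r] base_D(1)[OF w] by (simp add: unit_dom_def)
  have nv: "to_unit c ?v = w" unfolding to_unit_def hv using r by simp
  have "cone_map ?v = dilate D (cnorm c' u) (\<Phi> w)" using cone_map_props(3)[OF v] w nv hv by simp
  also have "\<dots> = u" unfolding u(4)[symmetric] by (rule dilate_to_unit[OF c' u(1)])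
  finally show "u \<in> cone_map ` unit_cone c Q" using v hv nv u by (intro image_eqI[of _ _ ?v]) (auto simp: unit_cone_def)
qed

lemma cone_map_inverse:
  assumes v: "v \<in> Om c" "to_unit c v \<in> base" shows "dilate D (cnorm c' (cone_map v)) (\<Psi> (to_unit c' (cone_map v))) = v"
  using cone_map_props(5,6)[OF v] \<Psi>_\<Phi>[OF v(2)] dilate_to_unit[OF c v(1)] by simp

lemma cone_map_inj: "Q \<subseteq> base \<Longrightarrow> inj_on cone_map (unit_cone c Q)"
proof (rule inj_onI)
  fix x y assume Q: "Q \<subseteq> base" and x: "x \<in> unit_cone c Q" "y \<in> unit_cone c Q" and e: "cone_map x = cone_map y"
  have "x = dilate D (cnorm c' (cone_map x)) (\<Psi> (to_unit c' (cone_map x)))" using cone_map_inverse[of x] x Q by (auto simp: unit_cone_def)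
  also have "\<dots> = y" unfolding e using cone_map_inverse[of y] x Q by (auto simp: unit_cone_def)
  finally show "x = y" .
qed

lemma cone_map_borel_image:
  assumes Q: "Q \<in> sets borel" "Q \<subseteq> base" and B: "B \<subseteq> unit_cone c Q" "B \<in> sets borel"
  shows "cone_map ` B \<in> sets borel"
proof -
  let ?T = "unit_cone c' (\<Phi> ` Q)" and ?inv = "\<lambda>u. dilate D (cnorm c' u) (\<Psi> (to_unit c' u))"
  have T: "?T \<in> sets borel" by (rule unit_cone_borel[OF c' image_borel[OF Q]])
  have TO: "?T \<subseteq> Om c'" by (auto simp: unit_cone_def)
  have "continuous_on ?T ?inv"
    by (intro continuous_intros continuous_on_subset[OF cnorm_cont[OF c'] TO]
        continuous_on_compose2[OF \<Psi>_cont continuous_on_subset[OF to_unit_cont[OF c'] TO]])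
       (use Q(2) in \<open>auto simp: unit_cone_def\<close>)
  then have "(\<lambda>u. if u \<in> ?T then ?inv u else 0) \<in> borel_measurable borel"
    using borel_measurable_continuous_on_if[OF T, of ?inv "\<lambda>_. 0"] by simp
  from measurable_sets_borel[OF this B(2)] have "?T \<inter> (\<lambda>u. if u \<in> ?T then ?inv u else 0) -` B \<in> sets borel" using T by simp
  moreover have "?T \<inter> (\<lambda>u. if u \<in> ?T then ?inv u else 0) -` B = cone_map ` B"
  proof (intro set_eqI iffI)
    fix u assume "u \<in> ?T \<inter> (\<lambda>u. if u \<in> ?T then ?inv u else 0) -` B"
    then have u: "u \<in> ?T" "?inv u \<in> B" by auto
    then obtain v where v: "v \<in> unit_cone c Q" "u = cone_map v" unfolding cone_map_image[OF Q(2), symmetric] by blast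
    have "?inv u = v" unfolding v(2) by (rule cone_map_inverse) (use v Q in \<open>auto simp: unit_cone_def\<close>)
    then show "u \<in> cone_map ` B" using u v by auto
  next
    fix u assume "u \<in> cone_map ` B"
    then obtain v where v: "v \<in> B" "u = cone_map v" by blast
    have vQ: "v \<in> unit_cone c Q" using v B by blast
    have "?inv u = v" unfolding v(2) by (rule cone_map_inverse) (use vQ Q in \<open>auto simp: unit_cone_def\<close>)
    moreover have "u \<in> ?T" unfolding cone_map_image[OF Q(2), symmetric] using v vQ by blast
    ultimately show "u \<in> ?T \<inter> (\<lambda>u. if u \<in> ?T then ?inv u else 0) -` B" using v by simp
  qed
  ultimately show ?thesis by simp
qed

lemma time_cont: "Q \<subseteq> base \<Longrightarrow> continuous_on (unit_cone c Q) (\<lambda>v. \<tau> (to_unit c v))"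
  by (rule continuous_on_compose2[OF \<tau>_cont continuous_on_subset[OF to_unit_cont[OF c]]]) (auto simp: unit_cone_def)

text \<open>The return time drops out of the derivative. Let \<open>b\<close> be the momentum at the
  return. The function \<open>\<theta>(t, w) = \<langle>b, x\<rangle>\<close> of the flow
  coordinates vanishes at all returns, since \<open>b\<close> is conormal. Its derivative in the
  conormal directions vanishes by tangency, and its time derivative is \<open>p \<noteq> 0\<close>
  by Euler's identity. So \<open>implicit_derivative_zero\<close> applies to the time.\<close>
lemma cone_map_deriv:
  assumes Q: "Q \<subseteq> base" and v: "v \<in> unit_cone c Q"
  shows "(cone_map has_derivative (\<lambda>x. merge_cn D (L c c' (\<tau> (to_unit c v)) v x))) (at v within unit_cone c Q)"
proof -
  let ?S = "unit_cone c Q" and ?t = "\<lambda>v. \<tau> (to_unit c v)"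
  have vD: "v \<in> Om c" "to_unit c v \<in> base" using v Q by (auto simp: unit_cone_def)
  have cn: "slice_pair c c' (?t x) (P c x)" "x \<in> Om c" if "x \<in> ?S" for x using cone_map_props(1)[of x] that Q by (auto simp: unit_cone_def)
  note a = slice_pairD[OF cn(1)[OF v]]
  have gd: "tangent c c' (?t v) v" using cone_map_props(2)[OF vD] slice_coords_P[OF c vD(1)] by (simp add: clean_def)
  have rng: "flow_coords c c' (?t x, x) \<in> range (split_cn D)" if "x \<in> ?S" for x
    using conormal_coords_iff[OF N_T0 c'] slice_pairD[OF cn(1)[OF that]] by (simp add: flow_coords_def)
  let ?p = "(?t v, v)" and ?dT = "\<lambda>(h, x). dPsi c c' (?t v, split_cn D v) (h, split_cn D x)"
  have dTh: "(flow_coords c c' has_derivative ?dT) (at ?p)" by (rule flow_coords_deriv[OF c c' vD(1) a(6)])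
  define b where "b = snd (flow_coords c c' ?p)"
  have b: "proj D b = 0" using rng[OF v] by (simp add: b_def range_split_iff)
  have x: "(?t v, split_cn D v) \<in> W c c'" using mem_W_split[OF vD(1)] a(6) by simp
  have lin: "linear (dPsi c c' (?t v, split_cn D v))" by (rule dPsi_linear[OF SC_A[OF c] SC_A[OF c'] x])
  \<comment> \<open>the time derivative of \<open>\<theta>\<close>\<close>
  let ?k = "b \<bullet> fst (dPsi c c' (?t v, split_cn D v) (1, 0))"
  have d\<theta>: "((\<lambda>p. b \<bullet> fst (flow_coords c c' p)) has_derivative (\<lambda>p. fst p * ?k)) (at ?p)"
  proof (rule has_derivative_eq_rhs)
    show "((\<lambda>p. b \<bullet> fst (flow_coords c c' p)) has_derivative (\<lambda>p. b \<bullet> fst (?dT p))) (at ?p)"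
      by (intro has_derivative_inner_right has_derivative_fst dTh)
    show "(\<lambda>p. b \<bullet> fst (?dT p)) = (\<lambda>p. fst p * ?k)"
    proof
      fix p :: "real \<times> (real^'n)"
      have e: "(fst p, split_cn D (snd p)) = fst p *\<^sub>R (1, 0) + (0, split_cn D (snd p))" by simp
      have "?dT p = fst p *\<^sub>R dPsi c c' (?t v, split_cn D v) (1, 0) + L c c' (?t v) v (snd p)"
        unfolding L_def case_prod_unfold e linear_add[OF lin] linear_scale[OF lin] ..
      moreover have "b \<bullet> fst (L c c' (?t v) v (snd p)) = 0"
        unfolding inner_commute[of b] by (rule proj_orth[OF _ b]) (use gd in \<open>simp add: tangent_def range_split_iff\<close>)
      ultimately show "b \<bullet> fst (?dT p) = fst p * ?k" by (simp add: inner_add_right)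
    qed
  qed
  have "?k \<noteq> 0"
  proof -
    let ?y = "Psi c c' (?t v, split_cn D v)"
    have y: "?y = coords c' (G (?t v) (P c v))" by (rule Psi_split)
    have yc: "fst ?y \<in> crange c'" "snd ?y \<noteq> 0" unfolding y using coords_T0[OF N_T0[OF a(2)] SC_A[OF c'] a(6)] by auto
    have b_snd: "b = snd ?y" by (simp add: b_def flow_coords_def y)
    have "?k = ham g c' ?y"
      unfolding dPsi_time[OF SC_A[OF c] SC_A[OF c'] x] b_snd
      using ham_euler[OF SC_A[OF c'] yc] by (simp add: ham_field_def inner_commute)
    then show ?thesis using ham_pos[OF SC_A[OF c'] yc] by simp
  qed
  moreover have "continuous (at v within ?S) ?t"
    using time_cont[OF Q] v by (simp add: continuous_on_eq_continuous_within)
  moreover have "b \<bullet> fst (flow_coords c c' (?t x, x)) = b \<bullet> fst (flow_coords c c' (?t v, v))" if "x \<in> ?S" for x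
    using proj_orth[of D "fst (flow_coords c c' (?t x, x))" b] proj_orth[of D "fst (flow_coords c c' (?t v, v))" b] rng[OF that] rng[OF v] b
    by (simp add: range_split_iff inner_commute)
  ultimately have "(?t has_derivative (\<lambda>_. 0)) (at v within ?S)"
    by (rule implicit_derivative_zero[where \<theta>="\<lambda>p. b \<bullet> fst (flow_coords c c' p)" and \<tau>="?t" and x=v and k="?k", OF d\<theta>])
  then have "((\<lambda>x. (?t x, x)) has_derivative (\<lambda>x. (0, x))) (at v within ?S)"
    by (intro has_derivative_Pair has_derivative_ident)
  then have "((\<lambda>x. flow_coords c c' (?t x, x)) has_derivative (\<lambda>x. ?dT (0, x))) (at v within ?S)"
    by (rule has_derivative_compose[where f="\<lambda>x. (?t x, x)" and x=v and g="flow_coords c c'", OF _ dTh])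
  then have "((\<lambda>x. merge_cn D (flow_coords c c' (?t x, x))) has_derivative (\<lambda>x. merge_cn D (?dT (0, x)))) (at v within ?S)"
    by (rule bounded_linear.has_derivative[OF bounded_linear_merge_cn])
  then show ?thesis by (simp add: cone_map_def[abs_def] flow_coords_def slice_coords_def L_def)
qed

definition piece_jac where "piece_jac w = J c c' (\<tau> w) (P c w)"

lemma piece_jac_cont: "continuous_on base piece_jac"
proof -
  have "continuous_on base (\<lambda>w. \<bar>det (M c c' (\<tau> w) w)\<bar> * dens_at c' (\<Phi> w) / dens_at c w)"
  proof -
    have d1: "continuous_on base (\<lambda>w. det (M c c' (\<tau> w) w))"
      using continuous_on_compose2[OF det_M_cont[OF c c'] graph_cont] graph_landing by auto
    have d2: "continuous_on base (\<lambda>w. dens_at c' (\<Phi> w))"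
      by (rule continuous_on_compose2[OF dens_at_cont[OF c'] \<Phi>_cont]) (use \<Phi>_P(3) in blast)
    have d3: "continuous_on base (dens_at c)" by (rule continuous_on_subset[OF dens_at_cont[OF c]]) (use base_D(2) in blast)
    have d4: "\<forall>x\<in>base. dens_at c x \<noteq> 0" using dens_at_pos[OF c base_D(2)] by force
    show ?thesis by (rule continuous_on_divide[OF continuous_on_mult[OF continuous_on_rabs[OF d1] d2] d3 d4])
  qed
  then show ?thesis
    by (rule continuous_on_eq) (simp add: piece_jac_def J_alt[OF c base_D(2) base_D(3)] \<Phi>_def)
qed

lemma base_borel: "base \<in> sets borel" using compact_imp_closed[OF base_compact] by simp

lemma borel_on_base:
  fixes f :: "real^'n \<Rightarrow> 'b::real_normed_vector"
  assumes "continuous_on base f" shows "(\<lambda>w. if w \<in> base then f w else 0) \<in> borel_measurable borel"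
  using borel_measurable_continuous_on_if[OF base_borel assms, of "\<lambda>_. 0"] by simp

text \<open>Express both sides as integrals over truncated cones and substitute \<open>u = cone_map
  v\<close>. The determinant of the derivative and the two densities combine to the Jacobian, which
  is invariant under dilations.\<close>
theorem piece_integral:
  assumes Q: "Q \<in> sets borel" "Q \<subseteq> base" and k: "k \<in> borel_measurable borel"
  shows "(\<integral>\<^sup>+z\<in>P c' ` \<Phi> ` Q. k (slice_coords c' z) \<partial>lam) = (\<integral>\<^sup>+z\<in>P c ` Q. ennreal (piece_jac (slice_coords c z)) * k (\<Phi> (slice_coords c z)) \<partial>lam)"
proof -
  have \<Phi>Q: "\<Phi> ` Q \<in> sets borel" "\<Phi> ` Q \<subseteq> unit_dom c'" using image_borel[OF Q] \<Phi>_P(2) Q(2) by auto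
  have QU: "Q \<subseteq> unit_dom c" using base_D(1) Q(2) by blast
  let ?t = "\<lambda>v. \<tau> (to_unit c v)"
  let ?dM = "\<lambda>v. det (matrix (\<lambda>x. merge_cn D (L c c' (?t v) v x)))"
  let ?h = "\<lambda>u. if u \<in> Om c' then k (to_unit c' u) * ennreal (dens_at c' u) else 0"
  have S: "unit_cone c Q \<in> sets borel" by (rule unit_cone_borel[OF c Q(1)])
  have Omb: "Om c' \<in> sets borel" using Om_open[OF c'] by simp
  have hb: "?h \<in> borel_measurable borel"
  proof -
    have n: "(\<lambda>u. if u \<in> Om c' then to_unit c' u else 0) \<in> borel_measurable borel"
      using borel_measurable_continuous_on_if[OF Omb to_unit_cont[OF c'], of "\<lambda>_. 0"] by simp
    have d: "(\<lambda>u. if u \<in> Om c' then dens_at c' u else 0) \<in> borel_measurable borel"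
      using borel_measurable_continuous_on_if[OF Omb dens_at_cont[OF c'], of "\<lambda>_. 0"] by simp
    have "?h = (\<lambda>u. k (if u \<in> Om c' then to_unit c' u else 0) * ennreal (if u \<in> Om c' then dens_at c' u else 0))" by (auto simp: fun_eq_iff)
    then show ?thesis using measurable_compose[OF n k] d by simp
  qed
  have Db: "(\<lambda>v. ?dM v * indicator (unit_cone c Q) v) \<in> borel_measurable borel"
  proof -
    have "continuous_on (unit_cone c Q) (\<lambda>v. (?t v, v))" by (intro continuous_intros time_cont Q(2))
    moreover have "(?t v, v) \<in> landing c c'" if "v \<in> unit_cone c Q" for v
      using slice_pair_landing[OF cone_map_props(1)[of v]] that Q(2) by (auto simp: unit_cone_def)
    ultimately have "continuous_on (unit_cone c Q) (\<lambda>v. det (M c c' (?t v) v))"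
      using continuous_on_compose2[OF det_M_cont[OF c c'], of "unit_cone c Q" "\<lambda>v. (?t v, v)"] by auto
    from borel_measurable_continuous_on_indicator[OF S this] show ?thesis
      by (simp add: M_def mult.commute)
  qed
  have "(\<integral>\<^sup>+z\<in>P c' ` \<Phi> ` Q. k (slice_coords c' z) \<partial>lam) = codim * (\<integral>\<^sup>+u\<in>unit_cone c' (\<Phi> ` Q). k (to_unit c' u) * ennreal (dens_at c' u) \<partial>lborel)"
    unfolding unit_cone_def by (rule leray_piece[OF c' \<Phi>Q k])
  also have "(\<integral>\<^sup>+u\<in>unit_cone c' (\<Phi> ` Q). k (to_unit c' u) * ennreal (dens_at c' u) \<partial>lborel) = (\<integral>\<^sup>+u\<in>cone_map ` unit_cone c Q. ?h u \<partial>lborel)"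
    unfolding cone_map_image[OF Q(2)] by (intro nn_integral_cong) (auto simp: unit_cone_def indicator_def)
  also have "\<dots> = (\<integral>\<^sup>+v\<in>unit_cone c Q. ennreal \<bar>?dM v\<bar> * ?h (cone_map v) \<partial>lborel)"
    by (rule nn_integral_change_of_variables[OF S cone_map_deriv[OF Q(2)] cone_map_inj[OF Q(2)] cone_map_borel_image[OF Q] Db hb])
  also have "\<dots> = (\<integral>\<^sup>+v\<in>unit_cone c Q. (ennreal (piece_jac (to_unit c v)) * k (\<Phi> (to_unit c v))) * ennreal (dens_at c v) \<partial>lborel)"
  proof (intro nn_integral_cong)
    fix v
    show "ennreal \<bar>?dM v\<bar> * ?h (cone_map v) * indicator (unit_cone c Q) v = ennreal (piece_jac (to_unit c v)) * k (\<Phi> (to_unit c v)) * ennreal (dens_at c v) * indicator (unit_cone c Q) v"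
    proof (cases "v \<in> unit_cone c Q")
      case True
      then have v: "v \<in> Om c" "to_unit c v \<in> base" using Q(2) by (auto simp: unit_cone_def)
      note f = cone_map_props[OF v]
      have dp: "dens_at c v > 0" by (rule dens_at_pos[OF c v(1)])
      have "piece_jac (to_unit c v) = \<bar>?dM v\<bar> * dens_at c' (cone_map v) / dens_at c v"
        unfolding piece_jac_def f(7)[symmetric] J_alt[OF c v(1) f(1)] by (simp add: M_def cone_map_def)
      then have "\<bar>?dM v\<bar> * dens_at c' (cone_map v) = piece_jac (to_unit c v) * dens_at c v" using dp by simp
      moreover have "0 \<le> piece_jac (to_unit c v)" unfolding piece_jac_def using J_pos[OF base_D(3,4)[OF v(2)]] by simp
      moreover have "0 \<le> dens_at c' (cone_map v)" using dens_at_pos[OF c' f(4)] by simp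
      ultimately have "ennreal \<bar>?dM v\<bar> * ennreal (dens_at c' (cone_map v)) = ennreal (piece_jac (to_unit c v)) * ennreal (dens_at c v)"
        using dp by (simp add: ennreal_mult[symmetric])
      then have "(ennreal \<bar>?dM v\<bar> * ennreal (dens_at c' (cone_map v))) * k (\<Phi> (to_unit c v)) = (ennreal (piece_jac (to_unit c v)) * ennreal (dens_at c v)) * k (\<Phi> (to_unit c v))"
        by (simp only:)
      then have "ennreal \<bar>?dM v\<bar> * (k (\<Phi> (to_unit c v)) * ennreal (dens_at c' (cone_map v))) = ennreal (piece_jac (to_unit c v)) * k (\<Phi> (to_unit c v)) * ennreal (dens_at c v)"
        by (simp only: mult_ac)
      then show ?thesis using f by simp
    qed simp
  qed
  also have "codim * \<dots> = codim * (\<integral>\<^sup>+w\<in>{w \<in> Om c. cnorm c w < 1 \<and> to_unit c w \<in> Q}. (if to_unit c w \<in> base then ennreal (piece_jac (to_unit c w)) * k (\<Phi> (to_unit c w)) else 0) * ennreal (dens_at c w) \<partial>lborel)"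
    using Q(2) by (intro arg_cong[where f="(*) codim"] nn_integral_cong) (auto simp: unit_cone_def indicator_def)
  also have "\<dots> = (\<integral>\<^sup>+z\<in>P c ` Q. (if slice_coords c z \<in> base then ennreal (piece_jac (slice_coords c z)) * k (\<Phi> (slice_coords c z)) else 0) \<partial>lam)"
  proof (rule leray_piece[OF c Q(1) QU, symmetric])
    have "(\<lambda>w. if w \<in> base then ennreal (piece_jac w) * k (\<Phi> w) else 0) =
        (\<lambda>w. ennreal (if w \<in> base then piece_jac w else 0) * k (if w \<in> base then \<Phi> w else 0))" by (auto simp: fun_eq_iff)
    then show "(\<lambda>w. if w \<in> base then ennreal (piece_jac w) * k (\<Phi> w) else 0) \<in> borel_measurable borel"
      using borel_on_base[OF piece_jac_cont] measurable_compose[OF borel_on_base[OF \<Phi>_cont] k] by simp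
  qed
  also have "\<dots> = (\<integral>\<^sup>+z\<in>P c ` Q. ennreal (piece_jac (slice_coords c z)) * k (\<Phi> (slice_coords c z)) \<partial>lam)"
  proof (intro nn_integral_cong)
    fix z
    have "slice_coords c z \<in> base" if zQ: "z \<in> P c ` Q"
    proof -
      obtain w where w: "w \<in> Q" "z = P c w" using zQ by blast
      then show ?thesis using slice_coords_P[OF c base_D(2)[of w]] Q(2) by auto
    qed
    then show "(if slice_coords c z \<in> base then ennreal (piece_jac (slice_coords c z)) * k (\<Phi> (slice_coords c z)) else 0) * indicator (P c ` Q) z
      = ennreal (piece_jac (slice_coords c z)) * k (\<Phi> (slice_coords c z)) * indicator (P c ` Q) z" by (auto simp: indicator_def)
  qed
  finally show ?thesis .
qed

end

context conormal_measure
begin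

text \<open>The Jacobian at time 0 is the quotient of the natural densities in two slice charts, and
  its value 1 expresses that the density is independent of the chart. This follows from the
  existence of \<open>lam\<close>: the transport formula at time 0 says that \<open>lam\<close>
  equals itself times the Jacobian, and \<open>lam\<close> charges every neighbourhood of a point at
  which the continuous Jacobian would differ from 1.\<close>
lemma J_0_unit:
  assumes cn: "slice_pair c c' 0 (P c w0)" and w0: "w0 \<in> unit_dom c"
  shows "J c c' 0 (P c w0) = 1"
proof (rule ccontr)
  assume ne: "J c c' 0 (P c w0) \<noteq> 1"
  note a = slice_pairD[OF cn]
  have c: "c \<in> SC" and c': "c' \<in> SC" using a by auto
  let ?O = "{w \<in> Om c. fst (P c w) \<in> fst c'}"
  have G0: "G 0 (P c w) = P c w" if "w \<in> Om c" for w using G_0[OF P_T0[OF c that]] .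
  have O_slice_pair: "slice_pair c c' 0 (P c w)" if "w \<in> ?O" for w
    using that P_N[OF c] P_in[OF c] c c' G0 by (auto simp: slice_pair_def)
  let ?j = "\<lambda>w. J c c' 0 (P c w)"
  have j_cont: "continuous_on ?O ?j"
  proof -
    have l: "(0, w) \<in> landing c c'" if "w \<in> ?O" for w using that G0 by (auto simp: landing_def)
    have d1: "continuous_on ?O (\<lambda>w. det (M c c' 0 w))"
    proof -
      have pc: "continuous_on ?O (\<lambda>w. (0, w))" by (intro continuous_intros)
      have "(\<lambda>w. (0, w)) ` ?O \<subseteq> landing c c'" using l by blast
      from continuous_on_compose2[OF det_M_cont[OF c c'] pc this] show ?thesis by simp
    qed
    have d2: "continuous_on ?O (\<lambda>w. dens_at c' (slice_coords c' (P c w)))"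
      by (rule continuous_on_compose2[OF dens_at_cont[OF c'] over_cont[OF c c']])
         (use conormal_coords(2)[OF P_N[OF c] c'] in auto)
    have d3: "continuous_on ?O (dens_at c)" by (rule continuous_on_subset[OF dens_at_cont[OF c]]) auto
    have d4: "\<forall>x\<in>?O. dens_at c x \<noteq> 0" using dens_at_pos[OF c] by force
    have "continuous_on ?O (\<lambda>w. \<bar>det (M c c' 0 w)\<bar> * dens_at c' (slice_coords c' (P c w)) / dens_at c w)"
      by (rule continuous_on_divide[OF continuous_on_mult[OF continuous_on_rabs[OF d1] d2] d3 d4])
    then show ?thesis
      by (rule continuous_on_eq) (use J_alt[OF c _ O_slice_pair] G0 in auto)
  qed
  have w0O: "w0 \<in> ?O" using w0 a G0 by (auto simp: unit_dom_def)
  have oO: "open ?O" by (rule over_open[OF c c'])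
  obtain q B where qB: "open B" "w0 \<in> B" "B \<subseteq> ?O" "q \<noteq> 1" "q > 0"
     "(q > 1 \<and> (\<forall>w\<in>B. ?j w > q)) \<or> (q < 1 \<and> (\<forall>w\<in>B. ?j w < q))"
  proof (cases "?j w0 > 1")
    case True
    let ?q = "(1 + ?j w0) / 2"
    have "open (?O \<inter> ?j -` {?q<..})" by (rule continuous_open_preimage[OF j_cont oO]) simp
    then show ?thesis by (rule that[of "?O \<inter> ?j -` {?q<..}" ?q]) (use True w0O in auto)
  next
    case False
    then have lt: "?j w0 < 1" using ne by simp
    have jp: "?j w0 > 0" by (rule J_pos[OF cn clean_0[OF cn]])
    let ?q = "(1 + ?j w0) / 2"
    have "open (?O \<inter> ?j -` {..<?q})" by (rule continuous_open_preimage[OF j_cont oO]) simp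
    then show ?thesis by (rule that[of "?O \<inter> ?j -` {..<?q}" ?q]) (use lt jp w0O in auto)
  qed
  obtain e where e: "e > 0" "cball w0 e \<subseteq> B" using qB(1,2) open_contains_cball by blast
  let ?Q = "{w \<in> cball w0 e. cnorm c w = 1}"
  have bO: "cball w0 e \<subseteq> Om c" using e(2) qB(3) by blast
  have Qc: "compact ?Q"
  proof -
    have "closed {w \<in> cball w0 e. cnorm c w = 1}"
      by (rule continuous_closed_preimage_constant[OF continuous_on_subset[OF cnorm_cont[OF c] bO] closed_cball])
    then have "compact (cball w0 e \<inter> {w \<in> cball w0 e. cnorm c w = 1})" by (intro compact_Int_closed compact_cball)
    moreover have "cball w0 e \<inter> {w \<in> cball w0 e. cnorm c w = 1} = ?Q" by auto
    ultimately show ?thesis by simp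
  qed
  have QU: "?Q \<subseteq> unit_dom c" using bO by (auto simp: unit_dom_def)
  have QB: "?Q \<subseteq> B" using e(2) by auto
  \<comment> \<open>the identity map on a small neighbourhood of \<open>w0\<close> is a piece\<close>
  let ?K = "{0::real} \<times> ?Q"
  have pc: "piece c c' ?K"
    unfolding piece_def
  proof (intro conjI c c' compact_Times Qc ballI)
    fix p assume "p \<in> ?K"
    then obtain w where w: "p = (0, w)" "w \<in> ?Q" by auto
    have "w \<in> ?O" using w QB qB(3) by blast
    then have "snd p \<in> unit_dom c \<and> slice_pair c c' (fst p) (P c (snd p)) \<and> clean c c' (fst p) (P c (snd p))"
      using w QU O_slice_pair clean_0 by auto
    then show "(case p of (t, w) \<Rightarrow> w \<in> unit_dom c \<and> slice_pair c c' t (P c w) \<and> clean c c' t (P c w))"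
      by (simp add: case_prod_beta)
  next
    fix p q assume "p \<in> ?K" "q \<in> ?K" then show "\<bar>fst p - fst q\<bar> < gap" using gap(1) by auto
  qed auto
  interpret pp: conormal_piece A g D H G lam c c' ?K by unfold_locales (rule pc)
  have base: "pp.base = ?Q" unfolding pp.base_def by (auto simp: image_iff)
  have tau: "pp.\<tau> w = 0" if "w \<in> ?Q" for w by (rule pp.\<tau>_eq) (use that in simp)
  have Qb: "?Q \<in> sets borel" using compact_imp_closed[OF Qc] by simp
  have Phi: "P c' (pp.\<Phi> w) = P c w" if "w \<in> ?Q" for w
    using pp.\<Phi>_P(1)[of w] that base tau[OF that] G0[of w] QU by (auto simp: unit_dom_def)
  let ?X = "P c ` ?Q"
  have Xs: "?X \<in> sets lam" by (rule P_image_sets[OF c Qb QU])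
  have im: "P c' ` pp.\<Phi> ` ?Q = ?X" using Phi by (force simp: image_iff)
  have "emeasure lam ?X = (\<integral>\<^sup>+z\<in>P c' ` pp.\<Phi> ` ?Q. 1 \<partial>lam)" unfolding im using Xs by simp
  also have "\<dots> = (\<integral>\<^sup>+z\<in>?X. ennreal (pp.piece_jac (slice_coords c z)) * 1 \<partial>lam)"
    by (rule pp.piece_integral[of ?Q "\<lambda>_. 1"]) (use Qb base in auto)
  also have "\<dots> = (\<integral>\<^sup>+z\<in>?X. ennreal (J c c' 0 z) \<partial>lam)"
  proof (intro nn_integral_cong)
    fix z show "ennreal (pp.piece_jac (slice_coords c z)) * 1 * indicator ?X z = ennreal (J c c' 0 z) * indicator ?X z"
    proof (cases "z \<in> ?X")
      case True
      then obtain w where w: "w \<in> ?Q" "z = P c w" by blast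
      have "slice_coords c z = w" using w slice_coords_P[OF c, of w] QU by (auto simp: unit_dom_def)
      moreover have "pp.piece_jac w = J c c' 0 (P c w)" unfolding pp.piece_jac_def tau[OF w(1)] ..
      ultimately show ?thesis using w by simp
    qed simp
  qed
  finally have eqX: "emeasure lam ?X = (\<integral>\<^sup>+z\<in>?X. ennreal (J c c' 0 z) \<partial>lam)" .
  have qint: "(\<integral>\<^sup>+z\<in>?X. ennreal q \<partial>lam) = ennreal q * emeasure lam ?X"
    using Xs by (simp add: nn_integral_cmult)
  have finX: "emeasure lam ?X < \<infinity>" by (rule lam_piece_finite[OF c Qc QU])
  define x where "x = measure lam ?X"
  have x: "emeasure lam ?X = ennreal x" "x \<ge> 0" using finX by (auto simp: x_def emeasure_eq_ennreal_measure)
  have "x = 0"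
    using qB(6)
  proof
    assume gq: "q > 1 \<and> (\<forall>w\<in>B. ?j w > q)"
    have "(\<integral>\<^sup>+z\<in>?X. ennreal q \<partial>lam) \<le> (\<integral>\<^sup>+z\<in>?X. ennreal (J c c' 0 z) \<partial>lam)" (is "(\<integral>\<^sup>+z\<in>_. ?L z \<partial>_) \<le> (\<integral>\<^sup>+z\<in>_. ?R z \<partial>_)")
    proof (intro nn_integral_mono)
      have *: "q \<le> ?j w" if "w \<in> ?Q" for w using gq QB that by (meson less_imp_le subsetD)
      fix z show "?L z * indicator ?X z \<le> ?R z * indicator ?X z" by (auto simp: indicator_def intro!: ennreal_leI *)
    qed
    then have "ennreal q * ennreal x \<le> ennreal x" using eqX qint x by simp
    then have "q * x \<le> x" using qB(5) x(2) by (simp add: ennreal_mult[symmetric])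
    then show "x = 0" using gq x(2) mult_strict_right_mono[of 1 q x] by (cases "x = 0") auto
  next
    assume lq: "q < 1 \<and> (\<forall>w\<in>B. ?j w < q)"
    have "(\<integral>\<^sup>+z\<in>?X. ennreal (J c c' 0 z) \<partial>lam) \<le> (\<integral>\<^sup>+z\<in>?X. ennreal q \<partial>lam)" (is "(\<integral>\<^sup>+z\<in>_. ?L z \<partial>_) \<le> (\<integral>\<^sup>+z\<in>_. ?R z \<partial>_)")
    proof (intro nn_integral_mono)
      have *: "?j w \<le> q" if "w \<in> ?Q" for w using lq QB that by (meson less_imp_le subsetD)
      fix z show "?L z * indicator ?X z \<le> ?R z * indicator ?X z" by (auto simp: indicator_def intro!: ennreal_leI *)
    qed
    then have "ennreal x \<le> ennreal q * ennreal x" using eqX qint x by simp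
    then have "x \<le> q * x" using qB(5) x(2) by (simp add: ennreal_mult[symmetric])
    then show "x = 0" using lq x(2) mult_strict_right_mono[of q 1 x] by (cases "x = 0") auto
  qed
  then have "(\<integral>\<^sup>+z\<in>?X. 1 \<partial>lam) = 0" using x Xs by simp
  then have "codim * (\<integral>\<^sup>+w\<in>{w \<in> Om c. cnorm c w < 1 \<and> to_unit c w \<in> ?Q}. 1 * ennreal (dens_at c w) \<partial>lborel) = 0"
    using leray_piece[OF c Qb QU, of "\<lambda>_. 1"] by simp
  then have z0: "(\<integral>\<^sup>+w\<in>{w \<in> Om c. cnorm c w < 1 \<and> to_unit c w \<in> ?Q}. ennreal (dens_at c w) \<partial>lborel) = 0"
    using card_pos by (cases "- D = {}") auto
  let ?V = "{w \<in> Om c. cnorm c w < 1 \<and> dist w0 (to_unit c w) < e}"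
  have oV: "open ?V"
  proof -
    have "open (Om c \<inter> (\<lambda>w. (cnorm c w, to_unit c w)) -` ({..<1} \<times> ball w0 e))"
      by (intro continuous_open_preimage Om_open[OF c] continuous_on_Pair cnorm_cont[OF c] to_unit_cont[OF c] open_Times) auto
    moreover have "Om c \<inter> (\<lambda>w. (cnorm c w, to_unit c w)) -` ({..<1} \<times> ball w0 e) = ?V" by auto
    ultimately show ?thesis by simp
  qed
  have dsb: "(\<lambda>w. if w \<in> Om c then dens_at c w else 0) \<in> borel_measurable borel"
    using borel_measurable_continuous_on_if[OF _ dens_at_cont[OF c], of "\<lambda>_. 0"] Om_open[OF c] by simp
  have "(\<integral>\<^sup>+w. ennreal (if w \<in> Om c then dens_at c w else 0) * indicator ?V w \<partial>lborel)
      \<le> (\<integral>\<^sup>+w\<in>{w \<in> Om c. cnorm c w < 1 \<and> to_unit c w \<in> ?Q}. ennreal (dens_at c w) \<partial>lborel)"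
    using cnorm_to_unit[OF c] by (intro nn_integral_mono) (auto simp: indicator_def)
  then have "(\<integral>\<^sup>+w. ennreal (if w \<in> Om c then dens_at c w else 0) * indicator ?V w \<partial>lborel) = 0" using z0 by simp
  then have "AE w in lborel. ennreal (if w \<in> Om c then dens_at c w else 0) * indicator ?V w = 0"
    using dsb oV by (subst nn_integral_0_iff_AE[symmetric]) auto
  then have "AE w in lborel. w \<notin> ?V"
  proof eventually_elim
    case (elim w)
    then show ?case using dens_at_pos[OF c, of w] by (auto simp: indicator_def ennreal_eq_0_iff)
  qed
  then have "?V \<in> null_sets lborel" using oV by (subst AE_iff_null_sets) auto
  then have "negligible ?V" using null_sets_completionI negligible_iff_null_sets by blast
  then have "?V = {}" using open_not_negligible[OF oV] by blast
  moreover have "dilate D (1/2) w0 \<in> ?V"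
  proof -
    have w0': "w0 \<in> Om c" "cnorm c w0 = 1" using w0 by (auto simp: unit_dom_def)
    have h: "cnorm c (dilate D (1/2) w0) = 1/2" using cnorm_dilate[of "1/2" c w0] w0' by simp
    have "to_unit c (dilate D (1/2) w0) = w0" unfolding to_unit_def h by simp
    then show ?thesis using h Om_dilate[OF w0'(1), of "1/2"] e(1) by simp
  qed
  ultimately show False by blast
qed

lemma J_0:
  assumes cn: "slice_pair c c' 0 z" shows "J c c' 0 z = 1"
proof -
  note a = slice_pairD[OF cn]
  let ?w = "slice_coords c z"
  have h: "cnorm c ?w > 0" by (rule cnorm_pos[OF a(3,7)])
  have e: "P c (to_unit c ?w) = cscale (1 / cnorm c ?w) z" using P_to_unit[OF a(3,7)] a(8) by simp
  have cn': "slice_pair c c' 0 (P c (to_unit c ?w))" unfolding e using h by (intro slice_pair_cscale[OF cn]) simp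
  have "J c c' 0 (P c (to_unit c ?w)) = 1" by (rule J_0_unit[OF cn' to_unit_unit_dom[OF a(3,7)]])
  then show ?thesis unfolding e using J_cscale[OF cn, of "1 / cnorm c ?w"] h by simp
qed

abbreviation "jc t z \<equiv> jacobian A g D H G t z"
abbreviation "Sg t \<equiv> Sigma_t A D H G t"

lemma jac_eq:
  assumes cn: "slice_pair c c' t z" and gd: "clean c c' t z" shows "jc t z = J c c' t z"
proof -
  note a = slice_pairD[OF cn]
  let ?d = "slice_at A D H (fst z)" and ?d' = "slice_at A D H (fst (G t z))"
  have cd: "slice_pair ?d ?d' t z" by (rule slice_at_slice_pair[OF a(1,2)])
  note b = slice_pairD[OF cd]
  have z0: "G 0 z = z" "G 0 (G t z) = G t z" using G_0 N_T0 a(1,2) by blast+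
  have 1: "slice_pair ?d c 0 z" "slice_pair c' ?d' 0 (G t z)" using a b z0 by (auto simp: slice_pair_def)
  have g1: "clean ?d c 0 z" "clean c' ?d' 0 (G t z)" using clean_0 1 by auto
  have 2: "slice_pair ?d c' (t + 0) z" "clean ?d c' (t + 0) z" "J ?d c' (t + 0) z = J c c' t (G 0 z) * J ?d c 0 z"
    using clean_comp(1,2)[OF 1(1), of c' t] J_comp[OF 1(1), of c' t] cn gd g1 z0 by auto
  have "J ?d ?d' (0 + t) z = J c' ?d' 0 (G t z) * J ?d c' t z"
    using J_comp[of ?d c' t z ?d' 0] 2 1 g1 by simp
  then have "J ?d ?d' t z = J c c' t z" using 2 z0 J_0[OF 1(1)] J_0[OF 1(2)] by simp
  then show ?thesis using jacobian_eq_J[OF a(1,2)] by simp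
qed

lemma jac_pos: "z \<in> Sg t \<Longrightarrow> jc t z > 0"
  using Sigma_slice_pair[of z t] jac_eq J_pos by metis

lemma jac_add:
  assumes "z \<in> Sg t" "G t z \<in> Sg s" shows "jc (s + t) z = jc s (G t z) * jc t z"
proof -
  have n: "z \<in> N" "G t z \<in> N" "G s (G t z) \<in> N" using Sigma_ND assms by auto
  obtain c c' c'' where c: "c \<in> SC" "fst z \<in> fst c" "c' \<in> SC" "fst (G t z) \<in> fst c'" "c'' \<in> SC" "fst (G s (G t z)) \<in> fst c''"
    using slice_exists[OF N_H[OF n(1)]] slice_exists[OF N_H[OF n(2)]] slice_exists[OF N_H[OF n(3)]] by blast
  have cn: "slice_pair c c' t z" "slice_pair c' c'' s (G t z)" using n c by (auto simp: slice_pair_def)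
  have gd: "clean c c' t z" "clean c' c'' s (G t z)" using Sigma_iff cn assms by auto
  show ?thesis unfolding jac_eq[OF cn(1) gd(1)] jac_eq[OF cn(2) gd(2)] jac_eq[OF clean_comp(1,2)[OF cn gd]]
    by (rule J_comp[OF cn gd])
qed

text \<open>The set of points in the domain of the flow with nonzero determinant is open and
  exhausted by compact sets; being a clean return of a unit covector at a time in \<open>[a,
  b]\<close> is a closed condition on it.\<close>
lemma pieces_exist:
  assumes c: "c \<in> SC" "c' \<in> SC" and ab: "b - a < gap"
  shows "\<exists>K :: nat \<Rightarrow> (real \<times> (real^'n)) set. (\<forall>m. piece c c' (K m)) \<and>
     (\<Union>m. K m) = {(t, w). t \<in> {a..b} \<and> w \<in> unit_dom c \<and> slice_pair c c' t (P c w) \<and> clean c c' t (P c w)}"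
proof -
  let ?O = "landing c c' \<inter> (\<lambda>p. det (M c c' (fst p) (snd p))) -` (- {0})"
  have oO: "open ?O" by (rule continuous_open_preimage[OF det_M_cont[OF c] landing_is_open[OF c]]) (intro open_Compl closed_singleton)
  obtain C where C: "\<And>n::nat. compact (C n)" "\<And>n. C n \<subseteq> ?O" "\<And>n. C n \<subseteq> interior (C (Suc n))" "\<Union>(range C) = ?O"
    by (rule open_Union_compact_subsets[OF oO]) (rule that, assumption+)
  let ?K = "\<lambda>m. C m \<inter> {p \<in> C m. fst p \<in> {a..b}} \<inter> {p \<in> C m. cnorm c (snd p) = 1}
     \<inter> {p \<in> C m. proj (- D) (fst (flow_coords c c' p)) = 0} \<inter> {p \<in> C m. proj D (snd (flow_coords c c' p)) = 0}
     \<inter> (\<Inter>v. {p \<in> C m. proj (- D) (fst (L c c' (fst p) (snd p) v)) = 0}) \<inter> (\<Inter>v. {p \<in> C m. proj D (snd (L c c' (fst p) (snd p) v)) = 0})"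
  have CL: "C m \<subseteq> landing c c'" for m using C(2)[of m] by blast
  have Kc: "compact (?K m)" for m
  proof -
    have cl: "closed (C m)" by (rule compact_imp_closed[OF C(1)])
    have pre: "closed {p \<in> C m. f p = y}" if "continuous_on (C m) f" for f :: "real \<times> (real^'n) \<Rightarrow> 'x::t1_space" and y
      by (rule continuous_closed_preimage_constant[OF that cl])
    have 1: "closed {p \<in> C m. fst p \<in> {a..b}}"
    proof -
      have "closed (C m \<inter> fst -` {a..b})" by (intro closed_Int cl closed_vimage closed_atLeastAtMost continuous_intros)
      moreover have "C m \<inter> fst -` {a..b} = {p \<in> C m. fst p \<in> {a..b}}" by auto
      ultimately show ?thesis by simp
    qed
    have hc: "continuous_on (C m) (\<lambda>p. cnorm c (snd p))"
      by (rule continuous_on_compose2[OF cnorm_cont[OF c(1)] continuous_on_snd[OF continuous_on_id]]) (use CL[of m] in \<open>auto simp: landing_def\<close>)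
    have Tc: "continuous_on (C m) (flow_coords c c')" by (rule continuous_on_subset[OF flow_coords_cont[OF c] CL])
    have Lcc: "continuous_on (C m) (\<lambda>p. L c c' (fst p) (snd p) v)" for v by (rule continuous_on_subset[OF L_cont[OF c] CL])
    show ?thesis
      by (intro compact_Int_closed C(1) 1 pre closed_INT ballI continuous_on_proj continuous_on_fst continuous_on_snd hc Tc Lcc)
  qed
  have char: "(t, w) \<in> ?K m \<longleftrightarrow> (t, w) \<in> C m \<and> t \<in> {a..b} \<and> w \<in> unit_dom c \<and> slice_pair c c' t (P c w) \<and> clean c c' t (P c w)" for t w m
  proof (cases "(t, w) \<in> C m")
    case True
    then have l: "w \<in> Om c" "fst (G t (P c w)) \<in> fst c'" "det (M c c' t w) \<noteq> 0" using C(2)[of m] by (auto simp: landing_def)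
    have T: "G t (P c w) \<in> T0" by (rule G_T0[OF P_T0[OF c(1) l(1)]])
    have cn: "slice_pair c c' t (P c w) \<longleftrightarrow> flow_coords c c' (t, w) \<in> range (split_cn D)"
      using conormal_coords_iff[OF T c(2) l(2)] P_N[OF c(1) l(1)] P_in[OF c(1) l(1)] c l(2) by (simp add: slice_pair_def flow_coords_def)
    have gd: "clean c c' t (P c w) \<longleftrightarrow> (\<forall>v. L c c' t w v \<in> range (split_cn D))"
      using l(3) slice_coords_P[OF c(1) l(1)] by (simp add: clean_def tangent_def)
    show ?thesis unfolding cn gd range_split_iff using True l(1) by (auto simp: unit_dom_def)
  qed auto
  show ?thesis
  proof (intro exI[of _ ?K] conjI allI)
    fix m show "piece c c' (?K m)"
      unfolding piece_def
    proof (intro conjI Kc c ballI)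
      fix p assume "p \<in> ?K m"
      then show "case p of (t, w) \<Rightarrow> w \<in> unit_dom c \<and> slice_pair c c' t (P c w) \<and> clean c c' t (P c w)"
        using char[of "fst p" "snd p" m] by (simp add: case_prod_unfold)
    next
      fix p q assume "p \<in> ?K m" "q \<in> ?K m"
      then have "fst p \<in> {a..b}" "fst q \<in> {a..b}" by auto
      then show "\<bar>fst p - fst q\<bar> < gap" using ab by (auto simp: abs_if)
    qed
  next
    show "(\<Union>m. ?K m) = {(t, w). t \<in> {a..b} \<and> w \<in> unit_dom c \<and> slice_pair c c' t (P c w) \<and> clean c c' t (P c w)}"
    proof (intro set_eqI iffI)
      fix p assume "p \<in> (\<Union>m. ?K m)"
      then obtain m where "p \<in> ?K m" by blast
      then show "p \<in> {(t, w). t \<in> {a..b} \<and> w \<in> unit_dom c \<and> slice_pair c c' t (P c w) \<and> clean c c' t (P c w)}"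
        using char[of "fst p" "snd p" m] by (simp add: case_prod_unfold)
    next
      fix p assume p: "p \<in> {(t, w). t \<in> {a..b} \<and> w \<in> unit_dom c \<and> slice_pair c c' t (P c w) \<and> clean c c' t (P c w)}"
      obtain t w where tw: "p = (t, w)" by (cases p)
      have q: "t \<in> {a..b}" "w \<in> unit_dom c" "slice_pair c c' t (P c w)" "clean c c' t (P c w)" using p tw by auto
      have w: "w \<in> Om c" using q(2) by (simp add: unit_dom_def)
      have "(t, w) \<in> ?O" using slice_pair_landing[OF q(3) w] q(4) slice_coords_P[OF c(1) w] by (simp add: clean_def)
      then obtain m where "(t, w) \<in> C m" using C(4) by blast
      then show "p \<in> (\<Union>m. ?K m)" using char[of t w m] q tw by blast
    qed
  qed
qed

end

context conormal_piece
begin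

lemma piece_transfer:
  assumes D0: "D0 \<in> sets lam" "D0 \<subseteq> P c ` base"
  defines "rho \<equiv> \<lambda>z. G (\<tau> (slice_coords c z)) z"
  shows "rho ` D0 \<in> sets lam"
    and "h \<in> borel_measurable lam \<Longrightarrow> (\<integral>\<^sup>+z\<in>D0. ennreal (jc (\<tau> (slice_coords c z)) z) * h (rho z) \<partial>lam) = (\<integral>\<^sup>+z\<in>rho ` D0. h z \<partial>lam)"
    and "B \<in> sets lam \<Longrightarrow> {z \<in> D0. rho z \<in> B} \<in> sets lam"
    and "B' \<in> sets borel \<Longrightarrow> {z \<in> D0. jc (\<tau> (slice_coords c z)) z \<in> B'} \<in> sets lam"
proof -
  let ?Q = "{w \<in> base. P c w \<in> D0}"
  have W: "slice_coords c (P c w) = w" if "w \<in> base" for w by (rule slice_coords_P[OF c base_D(2)[OF that]])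
  have AbU: "base \<subseteq> unit_dom c" using base_D(1) by blast
  have Qb: "?Q \<in> sets borel" "?Q \<subseteq> base"
  proof -
    have "{w \<in> Om c. P c w \<in> D0} \<in> sets borel" using D0(1) c sets_lam by blast
    moreover have "?Q = base \<inter> {w \<in> Om c. P c w \<in> D0}" using base_D(2) by blast
    ultimately show "?Q \<in> sets borel" using base_borel by simp
  qed blast
  have PQ: "P c ` ?Q = D0" using D0(2) by blast
  have zD: "\<exists>w\<in>?Q. z = P c w \<and> slice_coords c z = w" if "z \<in> D0" for z
  proof -
    obtain w where "w \<in> ?Q" "z = P c w" using \<open>z \<in> D0\<close> PQ by blast
    then show ?thesis using W by blast
  qed
  have rho: "rho (P c w) = P c' (\<Phi> w)" if "w \<in> base" for w
    unfolding rho_def W[OF that] \<Phi>_P(1)[OF that] ..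
  have rD: "rho ` D0 = P c' ` \<Phi> ` ?Q"
  proof -
    have "rho ` P c ` ?Q = (\<lambda>w. P c' (\<Phi> w)) ` ?Q" unfolding image_image by (rule image_cong) (use rho in auto)
    then show ?thesis unfolding PQ by (simp add: image_image)
  qed
  have PhiQ: "\<Phi> ` ?Q \<in> sets borel" "\<Phi> ` ?Q \<subseteq> unit_dom c'" using image_borel[OF Qb] \<Phi>_P(2) by auto
  show rs: "rho ` D0 \<in> sets lam" unfolding rD by (rule P_image_sets[OF c' PhiQ])
  have jcJ: "jc (\<tau> (slice_coords c z)) z = piece_jac (slice_coords c z)" if zQ: "z \<in> D0" for z
  proof -
    obtain w where w: "w \<in> ?Q" "z = P c w" "slice_coords c z = w" using zD[OF zQ] by blast
    then show ?thesis using jac_eq[OF base_D(3,4)[of w]] by (simp add: piece_jac_def)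
  qed
  show "(\<integral>\<^sup>+z\<in>D0. ennreal (jc (\<tau> (slice_coords c z)) z) * h (rho z) \<partial>lam) = (\<integral>\<^sup>+z\<in>rho ` D0. h z \<partial>lam)"
    if h: "h \<in> borel_measurable lam"
  proof -
    let ?k = "\<lambda>u. if u \<in> unit_dom c' then h (P c' u) else 0"
    have "(\<integral>\<^sup>+z\<in>rho ` D0. h z \<partial>lam) = (\<integral>\<^sup>+z\<in>P c' ` \<Phi> ` ?Q. ?k (slice_coords c' z) \<partial>lam)"
      unfolding rD
    proof (intro nn_integral_cong)
      fix z show "h z * indicator (P c' ` \<Phi> ` ?Q) z = ?k (slice_coords c' z) * indicator (P c' ` \<Phi> ` ?Q) z"
      proof (cases "z \<in> P c' ` \<Phi> ` ?Q")
        case True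
        then obtain w where w: "w \<in> ?Q" "z = P c' (\<Phi> w)" by blast
        have "slice_coords c' z = \<Phi> w" unfolding w(2) by (rule slice_coords_P[OF c' \<Phi>_P(3)]) (use w in simp)
        then show ?thesis using w \<Phi>_P(2)[of w] by simp
      qed simp
    qed
    also have "\<dots> = (\<integral>\<^sup>+z\<in>P c ` ?Q. ennreal (piece_jac (slice_coords c z)) * ?k (\<Phi> (slice_coords c z)) \<partial>lam)"
      by (rule piece_integral[OF Qb P_pullback_measurable[OF c' h]])
    also have "\<dots> = (\<integral>\<^sup>+z\<in>D0. ennreal (jc (\<tau> (slice_coords c z)) z) * h (rho z) \<partial>lam)"
      unfolding PQ
    proof (intro nn_integral_cong)
      fix z show "ennreal (piece_jac (slice_coords c z)) * ?k (\<Phi> (slice_coords c z)) * indicator D0 z = ennreal (jc (\<tau> (slice_coords c z)) z) * h (rho z) * indicator D0 z"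
      proof (cases "z \<in> D0")
        case True
        obtain w where w: "w \<in> ?Q" "z = P c w" "slice_coords c z = w" using zD[OF True] by blast
        have "?k (\<Phi> (slice_coords c z)) = h (rho z)" using w \<Phi>_P(2)[of w] rho[of w] by simp
        then show ?thesis using jcJ[OF True] by simp
      qed simp
    qed
    finally show ?thesis by simp
  qed
  show "{z \<in> D0. rho z \<in> B} \<in> sets lam" if B: "B \<in> sets lam"
  proof -
    let ?B = "{u \<in> Om c'. P c' u \<in> B}"
    have Bb: "?B \<in> sets borel" using B c' sets_lam by blast
    let ?R = "?Q \<inter> (\<lambda>w. if w \<in> base then \<Phi> w else 0) -` ?B"
    have "?R \<in> sets borel" using measurable_sets_borel[OF borel_on_base[OF \<Phi>_cont] Bb] Qb by simp
    then have "P c ` ?R \<in> sets lam" using AbU by (intro P_image_sets[OF c]) auto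
    moreover have "P c ` ?R = {z \<in> D0. rho z \<in> B}"
    proof (intro set_eqI iffI)
      fix z assume "z \<in> P c ` ?R"
      then show "z \<in> {z \<in> D0. rho z \<in> B}" using rho by auto
    next
      fix z assume "z \<in> {z \<in> D0. rho z \<in> B}"
      then have z: "z \<in> D0" "rho z \<in> B" by auto
      obtain w where w: "w \<in> ?Q" "z = P c w" "slice_coords c z = w" using zD[OF z(1)] by blast
      then have "w \<in> ?R" using z rho[of w] \<Phi>_P(3)[of w] by simp
      then show "z \<in> P c ` ?R" using w by blast
    qed
    ultimately show ?thesis by simp
  qed
  show "{z \<in> D0. jc (\<tau> (slice_coords c z)) z \<in> B'} \<in> sets lam" if B: "B' \<in> sets borel"
  proof -
    let ?R = "?Q \<inter> (\<lambda>w. if w \<in> base then piece_jac w else 0) -` B'"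
    have "?R \<in> sets borel" using measurable_sets_borel[OF borel_on_base[OF piece_jac_cont] B] Qb by simp
    then have "P c ` ?R \<in> sets lam" using AbU by (intro P_image_sets[OF c]) auto
    moreover have "P c ` ?R = {z \<in> D0. jc (\<tau> (slice_coords c z)) z \<in> B'}"
    proof (intro set_eqI iffI)
      fix z assume "z \<in> P c ` ?R"
      then obtain w where w: "w \<in> ?Q" "piece_jac w \<in> B'" "z = P c w" by auto
      then show "z \<in> {z \<in> D0. jc (\<tau> (slice_coords c z)) z \<in> B'}" using jcJ[of z] W[of w] by simp
    next
      fix z assume "z \<in> {z \<in> D0. jc (\<tau> (slice_coords c z)) z \<in> B'}"
      then have z: "z \<in> D0" "jc (\<tau> (slice_coords c z)) z \<in> B'" by auto
      obtain w where w: "w \<in> ?Q" "z = P c w" "slice_coords c z = w" using zD[OF z(1)] by blast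
      then have "w \<in> ?R" using z jcJ[OF z(1)] by simp
      then show "z \<in> P c ` ?R" using w by blast
    qed
    ultimately show ?thesis by simp
  qed
qed

end

context conormal_measure
begin

text \<open>On each piece the transport formula is an equality. Summing it over the disjoint pieces,
  whose images are disjoint by injectivity, leaves the integral over the image of
  \<open>E\<close>.\<close>
lemma countable_transfer:
  fixes cs cs' :: "nat \<Rightarrow> ('m, 'n) chart" and K :: "nat \<Rightarrow> (real \<times> (real^'n)) set" and Dk :: "nat \<Rightarrow> ('m, 'n) cov set"
    and T :: "('m, 'n) cov \<Rightarrow> real"
  assumes pc: "\<And>k. Dk k \<noteq> {} \<Longrightarrow> piece (cs k) (cs' k) (K k)"
    and Dm: "\<And>k. Dk k \<in> sets lam"
    and sub: "\<And>k z. z \<in> Dk k \<Longrightarrow> z \<in> unit_over (cs k) \<and> (T z, slice_coords (cs k) z) \<in> K k"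
    and disj: "disjoint_family Dk"
    and inj: "\<And>z z'. z \<in> (\<Union>k. Dk k) \<Longrightarrow> z' \<in> (\<Union>k. Dk k) \<Longrightarrow> G (T z) z = G (T z') z' \<Longrightarrow> z = z'"
  defines "E \<equiv> (\<Union>k. Dk k)"
  shows "E \<in> sets lam"
    and "(\<lambda>z. if z \<in> E then G (T z) z else z) \<in> measurable lam lam"
    and "(\<lambda>z. if z \<in> E then jc (T z) z else 0) \<in> borel_measurable lam"
    and "h \<in> borel_measurable lam \<Longrightarrow> (\<integral>\<^sup>+z\<in>E. ennreal (jc (T z) z) * h (G (T z) z) \<partial>lam) \<le> (\<integral>\<^sup>+z. h z \<partial>lam)"
proof -
  let ?rho = "\<lambda>z. G (T z) z"
  have each: "?rho ` Dk k \<in> sets lam"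
     "h \<in> borel_measurable lam \<Longrightarrow> (\<integral>\<^sup>+z\<in>Dk k. ennreal (jc (T z) z) * h (?rho z) \<partial>lam) = (\<integral>\<^sup>+z\<in>?rho ` Dk k. h z \<partial>lam)"
     "B \<in> sets lam \<Longrightarrow> {z \<in> Dk k. ?rho z \<in> B} \<in> sets lam"
     "B' \<in> sets borel \<Longrightarrow> {z \<in> Dk k. jc (T z) z \<in> B'} \<in> sets lam" for k h B B'
  proof -
    have *: "?rho ` Dk k \<in> sets lam \<and>
     (\<forall>h. h \<in> borel_measurable lam \<longrightarrow> (\<integral>\<^sup>+z\<in>Dk k. ennreal (jc (T z) z) * h (?rho z) \<partial>lam) = (\<integral>\<^sup>+z\<in>?rho ` Dk k. h z \<partial>lam)) \<and>
     (\<forall>B. B \<in> sets lam \<longrightarrow> {z \<in> Dk k. ?rho z \<in> B} \<in> sets lam) \<and>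
     (\<forall>B'. B' \<in> sets borel \<longrightarrow> {z \<in> Dk k. jc (T z) z \<in> B'} \<in> sets lam)"
    proof (cases "Dk k = {}")
      case False
      interpret pp: conormal_piece A g D H G lam "cs k" "cs' k" "K k" by unfold_locales (rule pc[OF False])
      have t: "pp.\<tau> (slice_coords (cs k) z) = T z" if "z \<in> Dk k" for z using pp.\<tau>_eq sub[OF that] by blast
      have D0: "Dk k \<subseteq> P (cs k) ` pp.base"
      proof
        fix z assume z: "z \<in> Dk k"
        then have "slice_coords (cs k) z \<in> pp.base" unfolding pp.base_def using sub[OF z] by force
        then show "z \<in> P (cs k) ` pp.base" using unit_over_W[OF pp.c, of z] sub[OF z] by (intro image_eqI[of _ _ "slice_coords (cs k) z"]) auto
      qed
      note pt = pp.piece_transfer[OF Dm D0]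
      have im: "(\<lambda>z. G (pp.\<tau> (slice_coords (cs k) z)) z) ` Dk k = ?rho ` Dk k" by (rule image_cong) (use t in auto)
      have i1: "(\<integral>\<^sup>+z\<in>Dk k. ennreal (jc (pp.\<tau> (slice_coords (cs k) z)) z) * h (G (pp.\<tau> (slice_coords (cs k) z)) z) \<partial>lam)
          = (\<integral>\<^sup>+z\<in>Dk k. ennreal (jc (T z) z) * h (?rho z) \<partial>lam)" for h
        by (intro nn_integral_cong) (auto simp: indicator_def t)
      have s1: "{z \<in> Dk k. G (pp.\<tau> (slice_coords (cs k) z)) z \<in> B} = {z \<in> Dk k. ?rho z \<in> B}" for B using t by auto
      have s2: "{z \<in> Dk k. jc (pp.\<tau> (slice_coords (cs k) z)) z \<in> B} = {z \<in> Dk k. jc (T z) z \<in> B}" for B using t by auto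
      show ?thesis using pt[unfolded im i1 s1 s2] by blast
    qed simp
    show "?rho ` Dk k \<in> sets lam" using * by blast
    show "h \<in> borel_measurable lam \<Longrightarrow> (\<integral>\<^sup>+z\<in>Dk k. ennreal (jc (T z) z) * h (?rho z) \<partial>lam) = (\<integral>\<^sup>+z\<in>?rho ` Dk k. h z \<partial>lam)" using * by blast
    show "B \<in> sets lam \<Longrightarrow> {z \<in> Dk k. ?rho z \<in> B} \<in> sets lam" using * by blast
    show "B' \<in> sets borel \<Longrightarrow> {z \<in> Dk k. jc (T z) z \<in> B'} \<in> sets lam" using * by blast
  qed
  show E: "E \<in> sets lam" unfolding E_def using Dm by blast
  have Esp: "E \<subseteq> space lam" using sets.sets_into_space[OF E] .
  show rm: "(\<lambda>z. if z \<in> E then ?rho z else z) \<in> measurable lam lam"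
  proof (rule measurableI)
    fix z assume z: "z \<in> space lam"
    show "(if z \<in> E then ?rho z else z) \<in> space lam"
    proof (cases "z \<in> E")
      case True
      then obtain k where "z \<in> Dk k" by (auto simp: E_def)
      then show ?thesis using True sets.sets_into_space[OF each(1)[of k]] by auto
    qed (use z in simp)
  next
    fix B assume B: "B \<in> sets lam"
    have "(\<lambda>z. if z \<in> E then ?rho z else z) -` B \<inter> space lam = (\<Union>k. {z \<in> Dk k. ?rho z \<in> B}) \<union> (B - E)"
    proof (intro set_eqI)
      fix z
      have "z \<in> E \<longleftrightarrow> (\<exists>k. z \<in> Dk k)" by (simp add: E_def)
      moreover have "z \<in> E \<Longrightarrow> z \<in> space lam" "z \<in> B \<Longrightarrow> z \<in> space lam" using Esp sets.sets_into_space[OF B] by blast+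
      ultimately show "z \<in> (\<lambda>z. if z \<in> E then ?rho z else z) -` B \<inter> space lam \<longleftrightarrow> z \<in> (\<Union>k. {z \<in> Dk k. ?rho z \<in> B}) \<union> (B - E)"
        by (cases "z \<in> E"; cases "z \<in> B") simp_all
    qed
    then show "(\<lambda>z. if z \<in> E then ?rho z else z) -` B \<inter> space lam \<in> sets lam" using each(3)[OF B] B E by auto
  qed
  show jm: "(\<lambda>z. if z \<in> E then jc (T z) z else 0) \<in> borel_measurable lam"
  proof (rule measurableI)
    fix B :: "real set" assume B: "B \<in> sets borel"
    have "(\<lambda>z. if z \<in> E then jc (T z) z else 0) -` B \<inter> space lam = (\<Union>k. {z \<in> Dk k. jc (T z) z \<in> B}) \<union> (if 0 \<in> B then space lam - E else {})"
    proof (intro set_eqI)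
      fix z
      have "z \<in> E \<longleftrightarrow> (\<exists>k. z \<in> Dk k)" by (simp add: E_def)
      moreover have "z \<in> E \<Longrightarrow> z \<in> space lam" using Esp by blast
      ultimately show "z \<in> (\<lambda>z. if z \<in> E then jc (T z) z else 0) -` B \<inter> space lam \<longleftrightarrow> z \<in> (\<Union>k. {z \<in> Dk k. jc (T z) z \<in> B}) \<union> (if 0 \<in> B then space lam - E else {})"
        by (cases "z \<in> E"; cases "0 \<in> B") simp_all
    qed
    then show "(\<lambda>z. if z \<in> E then jc (T z) z else 0) -` B \<inter> space lam \<in> sets lam" using each(4)[OF B] E by auto
  qed simp
  assume h: "h \<in> borel_measurable lam"
  let ?f = "\<lambda>z. ennreal (if z \<in> E then jc (T z) z else 0) * h (if z \<in> E then ?rho z else z)"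
  have fm: "?f \<in> borel_measurable lam" using jm measurable_compose[OF rm h] by simp
  have fD: "(\<integral>\<^sup>+z\<in>X. ?f z \<partial>lam) = (\<integral>\<^sup>+z\<in>X. ennreal (jc (T z) z) * h (?rho z) \<partial>lam)" if "X \<subseteq> E" for X
    using that by (intro nn_integral_cong) (auto simp: indicator_def)
  have dr: "disjoint_family (\<lambda>k. ?rho ` Dk k)"
    unfolding disjoint_family_on_def
  proof (intro ballI impI)
    fix j k :: nat assume jk: "j \<noteq> k"
    show "?rho ` Dk j \<inter> ?rho ` Dk k = {}"
    proof (rule ccontr)
      assume "?rho ` Dk j \<inter> ?rho ` Dk k \<noteq> {}"
      then obtain y where "y \<in> ?rho ` Dk j" "y \<in> ?rho ` Dk k" by blast
      then obtain z z' where zz: "z \<in> Dk j" "z' \<in> Dk k" "?rho z = ?rho z'" by (elim imageE) (rule that, assumption+, simp)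
      have "z = z'" by (rule inj[OF _ _ zz(3)]) (use zz(1,2) in \<open>auto simp: E_def\<close>)
      then show False using zz(1,2) disj jk by (auto simp: disjoint_family_on_def)
    qed
  qed
  have "(\<integral>\<^sup>+z\<in>E. ennreal (jc (T z) z) * h (?rho z) \<partial>lam) = emeasure (density lam ?f) E"
    using fm E fD[of E] by (simp add: emeasure_density)
  also have "\<dots> = (\<Sum>k. emeasure (density lam ?f) (Dk k))"
    unfolding E_def by (rule suminf_emeasure[symmetric]) (use Dm disj in auto)
  also have "\<dots> = (\<Sum>k. emeasure (density lam h) (?rho ` Dk k))"
  proof (rule suminf_cong)
    fix k
    have "Dk k \<subseteq> E" by (auto simp: E_def)
    then show "emeasure (density lam ?f) (Dk k) = emeasure (density lam h) (?rho ` Dk k)"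
      using fm Dm each(1) each(2)[OF h] h fD by (simp add: emeasure_density)
  qed
  also have "\<dots> = emeasure (density lam h) (\<Union>k. ?rho ` Dk k)"
    by (rule suminf_emeasure) (use each(1) dr in auto)
  also have "\<dots> \<le> emeasure (density lam h) (space (density lam h))"
    by (rule emeasure_space)
  also have "\<dots> = (\<integral>\<^sup>+z. h z \<partial>lam)" using h by (simp add: emeasure_density cong: nn_integral_cong)
  finally show "(\<integral>\<^sup>+z\<in>E. ennreal (jc (T z) z) * h (?rho z) \<partial>lam) \<le> (\<integral>\<^sup>+z. h z \<partial>lam)" .
qed

text \<open>Exhaustions for all pairs of slice charts from a finite atlas, arranged in one
  sequence.\<close>
lemma window_cover:
  assumes ab: "b - a < gap"
  shows "\<exists>(cs :: nat \<Rightarrow> ('m, 'n) chart) cs' K. (\<forall>l. K l \<noteq> {} \<longrightarrow> piece (cs l) (cs' l) (K l)) \<and>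
     (\<forall>l t w. (t, w) \<in> K l \<longrightarrow> t \<in> {a..b} \<and> P (cs l) w \<in> Sg t) \<and>
     (\<forall>z\<in>SN. \<forall>t\<in>{a..b}. z \<in> Sg t \<longrightarrow> (\<exists>l. z \<in> unit_over (cs l) \<and> (t, slice_coords (cs l) z) \<in> K l))"
proof -
  obtain I :: "nat set" and cs Ks where I: "finite I" "\<And>i. i \<in> I \<Longrightarrow> cs i \<in> SC" "\<And>i. i \<in> I \<Longrightarrow> compact (Ks i)"
      "\<And>i. i \<in> I \<Longrightarrow> Ks i \<subseteq> Om (cs i)"
      "\<And>z. z \<in> N \<Longrightarrow> \<exists>i\<in>I. \<exists>w\<in>Ks i. \<exists>r>0. z = cscale r (P (cs i) w)"
    by (rule finite_atlas) (rule that, assumption+)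
  let ?S = "\<lambda>p. {(t, w). t \<in> {a..b} \<and> w \<in> unit_dom (cs (fst p)) \<and> slice_pair (cs (fst p)) (cs (snd p)) t (P (cs (fst p)) w) \<and> clean (cs (fst p)) (cs (snd p)) t (P (cs (fst p)) w)}"
  have "\<forall>p\<in>I \<times> I. \<exists>K :: nat \<Rightarrow> (real \<times> (real^'n)) set. (\<forall>m. piece (cs (fst p)) (cs (snd p)) (K m)) \<and> (\<Union>m. K m) = ?S p"
    using pieces_exist[OF I(2) I(2) ab] by auto
  from bchoice[OF this] obtain K0 :: "nat \<times> nat \<Rightarrow> nat \<Rightarrow> (real \<times> (real^'n)) set"
    where K0': "\<forall>p\<in>I \<times> I. (\<forall>m. piece (cs (fst p)) (cs (snd p)) (K0 p m)) \<and> (\<Union>m. K0 p m) = ?S p" ..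
  note K0 = bspec[OF K0']
  define ij where "ij l = prod_decode (fst (prod_decode l))" for l
  define K where "K l = (if ij l \<in> I \<times> I then K0 (ij l) (snd (prod_decode l)) else {})" for l
  show ?thesis
  proof (rule exI[of _ "\<lambda>l. cs (fst (ij l))"], rule exI[of _ "\<lambda>l. cs (snd (ij l))"], rule exI[of _ K], intro conjI allI impI ballI)
    fix l assume "K l \<noteq> {}"
    then have "ij l \<in> I \<times> I" by (auto simp: K_def split: if_splits)
    then show "piece (cs (fst (ij l))) (cs (snd (ij l))) (K l)" using K0 by (simp add: K_def)
  next
    fix l t w assume tw: "(t, w) \<in> K l"
    then have i: "ij l \<in> I \<times> I" by (auto simp: K_def split: if_splits)
    have "(t, w) \<in> ?S (ij l)" using tw K0[OF i] i by (auto simp: K_def)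
    then have "t \<in> {a..b}" "slice_pair (cs (fst (ij l))) (cs (snd (ij l))) t (P (cs (fst (ij l))) w)" "clean (cs (fst (ij l))) (cs (snd (ij l))) t (P (cs (fst (ij l))) w)" by auto
    then show "t \<in> {a..b}" "P (cs (fst (ij l))) w \<in> Sg t" using Sigma_iff by auto
  next
    fix z t assume z: "z \<in> SN" and t: "t \<in> {a..b}" and s: "z \<in> Sg t"
    have n: "z \<in> N" "G t z \<in> N" using Sigma_ND[OF s] by auto
    have in_chart: "\<exists>i\<in>I. fst y \<in> fst (cs i)" if yN: "y \<in> N" for y
    proof -
      obtain i w r where i: "i \<in> I" "w \<in> Ks i" "r > 0" "y = cscale r (P (cs i) w)" using I(5)[OF yN] by (elim bexE exE conjE) (rule that)
      have "w \<in> Om (cs i)" using i(2) I(4)[OF i(1)] by blast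
      then show ?thesis using P_in[OF I(2)[OF i(1)]] i by auto
    qed
    obtain i where i: "i \<in> I" "fst z \<in> fst (cs i)" using in_chart[OF n(1)] by blast
    obtain j where j: "j \<in> I" "fst (G t z) \<in> fst (cs j)" using in_chart[OF n(2)] by blast
    have zX: "z \<in> unit_over (cs i)" using z i by (simp add: unit_over_def)
    have zw: "slice_coords (cs i) z \<in> unit_dom (cs i)" "P (cs i) (slice_coords (cs i) z) = z" using unit_over_W[OF I(2)[OF i(1)] zX] by auto
    have cn: "slice_pair (cs i) (cs j) t z" using n i j I(2) by (simp add: slice_pair_def)
    have "clean (cs i) (cs j) t z" using Sigma_iff[OF cn] s by simp
    then have "(t, slice_coords (cs i) z) \<in> ?S (i, j)" using t zw cn by simp
    moreover have "(\<Union>m. K0 (i, j) m) = ?S (i, j)" by (rule conjunct2[OF K0]) (simp add: i j)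
    ultimately have "(t, slice_coords (cs i) z) \<in> (\<Union>m. K0 (i, j) m)" by simp
    then obtain m where m: "(t, slice_coords (cs i) z) \<in> K0 (i, j) m" unfolding UN_iff by (elim bexE) (rule that)
    have "ij (prod_encode (prod_encode (i, j), m)) = (i, j)" by (simp add: ij_def)
    then show "\<exists>l. z \<in> unit_over (cs (fst (ij l))) \<and> (t, slice_coords (cs (fst (ij l))) z) \<in> K l"
      using m i j zX by (intro exI[of _ "prod_encode (prod_encode (i, j), m)"]) (simp add: K_def)
  qed
qed

text \<open>Times are looked for in a sequence of windows shorter than \<open>gap\<close>, each of
  which contains at most one return of a given point. A time selection \<open>T\<close> that picks
  the return in the first possible window agrees with the time functions of the pieces of that
  window. The windows cover the case of a single time as well as that of the first return.\<close>
lemma first_window_transfer: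
  fixes a b :: "nat \<Rightarrow> real" and T :: "('m, 'n) cov \<Rightarrow> real"
  assumes ab: "\<And>n. b n - a n < gap"
  defines "Rn \<equiv> \<lambda>n. {z \<in> SN. \<exists>t\<in>{a n..b n}. z \<in> Sg t}"
  assumes T: "\<And>z n. z \<in> Rn n \<Longrightarrow> (\<And>m. m < n \<Longrightarrow> z \<notin> Rn m) \<Longrightarrow> T z \<in> {a n..b n} \<and> z \<in> Sg (T z)"
    and inj: "\<And>z z'. z \<in> (\<Union>n. Rn n) \<Longrightarrow> z' \<in> (\<Union>n. Rn n) \<Longrightarrow> G (T z) z = G (T z') z' \<Longrightarrow> z = z'"
  defines "E \<equiv> (\<Union>n. Rn n)"
  shows "E \<in> sets lam"
    and "(\<lambda>z. if z \<in> E then G (T z) z else z) \<in> measurable lam lam"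
    and "(\<lambda>z. if z \<in> E then jc (T z) z else 0) \<in> borel_measurable lam"
    and "h \<in> borel_measurable lam \<Longrightarrow> (\<integral>\<^sup>+z\<in>E. ennreal (jc (T z) z) * h (G (T z) z) \<partial>lam) \<le> (\<integral>\<^sup>+z. h z \<partial>lam)"
proof -
  define Q where "Q n x \<longleftrightarrow> (\<forall>l. snd (snd x) l \<noteq> {} \<longrightarrow> piece (fst x l) (fst (snd x) l) (snd (snd x) l)) \<and>
     (\<forall>l t w. (t, w) \<in> snd (snd x) l \<longrightarrow> t \<in> {a n..b n} \<and> P (fst x l) w \<in> Sg t) \<and>
     (\<forall>z\<in>SN. \<forall>t\<in>{a n..b n}. z \<in> Sg t \<longrightarrow> (\<exists>l. z \<in> unit_over (fst x l) \<and> (t, slice_coords (fst x l) z) \<in> snd (snd x) l))"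
    for n and x :: "(nat \<Rightarrow> ('m, 'n) chart) \<times> (nat \<Rightarrow> ('m, 'n) chart) \<times> (nat \<Rightarrow> (real \<times> (real^'n)) set)"
  have "\<forall>n. \<exists>x. Q n x"
  proof
    fix n
    obtain cs cs' :: "nat \<Rightarrow> ('m, 'n) chart" and K :: "nat \<Rightarrow> (real \<times> (real^'n)) set"
      where "(\<forall>l. K l \<noteq> {} \<longrightarrow> piece (cs l) (cs' l) (K l)) \<and>
     (\<forall>l t w. (t, w) \<in> K l \<longrightarrow> t \<in> {a n..b n} \<and> P (cs l) w \<in> Sg t) \<and>
     (\<forall>z\<in>SN. \<forall>t\<in>{a n..b n}. z \<in> Sg t \<longrightarrow> (\<exists>l. z \<in> unit_over (cs l) \<and> (t, slice_coords (cs l) z) \<in> K l))"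
      using window_cover[OF ab[of n]] by (elim exE) (rule that, assumption)
    then have "Q n (cs, cs', K)" unfolding Q_def fst_conv snd_conv .
    then show "\<exists>x. Q n x" ..
  qed
  from choice[OF this] obtain x where "\<forall>n. Q n (x n)" ..
  then have Qx: "Q n (x n)" for n by blast
  have x: "piece (fst (x n) l) (fst (snd (x n)) l) (snd (snd (x n)) l)" if "snd (snd (x n)) l \<noteq> {}" for n l
    using that Qx[of n] unfolding Q_def by blast
  have x2: "t \<in> {a n..b n} \<and> P (fst (x n) l) w \<in> Sg t" if "(t, w) \<in> snd (snd (x n)) l" for n l t w
    using that Qx[of n] unfolding Q_def by blast
  have x3: "\<exists>l. z \<in> unit_over (fst (x n) l) \<and> (t, slice_coords (fst (x n) l) z) \<in> snd (snd (x n)) l"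
      if "z \<in> SN" "t \<in> {a n..b n}" "z \<in> Sg t" for n t z
    using that Qx[of n] unfolding Q_def by blast
  define cs where "cs n l = fst (x n) l" for n l
  define cs' where "cs' n l = fst (snd (x n)) l" for n l
  define K where "K n l = snd (snd (x n)) l" for n l
  note pc = x[folded cs_def cs'_def K_def] and Kin = x2[folded cs_def K_def] and cov = x3[folded cs_def K_def]
  define X where "X n l = P (cs n l) ` snd ` K n l" for n l
  have Xs: "X n l \<in> sets lam" for n l
  proof (cases "K n l = {}")
    case False
    interpret pp: conormal_piece A g D H G lam "cs n l" "cs' n l" "K n l" by unfold_locales (rule pc[OF False])
    have "P (cs n l) ` pp.base \<in> sets lam" by (rule P_image_sets[OF pp.c pp.base_borel]) (use pp.base_D(1) in blast)
    then show ?thesis by (simp add: X_def pp.base_def)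
  qed (simp add: X_def)
  have X_D: "z \<in> SN" "z \<in> unit_over (cs n l)" "\<exists>t\<in>{a n..b n}. (t, slice_coords (cs n l) z) \<in> K n l \<and> z \<in> Sg t" if zX: "z \<in> X n l" for z n l
  proof -
    obtain t w where tw: "(t, w) \<in> K n l" "z = P (cs n l) w" using zX by (auto simp: X_def)
    have ne: "K n l \<noteq> {}" using tw by blast
    interpret pp: conormal_piece A g D H G lam "cs n l" "cs' n l" "K n l" by unfold_locales (rule pc[OF ne])
    have w: "w \<in> unit_dom (cs n l)" "w \<in> Om (cs n l)" using pp.K_D[OF tw(1)] by auto
    show "z \<in> unit_over (cs n l)" using unit_dom_P[OF pp.c w(1)] tw by simp
    then show "z \<in> SN" by (simp add: unit_over_def)
    show "\<exists>t\<in>{a n..b n}. (t, slice_coords (cs n l) z) \<in> K n l \<and> z \<in> Sg t"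
      using tw slice_coords_P[OF pp.c w(2)] Kin[OF tw(1)] by auto
  qed
  have RX: "Rn n = (\<Union>l. X n l)" for n
  proof (intro set_eqI iffI)
    fix z assume "z \<in> Rn n"
    then obtain t where t: "z \<in> SN" "t \<in> {a n..b n}" "z \<in> Sg t" by (auto simp: Rn_def)
    obtain l where l: "z \<in> unit_over (cs n l)" "(t, slice_coords (cs n l) z) \<in> K n l" using cov[OF t] by blast
    have "K n l \<noteq> {}" using l by blast
    then have "cs n l \<in> SC" using pc by (auto simp: piece_def)
    then have "P (cs n l) (slice_coords (cs n l) z) = z" using unit_over_W l(1) by blast
    then have "z \<in> X n l" unfolding X_def using l(2) by force
    then show "z \<in> (\<Union>l. X n l)" by blast
  next
    fix z assume "z \<in> (\<Union>l. X n l)"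
    then obtain l where "z \<in> X n l" by blast
    from X_D[OF this] show "z \<in> Rn n" by (auto simp: Rn_def)
  qed
  have Rs: "Rn n \<in> sets lam" for n unfolding RX using Xs by blast
  define Dp where "Dp n l = X n l - (\<Union>m<n. Rn m) - (\<Union>j<l. X n j)" for n l
  define Dk where "Dk k = Dp (fst (prod_decode k)) (snd (prod_decode k))" for k
  have DX: "Dp n l \<subseteq> X n l" for n l by (auto simp: Dp_def)
  have EU: "(\<Union>k. Dk k) = E"
  proof (intro set_eqI iffI)
    fix z assume "z \<in> (\<Union>k. Dk k)"
    then show "z \<in> E" using DX unfolding Dk_def E_def RX by blast
  next
    fix z assume "z \<in> E"
    then obtain n0 where "z \<in> Rn n0" by (auto simp: E_def)
    then obtain n where n: "z \<in> Rn n" "\<And>m. m < n \<Longrightarrow> z \<notin> Rn m" using LeastI[of "\<lambda>n. z \<in> Rn n" n0] not_less_Least[of _ "\<lambda>n. z \<in> Rn n"] by blast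
    then obtain l0 where "z \<in> X n l0" using RX by blast
    then obtain l where l: "z \<in> X n l" "\<And>j. j < l \<Longrightarrow> z \<notin> X n j" using LeastI[of "\<lambda>l. z \<in> X n l" l0] not_less_Least[of _ "\<lambda>l. z \<in> X n l"] by blast
    have "z \<in> Dp n l" using n l by (auto simp: Dp_def)
    then have "z \<in> Dk (prod_encode (n, l))" by (simp add: Dk_def)
    then show "z \<in> (\<Union>k. Dk k)" by blast
  qed
  have disj: "disjoint_family Dk"
    unfolding disjoint_family_on_def
  proof (intro ballI impI)
    fix j k :: nat assume jk: "j \<noteq> k"
    obtain n l n' l' where e: "prod_decode j = (n, l)" "prod_decode k = (n', l')" by fastforce
    have ne: "(n, l) \<noteq> (n', l')" using jk e by (metis prod_decode_inverse)
    have sub: "X p q \<subseteq> Rn p" for p q using RX by blast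
    have "Dp n l \<inter> Dp n' l' = {}"
    proof (cases "n = n'")
      case True
      then have "l \<noteq> l'" using ne by simp
      then show ?thesis unfolding True Dp_def by (cases "l < l'") (auto simp: not_less)
    next
      case False
      then show ?thesis unfolding Dp_def using sub[of n l] sub[of n' l'] by (cases "n < n'") (auto simp: not_less)
    qed
    then show "Dk j \<inter> Dk k = {}" by (simp add: Dk_def e)
  qed
  have Dm: "Dk k \<in> sets lam" for k unfolding Dk_def Dp_def using Xs Rs by (intro sets.Diff sets.finite_UN) auto
  let ?c = "\<lambda>k. cs (fst (prod_decode k)) (snd (prod_decode k))" and ?c' = "\<lambda>k. cs' (fst (prod_decode k)) (snd (prod_decode k))"
    and ?K = "\<lambda>k. K (fst (prod_decode k)) (snd (prod_decode k))"
  have p1: "piece (?c k) (?c' k) (?K k)" if "Dk k \<noteq> {}" for k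
  proof -
    have "?K k \<noteq> {}" using that DX by (auto simp: Dk_def X_def)
    then show ?thesis by (rule pc)
  qed
  have p2: "z \<in> unit_over (?c k) \<and> (T z, slice_coords (?c k) z) \<in> ?K k" if z: "z \<in> Dk k" for k z
  proof -
    obtain n l where nl: "prod_decode k = (n, l)" by fastforce
    have zX: "z \<in> X n l" and first: "\<And>m. m < n \<Longrightarrow> z \<notin> Rn m" using z nl by (auto simp: Dk_def Dp_def)
    obtain t where t: "t \<in> {a n..b n}" "(t, slice_coords (cs n l) z) \<in> K n l" "z \<in> Sg t" using X_D(3)[OF zX] by blast
    have "z \<in> Rn n" using zX RX by blast
    from T[OF this first] have Tz: "T z \<in> {a n..b n}" "z \<in> Sg (T z)" by auto
    have "T z = t"
      by (rule return_times_separated[OF N_T0])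
         (use Sigma_ND[OF t(3)] Sigma_ND[OF Tz(2)] t(1) Tz(1) ab[of n] in \<open>auto simp: abs_if\<close>)
    then show ?thesis using t X_D(2)[OF zX] nl by simp
  qed
  note tr = countable_transfer[of Dk ?c ?c' ?K T, unfolded EU] and inj' = inj[folded E_def]
  show "E \<in> sets lam"
    by (rule tr(1)) (erule p1 | rule Dm | erule p2 | rule disj | erule (2) inj')+
  show "(\<lambda>z. if z \<in> E then G (T z) z else z) \<in> measurable lam lam"
    by (rule tr(2)) (erule p1 | rule Dm | erule p2 | rule disj | erule (2) inj')+
  show "(\<lambda>z. if z \<in> E then jc (T z) z else 0) \<in> borel_measurable lam"
    by (rule tr(3)) (erule p1 | rule Dm | erule p2 | rule disj | erule (2) inj')+
  show "(\<integral>\<^sup>+z\<in>E. ennreal (jc (T z) z) * h (G (T z) z) \<partial>lam) \<le> (\<integral>\<^sup>+z. h z \<partial>lam)"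
    if "h \<in> borel_measurable lam"
    by (rule tr(4)) (erule p1 | rule Dm | erule p2 | rule disj | erule (2) inj' | rule that)+
qed

end

context conormal_measure
begin

section \<open>The first return map and the proof of the theorem\<close>
lemma unit_Sigma_iff: "z \<in> unit_Sigma A g D H G t \<longleftrightarrow> z \<in> SN \<and> z \<in> Sg t"
  by (auto simp: unit_Sigma_def)

lemma Sigma_T0: "z \<in> Sg t \<Longrightarrow> z \<in> T0"
  using Sigma_ND N_T0 by blast

lemma Sigma_inj:
  assumes "z \<in> Sg t" "z' \<in> Sg t" "G t z = G t z'" shows "z = z'"
proof -
  have "z = G (- t) (G t z)" by (rule G_minus(1)[OF Sigma_T0[OF assms(1)], symmetric])
  also have "\<dots> = z'" unfolding assms(3) by (rule G_minus(1)[OF Sigma_T0[OF assms(2)]])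
  finally show ?thesis .
qed

lemma SN_flow: "z \<in> SN \<Longrightarrow> z \<in> Sg t \<Longrightarrow> G t z \<in> SN"
  using Sigma_ND[of z t] cov_norm_G[OF N_T0, of z t] by (simp add: SN_N)

lemma Sigma_diff:
  assumes "z \<in> Sg s" "z \<in> Sg t" shows "G s z \<in> Sg (t - s)"
proof -
  have "z \<in> T0" using Sigma_ND[OF assms(1)] N_T0 by blast
  then have "G (- s) (G s z) = z" by (rule G_minus)
  then show ?thesis using Sigma_add[OF Sigma_minus[OF assms(1)], of t] assms(2) by simp
qed

lemma jac_0: "z \<in> N \<Longrightarrow> jc 0 z = 1"
proof -
  assume z: "z \<in> N"
  obtain c where c: "c \<in> SC" "fst z \<in> fst c" using slice_exists[OF N_H[OF z]] by blast
  have cn: "slice_pair c c 0 z" using z c G_0[OF N_T0[OF z]] by (simp add: slice_pair_def)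
  show "jc 0 z = 1" using jac_eq[OF cn clean_0[OF cn]] J_0[OF cn] by simp
qed

lemma return_ge_gap: "z \<in> Sg t \<Longrightarrow> 0 < t \<Longrightarrow> gap \<le> t"
  using gap(2)[of z t] Sigma_ND[of z t] by (meson not_le)

definition first_return :: "('m, 'n) cov \<Rightarrow> real" where
  "first_return z = (LEAST t. t > 0 \<and> z \<in> unit_Sigma A g D H G t)"

definition returning :: "('m, 'n) cov set" where
  "returning = {z \<in> SN. \<exists>t>0. z \<in> Sg t}"

text \<open>Return times of a point are separated by \<open>gap\<close>, so a positive return time
  within \<open>gap\<close> of their infimum is the smallest.\<close>
lemma first_return:
  assumes "z \<in> returning"
  shows "first_return z > 0" "z \<in> Sg (first_return z)" "\<And>t. 0 < t \<Longrightarrow> z \<in> Sg t \<Longrightarrow> first_return z \<le> t"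
proof -
  define X where "X = {t. t > 0 \<and> z \<in> Sg t}"
  have z: "z \<in> SN" and ne: "X \<noteq> {}" using assms by (auto simp: returning_def X_def)
  have bd: "bdd_below X" by (rule bdd_belowI[of _ 0]) (simp add: X_def)
  obtain t where t: "t \<in> X" "t < Inf X + gap" using cInf_lessD[OF ne, of "Inf X + gap"] gap(1) by auto
  have least: "t \<le> u" if u: "u \<in> X" for u
  proof (rule ccontr)
    assume "\<not> t \<le> u"
    then have "\<bar>t - u\<bar> < gap" using cInf_lower[OF u bd] t(2) by linarith
    moreover have "z \<in> Sg t" "z \<in> Sg u" using t(1) u by (simp_all add: X_def)
    ultimately have "t = u" using return_times_separated[OF Sigma_T0] Sigma_ND by blast
    then show False using \<open>\<not> t \<le> u\<close> by simp
  qed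
  have "first_return z = t" unfolding first_return_def
    by (rule Least_equality) (use t(1) least z in \<open>auto simp: X_def unit_Sigma_iff\<close>)
  then show "first_return z > 0" "z \<in> Sg (first_return z)" "\<And>t. 0 < t \<Longrightarrow> z \<in> Sg t \<Longrightarrow> first_return z \<le> t"
    using t(1) least by (auto simp: X_def)
qed

lemma return_time_eq:
  assumes "z \<in> SN"
  shows "return_time A g D H G z = (if z \<in> returning then ereal (first_return z) else \<infinity>)"
  unfolding return_time_def first_return_def returning_def using assms by (simp add: unit_Sigma_iff)

text \<open>If the images agree and \<open>T(z) < T(z')\<close>, then \<open>z'\<close> reaches
  \<open>z\<close> by a clean return at the time \<open>T(z') - T(z)\<close>, before its first
  return.\<close>
lemma first_return_inj:
  assumes z: "z \<in> returning" "z' \<in> returning" and eq: "G (first_return z) z = G (first_return z') z'"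
  shows "z = z'"
proof -
  have no: "\<not> first_return x < first_return y"
    if x: "x \<in> returning" "y \<in> returning" "G (first_return x) x = G (first_return y) y" for x y
  proof
    assume lt: "first_return x < first_return y"
    have "G (first_return x) x \<in> Sg (- first_return x)" by (rule Sigma_minus[OF first_return(2)[OF x(1)]])
    then have "y \<in> Sg (- first_return x + first_return y)"
      by (intro Sigma_add[OF first_return(2)[OF x(2)]]) (simp add: x(3))
    then have "first_return y \<le> - first_return x + first_return y"
      by (intro first_return(3)[OF x(2)]) (use lt in simp_all)
    then show False using first_return(1)[OF x(1)] by simp
  qed
  have same: "first_return z = first_return z'" using no[OF z eq] no[OF z(2,1) eq[symmetric]] by simp
  show ?thesis
    by (rule Sigma_inj[OF first_return(2)[OF z(1)]]) (use first_return(2)[OF z(2)] same eq in simp_all)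
qed

lemma window_index:
  assumes "gap / 2 \<le> u"
  shows "\<exists>m::nat. (real m + 1) * gap / 2 \<le> u \<and> u \<le> (real m + 2) * gap / 2"
proof -
  define k where "k = nat \<lfloor>2 * u / gap\<rfloor>"
  have 1: "1 \<le> 2 * u / gap" using assms gap(1) by (simp add: field_simps)
  then have "k \<ge> 1" unfolding k_def by (simp add: le_nat_iff le_floor_iff)
  moreover have "real k \<le> 2 * u / gap" "2 * u / gap \<le> real k + 1" using 1 unfolding k_def by linarith+
  ultimately have "(real (k - 1) + 1) * gap / 2 \<le> u" "u \<le> (real (k - 1) + 2) * gap / 2"
    using gap(1) by (auto simp: field_simps of_nat_diff)
  then show ?thesis by blast
qed

lemma first_return_transfer:
  shows "returning \<in> sets lam"
    and "(\<lambda>z. if z \<in> returning then G (first_return z) z else z) \<in> measurable lam lam"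
    and "(\<lambda>z. if z \<in> returning then jc (first_return z) z else 0) \<in> borel_measurable lam"
    and "h \<in> borel_measurable lam \<Longrightarrow>
      (\<integral>\<^sup>+z\<in>returning. ennreal (jc (first_return z) z) * h (G (first_return z) z) \<partial>lam) \<le> (\<integral>\<^sup>+z. h z \<partial>lam)"
proof -
  define a where "a n = (real n + 1) * gap / 2" for n
  define b where "b n = (real n + 2) * gap / 2" for n
  have ab: "b n - a n < gap" for n using gap(1) by (simp add: a_def b_def field_simps)
  let ?R = "\<lambda>n. {z \<in> SN. \<exists>t\<in>{a n..b n}. z \<in> Sg t}"
  have a_pos: "a n > 0" for n using gap(1) by (simp add: a_def)
  have win: "\<exists>m. t \<in> {a m..b m}" if "z \<in> Sg t" "0 < t" for z t
    using window_index[of t] return_ge_gap[OF that] gap(1) by (auto simp: a_def b_def)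
  have R: "(\<Union>n. ?R n) = returning"
  proof (intro set_eqI iffI)
    fix z assume "z \<in> (\<Union>n. ?R n)"
    then obtain n t where t: "z \<in> SN" "t \<in> {a n..b n}" "z \<in> Sg t" by blast
    then have "0 < t" using a_pos[of n] by simp
    then show "z \<in> returning" using t by (auto simp: returning_def)
  next
    fix z assume "z \<in> returning"
    then obtain t where t: "z \<in> SN" "0 < t" "z \<in> Sg t" by (auto simp: returning_def)
    obtain m where "t \<in> {a m..b m}" using win[OF t(3,2)] by blast
    then show "z \<in> (\<Union>n. ?R n)" using t by blast
  qed
  have T: "first_return z \<in> {a n..b n} \<and> z \<in> Sg (first_return z)"
    if z: "z \<in> ?R n" and first: "\<And>m. m < n \<Longrightarrow> z \<notin> ?R m" for z n
  proof -
    obtain t where t: "z \<in> SN" "t \<in> {a n..b n}" "z \<in> Sg t" using z by blast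
    have zr: "z \<in> returning" using z R by blast
    note f = first_return[OF zr]
    obtain m where m: "first_return z \<in> {a m..b m}" using win[OF f(2,1)] by blast
    then have "z \<in> ?R m" using f(2) t(1) by blast
    then have "n \<le> m" using first by (meson not_le)
    then have "a n \<le> a m" using gap(1) by (simp add: a_def)
    moreover have "first_return z \<le> t" using f(3)[OF _ t(3)] a_pos[of n] t(2) by simp
    ultimately show ?thesis using m t(2) f(2) by simp
  qed
  have inj: "z = z'" if "z \<in> (\<Union>n. ?R n)" "z' \<in> (\<Union>n. ?R n)" "G (first_return z) z = G (first_return z') z'" for z z'
    using first_return_inj[OF _ _ that(3)] that(1,2) unfolding R by blast
  note tr = first_window_transfer[of b a first_return, OF ab, unfolded R]
  show "returning \<in> sets lam"
    by (rule tr(1)) (rule T, assumption+, rule inj, auto simp: R)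
  show "(\<lambda>z. if z \<in> returning then G (first_return z) z else z) \<in> measurable lam lam"
    by (rule tr(2)) (rule T, assumption+, rule inj, auto simp: R)
  show "(\<lambda>z. if z \<in> returning then jc (first_return z) z else 0) \<in> borel_measurable lam"
    by (rule tr(3)) (rule T, assumption+, rule inj, auto simp: R)
  show "(\<integral>\<^sup>+z\<in>returning. ennreal (jc (first_return z) z) * h (G (first_return z) z) \<partial>lam) \<le> (\<integral>\<^sup>+z. h z \<partial>lam)"
    if h: "h \<in> borel_measurable lam"
    by (rule tr(4)) (rule T, assumption+, rule inj, auto simp: R h)
qed

lemma single_time_transfer:
  shows "unit_Sigma A g D H G s \<in> sets lam"
    and "(\<lambda>z. if z \<in> unit_Sigma A g D H G s then jc s z else 0) \<in> borel_measurable lam"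
    and "h \<in> borel_measurable lam \<Longrightarrow>
      (\<integral>\<^sup>+z\<in>unit_Sigma A g D H G s. ennreal (jc s z) * h (G s z) \<partial>lam) \<le> (\<integral>\<^sup>+z. h z \<partial>lam)"
proof -
  have R: "(\<Union>n::nat. {z \<in> SN. \<exists>t\<in>{s..s}. z \<in> Sg t}) = unit_Sigma A g D H G s"
    by (auto simp: unit_Sigma_iff)
  have ab: "s - s < gap" using gap(1) by simp
  have inj: "z = z'" if "z \<in> unit_Sigma A g D H G s" "z' \<in> unit_Sigma A g D H G s" "G s z = G s z'" for z z'
    using Sigma_inj[OF _ _ that(3)] that(1,2) by (simp add: unit_Sigma_iff)
  note tr = first_window_transfer[of "\<lambda>_. s" "\<lambda>_. s" "\<lambda>_. s", OF ab, unfolded R]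
  show "unit_Sigma A g D H G s \<in> sets lam"
    by (rule tr(1)) (force, rule inj)
  show "(\<lambda>z. if z \<in> unit_Sigma A g D H G s then jc s z else 0) \<in> borel_measurable lam"
    by (rule tr(3)) (force, rule inj)
  show "(\<integral>\<^sup>+z\<in>unit_Sigma A g D H G s. ennreal (jc s z) * h (G s z) \<partial>lam) \<le> (\<integral>\<^sup>+z. h z \<partial>lam)"
    if h: "h \<in> borel_measurable lam"
    by (rule tr(4)) (force, rule inj, auto simp: h)
qed

text \<open>The integrand of \<open>q\<close> up to the constant and the Maslov factor, and its
  total mass.\<close>
definition amp :: "real \<Rightarrow> ('m, 'n) cov \<Rightarrow> real" where
  "amp t z = (if z \<in> unit_Sigma A g D H G t then sqrt (jc t z) else 0)"

definition mass :: "real \<Rightarrow> ennreal" where "mass t = (\<integral>\<^sup>+z. ennreal (amp t z) \<partial>lam)"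

lemma amp_measurable: "amp t \<in> borel_measurable lam"
proof -
  have "(\<lambda>z. sqrt (if z \<in> unit_Sigma A g D H G t then jc t z else 0)) \<in> borel_measurable lam"
    using single_time_transfer(2) by measurable
  moreover have "(\<lambda>z. sqrt (if z \<in> unit_Sigma A g D H G t then jc t z else 0)) = amp t"
    by (auto simp: amp_def)
  ultimately show ?thesis by simp
qed

lemma amp_nonneg: "amp t z \<ge> 0"
  using jac_pos[of z t] by (auto simp: amp_def unit_Sigma_iff less_imp_le)

text \<open>Substitute \<open>y = G\<^sup>-\<^sup>t z\<close>. Since \<open>J\<^sub>-\<^sub>t(z)
  J\<^sub>t(y) = J\<^sub>0(z) = 1\<close>, the weight \<open>\<surd>J\<^sub>-\<^sub>t(z)\<close>
  equals \<open>J\<^sub>-\<^sub>t(z) \<surd>J\<^sub>t(y)\<close>.\<close>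
lemma mass_minus: "mass (- t) \<le> mass t"
proof -
  have "mass (- t) = (\<integral>\<^sup>+z\<in>unit_Sigma A g D H G (- t). ennreal (jc (- t) z) * ennreal (amp t (G (- t) z)) \<partial>lam)"
    unfolding mass_def
  proof (intro nn_integral_cong)
    fix z
    show "ennreal (amp (- t) z) = ennreal (jc (- t) z) * ennreal (amp t (G (- t) z)) * indicator (unit_Sigma A g D H G (- t)) z"
    proof (cases "z \<in> unit_Sigma A g D H G (- t)")
      case True
      then have z: "z \<in> SN" "z \<in> Sg (- t)" by (auto simp: unit_Sigma_iff)
      let ?y = "G (- t) z"
      have y: "?y \<in> SN" "?y \<in> Sg t" using SN_flow[OF z] Sigma_minus[OF z(2)] by auto
      have "jc t ?y * jc (- t) z = 1" using jac_add[OF z(2) y(2)] jac_0 Sigma_ND[OF z(2)] by simp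
      then have "jc (- t) z * sqrt (jc t ?y) = sqrt (jc (- t) z)"
        using jac_pos[OF z(2)] jac_pos[OF y(2)]
        by (metis less_eq_real_def mult.commute mult.right_neutral real_sqrt_mult real_sqrt_mult_self real_sqrt_one abs_of_pos mult.assoc)
      then have "ennreal (jc (- t) z) * ennreal (amp t ?y) = ennreal (amp (- t) z)"
        using True y jac_pos[OF z(2)] jac_pos[OF y(2)]
        by (simp add: amp_def unit_Sigma_iff ennreal_mult[symmetric])
      then show ?thesis using True by simp
    qed (simp add: amp_def)
  qed
  also have "\<dots> \<le> mass t" unfolding mass_def
    by (rule single_time_transfer(3)) (use amp_measurable in measurable)
  finally show ?thesis .
qed

text \<open>The Maslov factor is a power of \<open>\<i>\<close>. If the integrand of
  \<open>q\<close> is not integrable, for instance not measurable, the integral is 0 by convention,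
  and the bound still holds.\<close>
lemma norm_q_coeff_le:
  "ennreal (cmod (q_coeff A g D H G lam t)) \<le> ennreal ((2 * pi) powi (- int CARD('n) + int (card D))) * mass t"
proof -
  let ?C = "(2 * pi) powi (- int CARD('n) + int (card D)) :: real"
  let ?f = "\<lambda>z. indicator (unit_Sigma A g D H G t) z *\<^sub>R (\<i> powi maslov_index A g D H G t z * complex_of_real (sqrt (jc t z)))"
  have q: "q_coeff A g D H G lam t = complex_of_real ?C * (LINT z|lam. ?f z)"
    unfolding q_coeff_def set_lebesgue_integral_def ..
  have n: "norm (?f z) = amp t z" for z
    using jac_pos[of z t] by (auto simp: amp_def norm_mult norm_power_int unit_Sigma_iff)
  have le: "ennreal (norm (LINT z|lam. ?f z)) \<le> mass t"
  proof (cases "integrable lam ?f")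
    case True
    from integral_norm_bound_ennreal[OF this] show ?thesis unfolding n mass_def .
  next
    case False
    then show ?thesis by (simp add: not_integrable_integral_eq)
  qed
  have C: "?C \<ge> 0" by simp
  have "norm (complex_of_real ?C) = ?C" unfolding norm_of_real using C by (rule abs_of_nonneg)
  then have "ennreal (cmod (q_coeff A g D H G lam t)) = ennreal ?C * ennreal (norm (LINT z|lam. ?f z))"
    unfolding q norm_mult by (simp only: ennreal_mult[OF C norm_ge_zero])
  also have "\<dots> \<le> ennreal ?C * mass t" by (rule mult_left_mono[OF le zero_le])
  finally show ?thesis .
qed

definition return_weight :: "('m, 'n) cov \<Rightarrow> real" where
  "return_weight z = (if z \<in> returning then sqrt (jc (first_return z) z) else 0)"

definition return_map :: "('m, 'n) cov \<Rightarrow> ('m, 'n) cov" where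
  "return_map z = (if z \<in> returning then G (first_return z) z else z)"

lemma returning_jac_pos: "z \<in> returning \<Longrightarrow> jc (first_return z) z > 0"
  using jac_pos first_return(2) by blast

lemma return_weight_nonneg: "return_weight z \<ge> 0"
  using less_imp_le[OF returning_jac_pos[of z]] by (simp add: return_weight_def)

lemma return_weighted_composition: "weighted_composition lam return_map return_weight"
proof -
  interpret finite_measure lam by (rule finite_measureI) (use lam_finite in simp)
  show ?thesis
  proof unfold_locales
    show "return_map \<in> measurable lam lam" unfolding return_map_def using first_return_transfer(2) by (simp add: cong: if_cong)
    have "(\<lambda>z. sqrt (if z \<in> returning then jc (first_return z) z else 0)) \<in> borel_measurable lam"
      using first_return_transfer(3) by measurable
    moreover have "(\<lambda>z. sqrt (if z \<in> returning then jc (first_return z) z else 0)) = return_weight"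
      by (auto simp: return_weight_def)
    ultimately show "return_weight \<in> borel_measurable lam" by simp
    show "0 \<le> return_weight z" for z by (rule return_weight_nonneg)
    fix k :: "('m, 'n) cov \<Rightarrow> ennreal" assume k: "k \<in> borel_measurable lam"
    have "(\<integral>\<^sup>+z. ennreal ((return_weight z)\<^sup>2) * k (return_map z) \<partial>lam) =
        (\<integral>\<^sup>+z\<in>returning. ennreal (jc (first_return z) z) * k (G (first_return z) z) \<partial>lam)"
      by (intro nn_integral_cong) (auto simp: return_weight_def return_map_def indicator_def less_imp_le[OF returning_jac_pos])
    then show "(\<integral>\<^sup>+z. ennreal ((return_weight z)\<^sup>2) * k (return_map z) \<partial>lam) \<le> (\<integral>\<^sup>+z. k z \<partial>lam)"
      using first_return_transfer(4)[OF k] by simp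
  qed
qed

interpretation wco: weighted_composition lam return_map return_weight by (rule return_weighted_composition)

text \<open>Induction on the number \<open>K\<close> of possible returns. The first return
  contributes the weight \<open>U 1\<close>; the later ones are returns of the image point at times
  shortened by \<open>T \<ge> gap\<close>, with the weight multiplied by that of the first
  return.\<close>
lemma sum_amp_le:
  assumes "finite F" "F \<subseteq> {0<..<real K * gap}" "z \<in> SN"
  shows "(\<Sum>t\<in>F. amp t z) \<le> (\<Sum>k<K. wco.U (Suc k) z)"
  using assms
proof (induction K arbitrary: F z)
  case 0
  then have "F = {}" by auto
  then show ?case by simp
next
  case (Suc K)
  show ?case
  proof (cases "z \<in> returning")
    case False
    then have "amp t z = 0" if "t \<in> F" for t
      using that Suc.prems by (auto simp: amp_def unit_Sigma_iff returning_def)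
    then have "(\<Sum>t\<in>F. amp t z) = 0" by simp
    then show ?thesis using sum_nonneg[of "{..<Suc K}" "\<lambda>k. wco.U (Suc k) z"] wco.U_nonneg by simp
  next
    case True
    note f = first_return[OF True]
    let ?T = "first_return z"
    let ?F' = "(\<lambda>t. t - ?T) ` {t \<in> F. ?T < t}"
    have inj: "inj_on (\<lambda>t. t - ?T) {t \<in> F. ?T < t}" by (simp add: inj_on_def)
    have y: "G ?T z \<in> SN" by (rule SN_flow[OF Suc.prems(3) f(2)])
    have return_weight: "return_weight z = sqrt (jc ?T z)" and return_map: "return_map z = G ?T z" using True by (auto simp: return_weight_def return_map_def)
    have late: "amp t z \<le> return_weight z * amp (t - ?T) (G ?T z)" if "?T < t" for t
    proof (cases "z \<in> Sg t")
      case True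
      have s: "G ?T z \<in> Sg (t - ?T)" by (rule Sigma_diff[OF f(2) True])
      have "jc t z = jc (t - ?T) (G ?T z) * jc ?T z" using jac_add[OF f(2) s] by simp
      then show ?thesis using s y True Suc.prems(3) by (simp add: amp_def unit_Sigma_iff return_weight real_sqrt_mult)
    next
      case False
      then have "amp t z = 0" by (simp add: amp_def unit_Sigma_iff)
      then show ?thesis using return_weight_nonneg[of z] amp_nonneg[of "t - ?T" "G ?T z"] by simp
    qed
    have early: "amp t z = 0" if "t \<in> F" "t < ?T" for t
      using that f(3)[of t] Suc.prems(2) by (force simp: amp_def unit_Sigma_iff)
    have "(\<Sum>t\<in>F. amp t z) = (\<Sum>t\<in>{t \<in> F. t = ?T} \<union> {t \<in> F. ?T < t}. amp t z)"
      by (rule sum.mono_neutral_right) (use Suc.prems(1) early in \<open>auto simp: not_less_iff_gr_or_eq\<close>)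
    also have "\<dots> = (\<Sum>t\<in>{t \<in> F. t = ?T}. amp t z) + (\<Sum>t\<in>{t \<in> F. ?T < t}. amp t z)"
      by (rule sum.union_disjoint) (use Suc.prems(1) in auto)
    also have "(\<Sum>t\<in>{t \<in> F. t = ?T}. amp t z) \<le> (\<Sum>t\<in>{?T}. amp t z)"
      by (rule sum_mono2) (auto simp: amp_nonneg)
    also have "(\<Sum>t\<in>{?T}. amp t z) \<le> return_weight z"
      using f(2) Suc.prems(3) by (simp add: amp_def unit_Sigma_iff return_weight)
    also have "(\<Sum>t\<in>{t \<in> F. ?T < t}. amp t z) \<le> (\<Sum>t\<in>{t \<in> F. ?T < t}. return_weight z * amp (t - ?T) (G ?T z))"
      by (rule sum_mono) (simp add: late)
    also have "\<dots> = return_weight z * (\<Sum>t\<in>?F'. amp t (G ?T z))"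
      by (simp add: sum.reindex[OF inj] sum_distrib_left)
    also have "\<dots> \<le> return_weight z * (\<Sum>k<K. wco.U (Suc k) (G ?T z))"
    proof (rule mult_left_mono[OF _ return_weight_nonneg], rule Suc.IH)
      show "?F' \<subseteq> {0<..<real K * gap}"
      proof
        fix u assume "u \<in> ?F'"
        then obtain t where t: "t \<in> F" "?T < t" "u = t - ?T" by blast
        then have "t < real (Suc K) * gap" using Suc.prems(2) by auto
        then show "u \<in> {0<..<real K * gap}" using t return_ge_gap[OF f(2,1)] by (simp add: algebra_simps)
      qed
    qed (use Suc.prems(1) y in auto)
    also have "return_weight z + return_weight z * (\<Sum>k<K. wco.U (Suc k) (G ?T z)) = (\<Sum>k<Suc K. wco.U (Suc k) z)"
      unfolding sum.lessThan_Suc_shift wco.U_Suc[of _ z] return_map by (simp add: sum_distrib_left)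
    finally show ?thesis by simp
  qed
qed

lemma sum_mass_le:
  assumes F: "finite F" "F \<subseteq> {0<..<real K * gap}"
  shows "(\<Sum>t\<in>F. mass t) \<le> ennreal (real (Suc K) * (\<integral>z. wco.A (Suc K) z \<partial>lam))"
proof -
  have int: "integrable lam (wco.A (Suc K))" by (rule wco.integral_le_l2norm(1)[OF wco.A_sq_int(1)])
  have "(\<Sum>t\<in>F. mass t) = (\<integral>\<^sup>+z. (\<Sum>t\<in>F. ennreal (amp t z)) \<partial>lam)"
    unfolding mass_def by (rule nn_integral_sum[symmetric]) (use amp_measurable in measurable)
  also have "\<dots> \<le> (\<integral>\<^sup>+z. ennreal (real (Suc K) * wco.A (Suc K) z) \<partial>lam)"
  proof (rule nn_integral_mono)
    fix z assume "z \<in> space lam"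
    then have z: "z \<in> SN" by (simp add: space_lam)
    have "(\<Sum>t\<in>F. amp t z) \<le> (\<Sum>k<K. wco.U (Suc k) z)" by (rule sum_amp_le[OF F z])
    also have "\<dots> \<le> (\<Sum>k<Suc K. wco.U k z)" unfolding sum.lessThan_Suc_shift by simp
    also have "\<dots> = real (Suc K) * wco.A (Suc K) z" by (simp add: wco.A_def wco.S_one)
    finally show "(\<Sum>t\<in>F. ennreal (amp t z)) \<le> ennreal (real (Suc K) * wco.A (Suc K) z)"
      by (simp add: amp_nonneg ennreal_leI)
  qed
  also have "\<dots> = ennreal (\<integral>z. real (Suc K) * wco.A (Suc K) z \<partial>lam)"
    by (rule nn_integral_eq_integral) (use int wco.A_nonneg in auto)
  finally show ?thesis by simp
qed

text \<open>A fixed vector \<open>h\<close> of the operator gives the invariant density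
  \<open>h\<^sup>2\<close>.\<close>
lemma averages_tendsto_0:
  assumes triv: "\<forall>f :: ('m, 'n) cov \<Rightarrow> real.
           integrable lam f \<and> return_invariant A g D H G lam f \<longrightarrow> (AE z in lam. f z = 0)"
  shows "(\<lambda>n. \<integral>z. wco.A n z \<partial>lam) \<longlonglongrightarrow> 0"
proof (rule wco.integral_average_tendsto_0)
  fix h assume h: "h \<in> borel_measurable lam" "integrable lam (\<lambda>z. (h z)\<^sup>2)"
    and inv: "AE z in lam. h z = return_weight z * h (return_map z)"
  have "return_invariant A g D H G lam (\<lambda>z. (h z)\<^sup>2)"
    unfolding return_invariant_def
  proof (rule AE_mp[OF inv], rule AE_I2, rule impI)
    fix z assume "z \<in> space lam" and e: "h z = return_weight z * h (return_map z)"
    then have z: "z \<in> SN" by (simp add: space_lam)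
    show "let T = return_time A g D H G z; t = real_of_ereal T in
        if T < \<infinity> then (h z)\<^sup>2 = (h (G t z))\<^sup>2 * jc t z else (h z)\<^sup>2 = 0"
    proof (cases "z \<in> returning")
      case True
      have "(h z)\<^sup>2 = (h (G (first_return z) z))\<^sup>2 * jc (first_return z) z"
        unfolding e using True returning_jac_pos[OF True] by (simp add: return_weight_def return_map_def power_mult_distrib)
      then show ?thesis using True by (simp add: return_time_eq[OF z] Let_def)
    next
      case False
      have "h z = 0" unfolding e using False by (simp add: return_weight_def)
      then show ?thesis using False by (simp add: return_time_eq[OF z] Let_def)
    qed
  qed
  then have "AE z in lam. (h z)\<^sup>2 = 0" using triv h(2) by blast
  then show "AE z in lam. h z = 0" by simp
qed

theorem q_average_tendsto_0:
  assumes triv: "\<forall>f :: ('m, 'n) cov \<Rightarrow> real.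
           integrable lam f \<and> return_invariant A g D H G lam f \<longrightarrow> (AE z in lam. f z = 0)"
  shows "((\<lambda>T::real. ennreal (1 / T) *
            (\<Sum>\<^sub>\<infinity>t\<in>recurrent_times A g D H G lam \<inter> {-T..T}. ennreal (cmod (q_coeff A g D H G lam t))))
          \<longlongrightarrow> 0) at_top"
proof -
  define C where "C = (2 * pi) powi (- int CARD('n) + int (card D))"
  have C: "C \<ge> 0" by (simp add: C_def)
  \<comment> \<open>every time in \<open>[-T, T]\<close> has modulus less than \<open>K(T) gap\<close>\<close>
  define K where "K T = nat \<lceil>T / gap\<rceil> + 1" for T
  define I where "I n = (\<integral>z. wco.A n z \<partial>lam)" for n
  have I0: "I n \<ge> 0" for n unfolding I_def by (intro integral_nonneg_AE AE_I2 wco.A_nonneg)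
  have bound: "ennreal (1 / T) * (\<Sum>\<^sub>\<infinity>t\<in>recurrent_times A g D H G lam \<inter> {-T..T}. ennreal (cmod (q_coeff A g D H G lam t)))
      \<le> ennreal (2 * C * (1 / gap + 3) * I (Suc (K T)))" if T: "T \<ge> 1" for T
  proof -
    have TK: "T < real (K T) * gap"
    proof -
      have "T / gap \<le> real (nat \<lceil>T / gap\<rceil>)" by linarith
      then have "T / gap < real (K T)" by (simp add: K_def)
      then show ?thesis using gap(1) by (simp add: pos_divide_less_eq)
    qed
    have KT: "real (Suc (K T)) \<le> T * (1 / gap + 3)"
    proof -
      have "0 \<le> T / gap" using T gap(1) by simp
      then have "real (nat \<lceil>T / gap\<rceil>) \<le> T / gap + 1" by linarith
      then have "real (Suc (K T)) \<le> T / gap + 3" by (simp add: K_def)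
      also have "\<dots> \<le> T * (1 / gap + 3)" using T by (simp add: algebra_simps)
      finally show ?thesis .
    qed
    let ?M = "ennreal (real (Suc (K T)) * I (Suc (K T)))"
    have "(\<Sum>\<^sub>\<infinity>t\<in>recurrent_times A g D H G lam \<inter> {-T..T}. ennreal (cmod (q_coeff A g D H G lam t))) \<le> ennreal C * (?M + ?M)"
    proof (rule infsum_le_finite_sums[OF nonneg_summable_on_complete])
      fix F assume F: "finite F" "F \<subseteq> recurrent_times A g D H G lam \<inter> {-T..T}"
      let ?P = "{t \<in> F. 0 < t}" and ?Q = "{t \<in> F. t < 0}"
      \<comment> \<open>\<open>0\<close> is not a recurrent time\<close>
      have "F = ?P \<union> ?Q" using F(2) by (auto simp: recurrent_times_def)
      then have "(\<Sum>t\<in>F. mass t) = (\<Sum>t\<in>?P \<union> ?Q. mass t)" by simp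
      also have "\<dots> = (\<Sum>t\<in>?P. mass t) + (\<Sum>t\<in>?Q. mass t)"
        by (rule sum.union_disjoint) (use F(1) in auto)
      also have "(\<Sum>t\<in>?P. mass t) \<le> ?M" unfolding I_def
        by (rule sum_mass_le) (use F TK in force)+
      also have "(\<Sum>t\<in>?Q. mass t) \<le> (\<Sum>t\<in>?Q. mass (- t))"
        by (rule sum_mono) (use mass_minus[of "- t" for t] in simp)
      also have "(\<Sum>t\<in>?Q. mass (- t)) = (\<Sum>t\<in>uminus ` ?Q. mass t)"
        by (simp add: sum.reindex)
      also have "\<dots> \<le> ?M" unfolding I_def
        by (rule sum_mass_le) (use F TK in force)+
      finally have sm: "(\<Sum>t\<in>F. mass t) \<le> ?M + ?M" by (simp add: add_mono)
      have "(\<Sum>t\<in>F. ennreal (cmod (q_coeff A g D H G lam t))) \<le> (\<Sum>t\<in>F. ennreal C * mass t)"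
        unfolding C_def by (rule sum_mono) (rule norm_q_coeff_le)
      also have "\<dots> = ennreal C * (\<Sum>t\<in>F. mass t)" by (simp add: sum_distrib_left)
      also have "\<dots> \<le> ennreal C * (?M + ?M)" by (rule mult_left_mono[OF sm]) simp
      finally show "(\<Sum>t\<in>F. ennreal (cmod (q_coeff A g D H G lam t))) \<le> ennreal C * (?M + ?M)" .
    qed simp
    also have "ennreal C * (?M + ?M) = ennreal (2 * C * (real (Suc (K T)) * I (Suc (K T))))"
      using C I0 by (simp add: ennreal_plus[symmetric] ennreal_mult[symmetric] del: ennreal_plus)
    finally have le: "(\<Sum>\<^sub>\<infinity>t\<in>recurrent_times A g D H G lam \<inter> {-T..T}. ennreal (cmod (q_coeff A g D H G lam t)))
        \<le> ennreal (2 * C * (real (Suc (K T)) * I (Suc (K T))))" .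
    have "ennreal (1 / T) * (\<Sum>\<^sub>\<infinity>t\<in>recurrent_times A g D H G lam \<inter> {-T..T}. ennreal (cmod (q_coeff A g D H G lam t)))
        \<le> ennreal (1 / T) * ennreal (2 * C * (real (Suc (K T)) * I (Suc (K T))))"
      by (rule mult_left_mono[OF le]) simp
    also have "\<dots> = ennreal (1 / T * (2 * C * (real (Suc (K T)) * I (Suc (K T)))))"
      by (rule ennreal_mult[symmetric]) (use T C I0 in auto)
    also have "\<dots> \<le> ennreal (2 * C * (1 / gap + 3) * I (Suc (K T)))"
    proof (rule ennreal_leI)
      have "1 / T * (2 * C * (real (Suc (K T)) * I (Suc (K T)))) = 2 * C * (real (Suc (K T)) / T) * I (Suc (K T))" by simp
      also have "\<dots> \<le> 2 * C * (1 / gap + 3) * I (Suc (K T))"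
        by (intro mult_right_mono mult_left_mono I0) (use KT T C in \<open>simp_all add: pos_divide_le_eq mult.commute\<close>)
      finally show "1 / T * (2 * C * (real (Suc (K T)) * I (Suc (K T)))) \<le> 2 * C * (1 / gap + 3) * I (Suc (K T))" .
    qed
    finally show ?thesis .
  qed
  have "filterlim (\<lambda>T. Suc (K T)) at_top at_top"
    unfolding filterlim_at_top
  proof
    fix Z :: nat
    have "Z \<le> Suc (K T)" if "T \<ge> real Z * gap" for T
    proof -
      have "real Z \<le> T / gap" using that gap(1) by (simp add: pos_le_divide_eq)
      then show ?thesis unfolding K_def by linarith
    qed
    then show "eventually (\<lambda>T. Z \<le> Suc (K T)) at_top" unfolding eventually_at_top_linorder by blast
  qed
  then have "((\<lambda>T. I (Suc (K T))) \<longlongrightarrow> 0) at_top"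
    by (rule filterlim_compose[rotated]) (unfold I_def, rule averages_tendsto_0[OF triv])
  then have "((\<lambda>T. 2 * C * (1 / gap + 3) * I (Suc (K T))) \<longlongrightarrow> 2 * C * (1 / gap + 3) * 0) at_top"
    by (rule tendsto_mult_left)
  then have lim: "((\<lambda>T. ennreal (2 * C * (1 / gap + 3) * I (Suc (K T)))) \<longlongrightarrow> 0) at_top"
    using tendsto_ennrealI by fastforce
  show ?thesis
    by (rule tendsto_sandwich[OF _ _ tendsto_const lim])
       (auto intro!: eventually_at_top_linorderI[of 1] bound)
qed

end

theorem theorem1p6:
  fixes A :: "('m::t2_space, 'n::finite) chart set"
    and g :: "('m, 'n) metric"
    and D :: "'n set"
    and H :: "'m set"
    and G :: "real \<Rightarrow> ('m, 'n) cov \<Rightarrow> ('m, 'n) cov"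
    and lam :: "('m, 'n) cov measure"
  assumes "closed_riemannian_manifold A g"
    and "card D < CARD('n)"
    and "compact_submanifold A D H"
    and "hamilton_flow A g G"
    and "leray_measure A g D H lam"
    and "\<forall>f :: ('m, 'n) cov \<Rightarrow> real.
           integrable lam f \<and> return_invariant A g D H G lam f \<longrightarrow> (AE z in lam. f z = 0)"
  shows "((\<lambda>T::real. ennreal (1 / T) *
            (\<Sum>\<^sub>\<infinity>t\<in>recurrent_times A g D H G lam \<inter> {-T..T}. ennreal (cmod (q_coeff A g D H G lam t))))
          \<longlongrightarrow> 0) at_top"
proof -
  interpret conormal_measure A g D H G lam by unfold_locales (fact assms)+
  show ?thesis by (rule q_average_tendsto_0[OF assms(6)])
qed

end
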